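(* Let $(G,\mathbb{P})$ be a finitely generated relatively hyperbolic group. Then there is a $G$-equivariant continuous map $f$ from the Morse boundary $\partial_M G$ to the Bowditch boundary $\partial(G,\mathbb{P})$ with the following properties: (1) The map $f$ maps the set of non-peripheral limit points of $\partial_M G$ injectively into the set of non-parabolic points of $\partial(G,\mathbb{P})$. (2) The map $f$ maps peripheral limit points of the same type in $\partial_M G$ to the same parabolic point in $\partial(G,\mathbb{P})$. In particular, if the Morse boundary of each peripheral subgroup is empty, then $f$ maps the Morse boundary $\partial_M G$ injectively into the set of non-parabolic points of $\partial(G,\mathbb{P})$.
   Context: All metric spaces on which Morse boundaries are considered are proper geodesic metric spaces. $\Gamma(G,S)$ denotes the Cayley graph of $G$ with respect to $S$, with edges of length 1. **Relative hyperbolicity.** Let $G$ be a finitely generated group, $S$ a finite generating set and $\mathbb{P}$ a finite collection of subgroups of $G$. The coned-off Cayley graph $\hat\Gamma=\hat\Gamma(G,S,\mathbb{P})$ is obtained from $\Gamma(G,S)$ by adding, for each left coset $gP$ with $P\in\mathbb{P}$, a vertex $v_{gP}$ (a peripheral vertex), and for each $x\in gP$ an edge of length $1/2$ from $x$ to $v_{gP}$. $(G,\mathbb{P})$ is relatively hyperbolic if $\hat\Gamma$ is $\delta$-hyperbolic for some $\delta$ and fine (for each $n>0$, each edge is contained in only finitely many circuits, i.e. embedded cycles, of length $n$). The members of $\mathbb{P}$ are the peripheral subgroups (known to be finitely generated); their left cosets $gP$ are the peripheral left cosets. **Morse geodesics.** A $(K,L)$-quasi-geodesic is a map $\gamma$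 from an interval of $\mathbb{R}$ with $\frac1K|s-t|-L\le d(\gamma(s),\gamma(t))\le K|s-t|+L$; a geodesic is a $(1,0)$-quasi-geodesic. For a function $N:[1,\infty)\times[0,\infty)\to[0,\infty)$ (a Morse gauge), a quasi-geodesic $\gamma$ is $N$-Morse if for all $K\ge1$, $L>0$ every $(K,L)$-quasi-geodesic with endpoints on $\gamma$ lies in the $N(K,L)$-neighborhood of $\gamma$; it is Morse if it is $N$-Morse for some $N$. Let $\mathcal{M}$ be the set of all Morse gauges, ordered pointwise. **Morse boundary.** For a proper geodesic space $X$ and basepoint $p$, $\partial_M X_p$ is the set of equivalence classes $[\alpha]$ of Morse geodesic rays $\alpha:[0,\infty)\to X$ with $\alpha(0)=p$, where $\alpha,\alpha'$ are equivalent if there is $K$ with $d(\alpha(t),\alpha'(t))<K$ for all $t>0$. $\partial_M^N X_p$ is the subset of classes containing an $N$-Morse geodesic ray from $p$. In $\partial_M^N X_p$, $x_n\to x$ means: there exist $N$-Morse geodesic rays $\alpha_n$ with $\alpha_n(0)=p$, $[\alpha_n]=x_n$, such that every subsequence of $(\alpha_n)$ contains a subsequence converging uniformly on compact sets to a geodesic ray $\alpha$ with $[\alpha]=x$. A subset $F$ is closed if $\{x_n\}\subset F$ and $x_n\to x$ imply $x\in F$. $\partial_M X_p$ carries the direct limit topology $\varinjlim_{\mathcal{M}}\partial_M^N X_p$. It is independent of the basepoint and a quasi-isometry invariant; the Morse boundary $\partial_M G$ of a finitely generated group is that of its Cayley graph. $G$ acts on $\partial_M G$ by $g[\alpha]=[\beta]$,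 where $\alpha,\beta$ are rays at the basepoint such that the Hausdorff distance between $g\alpha$ and $\beta$ is finite. **Peripheral limit points.** For a peripheral left coset $gP$, $\partial_M gP\subset\partial_M G$ is the set of all $[\gamma]\in\partial_M G$ such that $\gamma$ is contained in the $R$-neighborhood of $gP$ in $\Gamma(G,S)$ for some $R$. A peripheral limit point is an element of some $\partial_M gP$; all other elements of $\partial_M G$ are non-peripheral limit points. Two peripheral limit points are of the same type if both lie in $\partial_M gP$ for some peripheral left coset $gP$. **Bowditch boundary.** Let $V(\hat\Gamma)$ be the vertex set of $\hat\Gamma$, $V_\infty(\hat\Gamma)$ the set of all peripheral vertices, and $\partial\hat\Gamma$ the usual hyperbolic boundary of $\hat\Gamma$. As a set $\partial(G,\mathbb{P})=\Delta_\infty(\hat\Gamma)=V_\infty(\hat\Gamma)\cup\partial\hat\Gamma$. For $a\in\Delta_\infty(\hat\Gamma)$ and a finite set $A\subset V(\hat\Gamma)$ not containing $a$, let $M(a,A)$ be the set of $b\in\Delta_\infty(\hat\Gamma)$ such that at least one geodesic in $\hat\Gamma$ from $a$ to $b$ does not meet $A$. A set $U\subset\Delta_\infty(\hat\Gamma)$ is open if for every $a\in U$ there is a finite $A\subset V(\hat\Gamma)$ not containing $a$ with $M(a,A)\subset U$. This does not depend on the choice of $S$. $G$ acts on $\partial(G,\mathbb{P})$ via its isometric action on $\hat\Gamma$ (with $g\,v_{hP}=v_{ghP}$). Elements of $V_\infty(\hat\Gamma)$ are the parabolic points and elements of $\partial\hat\Gamma$ are the non-parabolic points. *)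

theory Defs
  imports "HOL-Analysis.Analysis" "HOL-Algebra.Generated_Groups"
begin

text \<open>Metric spaces are given by a carrier \<open>M\<close> and a distance \<open>d\<close>, as in the locale
  \<^locale>\<open>Metric_space\<close>.\<close>

section \<open>Quasi-geodesics and hyperbolicity\<close>

definition quasi_geodesic ::
  "'x set \<Rightarrow> ('x \<Rightarrow> 'x \<Rightarrow> real) \<Rightarrow> real \<Rightarrow> real \<Rightarrow> real set \<Rightarrow> (real \<Rightarrow> 'x) \<Rightarrow> bool" where
  "quasi_geodesic M d K L I \<gamma> \<longleftrightarrow> is_interval I \<and> \<gamma> ` I \<subseteq> M \<and>
     (\<forall>s\<in>I. \<forall>t\<in>I. \<bar>s - t\<bar> / K - L \<le> d (\<gamma> s) (\<gamma> t) \<and> d (\<gamma> s) (\<gamma> t) \<le> K * \<bar>s - t\<bar> + L)"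

definition geodesic ::
  "'x set \<Rightarrow> ('x \<Rightarrow> 'x \<Rightarrow> real) \<Rightarrow> real set \<Rightarrow> (real \<Rightarrow> 'x) \<Rightarrow> bool" where
  "geodesic M d I \<gamma> \<longleftrightarrow> quasi_geodesic M d 1 0 I \<gamma>"

definition nbhd :: "'x set \<Rightarrow> ('x \<Rightarrow> 'x \<Rightarrow> real) \<Rightarrow> real \<Rightarrow> 'x set \<Rightarrow> 'x set" where
  "nbhd M d R A = {x \<in> M. \<exists>a\<in>A. d x a \<le> R}"

definition finite_hausdorff_distance ::
  "'x set \<Rightarrow> ('x \<Rightarrow> 'x \<Rightarrow> real) \<Rightarrow> 'x set \<Rightarrow> 'x set \<Rightarrow> bool" where
  "finite_hausdorff_distance M d A B \<longleftrightarrow> (\<exists>R. A \<subseteq> nbhd M d R B \<and> B \<subseteq> nbhd M d R A)"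

definition geodesic_segment ::
  "'x set \<Rightarrow> ('x \<Rightarrow> 'x \<Rightarrow> real) \<Rightarrow> 'x \<Rightarrow> 'x \<Rightarrow> 'x set \<Rightarrow> bool" where
  "geodesic_segment M d x y A \<longleftrightarrow>
     (\<exists>\<gamma> a. 0 \<le> a \<and> geodesic M d {0..a} \<gamma> \<and> \<gamma> 0 = x \<and> \<gamma> a = y \<and> A = \<gamma> ` {0..a})"

text \<open>A geodesic space all of whose geodesic triangles are \<open>\<delta>\<close>-slim.\<close>

definition hyperbolic :: "'x set \<Rightarrow> ('x \<Rightarrow> 'x \<Rightarrow> real) \<Rightarrow> real \<Rightarrow> bool" where
  "hyperbolic M d \<delta> \<longleftrightarrow>
     (\<forall>x\<in>M. \<forall>y\<in>M. \<exists>A. geodesic_segment M d x y A) \<and>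
     (\<forall>x y z A B C. geodesic_segment M d x y A \<longrightarrow> geodesic_segment M d y z B \<longrightarrow>
        geodesic_segment M d x z C \<longrightarrow> A \<subseteq> nbhd M d \<delta> (B \<union> C))"

text \<open>The Gromov boundary is built from sequences converging to infinity, since the
  coned-off Cayley graph is in general not proper.\<close>

definition gromov_product :: "('x \<Rightarrow> 'x \<Rightarrow> real) \<Rightarrow> 'x \<Rightarrow> 'x \<Rightarrow> 'x \<Rightarrow> real" where
  "gromov_product d p x y = (d x p + d y p - d x y) / 2"

definition gromov_rel ::
  "'x set \<Rightarrow> ('x \<Rightarrow> 'x \<Rightarrow> real) \<Rightarrow> 'x \<Rightarrow> ((nat \<Rightarrow> 'x) \<times> (nat \<Rightarrow> 'x)) set" where
  "gromov_rel M d p = {(u, w). range u \<subseteq> M \<and> range w \<subseteq> M \<and>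
     (\<forall>C. \<exists>n. \<forall>i\<ge>n. \<forall>j\<ge>n. C \<le> gromov_product d p (u i) (u j)) \<and>
     (\<forall>C. \<exists>n. \<forall>i\<ge>n. \<forall>j\<ge>n. C \<le> gromov_product d p (w i) (w j)) \<and>
     (\<forall>C. \<exists>n. \<forall>i\<ge>n. \<forall>j\<ge>n. C \<le> gromov_product d p (u i) (w j))}"

definition hyperbolic_boundary ::
  "'x set \<Rightarrow> ('x \<Rightarrow> 'x \<Rightarrow> real) \<Rightarrow> 'x \<Rightarrow> (nat \<Rightarrow> 'x) set set" where
  "hyperbolic_boundary M d p =
     {u. range u \<subseteq> M \<and> (\<forall>C. \<exists>n. \<forall>i\<ge>n. \<forall>j\<ge>n. C \<le> gromov_product d p (u i) (u j))}
     // gromov_rel M d p"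


section \<open>The Morse boundary\<close>

text \<open>Morse gauges are functions on \<open>[1,\<infinity>) \<times> [0,\<infinity>)\<close>; their values elsewhere are never used.\<close>

definition morse_gauge :: "(real \<Rightarrow> real \<Rightarrow> real) \<Rightarrow> bool" where
  "morse_gauge N \<longleftrightarrow> (\<forall>K\<ge>1. \<forall>L\<ge>0. 0 \<le> N K L)"

definition N_morse ::
  "'x set \<Rightarrow> ('x \<Rightarrow> 'x \<Rightarrow> real) \<Rightarrow> (real \<Rightarrow> real \<Rightarrow> real) \<Rightarrow> real set \<Rightarrow> (real \<Rightarrow> 'x) \<Rightarrow> bool" where
  "N_morse M d N I \<gamma> \<longleftrightarrow>
     (\<forall>K\<ge>1. \<forall>L>0. \<forall>\<sigma> a b. a \<le> b \<longrightarrow> quasi_geodesic M d K L {a..b} \<sigma> \<longrightarrow>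
        \<sigma> a \<in> \<gamma> ` I \<longrightarrow> \<sigma> b \<in> \<gamma> ` I \<longrightarrow> \<sigma> ` {a..b} \<subseteq> nbhd M d (N K L) (\<gamma> ` I))"

definition N_morse_rays ::
  "'x set \<Rightarrow> ('x \<Rightarrow> 'x \<Rightarrow> real) \<Rightarrow> 'x \<Rightarrow> (real \<Rightarrow> real \<Rightarrow> real) \<Rightarrow> (real \<Rightarrow> 'x) set" where
  "N_morse_rays M d p N = {\<alpha>. geodesic M d {0..} \<alpha> \<and> \<alpha> 0 = p \<and> N_morse M d N {0..} \<alpha>}"

definition morse_rays ::
  "'x set \<Rightarrow> ('x \<Rightarrow> 'x \<Rightarrow> real) \<Rightarrow> 'x \<Rightarrow> (real \<Rightarrow> 'x) set" where
  "morse_rays M d p = (\<Union>N\<in>Collect morse_gauge. N_morse_rays M d p N)"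

definition ray_rel ::
  "'x set \<Rightarrow> ('x \<Rightarrow> 'x \<Rightarrow> real) \<Rightarrow> 'x \<Rightarrow> ((real \<Rightarrow> 'x) \<times> (real \<Rightarrow> 'x)) set" where
  "ray_rel M d p = {(\<alpha>, \<beta>). \<alpha> \<in> morse_rays M d p \<and> \<beta> \<in> morse_rays M d p \<and>
     (\<exists>K. \<forall>t>0. d (\<alpha> t) (\<beta> t) < K)}"

definition morse_boundary ::
  "'x set \<Rightarrow> ('x \<Rightarrow> 'x \<Rightarrow> real) \<Rightarrow> 'x \<Rightarrow> (real \<Rightarrow> 'x) set set" where
  "morse_boundary M d p = morse_rays M d p // ray_rel M d p"

definition morse_stratum ::
  "'x set \<Rightarrow> ('x \<Rightarrow> 'x \<Rightarrow> real) \<Rightarrow> 'x \<Rightarrow> (real \<Rightarrow> real \<Rightarrow> real) \<Rightarrow> (real \<Rightarrow> 'x) set set" where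
  "morse_stratum M d p N = {x \<in> morse_boundary M d p. \<exists>\<alpha>\<in>x. \<alpha> \<in> N_morse_rays M d p N}"

definition converges_on_compacts ::
  "('x \<Rightarrow> 'x \<Rightarrow> real) \<Rightarrow> (nat \<Rightarrow> real \<Rightarrow> 'x) \<Rightarrow> (real \<Rightarrow> 'x) \<Rightarrow> bool" where
  "converges_on_compacts d as \<alpha> \<longleftrightarrow>
     (\<forall>C. compact C \<longrightarrow> C \<subseteq> {0..} \<longrightarrow>
        (\<forall>\<epsilon>>0. \<forall>\<^sub>F n in sequentially. \<forall>t\<in>C. d (as n t) (\<alpha> t) < \<epsilon>))"

definition stratum_converges ::
  "'x set \<Rightarrow> ('x \<Rightarrow> 'x \<Rightarrow> real) \<Rightarrow> 'x \<Rightarrow> (real \<Rightarrow> real \<Rightarrow> real) \<Rightarrow>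
     (nat \<Rightarrow> (real \<Rightarrow> 'x) set) \<Rightarrow> (real \<Rightarrow> 'x) set \<Rightarrow> bool" where
  "stratum_converges M d p N xs x \<longleftrightarrow>
     range xs \<subseteq> morse_stratum M d p N \<and> x \<in> morse_stratum M d p N \<and>
     (\<exists>as. (\<forall>n. as n \<in> N_morse_rays M d p N \<and> as n \<in> xs n) \<and>
        (\<forall>r::nat \<Rightarrow> nat. strict_mono r \<longrightarrow>
          (\<exists>r'::nat \<Rightarrow> nat. strict_mono r' \<and>
             (\<exists>\<alpha>\<in>x. converges_on_compacts d (as \<circ> r \<circ> r') \<alpha>))))"

definition stratum_closed ::
  "'x set \<Rightarrow> ('x \<Rightarrow> 'x \<Rightarrow> real) \<Rightarrow> 'x \<Rightarrow> (real \<Rightarrow> real \<Rightarrow> real) \<Rightarrow> (real \<Rightarrow> 'x) set set \<Rightarrow> bool" where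
  "stratum_closed M d p N F \<longleftrightarrow> F \<subseteq> morse_stratum M d p N \<and>
     (\<forall>xs x. range xs \<subseteq> F \<longrightarrow> stratum_converges M d p N xs x \<longrightarrow> x \<in> F)"

definition stratum_topology ::
  "'x set \<Rightarrow> ('x \<Rightarrow> 'x \<Rightarrow> real) \<Rightarrow> 'x \<Rightarrow> (real \<Rightarrow> real \<Rightarrow> real) \<Rightarrow> (real \<Rightarrow> 'x) set topology" where
  "stratum_topology M d p N = topology (\<lambda>U. U \<subseteq> morse_stratum M d p N \<and>
     stratum_closed M d p N (morse_stratum M d p N - U))"

text \<open>The direct limit of the strata, which are ordered by inclusion with union
  \<^const>\<open>morse_boundary\<close>: the final topology with respect to the inclusions.\<close>

definition morse_topology ::
  "'x set \<Rightarrow> ('x \<Rightarrow> 'x \<Rightarrow> real) \<Rightarrow> 'x \<Rightarrow> (real \<Rightarrow> 'x) set topology" where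
  "morse_topology M d p = topology (\<lambda>U. U \<subseteq> morse_boundary M d p \<and>
     (\<forall>N. morse_gauge N \<longrightarrow> openin (stratum_topology M d p N) (U \<inter> morse_stratum M d p N)))"

lemma stratum_converges_subseq:
  assumes "stratum_converges M d p N xs x" and "strict_mono (s :: nat \<Rightarrow> nat)"
  shows "stratum_converges M d p N (xs \<circ> s) x"
proof -
  from assms(1) obtain as where
    xs: "range xs \<subseteq> morse_stratum M d p N" and x: "x \<in> morse_stratum M d p N"
    and as: "\<forall>n. as n \<in> N_morse_rays M d p N \<and> as n \<in> xs n"
    and sub: "\<forall>r::nat \<Rightarrow> nat. strict_mono r \<longrightarrow>
      (\<exists>r'::nat \<Rightarrow> nat. strict_mono r' \<and> (\<exists>\<alpha>\<in>x. converges_on_compacts d (as \<circ> r \<circ> r') \<alpha>))"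
    unfolding stratum_converges_def by (elim conjE exE) (rule that)
  have "\<exists>r'::nat \<Rightarrow> nat. strict_mono r' \<and> (\<exists>\<alpha>\<in>x. converges_on_compacts d ((as \<circ> s) \<circ> r \<circ> r') \<alpha>)"
    if "strict_mono r" for r :: "nat \<Rightarrow> nat"
    using sub[rule_format, of "s \<circ> r"] that assms(2) by (simp add: strict_mono_o comp_assoc)
  moreover have "range (xs \<circ> s) \<subseteq> morse_stratum M d p N"
    using xs by auto
  moreover have "\<forall>n. (as \<circ> s) n \<in> N_morse_rays M d p N \<and> (as \<circ> s) n \<in> (xs \<circ> s) n"
    using as by simp
  ultimately show ?thesis
    unfolding stratum_converges_def using x by (intro conjI exI[of _ "as \<circ> s"]) simp_all
qed

lemma stratum_closed_Un:
  assumes "stratum_closed M d p N E" and "stratum_closed M d p N F"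
  shows "stratum_closed M d p N (E \<union> F)"
  unfolding stratum_closed_def
proof (intro conjI allI impI)
  show "E \<union> F \<subseteq> morse_stratum M d p N"
    using assms unfolding stratum_closed_def by blast
  fix xs :: "nat \<Rightarrow> (real \<Rightarrow> 'a) set" and x
  assume xs: "range xs \<subseteq> E \<union> F" and conv: "stratum_converges M d p N xs x"
  have key: "x \<in> C" if C: "stratum_closed M d p N C" and inf: "infinite {n. xs n \<in> C}" for C
  proof -
    obtain s :: "nat \<Rightarrow> nat" where s: "strict_mono s" "\<And>n. s n \<in> {n. xs n \<in> C}"
      using infinite_enumerate[OF inf] by blast
    have "range (xs \<circ> s) \<subseteq> C" using s(2) by auto
    then show ?thesis
      using C stratum_converges_subseq[OF conv s(1)] unfolding stratum_closed_def by blast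
  qed
  have "{n. xs n \<in> E} \<union> {n. xs n \<in> F} = UNIV" using xs by blast
  then have "infinite {n. xs n \<in> E} \<or> infinite {n. xs n \<in> F}"
    by (metis finite_UnI infinite_UNIV_nat)
  then show "x \<in> E \<union> F" using key assms by blast
qed

lemma openin_stratum_topology:
  "openin (stratum_topology M d p N) U \<longleftrightarrow> U \<subseteq> morse_stratum M d p N \<and>
     stratum_closed M d p N (morse_stratum M d p N - U)"
proof -
  let ?X = "morse_stratum M d p N"
  have "istopology (\<lambda>U. U \<subseteq> ?X \<and> stratum_closed M d p N (?X - U))"
    unfolding istopology_def
  proof (intro conjI allI impI)
    fix U V assume "U \<subseteq> ?X \<and> stratum_closed M d p N (?X - U)"
      and "V \<subseteq> ?X \<and> stratum_closed M d p N (?X - V)"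
    then show "U \<inter> V \<subseteq> ?X" "stratum_closed M d p N (?X - U \<inter> V)"
      by (auto simp: Diff_Int stratum_closed_Un)
  next
    fix \<K> assume K: "\<forall>U\<in>\<K>. U \<subseteq> ?X \<and> stratum_closed M d p N (?X - U)"
    then show "\<Union>\<K> \<subseteq> ?X" by blast
    show "stratum_closed M d p N (?X - \<Union>\<K>)"
      unfolding stratum_closed_def
    proof (intro conjI allI impI)
      fix xs x assume xs: "range xs \<subseteq> ?X - \<Union>\<K>" and conv: "stratum_converges M d p N xs x"
      have "x \<notin> U" if "U \<in> \<K>" for U
      proof -
        have "range xs \<subseteq> ?X - U" using xs that by blast
        then show ?thesis using K that conv unfolding stratum_closed_def by blast
      qed
      moreover have "x \<in> ?X" using conv unfolding stratum_converges_def by blast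
      ultimately show "x \<in> ?X - \<Union>\<K>" by blast
    qed blast
  qed
  then show ?thesis
    unfolding stratum_topology_def by (simp add: topology_inverse')
qed

lemma openin_morse_topology:
  "openin (morse_topology M d p) U \<longleftrightarrow> U \<subseteq> morse_boundary M d p \<and>
     (\<forall>N. morse_gauge N \<longrightarrow> openin (stratum_topology M d p N) (U \<inter> morse_stratum M d p N))"
proof -
  let ?P = "\<lambda>U. U \<subseteq> morse_boundary M d p \<and>
     (\<forall>N. morse_gauge N \<longrightarrow> openin (stratum_topology M d p N) (U \<inter> morse_stratum M d p N))"
  have "istopology ?P"
    unfolding istopology_def
  proof (intro conjI allI impI)
    fix U V assume U: "?P U" and V: "?P V"
    show "U \<inter> V \<subseteq> morse_boundary M d p" using conjunct1[OF U] by blast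
    fix N assume N: "morse_gauge N"
    have "openin (stratum_topology M d p N) (U \<inter> morse_stratum M d p N)"
      "openin (stratum_topology M d p N) (V \<inter> morse_stratum M d p N)"
      using U V N by simp_all
    then have "openin (stratum_topology M d p N)
        ((U \<inter> morse_stratum M d p N) \<inter> (V \<inter> morse_stratum M d p N))"
      by (rule openin_Int)
    moreover have "(U \<inter> morse_stratum M d p N) \<inter> (V \<inter> morse_stratum M d p N)
        = U \<inter> V \<inter> morse_stratum M d p N" by blast
    ultimately show "openin (stratum_topology M d p N) (U \<inter> V \<inter> morse_stratum M d p N)"
      by (simp only:)
  next
    fix \<K> assume K: "\<forall>U\<in>\<K>. ?P U"
    show "\<Union>\<K> \<subseteq> morse_boundary M d p" using K by (intro Union_least) simp
    fix N assume N: "morse_gauge N"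
    have "openin (stratum_topology M d p N) (\<Union>U\<in>\<K>. U \<inter> morse_stratum M d p N)"
    proof (rule openin_Union)
      fix W assume "W \<in> (\<lambda>U. U \<inter> morse_stratum M d p N) ` \<K>"
      then show "openin (stratum_topology M d p N) W" using K N by (elim imageE) simp
    qed
    moreover have "(\<Union>U\<in>\<K>. U \<inter> morse_stratum M d p N) = \<Union>\<K> \<inter> morse_stratum M d p N" by blast
    ultimately show "openin (stratum_topology M d p N) (\<Union>\<K> \<inter> morse_stratum M d p N)"
      by (simp only:)
  qed
  then show ?thesis
    unfolding morse_topology_def by (simp only: topology_inverse')
qed


section \<open>Metric graphs\<close>

text \<open>Simplicial graphs: an edge is the two-element set of its endpoints.\<close>

record 'v metric_graph =
  verts :: "'v set"
  edges :: "'v set set"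
  edge_len :: "'v set \<Rightarrow> real"

text \<open>Points of the geometric realization are barycentric coordinate functions: \<open>cell e\<close> is the
  closed edge (or vertex) spanned by \<open>e\<close>.\<close>

definition cell :: "'v set \<Rightarrow> ('v \<Rightarrow> real) set" where
  "cell e = {x. (\<forall>v. 0 \<le> x v) \<and> (\<forall>v. v \<notin> e \<longrightarrow> x v = 0) \<and> (\<Sum>v\<in>e. x v) = 1}"

definition vpoint :: "'v \<Rightarrow> 'v \<Rightarrow> real" where
  "vpoint v = indicator {v}"

definition realization :: "'v metric_graph \<Rightarrow> ('v \<Rightarrow> real) set" where
  "realization \<Gamma> = (\<Union>v\<in>verts \<Gamma>. cell {v}) \<union> (\<Union>e\<in>edges \<Gamma>. cell e)"

text \<open>\<open>chain_length \<Gamma> x y r\<close>: some piecewise linear path from \<open>x\<close> to \<open>y\<close>, each piece of which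
  stays in one closed edge, has length \<open>r\<close>. On an edge \<open>{u,w}\<close> both summands
  \<open>\<bar>y v - z v\<bar>\<close> are equal, whence the factor \<open>1/2\<close>.\<close>

inductive chain_length ::
  "'v metric_graph \<Rightarrow> ('v \<Rightarrow> real) \<Rightarrow> ('v \<Rightarrow> real) \<Rightarrow> real \<Rightarrow> bool" for \<Gamma> where
  refl: "x \<in> realization \<Gamma> \<Longrightarrow> chain_length \<Gamma> x x 0"
| step: "\<lbrakk>chain_length \<Gamma> x y r; e \<in> edges \<Gamma>; y \<in> cell e; z \<in> cell e\<rbrakk> \<Longrightarrow>
     chain_length \<Gamma> x z (r + edge_len \<Gamma> e * (\<Sum>v\<in>e. \<bar>y v - z v\<bar>) / 2)"

definition gdist :: "'v metric_graph \<Rightarrow> ('v \<Rightarrow> real) \<Rightarrow> ('v \<Rightarrow> real) \<Rightarrow> real" where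
  "gdist \<Gamma> x y = Inf {r. chain_length \<Gamma> x y r}"

text \<open>The linear extension of a vertex map to the geometric realization.\<close>

definition extend_map :: "('v \<Rightarrow> 'w) \<Rightarrow> ('v \<Rightarrow> real) \<Rightarrow> 'w \<Rightarrow> real" where
  "extend_map \<phi> x w = (\<Sum>v | x v \<noteq> 0 \<and> \<phi> v = w. x v)"

text \<open>A circuit is identified with its set of edges.\<close>

definition circuit :: "'v metric_graph \<Rightarrow> 'v set set \<Rightarrow> bool" where
  "circuit \<Gamma> C \<longleftrightarrow> (\<exists>vs. distinct vs \<and> 3 \<le> length vs \<and> C \<subseteq> edges \<Gamma> \<and>
     C = {{vs ! i, vs ! (Suc i mod length vs)} | i. i < length vs})"

definition fine_graph :: "'v metric_graph \<Rightarrow> bool" where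
  "fine_graph \<Gamma> \<longleftrightarrow> (\<forall>n::nat. 0 < n \<longrightarrow>
     (\<forall>e\<in>edges \<Gamma>. finite {C. circuit \<Gamma> C \<and> e \<in> C \<and> (\<Sum>c\<in>C. edge_len \<Gamma> c) = real n}))"


section \<open>Cayley graphs and coned-off Cayley graphs\<close>

definition finite_generating_set :: "('a, 'b) monoid_scheme \<Rightarrow> 'a set \<Rightarrow> bool" where
  "finite_generating_set G S \<longleftrightarrow> finite S \<and> S \<subseteq> carrier G \<and> generate G S = carrier G"

definition cayley_graph :: "('a, 'b) monoid_scheme \<Rightarrow> 'a set \<Rightarrow> 'a metric_graph" where
  "cayley_graph G S = \<lparr>verts = carrier G,
     edges = {{g, g \<otimes>\<^bsub>G\<^esub> s} | g s. g \<in> carrier G \<and> s \<in> S \<and> s \<noteq> \<one>\<^bsub>G\<^esub>},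
     edge_len = (\<lambda>e. 1)\<rparr>"

definition peripheral_cosets :: "('a, 'b) monoid_scheme \<Rightarrow> 'a set set \<Rightarrow> 'a set set" where
  "peripheral_cosets G \<P> = {g <#\<^bsub>G\<^esub> P | g P. g \<in> carrier G \<and> P \<in> \<P>}"

text \<open>Group elements are the vertices \<open>Inl g\<close>, peripheral vertices are \<open>Inr (g <# P)\<close>. A left
  coset of a subgroup determines the subgroup, so distinct pairs of a member of \<open>\<P>\<close> and a left
  coset of it yield distinct vertices.\<close>

definition coned_off_graph ::
  "('a, 'b) monoid_scheme \<Rightarrow> 'a set \<Rightarrow> 'a set set \<Rightarrow> ('a + 'a set) metric_graph" where
  "coned_off_graph G S \<P> = \<lparr>verts = Inl ` carrier G \<union> Inr ` peripheral_cosets G \<P>,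
     edges = (\<lambda>e. Inl ` e) ` edges (cayley_graph G S) \<union>
       {{Inl x, Inr C} | x C. C \<in> peripheral_cosets G \<P> \<and> x \<in> C},
     edge_len = (\<lambda>e. if e \<subseteq> range Inl then 1 else 1/2)\<rparr>"

definition relatively_hyperbolic ::
  "('a, 'b) monoid_scheme \<Rightarrow> 'a set \<Rightarrow> 'a set set \<Rightarrow> bool" where
  "relatively_hyperbolic G S \<P> \<longleftrightarrow> (let \<Gamma> = coned_off_graph G S \<P> in
     (\<exists>\<delta>. hyperbolic (realization \<Gamma>) (gdist \<Gamma>) \<delta>) \<and> fine_graph \<Gamma>)"


section \<open>The Morse boundary of a group\<close>

abbreviation cayley_space :: "('a, 'b) monoid_scheme \<Rightarrow> 'a set \<Rightarrow> ('a \<Rightarrow> real) set" where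
  "cayley_space G S \<equiv> realization (cayley_graph G S)"

abbreviation cayley_dist ::
  "('a, 'b) monoid_scheme \<Rightarrow> 'a set \<Rightarrow> ('a \<Rightarrow> real) \<Rightarrow> ('a \<Rightarrow> real) \<Rightarrow> real" where
  "cayley_dist G S \<equiv> gdist (cayley_graph G S)"

definition group_morse_boundary ::
  "('a, 'b) monoid_scheme \<Rightarrow> 'a set \<Rightarrow> (real \<Rightarrow> 'a \<Rightarrow> real) set set" where
  "group_morse_boundary G S =
     morse_boundary (cayley_space G S) (cayley_dist G S) (vpoint \<one>\<^bsub>G\<^esub>)"

definition group_morse_topology ::
  "('a, 'b) monoid_scheme \<Rightarrow> 'a set \<Rightarrow> (real \<Rightarrow> 'a \<Rightarrow> real) set topology" where
  "group_morse_topology G S =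
     morse_topology (cayley_space G S) (cayley_dist G S) (vpoint \<one>\<^bsub>G\<^esub>)"

text \<open>For a finitely generated group, emptiness of the Morse boundary does not depend on the
  finite generating set.\<close>

definition empty_morse_boundary :: "('a, 'b) monoid_scheme \<Rightarrow> bool" where
  "empty_morse_boundary H \<longleftrightarrow>
     (\<exists>T. finite_generating_set H T \<and> group_morse_boundary H T = {})"

text \<open>\<open>g[\<alpha>]\<close> is the class of all Morse rays \<open>\<beta>\<close> from the basepoint at finite Hausdorff distance
  from \<open>g\<alpha>\<close>.\<close>

definition morse_action ::
  "('a, 'b) monoid_scheme \<Rightarrow> 'a set \<Rightarrow> 'a \<Rightarrow> (real \<Rightarrow> 'a \<Rightarrow> real) set \<Rightarrow> (real \<Rightarrow> 'a \<Rightarrow> real) set" where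
  "morse_action G S g x =
     {\<beta> \<in> morse_rays (cayley_space G S) (cayley_dist G S) (vpoint \<one>\<^bsub>G\<^esub>). \<exists>\<alpha>\<in>x.
        finite_hausdorff_distance (cayley_space G S) (cayley_dist G S)
          (extend_map (\<lambda>h. g \<otimes>\<^bsub>G\<^esub> h) ` \<alpha> ` {0..}) (\<beta> ` {0..})}"

definition coset_morse_boundary ::
  "('a, 'b) monoid_scheme \<Rightarrow> 'a set \<Rightarrow> 'a set \<Rightarrow> (real \<Rightarrow> 'a \<Rightarrow> real) set set" where
  "coset_morse_boundary G S C = {x \<in> group_morse_boundary G S. \<exists>\<gamma>\<in>x. \<exists>R.
     \<gamma> ` {0..} \<subseteq> nbhd (cayley_space G S) (cayley_dist G S) R (vpoint ` C)}"

definition peripheral_limit_points ::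
  "('a, 'b) monoid_scheme \<Rightarrow> 'a set \<Rightarrow> 'a set set \<Rightarrow> (real \<Rightarrow> 'a \<Rightarrow> real) set set" where
  "peripheral_limit_points G S \<P> = (\<Union>C\<in>peripheral_cosets G \<P>. coset_morse_boundary G S C)"

definition nonperipheral_limit_points ::
  "('a, 'b) monoid_scheme \<Rightarrow> 'a set \<Rightarrow> 'a set set \<Rightarrow> (real \<Rightarrow> 'a \<Rightarrow> real) set set" where
  "nonperipheral_limit_points G S \<P> = group_morse_boundary G S - peripheral_limit_points G S \<P>"

definition same_type ::
  "('a, 'b) monoid_scheme \<Rightarrow> 'a set \<Rightarrow> 'a set set \<Rightarrow>
     (real \<Rightarrow> 'a \<Rightarrow> real) set \<Rightarrow> (real \<Rightarrow> 'a \<Rightarrow> real) set \<Rightarrow> bool" where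
  "same_type G S \<P> x y \<longleftrightarrow> (\<exists>C\<in>peripheral_cosets G \<P>.
     x \<in> coset_morse_boundary G S C \<and> y \<in> coset_morse_boundary G S C)"


section \<open>The Bowditch boundary\<close>

text \<open>Parabolic points are \<open>Inl v\<close> for a peripheral vertex \<open>v\<close>, non-parabolic points are
  \<open>Inr \<xi>\<close> for a point \<open>\<xi>\<close> of the hyperbolic boundary of the coned-off graph.\<close>

type_synonym 'a bowditch_point =
  "('a + 'a set) + (nat \<Rightarrow> ('a + 'a set) \<Rightarrow> real) set"

definition parabolic_points ::
  "('a, 'b) monoid_scheme \<Rightarrow> 'a set set \<Rightarrow> 'a bowditch_point set" where
  "parabolic_points G \<P> = Inl ` Inr ` peripheral_cosets G \<P>"

definition nonparabolic_points ::
  "('a, 'b) monoid_scheme \<Rightarrow> 'a set \<Rightarrow> 'a set set \<Rightarrow> 'a bowditch_point set" where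
  "nonparabolic_points G S \<P> = (let \<Gamma> = coned_off_graph G S \<P> in
     Inr ` hyperbolic_boundary (realization \<Gamma>) (gdist \<Gamma>) (vpoint (Inl \<one>\<^bsub>G\<^esub>)))"

definition bowditch_boundary ::
  "('a, 'b) monoid_scheme \<Rightarrow> 'a set \<Rightarrow> 'a set set \<Rightarrow> 'a bowditch_point set" where
  "bowditch_boundary G S \<P> = parabolic_points G \<P> \<union> nonparabolic_points G S \<P>"

text \<open>Initial and terminal points of a geodesic defined on an interval \<open>I\<close>: either a vertex,
  attained at the least (greatest) element of \<open>I\<close>, or a boundary point, to which the geodesic
  converges along an infinite end of \<open>I\<close>.\<close>

fun starts_at :: "real set \<Rightarrow> (real \<Rightarrow> 'v \<Rightarrow> real) \<Rightarrow> 'v + (nat \<Rightarrow> 'v \<Rightarrow> real) set \<Rightarrow> bool" where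
  "starts_at I \<gamma> (Inl v) \<longleftrightarrow> (\<exists>s\<in>I. (\<forall>t\<in>I. s \<le> t) \<and> \<gamma> s = vpoint v)"
| "starts_at I \<gamma> (Inr \<xi>) \<longleftrightarrow> (\<exists>t. {..t} \<subseteq> I \<and> (\<lambda>n. \<gamma> (t - real n)) \<in> \<xi>)"

fun ends_at :: "real set \<Rightarrow> (real \<Rightarrow> 'v \<Rightarrow> real) \<Rightarrow> 'v + (nat \<Rightarrow> 'v \<Rightarrow> real) set \<Rightarrow> bool" where
  "ends_at I \<gamma> (Inl v) \<longleftrightarrow> (\<exists>s\<in>I. (\<forall>t\<in>I. t \<le> s) \<and> \<gamma> s = vpoint v)"
| "ends_at I \<gamma> (Inr \<xi>) \<longleftrightarrow> (\<exists>t. {t..} \<subseteq> I \<and> (\<lambda>n. \<gamma> (t + real n)) \<in> \<xi>)"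

text \<open>The sets \<open>M(a,A)\<close>.\<close>

definition bowditch_nbhd ::
  "('a, 'b) monoid_scheme \<Rightarrow> 'a set \<Rightarrow> 'a set set \<Rightarrow>
     'a bowditch_point \<Rightarrow> ('a + 'a set) set \<Rightarrow> 'a bowditch_point set" where
  "bowditch_nbhd G S \<P> a A = (let \<Gamma> = coned_off_graph G S \<P> in
     {b \<in> bowditch_boundary G S \<P>. \<exists>I \<gamma>. geodesic (realization \<Gamma>) (gdist \<Gamma>) I \<gamma> \<and>
        starts_at I \<gamma> a \<and> ends_at I \<gamma> b \<and> \<gamma> ` I \<inter> vpoint ` A = {}})"

definition bowditch_open ::
  "('a, 'b) monoid_scheme \<Rightarrow> 'a set \<Rightarrow> 'a set set \<Rightarrow> 'a bowditch_point set \<Rightarrow> bool" where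
  "bowditch_open G S \<P> U \<longleftrightarrow> U \<subseteq> bowditch_boundary G S \<P> \<and>
     (\<forall>a\<in>U. \<exists>A. finite A \<and> A \<subseteq> verts (coned_off_graph G S \<P>) \<and> a \<notin> Inl ` A \<and>
        bowditch_nbhd G S \<P> a A \<subseteq> U)"

definition bowditch_topology ::
  "('a, 'b) monoid_scheme \<Rightarrow> 'a set \<Rightarrow> 'a set set \<Rightarrow> 'a bowditch_point topology" where
  "bowditch_topology G S \<P> = topology (bowditch_open G S \<P>)"

lemma bowditch_nbhd_antimono:
  "A \<subseteq> B \<Longrightarrow> bowditch_nbhd G S \<P> a B \<subseteq> bowditch_nbhd G S \<P> a A"
  unfolding bowditch_nbhd_def Let_def by blast

lemma bowditch_open_Int:
  assumes U: "bowditch_open G S \<P> U" and V: "bowditch_open G S \<P> V"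
  shows "bowditch_open G S \<P> (U \<inter> V)"
  unfolding bowditch_open_def
proof (intro conjI ballI)
  show "U \<inter> V \<subseteq> bowditch_boundary G S \<P>"
    using U unfolding bowditch_open_def by blast
  fix a assume "a \<in> U \<inter> V"
  then have a: "a \<in> U" "a \<in> V" by auto
  obtain A where A: "finite A" "A \<subseteq> verts (coned_off_graph G S \<P>)" "a \<notin> Inl ` A"
    "bowditch_nbhd G S \<P> a A \<subseteq> U"
    using bspec[OF conjunct2[OF U[unfolded bowditch_open_def]] a(1)] by (elim exE conjE)
  obtain B where B: "finite B" "B \<subseteq> verts (coned_off_graph G S \<P>)" "a \<notin> Inl ` B"
    "bowditch_nbhd G S \<P> a B \<subseteq> V"
    using bspec[OF conjunct2[OF V[unfolded bowditch_open_def]] a(2)] by (elim exE conjE)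
  have "finite (A \<union> B)" "A \<union> B \<subseteq> verts (coned_off_graph G S \<P>)"
    using A B by simp_all
  moreover have "a \<notin> Inl ` (A \<union> B)"
    using A(3) B(3) by (simp add: image_Un)
  moreover have "bowditch_nbhd G S \<P> a (A \<union> B) \<subseteq> U \<inter> V"
  proof (rule Int_greatest)
    show "bowditch_nbhd G S \<P> a (A \<union> B) \<subseteq> U"
      using bowditch_nbhd_antimono A(4) by (rule order_trans) simp
    show "bowditch_nbhd G S \<P> a (A \<union> B) \<subseteq> V"
      using bowditch_nbhd_antimono B(4) by (rule order_trans) simp
  qed
  ultimately show "\<exists>A. finite A \<and> A \<subseteq> verts (coned_off_graph G S \<P>) \<and> a \<notin> Inl ` A \<and>
      bowditch_nbhd G S \<P> a A \<subseteq> U \<inter> V"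
    by (intro exI[of _ "A \<union> B"] conjI)
qed

lemma bowditch_open_Union:
  assumes K: "\<forall>U\<in>\<K>. bowditch_open G S \<P> U"
  shows "bowditch_open G S \<P> (\<Union>\<K>)"
  unfolding bowditch_open_def
proof (intro conjI ballI)
  show "\<Union>\<K> \<subseteq> bowditch_boundary G S \<P>"
    using K by (intro Union_least) (simp add: bowditch_open_def)
  fix a assume "a \<in> \<Union>\<K>"
  then obtain U where U: "U \<in> \<K>" "a \<in> U" by (rule UnionE)
  obtain A where A: "finite A" "A \<subseteq> verts (coned_off_graph G S \<P>)" "a \<notin> Inl ` A"
    "bowditch_nbhd G S \<P> a A \<subseteq> U"
    using bspec[OF conjunct2[OF bspec[OF K U(1), unfolded bowditch_open_def]] U(2)]
    by (elim exE conjE)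
  have "bowditch_nbhd G S \<P> a A \<subseteq> \<Union>\<K>"
    using A(4) Union_upper[OF U(1)] by (rule order_trans)
  with A(1-3) show "\<exists>A. finite A \<and> A \<subseteq> verts (coned_off_graph G S \<P>) \<and> a \<notin> Inl ` A \<and>
      bowditch_nbhd G S \<P> a A \<subseteq> \<Union>\<K>"
    by (intro exI[of _ A] conjI)
qed

lemma openin_bowditch_topology: "openin (bowditch_topology G S \<P>) = bowditch_open G S \<P>"
proof -
  have "istopology (bowditch_open G S \<P>)"
    unfolding istopology_def by (intro conjI allI impI bowditch_open_Int bowditch_open_Union)
  then show ?thesis
    unfolding bowditch_topology_def by (simp only: topology_inverse')
qed

definition coned_off_action ::
  "('a, 'b) monoid_scheme \<Rightarrow> 'a \<Rightarrow> 'a + 'a set \<Rightarrow> 'a + 'a set" where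
  "coned_off_action G g = map_sum (\<lambda>h. g \<otimes>\<^bsub>G\<^esub> h) (\<lambda>C. g <#\<^bsub>G\<^esub> C)"

definition bowditch_action ::
  "('a, 'b) monoid_scheme \<Rightarrow> 'a \<Rightarrow> 'a bowditch_point \<Rightarrow> 'a bowditch_point" where
  "bowditch_action G g = map_sum (coned_off_action G g)
     (\<lambda>\<xi>. (\<lambda>u. extend_map (coned_off_action G g) \<circ> u) ` \<xi>)"

end

theory Submission
  imports Defs
begin

text \<open>The boundary of the coned-off graph is compared with the Morse boundary through the nearest
  point projections to peripheral cosets. A path of the coned-off graph that avoids the cone point
  of a coset \<open>C\<close> and joins two points of \<open>C\<close> closes up to a circuit through it, so fineness shows that
  the projection to \<open>C\<close> changes by a bounded amount along every edge not contained in \<open>C\<close>. Summing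
  over the cosets that a geodesic of the coned-off graph traverses, the geodesic together with
  shortest paths in these cosets is an undistorted subset of the Cayley graph. A Morse ray therefore
  stays close to it: the points of the ray either converge to a point of the hyperbolic boundary of
  the coned-off graph, or stay close to a single peripheral coset. This dichotomy defines the map.

  If two rays have the same limit in the hyperbolic boundary, fineness forces fellow-travelling
  geodesics of the coned-off graph to pass through points that are close in the Cayley graph, so the
  rays come close to each other infinitely often and, being Morse, are asymptotic; this is
  injectivity. For continuity, rays that agree for a long time have limits that are joined, by a
  limiting argument with finite balls, by geodesics of the coned-off graph which avoid a given finite
  set: they stay far from the base point, or they leave the cone point of \<open>C\<close> through an element far
  from the projections to \<open>C\<close> of the given vertices. Finally, a Morse ray near a coset of \<open>P\<close> yields a
  Morse ray of \<open>P\<close>, as peripheral subgroups are undistorted.\<close>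

section \<open>Graph metrics and coned-off graphs\<close>

text \<open>Two obstacles shape the proof. The coned-off graph is not locally finite, so geodesics
  in it need not subconverge; limits are extracted in the word metric instead, whose balls are
  finite, and \<open>fellow_close\<close> supplies the word-metric bounds that this requires.
  Moreover, hyperbolicity concerns the coned-off graph only, so the Morse property is the one link
  from its geodesics back to a ray; \<open>bpath_near\<close> is this link. Up to the boundary
  everything is done with the integer-valued metrics \<open>d\<close> and \<open>D\<close> on the
  group: two half-edges through a cone point make a step of length 1, so geodesics can be recorded
  by their group elements. Rays become sequences with additive error 1, and since the
  quasi-geodesics of the Morse condition may be discontinuous, discrete chains can be tested against
  them directly. Cosets enter through failure of compactness: if the distance \<open>D\<close> from
  the start does not tend to infinity, geodesics of bounded length reach infinitely many points, and
  such branching is possible only inside a coset. Continuity is tested within one stratum, where all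
  rays share a gauge and hence all constants.\<close>

locale graph_metric =
  fixes V :: "'a set" and d :: "'a \<Rightarrow> 'a \<Rightarrow> nat"
  assumes d0: "x \<in> V \<Longrightarrow> y \<in> V \<Longrightarrow> d x y = 0 \<longleftrightarrow> x = y"
    and dsym: "d x y = d y x"
    and dtri: "x \<in> V \<Longrightarrow> y \<in> V \<Longrightarrow> z \<in> V \<Longrightarrow> d x z \<le> d x y + d y z"
    and dpath: "x \<in> V \<Longrightarrow> y \<in> V \<Longrightarrow>
      \<exists>p. p 0 = x \<and> p (d x y) = y \<and> (\<forall>i. p i \<in> V) \<and> (\<forall>i<d x y. d (p i) (p (Suc i)) \<le> 1)"
begin

lemma drefl [simp]: "x \<in> V \<Longrightarrow> d x x = 0"
  by (simp add: d0)

lemma chain_le: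
  assumes "\<And>k. i \<le> k \<Longrightarrow> k \<le> j \<Longrightarrow> p k \<in> V" "\<And>k. i \<le> k \<Longrightarrow> k < j \<Longrightarrow> d (p k) (p (Suc k)) \<le> c" "i \<le> j"
  shows "d (p i) (p j) \<le> c * (j - i)"
  using assms(3,1,2)
proof (induction j rule: dec_induct)
  case base thus ?case by simp
next
  case (step n)
  have "d (p i) (p (Suc n)) \<le> d (p i) (p n) + d (p n) (p (Suc n))"
    using step by (intro dtri) auto
  also have "\<dots> \<le> c * (n - i) + c" using step by (intro add_mono) auto
  also have "\<dots> = c * (Suc n - i)" using step by (simp add: Suc_diff_le)
  finally show ?case .
qed

definition geo :: "nat \<Rightarrow> (nat \<Rightarrow> 'a) \<Rightarrow> bool" where
  "geo n c \<longleftrightarrow> (\<forall>i\<le>n. c i \<in> V) \<and> (\<forall>i j. i \<le> j \<longrightarrow> j \<le> n \<longrightarrow> d (c i) (c j) = j - i)"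

lemma geoV: "geo n c \<Longrightarrow> i \<le> n \<Longrightarrow> c i \<in> V"
  by (simp add: geo_def)

lemma geoD: "geo n c \<Longrightarrow> i \<le> j \<Longrightarrow> j \<le> n \<Longrightarrow> d (c i) (c j) = j - i"
  by (simp add: geo_def)

text \<open>The path has \<open>d x y\<close> steps of length at most 1, so all triangle
  inequalities along it are equalities.\<close>

lemma geo_ex:
  assumes "x \<in> V" "y \<in> V"
  obtains p where "p 0 = x" "p (d x y) = y" "geo (d x y) p"
proof -
  obtain p where p: "p 0 = x" "p (d x y) = y" "\<And>i. p i \<in> V" "\<And>i. i < d x y \<Longrightarrow> d (p i) (p (Suc i)) \<le> 1"
    using dpath[OF assms] by blast
  have le: "d (p i) (p j) \<le> j - i" if "i \<le> j" "j \<le> d x y" for i j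
    using chain_le[of i j p 1] p that by simp
  have "d (p i) (p j) = j - i" if "i \<le> j" "j \<le> d x y" for i j
  proof -
    have "d x y \<le> d x (p i) + d (p i) y" using p assms by (intro dtri) auto
    moreover have "d (p i) y \<le> d (p i) (p j) + d (p j) y" using p assms by (intro dtri) auto
    moreover have "d x (p i) \<le> i" using le[of 0 i] p that by simp
    moreover have "d (p j) y \<le> d x y - j" using le[of j "d x y"] p that by simp
    ultimately show ?thesis using le[OF that] that by linarith
  qed
  hence "geo (d x y) p" using p unfolding geo_def by blast
  thus ?thesis using that p by blast
qed

definition Iv :: "'a \<Rightarrow> 'a \<Rightarrow> 'a set" where
  "Iv u w = {z \<in> V. d u z + d z w = d u w}"

lemma Iv_D: "z \<in> Iv u w \<Longrightarrow> z \<in> V \<and> d u z + d z w = d u w"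
  by (simp add: Iv_def)

lemma Iv_sym: "Iv u w = Iv w u"
  unfolding Iv_def using dsym by (auto simp: add.commute)

lemma geo_Iv: "geo n c \<Longrightarrow> i \<le> j \<Longrightarrow> j \<le> k \<Longrightarrow> k \<le> n \<Longrightarrow> c j \<in> Iv (c i) (c k)"
  unfolding Iv_def by (auto simp: geoD geoV)

lemma Iv_point:
  assumes "x \<in> V" "y \<in> V" "t \<le> d x y"
  obtains z where "z \<in> Iv x y" "d x z = t" "d z y = d x y - t"
proof -
  obtain p where p: "p 0 = x" "p (d x y) = y" "geo (d x y) p" using geo_ex assms by blast
  have "d x (p t) = t" using geoD[OF p(3), of 0 t] p assms by simp
  moreover have "d (p t) y = d x y - t" using geoD[OF p(3), of t "d x y"] p assms by simp
  ultimately show ?thesis using that[of "p t"] assms geoV[OF p(3)] by (auto simp: Iv_def)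
qed

lemma geo_rev: "geo n c \<Longrightarrow> geo n (\<lambda>i. c (n - i))"
  unfolding geo_def
proof (intro conjI allI impI)
  fix i j assume A: "(\<forall>i\<le>n. c i \<in> V) \<and> (\<forall>i j. i \<le> j \<longrightarrow> j \<le> n \<longrightarrow> d (c i) (c j) = j - i)" "i \<le> j" "j \<le> n"
  have "d (c (n - j)) (c (n - i)) = (n - i) - (n - j)" using A by auto
  also have "\<dots> = j - i" using A by auto
  finally show "d (c (n - i)) (c (n - j)) = j - i" by (simp add: dsym)
qed auto

lemma geo_abs:
  assumes "geo n c" "i \<le> n" "j \<le> n"
  shows "int (d (c i) (c j)) = \<bar>int i - int j\<bar>"
proof (cases "i \<le> j")
  case True thus ?thesis using geoD[OF assms(1)] assms by auto
next
  case False thus ?thesis using geoD[OF assms(1), of j i] dsym[of "c i"] assms by auto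
qed

lemma geo_sub: "geo n c \<Longrightarrow> k + m \<le> n \<Longrightarrow> geo m (\<lambda>i. c (k + i))"
  unfolding geo_def by auto

end

section \<open>Shortest walks of a relation\<close>

lemma shortest_walk:
  assumes "(x, y) \<in> R ^^ n" "\<And>m. m < n \<Longrightarrow> (x, y) \<notin> R ^^ m"
  obtains f where "f 0 = x" "f n = y" "\<And>i. i < n \<Longrightarrow> (f i, f (Suc i)) \<in> R"
    "inj_on f {..n}"
proof -
  obtain f where f: "f 0 = x" "f n = y" "\<And>i. i < n \<Longrightarrow> (f i, f (Suc i)) \<in> R"
    using assms(1) unfolding relpow_fun_conv by blast
  have seg: "(f i, f j) \<in> R ^^ (j - i)" if "i \<le> j" "j \<le> n" for i j
    unfolding relpow_fun_conv by (intro exI[of _ "\<lambda>k. f (i + k)"]) (use f that in auto)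
  \<comment> \<open>Cutting out the loop between two visits of a vertex would leave a shorter
    walk.\<close>
  have "i = j" if "i \<le> j" "j \<le> n" "f i = f j" for i j
  proof (rule ccontr)
    assume "i \<noteq> j"
    have "(x, f i) \<in> R ^^ i" using seg[of 0 i] that f by simp
    moreover have "(f i, y) \<in> R ^^ (n - j)" using seg[of j n] that f by simp
    ultimately have "(x, y) \<in> R ^^ (i + (n - j))" unfolding relpow_add by blast
    moreover have "i + (n - j) < n" using that \<open>i \<noteq> j\<close> by simp
    ultimately show False using assms(2) by blast
  qed
  hence "inj_on f {..n}" by (intro inj_onI) (metis atMost_iff linear)
  thus ?thesis using that f by blast
qed

lemma relpow_sym:
  assumes "sym R" "(x, y) \<in> R ^^ n" shows "(y, x) \<in> R ^^ n"
  using assms(2)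
proof (induction n arbitrary: y)
  case 0 thus ?case by simp
next
  case (Suc n)
  then obtain z where "(x, z) \<in> R ^^ n" "(z, y) \<in> R" by auto
  hence "(z, x) \<in> R ^^ n" "(y, z) \<in> R" using Suc.IH assms(1) by (auto dest: symD)
  thus ?case by (meson relpow_Suc_I2)
qed

text \<open>\<open>V\<close> is the group, \<open>d\<close> its word metric, \<open>CC\<close> the set of peripheral cosets and \<open>D\<close> the distance of
  the coned-off graph between group elements. Fineness enters only through \<open>B\<close>: the word metric
  diameter of a circuit with at most \<open>n\<close> vertices is at most \<open>B n\<close>.\<close>

fun cadj :: "'a set \<Rightarrow> ('a \<Rightarrow> 'a \<Rightarrow> nat) \<Rightarrow> 'a set set \<Rightarrow> 'a + 'a set \<Rightarrow> 'a + 'a set \<Rightarrow> bool" where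
  "cadj V d CC (Inl x) (Inl y) \<longleftrightarrow> x \<in> V \<and> y \<in> V \<and> d x y = 1"
| "cadj V d CC (Inl x) (Inr C) \<longleftrightarrow> C \<in> CC \<and> x \<in> C"
| "cadj V d CC (Inr C) (Inl x) \<longleftrightarrow> C \<in> CC \<and> x \<in> C"
| "cadj V d CC (Inr C) (Inr C') \<longleftrightarrow> False"

locale cone_graph = X: graph_metric V d + Y: graph_metric V D
  for V :: "'a set" and d D :: "'a \<Rightarrow> 'a \<Rightarrow> nat" +
  fixes CC :: "'a set set" and \<delta> :: nat and B :: "nat \<Rightarrow> nat"
  assumes fin_ball: "x \<in> V \<Longrightarrow> finite {y \<in> V. d x y \<le> n}"
    and D_le: "x \<in> V \<Longrightarrow> y \<in> V \<Longrightarrow> D x y \<le> d x y"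
    and CC_V: "C \<in> CC \<Longrightarrow> C \<subseteq> V" and CC_ne: "C \<in> CC \<Longrightarrow> C \<noteq> {}"
    and CC_D: "C \<in> CC \<Longrightarrow> x \<in> C \<Longrightarrow> y \<in> C \<Longrightarrow> D x y \<le> 1"
    and D1: "x \<in> V \<Longrightarrow> y \<in> V \<Longrightarrow> D x y \<le> 1 \<Longrightarrow> d x y \<le> 1 \<or> (\<exists>C\<in>CC. x \<in> C \<and> y \<in> C)"
    and fin_CC: "x \<in> V \<Longrightarrow> finite {C \<in> CC. x \<in> C}"
    and hyp: "x \<in> V \<Longrightarrow> y \<in> V \<Longrightarrow> z \<in> V \<Longrightarrow> w \<in> V \<Longrightarrow>
      D x y + D z w \<le> max (D x z + D y w) (D x w + D y z) + \<delta>"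
    and circ: "distinct vs \<Longrightarrow> 3 \<le> length vs \<Longrightarrow> length vs \<le> n \<Longrightarrow>
      (\<And>i. i < length vs \<Longrightarrow> cadj V d CC (vs ! i) (vs ! (Suc i mod length vs))) \<Longrightarrow>
      Inl x \<in> set vs \<Longrightarrow> Inl y \<in> set vs \<Longrightarrow> d x y \<le> B n"
    and B_mono: "m \<le> n \<Longrightarrow> B m \<le> B n"
begin

section \<open>Circuits and walks inside finite vertex sets\<close>

abbreviation "adj \<equiv> cadj V d CC"

lemma adj_sym: "adj u v \<longleftrightarrow> adj v u"
  by (cases u; cases v) (auto simp: X.dsym)

lemma adj_irrefl: "\<not> adj u u"
  by (cases u) auto

lemma circ_fun:
  assumes "inj_on f {..m}" "2 \<le> m" "m < n" "\<And>i. i < m \<Longrightarrow> adj (f i) (f (Suc i))" "adj (f m) (f 0)"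
    and "i \<le> m" "j \<le> m" "f i = Inl x" "f j = Inl y"
  shows "d x y \<le> B n"
proof (rule circ[where vs = "map f [0..<Suc m]"])
  show "distinct (map f [0..<Suc m])"
    using assms(1) by (simp add: distinct_map atLeast0LessThan lessThan_Suc_atMost del: upt_Suc)
  fix i assume "i < length (map f [0..<Suc m])"
  hence "i \<le> m" by simp
  thus "adj (map f [0..<Suc m] ! i) (map f [0..<Suc m] ! (Suc i mod length (map f [0..<Suc m])))"
    using assms(4)[of i] assms(5) by (cases "i = m") (simp_all del: upt_Suc)
next
  show "Inl x \<in> set (map f [0..<Suc m])" using assms(6,8) by (auto simp del: upt_Suc simp: image_iff intro!: bexI[of _ i])
  show "Inl y \<in> set (map f [0..<Suc m])" using assms(7,9) by (auto simp del: upt_Suc simp: image_iff intro!: bexI[of _ j])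
qed (use assms in auto)

text \<open>Edges with both ends in \<open>W\<close>; the size of \<open>W\<close> then bounds the
  number of vertices of every simple walk, and so of the circuits built from it.\<close>

definition adj_on :: "('a + 'a set) set \<Rightarrow> (('a + 'a set) \<times> ('a + 'a set)) set" where
  "adj_on W = {(u, v). u \<in> W \<and> v \<in> W \<and> adj u v}"

lemma adj_on_mono: "W \<subseteq> W' \<Longrightarrow> adj_on W \<subseteq> adj_on W'"
  unfolding adj_on_def by auto

lemma adj_on_rtrancl_mono: "W \<subseteq> W' \<Longrightarrow> p \<in> (adj_on W)\<^sup>* \<Longrightarrow> p \<in> (adj_on W')\<^sup>*"
  using rtrancl_mono[OF adj_on_mono] by blast

lemma adj_on_rtrancl_sym: "(u, v) \<in> (adj_on W)\<^sup>* \<Longrightarrow> (v, u) \<in> (adj_on W)\<^sup>*"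
  by (rule symD[OF sym_rtrancl]) (auto simp: sym_def adj_on_def adj_sym)

lemma shortest_walk_ex:
  assumes "(x, y) \<in> R\<^sup>*"
  obtains f n where "f 0 = x" "f n = y" "\<And>i. i < n \<Longrightarrow> (f i, f (Suc i)) \<in> R" "inj_on f {..n}"
proof -
  have ex: "\<exists>n. (x, y) \<in> R ^^ n" using assms by (simp add: rtrancl_power)
  define n where "n = (LEAST n. (x, y) \<in> R ^^ n)"
  have "(x, y) \<in> R ^^ n" unfolding n_def using ex by (rule LeastI_ex)
  moreover have "(x, y) \<notin> R ^^ m" if "m < n" for m
    using not_less_Least[of m "\<lambda>n. (x, y) \<in> R ^^ n"] that unfolding n_def by blast
  ultimately show ?thesis using that by (rule shortest_walk)
qed

text \<open>A shortest walk inside \<open>W\<close> is simple and misses the cone point of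
  \<open>C\<close>; adding that cone point closes it to a circuit with at most \<open>n + 1\<close>
  vertices.\<close>

lemma angle_rel:
  assumes C: "C \<in> CC" "a \<in> C" "a' \<in> C" "Inr C \<notin> W" and W: "finite W" "card W \<le> n"
    and walk: "(Inl a, Inl a') \<in> (adj_on W)\<^sup>*"
  shows "d a a' \<le> B (Suc n)"
proof (cases "a = a'")
  case True thus ?thesis using C CC_V[OF C(1)] by (simp add: subset_iff)
next
  case False
  obtain f m where f: "f 0 = Inl a" "f m = Inl a'" "\<And>i. i < m \<Longrightarrow> (f i, f (Suc i)) \<in> adj_on W" "inj_on f {..m}"
    using shortest_walk_ex[OF walk] by blast
  have m: "0 < m" using f False by (metis Inl_inject gr0I)
  have inW: "f i \<in> W" if "i \<le> m" for i
    using f(3)[of i] f(3)[of "i - 1"] that m unfolding adj_on_def by (cases "i = m") auto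
  have "card (f ` {..m}) \<le> card W" using inW W by (intro card_mono) auto
  hence mn: "m < n" using W f(4) by (simp add: card_image)
  define g where "g i = (case i of 0 \<Rightarrow> Inr C | Suc k \<Rightarrow> f k)" for i
  show ?thesis
  proof (rule circ_fun[of g "Suc m" "Suc n" 1 "Suc m"])
    have inj: "f i = f j \<Longrightarrow> i \<le> m \<Longrightarrow> j \<le> m \<Longrightarrow> i = j" for i j using f(4) by (auto dest: inj_onD)
    show "inj_on g {..Suc m}"
    proof (rule inj_onI)
      fix i j assume *: "i \<in> {..Suc m}" "j \<in> {..Suc m}" "g i = g j"
      have nC: "f k \<noteq> Inr C" if "k \<le> m" for k using inW[OF that] C(4) by auto
      show "i = j"
      proof (cases i)
        case 0 thus ?thesis using * nC[of "j - 1"] unfolding g_def by (cases j) auto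
      next
        case (Suc i')
        thus ?thesis using * nC[of i'] inj[of i' "j - 1"] unfolding g_def by (cases j) auto
      qed
    qed
    show "adj (g i) (g (Suc i))" if "i < Suc m" for i
      using that f(3)[of "i - 1"] f(1) C unfolding g_def adj_on_def by (cases i) auto
    show "adj (g (Suc m)) (g 0)" using f C unfolding g_def by auto
  qed (use m mn f in \<open>auto simp: g_def\<close>)
qed

text \<open>Each step contributes at most its end point and one cone point, whence
  \<open>2 * n + 1\<close>. The predicate \<open>P\<close> selects the cone points that may be used,
  and the description of \<open>W\<close> is recorded so that its disjointness from other sets can
  be checked.\<close>

lemma walk_set:
  assumes "\<And>i. i \<le> n \<Longrightarrow> w i \<in> V"
    "\<And>i. i < n \<Longrightarrow> d (w i) (w (Suc i)) \<le> 1 \<or> (\<exists>C\<in>CC. P C \<and> w i \<in> C \<and> w (Suc i) \<in> C)"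
  shows "\<exists>W. finite W \<and> card W \<le> 2 * n + 1 \<and> (Inl (w 0), Inl (w n)) \<in> (adj_on W)\<^sup>* \<and> Inl (w 0) \<in> W \<and>
    W \<subseteq> Inl ` w ` {..n} \<union> {Inr C | C i. C \<in> CC \<and> P C \<and> i < n \<and> w i \<in> C \<and> w (Suc i) \<in> C \<and> w i \<noteq> w (Suc i)}"
  using assms
proof (induction n)
  case 0
  show ?case by (intro exI[of _ "{Inl (w 0)}"]) auto
next
  case (Suc n)
  let ?U = "\<lambda>n. Inl ` w ` {..n} \<union> {Inr C | C i. C \<in> CC \<and> P C \<and> i < n \<and> w i \<in> C \<and> w (Suc i) \<in> C \<and> w i \<noteq> w (Suc i)}"
  obtain W where W: "finite W" "card W \<le> 2 * n + 1" "(Inl (w 0), Inl (w n)) \<in> (adj_on W)\<^sup>*" "Inl (w 0) \<in> W" "W \<subseteq> ?U n"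
    using Suc.IH[OF Suc.prems(1) Suc.prems(2)] by auto
  have U: "?U n \<subseteq> ?U (Suc n)" by (auto intro: less_SucI)
  have nW: "Inl (w n) \<in> W" using W(3,4) by (cases rule: rtranclE) (auto simp: adj_on_def)
  have V: "w n \<in> V" "w (Suc n) \<in> V" using Suc.prems by auto
  consider "w n = w (Suc n)" | "d (w n) (w (Suc n)) = 1" | C where "w n \<noteq> w (Suc n)" "C \<in> CC" "P C" "w n \<in> C" "w (Suc n) \<in> C"
    using Suc.prems(2)[of n] V X.d0[of "w n" "w (Suc n)"] by fastforce
  thus ?case
  proof cases
    case 1
    have "W \<subseteq> ?U (Suc n)" using W(5) U by (rule order_trans)
    thus ?thesis using W 1 by (intro exI[of _ W]) simp
  next
    case 2
    let ?W = "insert (Inl (w (Suc n))) W"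
    have "(Inl (w 0), Inl (w n)) \<in> (adj_on ?W)\<^sup>*" using W(3) by (rule adj_on_rtrancl_mono[rotated]) auto
    moreover have "(Inl (w n), Inl (w (Suc n))) \<in> adj_on ?W" using nW 2 V by (auto simp: adj_on_def)
    ultimately have "(Inl (w 0), Inl (w (Suc n))) \<in> (adj_on ?W)\<^sup>*" by simp
    moreover have "card ?W \<le> 2 * Suc n + 1" using W card_insert_le_m1[of "2 * n + 3" W] by (simp add: card_insert_if)
    moreover have "W \<subseteq> ?U (Suc n)" using W(5) U by (rule order_trans)
    hence "?W \<subseteq> ?U (Suc n)" by simp
    ultimately show ?thesis using W(1,4) by (intro exI[of _ ?W]) simp
  next
    case 3
    let ?W = "insert (Inr C) (insert (Inl (w (Suc n))) W)"
    have "(Inl (w 0), Inl (w n)) \<in> (adj_on ?W)\<^sup>*" using W(3) by (rule adj_on_rtrancl_mono[rotated]) auto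
    moreover have "(Inl (w n), Inr C) \<in> adj_on ?W" "(Inr C, Inl (w (Suc n))) \<in> adj_on ?W" using nW 3 by (auto simp: adj_on_def)
    ultimately have "(Inl (w 0), Inl (w (Suc n))) \<in> (adj_on ?W)\<^sup>*" by (meson rtrancl.rtrancl_into_rtrancl)
    moreover have "card ?W \<le> 2 * Suc n + 1" using W by (simp add: card_insert_if)
    moreover have "W \<subseteq> ?U (Suc n)" using W(5) U by (rule order_trans)
    hence "?W \<subseteq> ?U (Suc n)" using 3 by auto
    ultimately show ?thesis using W(1,4) by (intro exI[of _ ?W]) simp
  qed
qed

text \<open>Steps of the coned-off graph that can be made without the cone point of
  \<open>C\<close>. Both ends may still lie in \<open>C\<close> if they are equal or adjacent in the
  Cayley graph or share another coset.\<close>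

definition astep :: "'a set \<Rightarrow> 'a \<Rightarrow> 'a \<Rightarrow> bool" where
  "astep C x y \<longleftrightarrow> d x y \<le> 1 \<or> (\<exists>C'\<in>CC. C' \<noteq> C \<and> x \<in> C' \<and> y \<in> C')"

lemma astep_sym: "astep C x y \<longleftrightarrow> astep C y x"
  unfolding astep_def by (auto simp: X.dsym)

lemma angle_walk:
  assumes C: "C \<in> CC" "w 0 \<in> C" "w n \<in> C"
    and w: "\<And>i. i \<le> n \<Longrightarrow> w i \<in> V" "\<And>i. i < n \<Longrightarrow> astep C (w i) (w (Suc i))"
  shows "d (w 0) (w n) \<le> B (2 * n + 2)"
proof -
  obtain W where W: "finite W" "card W \<le> 2 * n + 1" "(Inl (w 0), Inl (w n)) \<in> (adj_on W)\<^sup>*"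
    "W \<subseteq> Inl ` w ` {..n} \<union> {Inr C' | C' i. C' \<in> CC \<and> C' \<noteq> C \<and> i < n \<and> w i \<in> C' \<and> w (Suc i) \<in> C' \<and> w i \<noteq> w (Suc i)}"
    using walk_set[of n w "\<lambda>C'. C' \<noteq> C"] w unfolding astep_def by auto
  have "Inr C \<notin> W" using W(4) by auto
  from angle_rel[OF C this W(1,2,3)] show ?thesis by simp
qed

text \<open>The edge from \<open>p\<close> to \<open>q\<close> is bypassed through \<open>L\<close>,
  \<open>M\<close> and \<open>R\<close>. As \<open>L\<close> and \<open>R\<close> are disjoint,
  edges of \<open>L\<close> and \<open>R\<close> alone do not lead from \<open>p\<close> to
  \<open>q\<close>, so a shortest bypass has an edge in \<open>M\<close>; closed up by the edge from
  \<open>p\<close> to \<open>q\<close> it is a circuit with at most \<open>n\<close>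
  vertices.\<close>

lemma edge_in_middle:
  assumes fin: "finite L" "finite M" "finite R" and card: "card (L \<union> M \<union> R) \<le> n"
    and p: "p \<in> L" "q \<in> R" "L \<inter> R = {}" "adj p q" "\<not> (p \<in> M \<and> q \<in> M)"
    and conn: "(p, u) \<in> (adj_on L)\<^sup>*" "(u, w) \<in> (adj_on M)\<^sup>*" "(w, q) \<in> (adj_on R)\<^sup>*"
  obtains v v' where "v \<in> M" "v' \<in> M" "adj v v'"
    "\<And>x y. Inl x \<in> {v, v', p, q} \<Longrightarrow> Inl y \<in> {v, v', p, q} \<Longrightarrow> d x y \<le> B n"
proof -
  let ?T = "adj_on L \<union> adj_on M \<union> adj_on R"
  have "(p, u) \<in> ?T\<^sup>*" using conn(1) by (rule set_mp[OF rtrancl_mono, rotated]) auto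
  also have "(u, w) \<in> ?T\<^sup>*" using conn(2) by (rule set_mp[OF rtrancl_mono, rotated]) auto
  also have "(w, q) \<in> ?T\<^sup>*" using conn(3) by (rule set_mp[OF rtrancl_mono, rotated]) auto
  finally have "(p, q) \<in> ?T\<^sup>*" .
  then obtain f m where f: "f 0 = p" "f m = q" "\<And>i. i < m \<Longrightarrow> (f i, f (Suc i)) \<in> ?T" "inj_on f {..m}"
    by (rule shortest_walk_ex) blast
  have "p \<noteq> q" using p(4) adj_irrefl by auto
  hence m0: "0 < m" using f by (metis gr0I)
  \<comment> \<open>The bypass is not the edge itself: \<open>L\<close> and \<open>R\<close> each
    contain only one of its ends, and \<open>M\<close> does not contain both by assumption.\<close>
  have "m \<noteq> 1"
  proof
    assume "m = 1"
    hence "(p, q) \<in> ?T" using f(1,2) f(3)[of 0] by simp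
    thus False using p unfolding adj_on_def by auto
  qed
  hence m: "2 \<le> m" using m0 by simp
  have adj: "adj (f i) (f (Suc i))" if "i < m" for i using f(3)[OF that] unfolding adj_on_def by auto
  have inW: "f i \<in> L \<union> M \<union> R" if "i \<le> m" for i
    using f(3)[of i] f(3)[of "i - 1"] that m0 unfolding adj_on_def by (cases "i = m") auto
  have "card (f ` {..m}) \<le> card (L \<union> M \<union> R)" using inW fin by (intro card_mono) auto
  hence mn: "m < n" using card f(4) by (simp add: card_image)
  have close: "adj (f m) (f 0)" using p f adj_sym by auto
  have "\<exists>i<m. (f i, f (Suc i)) \<in> adj_on M"
  proof (rule ccontr)
    assume no: "\<not> (\<exists>i<m. (f i, f (Suc i)) \<in> adj_on M)"
    have "f i \<in> L" if "i \<le> m" for i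
      using that
    proof (induction i)
      case 0 thus ?case using f p by simp
    next
      case (Suc i)
      hence "f i \<in> L" "(f i, f (Suc i)) \<in> adj_on L \<union> adj_on R" using no f(3)[of i] by auto
      thus ?case using p(3) unfolding adj_on_def by auto
    qed
    thus False using f p by blast
  qed
  then obtain i where i: "i < m" "(f i, f (Suc i)) \<in> adj_on M" by blast
  show ?thesis
  proof (rule that[of "f i" "f (Suc i)"])
    show "f i \<in> M" "f (Suc i) \<in> M" "adj (f i) (f (Suc i))" using i unfolding adj_on_def by auto
    fix x y assume "Inl x \<in> {f i, f (Suc i), p, q}" "Inl y \<in> {f i, f (Suc i), p, q}"
    hence "Inl x \<in> f ` {i, Suc i, 0, m}" "Inl y \<in> f ` {i, Suc i, 0, m}" using f(1,2) by auto
    then obtain k l where kl: "k \<in> {i, Suc i, 0, m}" "f k = Inl x" "l \<in> {i, Suc i, 0, m}" "f l = Inl y" by force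
    hence "k \<le> m" "l \<le> m" using i by auto
    thus "d x y \<le> B n" using circ_fun[OF f(4) m mn adj close] kl by blast
  qed
qed

end

section \<open>Projections to cosets\<close>

context cone_graph begin

section \<open>Thin triangles for metric intervals\<close>

lemma near_Iv:
  assumes "a \<in> V" "b \<in> V" "z \<in> V" "D a z + D z b \<le> D a b + \<kappa>"
  obtains z' where "z' \<in> Y.Iv a b" "D z z' \<le> \<kappa> + \<delta>"
proof (cases "D a z \<le> D a b")
  case True
  obtain z' where z': "z' \<in> Y.Iv a b" "D a z' = D a z" "D z' b = D a b - D a z"
    using Y.Iv_point[OF assms(1,2) True] by blast
  hence V: "z' \<in> V" using Y.Iv_D by blast
  have "D a b + D z z' \<le> max (D a z + D b z') (D a z' + D b z) + \<delta>"
    using hyp[of a b z z'] assms V by (simp add: Y.dsym)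
  hence "D z z' \<le> \<kappa> + \<delta>" using z' True assms(4) by (simp add: Y.dsym)
  thus ?thesis using that z' by blast
next
  case False
  hence "D z b \<le> \<kappa> + \<delta>" using assms(4) by simp
  moreover have "b \<in> Y.Iv a b" using assms by (simp add: Y.Iv_def)
  ultimately show ?thesis using that by blast
qed

text \<open>For \<open>u, w, z, t\<close> the four-point condition says that \<open>z\<close> lies
  between \<open>u\<close> and \<open>t\<close> or between \<open>t\<close> and \<open>w\<close> up
  to an excess \<delta>; passing to a point of the interval by \<open>near_Iv\<close> costs \<delta>
  once more.\<close>

lemma thin:
  assumes "z \<in> Y.Iv u w" "u \<in> V" "w \<in> V" "t \<in> V"
  obtains z' where "z' \<in> Y.Iv u t \<union> Y.Iv t w" "D z z' \<le> 2 * \<delta>"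
proof -
  have z: "z \<in> V" "D u z + D z w = D u w" using Y.Iv_D[OF assms(1)] by auto
  have "D u w + D z t \<le> max (D u z + D w t) (D u t + D w z) + \<delta>"
    using hyp[of u w z t] assms z by (simp add: Y.dsym)
  then consider "D t z + D z w \<le> D t w + \<delta>" | "D u z + D z t \<le> D u t + \<delta>"
    using z Y.dsym[of w z] Y.dsym[of z t] Y.dsym[of w t] by linarith
  thus ?thesis
  proof cases
    case 1
    thus ?thesis using near_Iv[of t w z \<delta>] assms z that by (auto simp: mult_2)
  next
    case 2
    thus ?thesis using near_Iv[of u t z \<delta>] assms z that by (auto simp: mult_2)
  qed
qed

text \<open>Distances are those of the coned-off graph, where \<open>C\<close> has diameter at most
  1; several points of \<open>C\<close> may be nearest, so the projection is a relation. That it is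
  coarsely well defined in the word metric is a consequence of fineness.\<close>

definition proj :: "'a set \<Rightarrow> 'a \<Rightarrow> 'a \<Rightarrow> bool" where
  "proj C u a \<longleftrightarrow> a \<in> C \<and> (\<forall>b\<in>C. D u a \<le> D u b)"

lemma proj_ex: "C \<in> CC \<Longrightarrow> \<exists>a. proj C u a"
  using CC_ne[of C] ex_has_least_nat[of "\<lambda>a. a \<in> C" _ "D u"] unfolding proj_def by blast

lemma CC_mem_V: "C \<in> CC \<Longrightarrow> x \<in> C \<Longrightarrow> x \<in> V"
  using CC_V by blast

section \<open>Walks that avoid the cone point of a coset\<close>

definition asteps :: "'a set \<Rightarrow> ('a \<times> 'a) set" where
  "asteps C = {(x, y). x \<in> V \<and> y \<in> V \<and> astep C x y}"

lemma asteps_sym: "(x, y) \<in> asteps C ^^ n \<Longrightarrow> (y, x) \<in> asteps C ^^ n"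
  by (rule relpow_sym) (auto simp: sym_def asteps_def astep_sym)

lemma angle:
  assumes "C \<in> CC" "a \<in> C" "a' \<in> C" "(a, a') \<in> asteps C ^^ n" "2 * n + 2 \<le> m"
  shows "d a a' \<le> B m"
proof -
  obtain w where w: "w 0 = a" "w n = a'" "\<And>i. i < n \<Longrightarrow> (w i, w (Suc i)) \<in> asteps C"
    using assms(4) unfolding relpow_fun_conv by blast
  have "w i \<in> V" if "i \<le> n" for i
    using w(3)[of i] that w CC_mem_V[OF assms(1,3)] unfolding asteps_def by (cases "i = n") auto
  hence "d (w 0) (w n) \<le> B (2 * n + 2)"
    using assms w by (intro angle_walk[of C]) (auto simp: asteps_def)
  also have "\<dots> \<le> B m" using assms by (intro B_mono)
  finally show ?thesis using w by simp
qed

lemma astepI: "x \<in> V \<Longrightarrow> y \<in> V \<Longrightarrow> D x y \<le> 1 \<Longrightarrow> \<not> (x \<in> C \<and> y \<in> C) \<Longrightarrow> astep C x y"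
  using D1[of x y] unfolding astep_def by blast

lemma astep_D: "x \<in> V \<Longrightarrow> y \<in> V \<Longrightarrow> astep C x y \<Longrightarrow> D x y \<le> 1"
  using D_le[of x y] CC_D unfolding astep_def by fastforce

text \<open>On a geodesic from \<open>x\<close> to \<open>y\<close> only the first point can lie in
  \<open>C\<close>, so two consecutive points never both do, and no step has to use the cone point
  of \<open>C\<close>.\<close>

lemma Iv_walk:
  assumes "x \<in> V" "y \<in> V" "\<And>z. z \<in> Y.Iv x y \<Longrightarrow> z \<in> C \<Longrightarrow> z = x"
  shows "(x, y) \<in> asteps C ^^ D x y"
proof -
  obtain p where p: "p 0 = x" "p (D x y) = y" "Y.geo (D x y) p"
    using Y.geo_ex assms by blast
  have "(p i, p (Suc i)) \<in> asteps C" if i: "i < D x y" for i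
  proof -
    have V: "p i \<in> V" "p (Suc i) \<in> V" using Y.geoV[OF p(3)] i by auto
    have "D (p 0) (p (Suc i)) = Suc i" using Y.geoD[OF p(3), of 0 "Suc i"] i by simp
    hence "p (Suc i) \<noteq> x" using p(1) V Y.drefl by fastforce
    moreover have "p (Suc i) \<in> Y.Iv x y" using Y.geo_Iv[OF p(3), of 0 "Suc i" "D x y"] i p by simp
    ultimately have "p (Suc i) \<notin> C" using assms(3) by blast
    moreover have "D (p i) (p (Suc i)) \<le> 1" using Y.geoD[OF p(3), of i "Suc i"] i by simp
    ultimately show ?thesis using astepI V unfolding asteps_def by auto
  qed
  thus ?thesis unfolding relpow_fun_conv using p by blast
qed

lemma proj_walk:
  assumes "C \<in> CC" "u \<in> V" "proj C u a"
  shows "(a, u) \<in> asteps C ^^ D a u"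
proof (rule Iv_walk)
  have a: "a \<in> C" using assms unfolding proj_def by blast
  thus "a \<in> V" using CC_mem_V assms by blast
  fix z assume z: "z \<in> Y.Iv a u" "z \<in> C"
  hence "D a z + D z u = D a u" "z \<in> V" using Y.Iv_D by auto
  moreover have "D u a \<le> D u z" using assms z unfolding proj_def by blast
  ultimately have "D a z = 0" by (simp add: Y.dsym)
  thus "z = a" using Y.d0 \<open>a \<in> V\<close> \<open>z \<in> V\<close> by auto
qed (use assms in auto)

text \<open>Lipschitz constant of the projections: the circuits through the cone point that arise in
  \<open>proj_far\<close> and \<open>proj_step\<close> have at most
  \<open>32 * \<delta> + 14\<close> vertices.\<close>

definition lip :: nat where "lip = max 1 (B (32 * \<delta> + 14))"
text \<open>A point at distance \<open>4 * \<delta> + 1\<close> from \<open>C\<close>, moved by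
  \<open>2 * \<delta>\<close>, is still closer to \<open>C\<close> than this.\<close>

definition \<rho> :: nat where "\<rho> = 6 * \<delta> + 2"

lemma B_lip: "m \<le> 32 * \<delta> + 14 \<Longrightarrow> B m \<le> lip"
  unfolding lip_def using B_mono[of m "32 * \<delta> + 14"] by simp

lemma lip_pos: "1 \<le> lip" by (simp add: lip_def)

text \<open>In the quadrilateral \<open>a, u, u', a'\<close> the side from \<open>u\<close> to
  \<open>u'\<close> is far from \<open>C\<close> and the side from \<open>a\<close> to
  \<open>a'\<close> has length at most 1, so the other two sides must follow each other near
  \<open>C\<close>. Crossing between them just outside the \<open>4 * \<delta>\<close>-neighbourhood
  of \<open>C\<close> gives a short walk from \<open>a\<close> to \<open>a'\<close> that avoids the
  cone point of \<open>C\<close>.\<close>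

lemma proj_far:
  assumes C: "C \<in> CC" and u: "u \<in> V" "u' \<in> V" and proj: "proj C u a" "proj C u' a'"
    and far: "\<And>w b. w \<in> Y.Iv u u' \<Longrightarrow> b \<in> C \<Longrightarrow> \<rho> \<le> D w b"
  shows "d a a' \<le> lip"
proof -
  let ?r = "4 * \<delta> + 1"
  have a: "a \<in> C" "a' \<in> C" "a \<in> V" "a' \<in> V" using proj CC_mem_V[OF C] unfolding proj_def by auto
  have "u \<in> Y.Iv u u'" using u by (simp add: Y.Iv_def)
  hence "\<rho> \<le> D u a" using far a by blast
  hence "?r \<le> D a u" by (simp add: \<rho>_def Y.dsym)
  then obtain w where w: "w \<in> Y.Iv a u" "D a w = ?r" "D w u = D a u - ?r"
    using Y.Iv_point[OF a(3) u(1)] by blast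
  have wV: "w \<in> V" using w Y.Iv_D by blast
  have wC: "?r \<le> D w b" if "b \<in> C" for b
  proof -
    have "D u a \<le> D u b" using proj that unfolding proj_def by blast
    moreover have "D u b \<le> D u w + D w b" using u wV CC_mem_V[OF C that] by (intro Y.dtri) auto
    ultimately show ?thesis using w \<open>?r \<le> D a u\<close> by (simp add: Y.dsym)
  qed
  obtain w1 where w1: "w1 \<in> Y.Iv a u' \<union> Y.Iv u' u" "D w w1 \<le> 2 * \<delta>"
    using thin[OF w(1)] a u by blast
  have w1V: "w1 \<in> V" using w1 Y.Iv_D by blast
  have "w1 \<notin> Y.Iv u' u"
  proof
    assume "w1 \<in> Y.Iv u' u"
    hence "\<rho> \<le> D w1 a" using far a Y.Iv_sym by blast
    also have "\<dots> \<le> D w1 w + D w a" using w1V wV a by (intro Y.dtri) auto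
    finally show False using w1 w by (simp add: \<rho>_def Y.dsym)
  qed
  hence "w1 \<in> Y.Iv a u'" using w1 by blast
  then obtain w' where w': "w' \<in> Y.Iv a a' \<union> Y.Iv a' u'" "D w1 w' \<le> 2 * \<delta>"
    using thin[of w1 a u' a'] a u by blast
  have w'V: "w' \<in> V" using w' Y.Iv_D by blast
  have ww': "D w w' \<le> 4 * \<delta>" using Y.dtri[of w w1 w'] wV w1V w'V w' w1 by simp
  have "w' \<notin> Y.Iv a a'"
  proof
    assume "w' \<in> Y.Iv a a'"
    hence "D a w' + D w' a' \<le> 1" using Y.Iv_D CC_D[OF C a(1,2)] by fastforce
    hence "D a w' = 0 \<or> D w' a' = 0" by arith
    hence "w' = a \<or> w' = a'" using Y.d0 a w'V by blast
    thus False using wC[of w'] a ww' by auto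
  qed
  hence w'I: "w' \<in> Y.Iv a' u'" using w' by blast
  \<comment> \<open>The distance from \<open>w\<close> to \<open>w'\<close> is smaller than that
    from \<open>w\<close> to \<open>C\<close>, so the geodesic cannot meet \<open>C\<close>.\<close>
  have "(w, w') \<in> asteps C ^^ D w w'"
  proof (rule Iv_walk[OF wV w'V])
    fix z assume z: "z \<in> Y.Iv w w'" "z \<in> C"
    hence "D w z \<le> D w w'" using Y.Iv_D by fastforce
    thus "z = w" using wC[OF z(2)] ww' by simp
  qed
  moreover have "(a, w) \<in> asteps C ^^ D a w"
  proof (rule Iv_walk[OF a(3) wV])
    fix z assume z: "z \<in> Y.Iv a w" "z \<in> C"
    hence "D a z + D z w = D a w" "z \<in> V" using Y.Iv_D by auto
    moreover have "?r \<le> D z w" using wC[OF z(2)] by (simp add: Y.dsym)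
    ultimately show "z = a" using Y.d0[of a z] a w by auto
  qed
  ultimately have aw': "(a, w') \<in> asteps C ^^ (D a w + D w w')" unfolding relpow_add by blast
  have dwa: "D w' a' \<le> D w' b" if "b \<in> C" for b
  proof -
    have "D u' a' \<le> D u' b" using proj that unfolding proj_def by blast
    moreover have "D u' b \<le> D u' w' + D w' b" using u w'V CC_mem_V[OF C that] by (intro Y.dtri) auto
    moreover have "D a' w' + D w' u' = D a' u'" using w'I Y.Iv_D by auto
    ultimately show ?thesis using Y.dsym[of u' w'] Y.dsym[of a' w'] Y.dsym[of u' a'] by linarith
  qed
  hence "proj C w' a'" using a unfolding proj_def by blast
  hence "(a', w') \<in> asteps C ^^ D a' w'" using proj_walk[OF C w'V] by blast
  hence "(w', a') \<in> asteps C ^^ D a' w'" by (rule asteps_sym)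
  with aw' have walk: "(a, a') \<in> asteps C ^^ (D a w + D w w' + D a' w')" unfolding relpow_add by blast
  have "D w' a' \<le> D w' a" using dwa a by blast
  also have "\<dots> \<le> D w' w + D w a" using w'V wV a by (intro Y.dtri) auto
  finally have "D a' w' \<le> 8 * \<delta> + 1" using ww' w by (simp add: Y.dsym)
  hence "2 * (D a w + D w w' + D a' w') + 2 \<le> 32 * \<delta> + 14" using ww' w by simp
  from angle[OF C a(1,2) walk this] show ?thesis using B_lip[of "32 * \<delta> + 14"] by simp
qed

text \<open>Far from \<open>C\<close> this is \<open>proj_far\<close> for an interval that consists
  of its end points; near \<open>C\<close> the walk from \<open>a\<close> through \<open>u\<close>
  and \<open>u'\<close> to \<open>a'\<close> is itself short.\<close>

lemma proj_step:
  assumes C: "C \<in> CC" and u: "u \<in> V" "u' \<in> V" and proj: "proj C u a" "proj C u' a'" and st: "astep C u u'"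
  shows "d a a' \<le> lip"
proof (cases "D u a < \<rho> \<or> D u' a' < \<rho>")
  case False
  show ?thesis
  proof (rule proj_far[OF C u proj])
    fix w b assume w: "w \<in> Y.Iv u u'" "b \<in> C"
    have "D u w + D w u' \<le> 1" "w \<in> V" using w Y.Iv_D[of w u u'] astep_D[OF u st] by auto
    hence "D u w = 0 \<or> D w u' = 0" by arith
    hence "w = u \<or> w = u'" using Y.d0 u \<open>w \<in> V\<close> by blast
    thus "\<rho> \<le> D w b" using w False proj unfolding proj_def by (meson le_trans not_le)
  qed
next
  case True
  have a: "a \<in> C" "a' \<in> C" "a \<in> V" "a' \<in> V" using proj CC_mem_V[OF C] unfolding proj_def by auto
  have "(a, u) \<in> asteps C ^^ D a u" using proj_walk[OF C u(1) proj(1)] .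
  moreover have "(u, u') \<in> asteps C ^^ 1" using st u by (simp add: asteps_def)
  moreover have "(u', a') \<in> asteps C ^^ D a' u'" using proj_walk[OF C u(2) proj(2)] by (rule asteps_sym)
  ultimately have walk: "(a, a') \<in> asteps C ^^ (D a u + 1 + D a' u')" unfolding relpow_add by blast
  have "D u a \<le> D u a'" "D u' a' \<le> D u' a" using proj a unfolding proj_def by auto
  moreover have "D u a' \<le> D u u' + D u' a'" "D u' a \<le> D u' u + D u a" using u a Y.dtri by auto
  moreover have "D u u' \<le> 1" using astep_D u st by blast
  moreover have "D u' u = D u u'" "D a u = D u a" "D a' u' = D u' a'" by (simp_all add: Y.dsym)
  ultimately have near: "D u a \<le> D u' a' + 1" "D u' a' \<le> D u a + 1" "D a u = D u a" "D a' u' = D u' a'"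
    by linarith+
  have "2 * (D a u + 1 + D a' u') + 2 \<le> 32 * \<delta> + 14"
    by (rule disjE[OF True]) (use near in \<open>simp_all add: \<rho>_def\<close>)
  from angle[OF C a(1,2) walk this] show ?thesis using B_lip[of "32 * \<delta> + 14"] by simp
qed

text \<open>Between the last time near \<open>a\<close> and the first later time near
  \<open>e\<close> all times belong to \<open>T\<close>. Hence at most \<open>card T + 1\<close>
  steps are made there, and each end adds one more \<kappa>.\<close>

lemma count_steps:
  assumes V: "a \<in> V" "e \<in> V" "\<And>m. m \<le> l \<Longrightarrow> g m \<in> V" and st: "\<And>m. m < l \<Longrightarrow> d (g m) (g (Suc m)) \<le> \<kappa>"
    and ends: "d a (g 0) \<le> \<kappa>" "d (g l) e \<le> \<kappa>" and T: "finite T"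
    and cov: "\<And>m. m \<le> l \<Longrightarrow> m \<in> T \<or> d a (g m) \<le> \<kappa> \<or> d (g m) e \<le> \<kappa>"
  shows "d a e \<le> \<kappa> * (card T + 3)"
proof -
  define S where "S = {m. m \<le> l \<and> d a (g m) \<le> \<kappa>}"
  define m0 where "m0 = Max S"
  have "finite S" "0 \<in> S" using ends by (auto simp: S_def)
  hence m0: "m0 \<in> S" "\<And>m. m \<in> S \<Longrightarrow> m \<le> m0" unfolding m0_def by (auto intro!: Max_in Max_ge)
  define m1 where "m1 = (LEAST m. m0 \<le> m \<and> m \<le> l \<and> d (g m) e \<le> \<kappa>)"
  have m1: "m0 \<le> m1 \<and> m1 \<le> l \<and> d (g m1) e \<le> \<kappa>"
    unfolding m1_def by (rule LeastI[of _ l]) (use m0 ends in \<open>auto simp: S_def\<close>)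
  have "{m0<..<m1} \<subseteq> T"
  proof
    fix m assume m: "m \<in> {m0<..<m1}"
    hence "\<not> d (g m) e \<le> \<kappa>" using not_less_Least[of m "\<lambda>m. m0 \<le> m \<and> m \<le> l \<and> d (g m) e \<le> \<kappa>"] m1
      unfolding m1_def by auto
    moreover have "m \<notin> S" using m0(2)[of m] m by auto
    ultimately show "m \<in> T" using cov[of m] m m1 unfolding S_def by auto
  qed
  hence "card {m0<..<m1} \<le> card T" using T by (rule card_mono[rotated])
  hence len: "m1 - m0 \<le> card T + 1" by auto
  have "d (g m0) (g m1) \<le> \<kappa> * (m1 - m0)" using m1 V st by (intro X.chain_le) auto
  also have "\<dots> \<le> \<kappa> * (card T + 1)" using len by (rule mult_le_mono2)
  finally have "d (g m0) (g m1) \<le> \<kappa> * (card T + 1)" .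
  moreover have "d a e \<le> d a (g m0) + d (g m0) e" "d (g m0) e \<le> d (g m0) (g m1) + d (g m1) e"
    using V m0(1) m1 by (auto simp: S_def intro!: X.dtri)
  moreover have "d a (g m0) \<le> \<kappa>" using m0 by (auto simp: S_def)
  ultimately have "d a e \<le> \<kappa> + \<kappa> * (card T + 1) + \<kappa>" using m1 by linarith
  thus ?thesis by (simp add: algebra_simps)
qed

end

section \<open>Geodesics of the coned-off graph\<close>

context cone_graph begin

definition block :: "'a set \<Rightarrow> bool" where
  "block b \<longleftrightarrow> b \<in> CC \<or> (\<exists>u v. b = {u, v} \<and> u \<in> V \<and> v \<in> V \<and> d u v \<le> 1)"

lemma block_V: "block b \<Longrightarrow> x \<in> b \<Longrightarrow> x \<in> V"
  unfolding block_def by (auto dest: CC_mem_V)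

lemma block_X: "block b \<Longrightarrow> b \<notin> CC \<Longrightarrow> x \<in> b \<Longrightarrow> y \<in> b \<Longrightarrow> d x y \<le> 1"
  unfolding block_def by (auto simp: X.dsym)

lemma block_D: "block b \<Longrightarrow> x \<in> b \<Longrightarrow> y \<in> b \<Longrightarrow> D x y \<le> 1"
  using block_X[of b x y] CC_D[of b x y] D_le[of x y] block_V[of b] by (cases "b \<in> CC") (auto intro: order_trans)

lemma block_astep: "block b \<Longrightarrow> b \<noteq> C \<Longrightarrow> x \<in> b \<Longrightarrow> y \<in> b \<Longrightarrow> astep C x y"
  using block_X unfolding astep_def by blast

text \<open>A geodesic of the coned-off graph: it traverses the blocks \<open>b 0, \<dots>, b n\<close> and passes
  through the group elements \<open>c 1, \<dots>, c n\<close>; blocks that are singletons or edges of the Cayley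
  graph are allowed, so a geodesic may start at a group element or at a cone point.\<close>

definition bpath :: "nat \<Rightarrow> (nat \<Rightarrow> 'a) \<Rightarrow> (nat \<Rightarrow> 'a set) \<Rightarrow> bool" where
  "bpath n c b \<longleftrightarrow> (\<forall>k\<le>n. block (b k)) \<and> (\<forall>k. 1 \<le> k \<longrightarrow> k \<le> n \<longrightarrow> c k \<in> b (k - 1) \<and> c k \<in> b k) \<and>
     (\<forall>k l. 1 \<le> k \<longrightarrow> k \<le> l \<longrightarrow> l \<le> n \<longrightarrow> D (c k) (c l) = l - k) \<and>
     (\<forall>k l. k \<le> n \<longrightarrow> b k \<in> CC \<longrightarrow> 1 \<le> l \<longrightarrow> l \<le> k \<longrightarrow> proj (b k) (c l) (c k)) \<and>
     (\<forall>k l. k < l \<longrightarrow> l \<le> n \<longrightarrow> b k \<in> CC \<longrightarrow> proj (b k) (c l) (c (Suc k))) \<and>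
     (\<forall>k l. k < l \<longrightarrow> l \<le> n \<longrightarrow> b k \<in> CC \<longrightarrow> b k \<noteq> b l)"

lemma bpathD:
  assumes "bpath n c b"
  shows "k \<le> n \<Longrightarrow> block (b k)" "1 \<le> k \<Longrightarrow> k \<le> n \<Longrightarrow> c k \<in> b (k - 1)" "1 \<le> k \<Longrightarrow> k \<le> n \<Longrightarrow> c k \<in> b k"
    "1 \<le> k \<Longrightarrow> k \<le> l \<Longrightarrow> l \<le> n \<Longrightarrow> D (c k) (c l) = l - k"
    "k \<le> n \<Longrightarrow> b k \<in> CC \<Longrightarrow> 1 \<le> l \<Longrightarrow> l \<le> k \<Longrightarrow> proj (b k) (c l) (c k)"
    "k < l \<Longrightarrow> l \<le> n \<Longrightarrow> b k \<in> CC \<Longrightarrow> proj (b k) (c l) (c (Suc k))"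
    "k < l \<Longrightarrow> l \<le> n \<Longrightarrow> b k \<in> CC \<Longrightarrow> b k \<noteq> b l"
  using assms by (simp_all add: bpath_def)

lemma bpath_V: "bpath n c b \<Longrightarrow> 1 \<le> k \<Longrightarrow> k \<le> n \<Longrightarrow> c k \<in> V"
  using bpathD(1)[of n c b k] bpathD(3)[of n c b k] block_V by blast

definition D0 :: nat where "D0 = 2 * \<rho> + 2"

text \<open>The distance between the projections of \<open>z\<close> and \<open>w\<close> to the block \<open>b k\<close> is bounded by the
  number of points on a geodesic \<open>p\<close> from \<open>z\<close> to \<open>w\<close> whose nearest point on \<open>c\<close> is close to
  \<open>b k\<close>.\<close>

lemma block_bound:
  assumes bp: "bpath n c b" and ij: "i < j" "j \<le> n" and zw: "z \<in> b i" "w \<in> b j"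
    and p: "X.geo l p" "p 0 = z" "p l = w"
    and r: "\<And>m. m \<le> l \<Longrightarrow> i < r m \<and> r m \<le> j"
    and rmin: "\<And>m k. m \<le> l \<Longrightarrow> i < k \<Longrightarrow> k \<le> j \<Longrightarrow> D (p m) (c (r m)) \<le> D (p m) (c k)"
    and k: "i \<le> k" "k \<le> j"
  shows "d (if k = i then z else c k) (if k = j then w else c (Suc k)) \<le>
    lip * (card {m. m \<le> l \<and> r m \<le> Suc k + D0 \<and> k \<le> r m + D0} + 3)" (is "d ?a ?e \<le> lip * (card ?T + 3)")
proof -
  have blk: "block (b m)" if "m \<le> n" for m using bpathD(1)[OF bp that] .
  have ae: "?a \<in> b k" "?e \<in> b k"
    using zw k ij bpathD(3)[OF bp, of k] bpathD(2)[OF bp, of "Suc k"] by auto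
  show ?thesis
  proof (cases "b k \<in> CC")
    case False
    have "d ?a ?e \<le> 1" using block_X[OF blk False ae] k ij by simp
    also have "\<dots> \<le> lip * (card ?T + 3)" using lip_pos by (simp add: Suc_leI)
    finally show ?thesis .
  next
    case C: True
    have pV: "p m \<in> V" if "m \<le> l" for m using X.geoV[OF p(1) that] .
    have cV: "c m \<in> V" if "i < m" "m \<le> j" for m using bpath_V[OF bp] that ij by simp
    have "\<forall>m. \<exists>a. proj (b k) (p m) a" using proj_ex[OF C] by blast
    then obtain g where g: "\<And>m. proj (b k) (p m) (g m)" by metis
    have gC: "g m \<in> b k" for m using g[of m] unfolding proj_def by blast
    have gV: "g m \<in> V" for m using CC_mem_V[OF C gC] .
    \<comment> \<open>A point \<open>w'\<close> between \<open>p m\<close> and its nearest point on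
      \<open>c\<close> is at least as close to that nearest point as to the block, up to 1. So a
      distance of \<open>2 * \<rho> + 2\<close> between the nearest point and \<beta> leaves \<rho>
      for \<open>w'\<close>; this is the origin of \<open>D0\<close>.\<close>
    have far: "\<rho> \<le> D w' \<beta>"
      if "m \<le> l" "w' \<in> Y.Iv (p m) (c (r m))" "\<beta> \<in> b k" "i < q" "q \<le> j" "c q \<in> b k"
        "D0 \<le> D (c (r m)) \<beta>" for m w' \<beta> q
    proof -
      have w': "w' \<in> V" "D (p m) w' + D w' (c (r m)) = D (p m) (c (r m))" using Y.Iv_D[OF that(2)] by auto
      have \<beta>: "\<beta> \<in> V" using CC_mem_V[OF C that(3)] .
      have "D (p m) (c (r m)) \<le> D (p m) (c q)" using rmin that by blast
      also have "\<dots> \<le> D (p m) w' + D w' (c q)" using pV w' cV that by (intro Y.dtri) auto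
      finally have "D w' (c (r m)) \<le> D w' (c q)" using w' by simp
      also have "\<dots> \<le> D w' \<beta> + D \<beta> (c q)" using w' cV that \<beta> by (intro Y.dtri) auto
      also have "\<dots> \<le> D w' \<beta> + 1" using CC_D[OF C that(3,6)] by simp
      finally have "D w' (c (r m)) \<le> D w' \<beta> + 1" .
      moreover have "D (c (r m)) \<beta> \<le> D (c (r m)) w' + D w' \<beta>" using w' cV \<beta> r[OF that(1)] by (intro Y.dtri) auto
      ultimately show ?thesis using that(7) unfolding D0_def by (simp add: Y.dsym)
    qed
    \<comment> \<open>The nearest point of \<open>c\<close> lies well before block \<open>k\<close>,
      so it projects to the entry point \<open>c k\<close>, and by \<open>proj_far\<close> so does
      \<open>p m\<close> up to \<open>lip\<close>.\<close>
    have before: "d (c k) (g m) \<le> lip" "k \<noteq> i" if m: "m \<le> l" and lt: "r m + D0 < k" for m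
    proof -
      have rm: "i < r m" "r m \<le> j" using r[OF m] by auto
      show "k \<noteq> i" using rm lt by simp
      have npc: "proj (b k) (c (r m)) (c k)" using bpathD(5)[OF bp _ C, of "r m"] k ij rm lt by simp
      have ck: "c k \<in> b k" using npc unfolding proj_def by blast
      have "D (c (r m)) (c k) = k - r m" using bpathD(4)[OF bp, of "r m" k] rm lt k ij by simp
      hence "D0 \<le> D (c (r m)) \<beta>" if "\<beta> \<in> b k" for \<beta>
        using npc that lt unfolding proj_def by fastforce
      hence "d (g m) (c k) \<le> lip"
        using far[OF m, of _ _ k] ck rm lt k by (intro proj_far[OF C pV[OF m] cV[OF rm] g npc]) auto
      thus "d (c k) (g m) \<le> lip" by (simp add: X.dsym)
    qed
    have after: "d (g m) (c (Suc k)) \<le> lip" "k \<noteq> j" if m: "m \<le> l" and lt: "Suc k + D0 < r m" for m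
    proof -
      have rm: "i < r m" "r m \<le> j" using r[OF m] by auto
      show "k \<noteq> j" using rm lt by simp
      have npc: "proj (b k) (c (r m)) (c (Suc k))" using bpathD(6)[OF bp _ _ C, of "r m"] k ij rm lt by simp
      have ck: "c (Suc k) \<in> b k" using npc unfolding proj_def by blast
      have "D (c (Suc k)) (c (r m)) = r m - Suc k" using bpathD(4)[OF bp, of "Suc k" "r m"] rm lt k ij by simp
      hence "D0 \<le> D (c (r m)) \<beta>" if "\<beta> \<in> b k" for \<beta>
        using npc that lt Y.dsym[of "c (Suc k)" "c (r m)"] unfolding proj_def by fastforce
      thus "d (g m) (c (Suc k)) \<le> lip"
        using far[OF m, of _ _ "Suc k"] ck rm lt k by (intro proj_far[OF C pV[OF m] cV[OF rm] g npc]) auto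
    qed
    have self: "proj (b k) x x" if "x \<in> b k" for x
      using that CC_mem_V[OF C that] unfolding proj_def by simp
    have start: "d ?a (g 0) \<le> lip"
    proof (cases "k = i")
      case True
      have zC: "z \<in> b k" "z \<in> V" using zw True CC_mem_V[OF C] by auto
      have "proj (b k) z (g 0)" using g[of 0] p by simp
      hence "d z (g 0) \<le> lip"
        using proj_step[OF C zC(2) zC(2) self[OF zC(1)]] zC by (auto simp: astep_def)
      thus ?thesis using True by simp
    next
      case False
      have zV: "z \<in> V" using pV[of 0] p by simp
      \<comment> \<open>As the blocks differ, passing from \<open>c (Suc i)\<close> to
        \<open>z\<close> inside \<open>b i\<close> avoids the cone point of \<open>b k\<close> and
        moves the projection by at most \<open>lip\<close>.\<close>
      have neq: "b i \<noteq> b k" using bpathD(7)[OF bp, of i k] False k ij C by (cases "b i \<in> CC") auto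
      have ci: "c (Suc i) \<in> b i" using bpathD(2)[OF bp, of "Suc i"] ij by simp
      have st: "astep (b k) (c (Suc i)) z" using block_astep[OF blk neq ci zw(1)] ij by simp
      have "proj (b k) (c (Suc i)) (c k)" using bpathD(5)[OF bp _ C, of "Suc i"] k ij False by simp
      moreover have "proj (b k) z (g 0)" using g[of 0] p by simp
      ultimately have "d (c k) (g 0) \<le> lip" using proj_step[OF C cV zV _ _ st] ij by simp
      thus ?thesis using False by simp
    qed
    have fin: "d (g l) ?e \<le> lip"
    proof (cases "k = j")
      case True
      have zC: "w \<in> b k" "w \<in> V" using zw True CC_mem_V[OF C] by auto
      have "proj (b k) w (g l)" using g[of l] p by simp
      hence "d (g l) w \<le> lip"
        using proj_step[OF C zC(2) zC(2) _ self[OF zC(1)]] zC by (auto simp: astep_def)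
      thus ?thesis using True by simp
    next
      case False
      have wV: "w \<in> V" using pV[of l] p by simp
      have neq: "b j \<noteq> b k" using bpathD(7)[OF bp, of k j] False k ij C by auto
      have cj: "c j \<in> b j" using bpathD(3)[OF bp, of j] ij by simp
      have st: "astep (b k) w (c j)" using block_astep[OF blk neq zw(2) cj] ij by simp
      have "proj (b k) (c j) (c (Suc k))" using bpathD(6)[OF bp _ _ C, of j] k ij False by simp
      moreover have "proj (b k) w (g l)" using g[of l] p by simp
      ultimately have "d (g l) (c (Suc k)) \<le> lip" using proj_step[OF C wV cV _ _ st] ij by simp
      thus ?thesis using False by simp
    qed
    show ?thesis
    proof (rule count_steps[where g = g and l = l])
      show "?a \<in> V" "?e \<in> V" using ae CC_mem_V[OF C] by blast+
      show "g m \<in> V" if "m \<le> l" for m by (rule gV)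
      show "d (g m) (g (Suc m)) \<le> lip" if m: "m < l" for m
      proof (rule proj_step[OF C _ _ g g])
        show "astep (b k) (p m) (p (Suc m))" using X.geoD[OF p(1), of m "Suc m"] m by (simp add: astep_def)
      qed (use pV m in auto)
      show "d ?a (g 0) \<le> lip" by (rule start)
      show "d (g l) ?e \<le> lip" by (rule fin)
      show "finite ?T" by simp
      show "m \<in> ?T \<or> d ?a (g m) \<le> lip \<or> d (g m) ?e \<le> lip" if m: "m \<le> l" for m
        using before[OF m] after[OF m] m by (cases "r m + D0 < k"; cases "Suc k + D0 < r m") auto
    qed
  qed
qed

definition block_const :: nat where "block_const = lip * (14 + 2 * D0)"

text \<open>Double counting: each point of a Cayley geodesic from \<open>z\<close> to
  \<open>w\<close> is charged to the blocks close to its nearest point on \<open>c\<close>, at most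
  \<open>2 * D0 + 2\<close> of them. Every block costs a further \<open>3 * lip\<close>, and there
  are at most \<open>d z w + 4\<close> blocks.\<close>

lemma bpath_total:
  assumes bp: "bpath n c b" and ij: "i < j" "j \<le> n" and zw: "z \<in> b i" "w \<in> b j"
  shows "(\<Sum>k=i..j. d (if k = i then z else c k) (if k = j then w else c (Suc k))) \<le> block_const * (d z w + 1)"
proof -
  have blk: "block (b m)" if "m \<le> n" for m using bpathD(1)[OF bp that] .
  have V: "z \<in> V" "w \<in> V" using block_V[OF blk zw(1)] block_V[OF blk zw(2)] ij by auto
  obtain p where p: "p 0 = z" "p (d z w) = w" "X.geo (d z w) p" using X.geo_ex V by blast
  let ?l = "d z w"
  have "\<exists>k. (i < k \<and> k \<le> j) \<and> (\<forall>k'. i < k' \<and> k' \<le> j \<longrightarrow> D (p m) (c k) \<le> D (p m) (c k'))" for m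
    using ex_has_least_nat[of "\<lambda>k. i < k \<and> k \<le> j" j "\<lambda>k. D (p m) (c k)"] ij by simp
  hence "\<forall>m. \<exists>k. (i < k \<and> k \<le> j) \<and> (\<forall>k'. i < k' \<and> k' \<le> j \<longrightarrow> D (p m) (c k) \<le> D (p m) (c k'))" by blast
  then obtain r where r: "\<And>m. i < r m \<and> r m \<le> j"
    and rmin: "\<And>m k. i < k \<Longrightarrow> k \<le> j \<Longrightarrow> D (p m) (c (r m)) \<le> D (p m) (c k)"
    by metis
  let ?P = "\<lambda>k m. r m \<le> Suc k + D0 \<and> k \<le> r m + D0"
  have "(\<Sum>k=i..j. d (if k = i then z else c k) (if k = j then w else c (Suc k))) \<le>
      (\<Sum>k=i..j. lip * (card {m. m \<le> ?l \<and> ?P k m} + 3))"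
    by (rule sum_mono, rule block_bound[OF bp ij zw p(3,1,2)]) (use r rmin in auto)
  also have "\<dots> = lip * (\<Sum>k=i..j. card {m. m \<le> ?l \<and> ?P k m}) + 3 * lip * (Suc j - i)"
    by (simp add: distrib_left sum.distrib sum_distrib_left mult_ac)
  also have "(\<Sum>k=i..j. card {m. m \<le> ?l \<and> ?P k m}) = (\<Sum>k=i..j. \<Sum>m\<le>?l. if ?P k m then 1 else 0)"
  proof (rule sum.cong[OF HOL.refl])
    fix k assume "k \<in> {i..j}"
    have "{m. m \<le> ?l \<and> ?P k m} = {..?l} \<inter> {m. ?P k m}" by auto
    thus "card {m. m \<le> ?l \<and> ?P k m} = (\<Sum>m\<le>?l. if ?P k m then 1 else 0)" by (simp add: sum.If_cases)
  qed
  also have "\<dots> = (\<Sum>m\<le>?l. \<Sum>k=i..j. if ?P k m then 1 else 0)" by (rule sum.swap)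
  also have "\<dots> \<le> (\<Sum>m\<le>?l. 2 * D0 + 2)"
  proof (rule sum_mono)
    fix m assume "m \<in> {..?l}"
    have "(\<Sum>k=i..j. if ?P k m then 1 else 0) = card {k \<in> {i..j}. ?P k m}"
      by (simp add: sum.If_cases Int_def)
    also have "\<dots> \<le> card {r m - (D0 + 1)..r m + D0}" by (intro card_mono) auto
    also have "\<dots> \<le> 2 * D0 + 2" by simp
    finally show "(\<Sum>k=i..j. if ?P k m then 1 else 0) \<le> 2 * D0 + 2" .
  qed
  also have "\<dots> = (2 * D0 + 2) * (?l + 1)" by simp
  also have "Suc j - i \<le> ?l + 4"
  proof -
    have c: "c (Suc i) \<in> b i" "c j \<in> b j" using bpathD(2)[OF bp, of "Suc i"] bpathD(3)[OF bp, of j] ij by auto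
    have cV: "c (Suc i) \<in> V" "c j \<in> V" using block_V[OF blk c(1)] block_V[OF blk c(2)] ij by auto
    have "D (c (Suc i)) (c j) = j - Suc i" using bpathD(4)[OF bp, of "Suc i" j] ij by simp
    moreover have "D (c (Suc i)) (c j) \<le> D (c (Suc i)) z + D z (c j)" "D z (c j) \<le> D z w + D w (c j)"
      using cV V Y.dtri by auto
    moreover have "D (c (Suc i)) z \<le> 1" using block_D[OF blk c(1) zw(1)] ij by simp
    moreover have "D w (c j) \<le> 1" using block_D[OF blk zw(2) c(2)] ij by simp
    moreover have "D z w \<le> d z w" using D_le V by blast
    ultimately show ?thesis using ij by linarith
  qed
  finally have "(\<Sum>k=i..j. d (if k = i then z else c k) (if k = j then w else c (Suc k))) \<le>
      lip * ((2 * D0 + 2) * (?l + 1)) + 3 * lip * (?l + 4)" by (simp add: mult_le_mono)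
  also have "\<dots> \<le> lip * ((2 * D0 + 2) * (?l + 1)) + lip * (12 * (?l + 1))"
    by (simp add: algebra_simps)
  also have "\<dots> = block_const * (?l + 1)" by (simp add: block_const_def algebra_simps)
  finally show ?thesis .
qed

end

section \<open>Discrete Morse sequences\<close>

context cone_graph begin

section \<open>Undistorted sets and shortest chains in them\<close>

definition jumps :: "'a set \<Rightarrow> ('a \<times> 'a) set" where
  "jumps Q = {(x, y). x \<in> Q \<and> y \<in> Q \<and> d x y \<le> lip}"

lemma jumps_mono: "Q \<subseteq> Q' \<Longrightarrow> p \<in> jumps Q ^^ n \<Longrightarrow> p \<in> jumps Q' ^^ n"
  by (cases p) (fastforce simp: relpow_fun_conv jumps_def)

lemma jumps_sym: "(x, y) \<in> jumps Q ^^ n \<Longrightarrow> (y, x) \<in> jumps Q ^^ n"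
  by (rule relpow_sym) (auto simp: sym_def jumps_def X.dsym)

text \<open>Projecting a Cayley geodesic to \<open>C\<close> fixes its ends and yields one jump
  inside \<open>C\<close> for each step, so \<open>C\<close> is undistorted.\<close>

lemma coset_chain:
  assumes C: "C \<in> CC" "a \<in> C" "e \<in> C"
  shows "(a, e) \<in> jumps C ^^ d a e"
proof -
  have V: "a \<in> V" "e \<in> V" using C CC_mem_V by auto
  obtain p where p: "p 0 = a" "p (d a e) = e" "X.geo (d a e) p" using X.geo_ex[OF V] by blast
  have "\<forall>m. \<exists>g. proj C (p m) g" using proj_ex[OF C(1)] by blast
  then obtain g where g: "\<And>m. proj C (p m) (g m)" by metis
  have gC: "g m \<in> C" for m using g[of m] unfolding proj_def by blast
  have fixed: "g m = p m" if "p m \<in> C" for m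
  proof -
    have "D (p m) (g m) \<le> D (p m) (p m)" using g[of m] that unfolding proj_def by blast
    thus ?thesis using Y.d0[of "p m" "g m"] CC_mem_V[OF C(1) that] CC_mem_V[OF C(1) gC] by simp
  qed
  have "(g m, g (Suc m)) \<in> jumps C" if "m < d a e" for m
  proof -
    have "d (g m) (g (Suc m)) \<le> lip"
    proof (rule proj_step[OF C(1) _ _ g g])
      show "astep C (p m) (p (Suc m))" using X.geoD[OF p(3), of m "Suc m"] that by (simp add: astep_def)
    qed (use X.geoV[OF p(3)] that in auto)
    thus ?thesis using gC unfolding jumps_def by auto
  qed
  moreover have "g 0 = a" "g (d a e) = e" using fixed[of 0] fixed[of "d a e"] p C by auto
  ultimately show ?thesis unfolding relpow_fun_conv by blast
qed

lemma block_chain: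
  assumes b: "block b" "a \<in> b" "e \<in> b"
  shows "(a, e) \<in> jumps b ^^ d a e"
proof (cases "b \<in> CC")
  case True thus ?thesis using coset_chain assms by blast
next
  case False
  have V: "a \<in> V" "e \<in> V" using block_V b by auto
  have "d a e \<le> 1" using block_X[OF b(1) False] b by blast
  then consider "d a e = 0" | "d a e = 1" by linarith
  thus ?thesis using V X.d0[of a e] b lip_pos by cases (auto simp: jumps_def)
qed

lemma bpath_pieces:
  assumes bp: "bpath n c b" and ij: "i < q" "q \<le> n" and z: "z \<in> b i"
  defines "A \<equiv> \<lambda>q. \<Sum>k=i..<q. d (if k = i then z else c k) (c (Suc k))"
  shows "(z, c q) \<in> jumps (\<Union>k\<le>n. b k) ^^ A q" "d z (c q) \<le> A q"
proof -
  let ?Q = "\<Union>k\<le>n. b k"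
  have blk: "block (b m)" if "m \<le> n" for m using bpathD(1)[OF bp that] .
  have zV: "z \<in> V" using block_V[OF blk z] ij by simp
  have cb: "c (Suc k) \<in> b k" if "k < n" for k using bpathD(2)[OF bp, of "Suc k"] that by simp
  have cb': "c k \<in> b k" if "1 \<le> k" "k \<le> n" for k using bpathD(3)[OF bp] that by simp
  have piece: "(x, y) \<in> jumps ?Q ^^ d x y" if "k \<le> n" "x \<in> b k" "y \<in> b k" for k x y
    using block_chain[OF blk[OF that(1)] that(2,3)] by (rule jumps_mono[rotated]) (use that in auto)
  have "(z, c q) \<in> jumps ?Q ^^ A q \<and> d z (c q) \<le> A q"
    using ij(1)[THEN Suc_leI] ij(2)
  proof (induction q rule: dec_induct)
    case base
    thus ?case using piece[of i z "c (Suc i)"] cb[of i] z ij by (simp add: A_def)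
  next
    case (step q)
    have "(c q, c (Suc q)) \<in> jumps ?Q ^^ d (c q) (c (Suc q))" using piece[of q] cb cb' step by simp
    moreover have "A (Suc q) = A q + d (c q) (c (Suc q))" using step by (simp add: A_def)
    moreover have "d z (c (Suc q)) \<le> d z (c q) + d (c q) (c (Suc q))"
      using zV bpath_V[OF bp] step by (intro X.dtri) auto
    ultimately show ?case using step unfolding relpow_add by (auto simp: relpow_add)
  qed
  thus "(z, c q) \<in> jumps ?Q ^^ A q" "d z (c q) \<le> A q" by auto
qed

lemma block_const_ge1: "1 \<le> block_const" using lip_pos by (simp add: block_const_def)

text \<open>The lengths added up in \<open>bpath_total\<close> are those of jump paths through the
  blocks in order, so the union of the blocks is undistorted; a partial sum bounds the distance to
  an intermediate \<open>c q\<close>.\<close>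

lemma bpath_dist:
  assumes bp: "bpath n c b" and ij: "i < j" "j \<le> n" and zw: "z \<in> b i" "w \<in> b j"
  shows "\<exists>m \<le> block_const * (d z w + 1). (z, w) \<in> jumps (\<Union>k\<le>n. b k) ^^ m"
    "i < q \<Longrightarrow> q \<le> j \<Longrightarrow> d z (c q) \<le> block_const * (d z w + 1)"
proof -
  let ?Q = "\<Union>k\<le>n. b k"
  define A where "A q = (\<Sum>k=i..<q. d (if k = i then z else c k) (c (Suc k)))" for q
  have "(\<Sum>k=i..j. d (if k = i then z else c k) (if k = j then w else c (Suc k))) = A j + d (c j) w"
  proof -
    have "{i..j} = insert j {i..<j}" using ij by auto
    hence "(\<Sum>k=i..j. d (if k = i then z else c k) (if k = j then w else c (Suc k))) =
      d (c j) w + (\<Sum>k=i..<j. d (if k = i then z else c k) (if k = j then w else c (Suc k)))"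
      using ij by simp
    also have "(\<Sum>k=i..<j. d (if k = i then z else c k) (if k = j then w else c (Suc k))) = A j"
      unfolding A_def by (intro sum.cong) auto
    finally show ?thesis by simp
  qed
  hence tot: "A j + d (c j) w \<le> block_const * (d z w + 1)" using bpath_total[OF bp ij zw] by simp
  have "(c j, w) \<in> jumps (b j) ^^ d (c j) w"
    using block_chain[of "b j" "c j" w] bpathD(1,3)[OF bp, of j] ij zw by simp
  hence "(c j, w) \<in> jumps ?Q ^^ d (c j) w" by (rule jumps_mono[rotated]) (use ij in auto)
  hence "(z, w) \<in> jumps ?Q ^^ (A j + d (c j) w)"
    using bpath_pieces(1)[OF bp ij zw(1)] unfolding relpow_add A_def by blast
  thus "\<exists>m \<le> block_const * (d z w + 1). (z, w) \<in> jumps ?Q ^^ m" using tot by blast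
  show "d z (c q) \<le> block_const * (d z w + 1)" if "i < q" "q \<le> j"
  proof -
    have "A q \<le> A j" unfolding A_def using that by (intro sum_mono2) auto
    moreover have "d z (c q) \<le> A q" using bpath_pieces(2)[OF bp _ _ zw(1), of q] that ij unfolding A_def by simp
    ultimately show ?thesis using tot by linarith
  qed
qed

lemma bpath_dist_any:
  assumes bp: "bpath n c b" and zw: "z \<in> (\<Union>k\<le>n. b k)" "w \<in> (\<Union>k\<le>n. b k)"
  shows "\<exists>m \<le> block_const * (d z w + 1). (z, w) \<in> jumps (\<Union>k\<le>n. b k) ^^ m"
proof -
  obtain i j where ij: "i \<le> n" "j \<le> n" "z \<in> b i" "w \<in> b j" using zw by auto
  consider "i < j" | "j < i" | "i = j" by linarith
  thus ?thesis
  proof cases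
    case 1 thus ?thesis using bpath_dist(1)[OF bp] ij by blast
  next
    case 2
    then obtain m where "m \<le> block_const * (d w z + 1)" "(w, z) \<in> jumps (\<Union>k\<le>n. b k) ^^ m"
      using bpath_dist(1)[OF bp 2 ij(1) ij(4,3)] by blast
    thus ?thesis using jumps_sym by (auto simp: X.dsym)
  next
    case 3
    have "(z, w) \<in> jumps (b i) ^^ d z w" using block_chain bpathD(1)[OF bp ij(1)] ij 3 by blast
    hence "(z, w) \<in> jumps (\<Union>k\<le>n. b k) ^^ d z w" by (rule jumps_mono[rotated]) (use ij in auto)
    moreover have "1 * d z w \<le> block_const * (d z w + 1)" by (rule mult_le_mono) (use block_const_ge1 in auto)
    ultimately show ?thesis by auto
  qed
qed

text \<open>A discrete quasi-geodesic with one constant. The upper bound is imposed on single steps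
  only, since \<open>chain_le\<close> adds them up.\<close>

definition chain :: "nat \<Rightarrow> nat \<Rightarrow> (nat \<Rightarrow> 'a) \<Rightarrow> bool" where
  "chain K M q \<longleftrightarrow> (\<forall>i\<le>M. q i \<in> V) \<and> (\<forall>i<M. d (q i) (q (Suc i)) \<le> K) \<and>
     (\<forall>i j. i \<le> j \<longrightarrow> j \<le> M \<longrightarrow> j - i \<le> K * (d (q i) (q j) + 1))"

text \<open>In an undistorted set a shortest path of jumps is a quasi-geodesic: between two of its
  points it cannot use more jumps than the number granted by \<open>qc\<close>.\<close>

lemma shortest_chain:
  assumes Q: "Q \<subseteq> V" "x \<in> Q" "y \<in> Q"
    and qc: "\<And>z w. z \<in> Q \<Longrightarrow> w \<in> Q \<Longrightarrow> \<exists>m \<le> K' * (d z w + 1). (z, w) \<in> jumps Q ^^ m"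
    and K: "lip \<le> K" "K' \<le> K"
  obtains M q where "chain K M q" "q 0 = x" "q M = y" "\<And>i. i \<le> M \<Longrightarrow> q i \<in> Q"
    "\<And>i. i < M \<Longrightarrow> d (q i) (q (Suc i)) \<le> lip"
proof -
  define n where "n = (LEAST n. (x, y) \<in> jumps Q ^^ n)"
  have n: "(x, y) \<in> jumps Q ^^ n" unfolding n_def by (rule LeastI_ex) (use qc[OF Q(2,3)] in blast)
  have least: "n \<le> m" if "(x, y) \<in> jumps Q ^^ m" for m unfolding n_def using that by (rule Least_le)
  obtain f where f: "f 0 = x" "f n = y" "\<And>i. i < n \<Longrightarrow> (f i, f (Suc i)) \<in> jumps Q"
    using n unfolding relpow_fun_conv by blast
  have seg: "(f i, f j) \<in> jumps Q ^^ (j - i)" if "i \<le> j" "j \<le> n" for i j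
    unfolding relpow_fun_conv by (intro exI[of _ "\<lambda>k. f (i + k)"]) (use f that in auto)
  have fQ: "f i \<in> Q" if "i \<le> n" for i
    using f(3)[of i] that f(2) Q(3) by (cases "i = n") (auto simp: jumps_def)
  have "j - i \<le> K * (d (f i) (f j) + 1)" if ij: "i \<le> j" "j \<le> n" for i j
  proof -
    obtain m where m: "m \<le> K' * (d (f i) (f j) + 1)" "(f i, f j) \<in> jumps Q ^^ m"
      using qc[of "f i" "f j"] fQ ij by auto
    have "(x, f i) \<in> jumps Q ^^ i" "(f j, y) \<in> jumps Q ^^ (n - j)" using seg[of 0 i] seg[of j n] ij f by auto
    hence "(x, y) \<in> jumps Q ^^ (i + m + (n - j))" using m(2) unfolding relpow_add by blast
    hence "j - i \<le> m" using least ij by fastforce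
    also have "\<dots> \<le> K * (d (f i) (f j) + 1)" using m(1) K(2) by (meson le_trans mult_le_mono1)
    finally show ?thesis .
  qed
  moreover have st: "d (f i) (f (Suc i)) \<le> lip" if "i < n" for i using f(3)[OF that] by (simp add: jumps_def)
  moreover have "f i \<in> V" if "i \<le> n" for i using fQ[OF that] Q(1) by blast
  ultimately have "chain K n f" unfolding chain_def using K(1) by (auto intro: order_trans)
  thus ?thesis using that[of n f] f(1,2) fQ st by blast
qed

text \<open>The last clause is the Morse property, with gauge \<open>\<Phi>\<close>, for discrete quasi-geodesics.\<close>

definition dmorse :: "(nat \<Rightarrow> nat) \<Rightarrow> (nat \<Rightarrow> 'a) \<Rightarrow> bool" where
  "dmorse \<Phi> x \<longleftrightarrow> (\<forall>n. x n \<in> V) \<and> (\<forall>n m. n \<le> m \<longrightarrow> m - n \<le> d (x n) (x m) + 1 \<and> d (x n) (x m) \<le> m - n + 1) \<and>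
     (\<forall>K M q. chain K M q \<longrightarrow> (\<exists>n. d (q 0) (x n) \<le> K) \<longrightarrow> (\<exists>n. d (q M) (x n) \<le> K) \<longrightarrow>
        (\<forall>i\<le>M. \<exists>n. d (q i) (x n) \<le> \<Phi> K))"

lemma dmorseV: "dmorse \<Phi> x \<Longrightarrow> x n \<in> V"
  unfolding dmorse_def by blast

lemma dmorse_dist:
  assumes "dmorse \<Phi> x"
  shows "d (x n) (x m) \<le> (if n \<le> m then m - n else n - m) + 1"
    "n \<le> m \<Longrightarrow> m \<le> n + d (x n) (x m) + 1" "m \<le> n + d (x n) (x m) + 1"
  using assms X.dsym[of "x n" "x m"] nat_le_linear[of n m] unfolding dmorse_def by (fastforce simp: le_diff_conv)+

section \<open>Chains compared with a Morse sequence\<close>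

lemma discrete_ivt:
  fixes \<nu> :: "nat \<Rightarrow> nat"
  assumes "a \<le> L" "\<nu> a \<le> n" "n \<le> \<nu> L" "\<And>i. a \<le> i \<Longrightarrow> i < L \<Longrightarrow> \<nu> (Suc i) \<le> \<nu> i + J"
  obtains i where "a \<le> i" "i \<le> L" "\<nu> i \<le> n" "n \<le> \<nu> i + J"
proof -
  define S where "S = {i. a \<le> i \<and> i \<le> L \<and> \<nu> i \<le> n}"
  have S: "finite S" "a \<in> S" using assms by (auto simp: S_def)
  define i where "i = Max S"
  have i: "i \<in> S" "\<And>j. j \<in> S \<Longrightarrow> j \<le> i" unfolding i_def using S by (auto intro!: Max_in Max_ge)
  have "n \<le> \<nu> i + J"
  proof (cases "i = L")
    case True thus ?thesis using assms by simp
  next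
    case False
    hence "i < L" using i by (auto simp: S_def)
    moreover have "Suc i \<notin> S" using i(2)[of "Suc i"] by auto
    ultimately have "n \<le> \<nu> (Suc i)" using i by (auto simp: S_def)
    also have "\<dots> \<le> \<nu> i + J" using assms(4)[of i] i False by (simp add: S_def)
    finally show ?thesis .
  qed
  thus ?thesis using that i by (auto simp: S_def)
qed

definition chain_const :: "(nat \<Rightarrow> nat) \<Rightarrow> nat \<Rightarrow> nat" where
  "chain_const \<Phi> K = (let f = max K (\<Phi> K); J = 2 * f + K + 1 in
     (3 * f + K + 2) + (K + K * (K * (2 * f + J + 2)) + f + 1))"

text \<open>Attach to each chain point the index of a nearby point of \<open>x\<close>. Consecutive
  indices differ by at most \<open>J\<close>, so they leave no large gap between \<open>s\<close>
  and \<open>t\<close>. An index below \<open>s\<close> is followed by one close to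
  \<open>s\<close>, at a chain point near \<open>q 0\<close>; the chain property bounds the time
  elapsed until then, so the index was not far below \<open>s\<close>.\<close>

lemma dmorse_chain:
  assumes x: "dmorse \<Phi> x" and q: "chain K M q" and ends: "d (q 0) (x s) \<le> K" "d (q M) (x t) \<le> K" and st: "s \<le> t"
  shows "i \<le> M \<Longrightarrow> \<exists>n. d (q i) (x n) \<le> max K (\<Phi> K) \<and> s \<le> n + chain_const \<Phi> K"
    "s \<le> n \<Longrightarrow> n \<le> t \<Longrightarrow> \<exists>i\<le>M. d (q i) (x n) \<le> chain_const \<Phi> K"
proof -
  define f where "f = max K (\<Phi> K)"
  define J where "J = 2 * f + K + 1"
  have chain_const: "chain_const \<Phi> K = (3 * f + K + 2) + (K + K * (K * (2 * f + J + 2)) + f + 1)"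
    unfolding chain_const_def Let_def f_def J_def ..
  have "\<forall>i\<le>M. \<exists>n. d (q i) (x n) \<le> \<Phi> K" using x q ends unfolding dmorse_def by blast
  then obtain \<mu> where \<mu>: "\<And>i. i \<le> M \<Longrightarrow> d (q i) (x (\<mu> i)) \<le> \<Phi> K" by metis
  \<comment> \<open>Index \<open>s\<close> at time 0 and \<open>t\<close> at an extra time
    \<open>Suc M\<close> prescribe both ends, even when \<open>M = 0\<close>.\<close>
  define \<nu> where "\<nu> i = (if i = 0 then s else if i = Suc M then t else \<mu> i)" for i
  define r where "r i = q (min i M)" for i
  have qV: "q i \<in> V" if "i \<le> M" for i using q that unfolding chain_def by blast
  have rV: "r i \<in> V" for i unfolding r_def by (rule qV) simp
  note xV = dmorseV[OF x]
  have near: "d (r i) (x (\<nu> i)) \<le> f" if iM: "i \<le> Suc M" for i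
  proof -
    consider "i = 0" | "i = Suc M" | "1 \<le> i" "i \<le> M" using iM by linarith
    thus ?thesis
    proof cases
      case 3 hence "d (r i) (x (\<nu> i)) \<le> \<Phi> K" using \<mu>[of i] by (simp add: r_def \<nu>_def)
      thus ?thesis by (simp add: f_def)
    qed (use ends in \<open>auto simp: r_def \<nu>_def f_def\<close>)
  qed
  have rstep: "d (r i) (r (Suc i)) \<le> K" for i
  proof (cases "i < M")
    case True thus ?thesis using q unfolding chain_def r_def by simp
  next
    case False hence "r (Suc i) = r i" by (simp add: r_def)
    thus ?thesis using rV by simp
  qed
  have jump: "\<nu> (Suc i) \<le> \<nu> i + J" if "i < Suc M" for i
  proof -
    have "d (x (\<nu> i)) (x (\<nu> (Suc i))) \<le> d (x (\<nu> i)) (r i) + d (r i) (x (\<nu> (Suc i)))"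
      "d (r i) (x (\<nu> (Suc i))) \<le> d (r i) (r (Suc i)) + d (r (Suc i)) (x (\<nu> (Suc i)))"
      using xV rV X.dtri by auto
    moreover have "d (x (\<nu> i)) (r i) \<le> f" "d (r (Suc i)) (x (\<nu> (Suc i))) \<le> f"
      using near[of i] near[of "Suc i"] that by (auto simp: X.dsym)
    ultimately have "d (x (\<nu> i)) (x (\<nu> (Suc i))) \<le> 2 * f + K" using rstep[of i] by linarith
    thus ?thesis using dmorse_dist(3)[OF x, of "\<nu> (Suc i)" "\<nu> i"] unfolding J_def by linarith
  qed
  show "\<exists>i\<le>M. d (q i) (x n) \<le> chain_const \<Phi> K" if n: "s \<le> n" "n \<le> t"
  proof -
    obtain i where i: "i \<le> Suc M" "\<nu> i \<le> n" "n \<le> \<nu> i + J"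
      using discrete_ivt[of 0 "Suc M" \<nu> n J] n jump by (auto simp: \<nu>_def)
    have "d (x (\<nu> i)) (x n) \<le> J + 1" using dmorse_dist(1)[OF x, of "\<nu> i" n] i by simp
    moreover have "d (r i) (x n) \<le> d (r i) (x (\<nu> i)) + d (x (\<nu> i)) (x n)" using xV rV X.dtri by auto
    ultimately have "d (r i) (x n) \<le> f + (J + 1)" using near[OF i(1)] by linarith
    hence "d (q (min i M)) (x n) \<le> chain_const \<Phi> K" unfolding chain_const J_def r_def by simp
    thus ?thesis by (meson min.cobounded2)
  qed
  show "\<exists>n. d (q i) (x n) \<le> max K (\<Phi> K) \<and> s \<le> n + chain_const \<Phi> K" if i: "i \<le> M"
  proof (cases "s \<le> \<nu> i")
    case True
    thus ?thesis using near[of i] i unfolding f_def r_def by (intro exI[of _ "\<nu> i"]) auto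
  next
    case False
    then obtain j where j: "i \<le> j" "j \<le> Suc M" "\<nu> j \<le> s" "s \<le> \<nu> j + J"
      using discrete_ivt[of i "Suc M" \<nu> s J] st i jump by (auto simp: \<nu>_def)
    have "d (x (\<nu> j)) (x s) \<le> J + 1" using dmorse_dist(1)[OF x, of "\<nu> j" s] j by simp
    moreover have "d (r j) (q 0) \<le> d (r j) (x (\<nu> j)) + d (x (\<nu> j)) (q 0)" using xV rV qV X.dtri by auto
    moreover have "d (x (\<nu> j)) (q 0) \<le> d (x (\<nu> j)) (x s) + d (x s) (q 0)" using xV rV qV X.dtri by auto
    moreover have "d (x s) (q 0) \<le> f" using ends by (simp add: X.dsym f_def)
    ultimately have "d (q 0) (r j) \<le> 2 * f + J + 1" using near[OF j(2)] by (simp add: X.dsym)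
    hence dj: "d (q 0) (q (min j M)) + 1 \<le> 2 * f + J + 2" by (simp add: r_def)
    have "min j M - 0 \<le> K * (d (q 0) (q (min j M)) + 1)" using q unfolding chain_def by (meson le0 min.cobounded2)
    also have "\<dots> \<le> K * (2 * f + J + 2)" using dj by (rule mult_le_mono2)
    finally have il: "i \<le> K * (2 * f + J + 2)" using i j by simp
    have "d (q 0) (q i) \<le> K * (i - 0)" using q i by (intro X.chain_le) (auto simp: chain_def)
    also have "\<dots> \<le> K * (K * (2 * f + J + 2))" using il by simp
    finally have "d (q 0) (q i) \<le> K * (K * (2 * f + J + 2))" .
    moreover have "d (x s) (x (\<nu> i)) \<le> d (x s) (q 0) + d (q 0) (x (\<nu> i))"
       "d (q 0) (x (\<nu> i)) \<le> d (q 0) (q i) + d (q i) (x (\<nu> i))" using xV qV i X.dtri by auto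
    moreover have "d (q i) (x (\<nu> i)) \<le> f" using near[of i] i by (simp add: r_def)
    moreover have "d (x s) (q 0) \<le> K" using ends by (simp add: X.dsym)
    ultimately have "d (x s) (x (\<nu> i)) \<le> K + K * (K * (2 * f + J + 2)) + f" by linarith
    hence "s \<le> \<nu> i + chain_const \<Phi> K" using dmorse_dist(3)[OF x, of s "\<nu> i"] X.dsym[of "x s"] unfolding chain_const by simp
    thus ?thesis using near[of i] i unfolding f_def r_def by (intro exI[of _ "\<nu> i"]) auto
  qed
qed

end

text \<open>Two geodesics joined at \<open>z\<close>; equality in the triangle inequality for
  \<open>x, z, y\<close> makes the concatenation geodesic.\<close>

lemma (in graph_metric) geo_through:
  assumes V: "x \<in> V" "y \<in> V" and z: "z \<in> Iv x y"
  obtains h where "geo (d x y) h" "h 0 = x" "h (d x z) = z" "h (d x y) = y"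
proof -
  have zV: "z \<in> V" and zD: "d x z + d z y = d x y" using z Iv_D by auto
  let ?n = "d x z" and ?m = "d z y"
  obtain g1 where g1: "g1 0 = x" "g1 ?n = z" "geo ?n g1" using geo_ex[OF V(1) zV] by blast
  obtain g2 where g2: "g2 0 = z" "g2 ?m = y" "geo ?m g2" using geo_ex[OF zV V(2)] by blast
  define h where "h k = (if k \<le> ?n then g1 k else g2 (k - ?n))" for k
  have hV: "h k \<in> V" if "k \<le> ?n + ?m" for k
    using geoV[OF g1(3)] geoV[OF g2(3)] that unfolding h_def by auto
  have upper: "d (h k) (h l) \<le> l - k" if kl: "k \<le> l" "l \<le> ?n + ?m" for k l
  proof -
    consider "l \<le> ?n" | "?n < k" | "k \<le> ?n" "?n < l" by linarith
    thus ?thesis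
    proof cases
      case 1 thus ?thesis using geoD[OF g1(3), of k l] kl by (simp add: h_def)
    next
      case 2 thus ?thesis using geoD[OF g2(3), of "k - ?n" "l - ?n"] kl by (simp add: h_def)
    next
      case 3
      have "d (h k) (h l) \<le> d (h k) z + d z (h l)" using hV kl zV by (intro dtri) auto
      moreover have "d (h k) z = ?n - k" using geoD[OF g1(3), of k ?n] 3 g1 by (simp add: h_def)
      moreover have "d z (h l) = l - ?n" using geoD[OF g2(3), of 0 "l - ?n"] 3 g2 kl by (simp add: h_def)
      ultimately show ?thesis using 3 by simp
    qed
  qed
  have h0: "h 0 = x" "h ?n = z" using g1 by (simp_all add: h_def)
  have hm: "h (?n + ?m) = y"
    using g1 g2 d0[OF zV V(2)] by (cases "?m = 0") (auto simp: h_def)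
  have "geo (?n + ?m) h"
    unfolding geo_def
  proof (intro conjI allI impI)
    fix k l assume kl: "k \<le> l" "l \<le> ?n + ?m"
    have "d x y \<le> d (h 0) (h k) + d (h k) y" using V hV[of k] kl h0 dtri[of x "h k" y] by simp
    moreover have "d (h k) y \<le> d (h k) (h l) + d (h l) (h (?n + ?m))"
      using V hV[of k] hV[of l] kl hm dtri[of "h k" "h l" y] by simp
    moreover have "d (h 0) (h k) \<le> k" using upper[of 0 k] kl by simp
    moreover have "d (h l) (h (?n + ?m)) \<le> ?n + ?m - l" using upper[of l "?n + ?m"] kl by simp
    ultimately show "d (h k) (h l) = l - k" using upper[OF kl] kl zD by linarith
  qed (use hV in auto)
  thus ?thesis using that h0 hm zD by simp
qed

context cone_graph begin

section \<open>Geodesics of the coned-off graph near a Morse sequence\<close>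

definition path_const :: "(nat \<Rightarrow> nat) \<Rightarrow> nat \<Rightarrow> nat" where
  "path_const \<Phi> K = (let K' = max K (max lip block_const) in block_const * (lip + 1) + max K' (\<Phi> K') + chain_const \<Phi> K')"

text \<open>A shortest chain in the union of the blocks is a quasi-geodesic with ends near
  \<open>x\<close>, hence near \<open>x\<close>. It must jump from a block before \<open>k\<close>
  to a block from \<open>k\<close> on, and \<open>bpath_dist\<close> places \<open>c k\<close> close
  to that jump. The bound on \<open>j\<close> says that the path does not run back along
  \<open>x\<close> beyond its start.\<close>

lemma bpath_near:
  assumes x: "dmorse \<Phi> x" and bp: "bpath n c b" and k: "1 \<le> k" "k \<le> n"
    and s: "x' \<in> b 0" "d x' (x s) \<le> K" and t: "y' \<in> b n" "d y' (x t) \<le> K" and st: "s \<le> t"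
  shows "\<exists>j. d (c k) (x j) \<le> path_const \<Phi> K \<and> s \<le> j + path_const \<Phi> K"
proof -
  define K' where "K' = max K (max lip block_const)"
  have K': "lip \<le> K'" "block_const \<le> K'" "K \<le> K'" by (auto simp: K'_def)
  have path_const: "path_const \<Phi> K = block_const * (lip + 1) + max K' (\<Phi> K') + chain_const \<Phi> K'" unfolding path_const_def Let_def K'_def ..
  let ?Q = "\<Union>k\<le>n. b k"
  have blk: "block (b m)" if "m \<le> n" for m using bpathD(1)[OF bp that] .
  have QV: "?Q \<subseteq> V" using block_V[OF blk] by auto
  obtain M q where q: "chain K' M q" "q 0 = x'" "q M = y'" "\<And>i. i \<le> M \<Longrightarrow> q i \<in> ?Q"
    "\<And>i. i < M \<Longrightarrow> d (q i) (q (Suc i)) \<le> lip"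
    by (rule shortest_chain[OF QV _ _ bpath_dist_any[OF bp] K'(1,2), of x' y']) (use s t in auto)
  have "\<exists>i\<le>M. d (q i) (c k) \<le> block_const * (lip + 1)"
  proof (cases "M = 0")
    \<comment> \<open>There is no jump, but the common end point lies in both end blocks, so
      \<open>bpath_dist\<close> applies to the pair \<open>x', x'\<close>.\<close>
    case True
    hence "x' = y'" using q by simp
    hence "d x' (c k) \<le> block_const * (d x' x' + 1)" using bpath_dist(2)[OF bp _ order_refl s(1), of x' k] t k by simp
    moreover have "d x' x' = 0" using s(1) QV by auto
    ultimately have "d x' (c k) \<le> block_const * (lip + 1)" by (simp add: trans_le_add1)
    thus ?thesis using q True by auto
  next
    case False
    have "\<exists>m. m \<le> n \<and> q i \<in> b m" if "i \<le> M" for i using q(4)[OF that] by auto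
    then obtain \<kappa>' where \<kappa>': "\<And>i. i \<le> M \<Longrightarrow> \<kappa>' i \<le> n \<and> q i \<in> b (\<kappa>' i)" by metis
    \<comment> \<open>A chain point may lie in several blocks; the first and the last one are
      assigned to the end blocks.\<close>
    define \<kappa> where "\<kappa> i = (if i = 0 then 0 else if i = M then n else \<kappa>' i)" for i
    have \<kappa>: "\<kappa> i \<le> n" "q i \<in> b (\<kappa> i)" if "i \<le> M" for i using \<kappa>'[OF that] q s t unfolding \<kappa>_def by auto
    have "\<exists>i<M. \<kappa> i < k \<and> k \<le> \<kappa> (Suc i)"
    proof (rule ccontr)
      assume no: "\<not> (\<exists>i<M. \<kappa> i < k \<and> k \<le> \<kappa> (Suc i))"
      have "\<kappa> i < k" if "i \<le> M" for i
        using that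
      proof (induction i)
        case 0 thus ?case using k by (simp add: \<kappa>_def)
      next
        case (Suc i) thus ?case using no by (meson Suc_le_lessD less_imp_le_nat not_le)
      qed
      from this[of M] show False using False k by (simp add: \<kappa>_def)
    qed
    then obtain i where i: "i < M" "\<kappa> i < k" "k \<le> \<kappa> (Suc i)" by blast
    have "d (q i) (c k) \<le> block_const * (d (q i) (q (Suc i)) + 1)"
      using bpath_dist(2)[OF bp _ \<kappa>(1)[of "Suc i"] \<kappa>(2)[of i] \<kappa>(2)[of "Suc i"], of k] i by simp
    also have "\<dots> \<le> block_const * (lip + 1)" using q(5)[OF i(1)] by simp
    finally show ?thesis using i by (intro exI[of _ i]) simp
  qed
  then obtain i where i: "i \<le> M" "d (q i) (c k) \<le> block_const * (lip + 1)" by blast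
  have "d (q 0) (x s) \<le> K'" "d (q M) (x t) \<le> K'" using s t q K' by auto
  then obtain j where j: "d (q i) (x j) \<le> max K' (\<Phi> K')" "s \<le> j + chain_const \<Phi> K'"
    using dmorse_chain(1)[OF x q(1) _ _ st i(1)] by blast
  have "d (c k) (x j) \<le> d (c k) (q i) + d (q i) (x j)"
    using bpath_V[OF bp k] dmorseV[OF x] q(4)[OF i(1)] QV by (intro X.dtri) auto
  hence "d (c k) (x j) \<le> path_const \<Phi> K" using i(2) j(1) unfolding path_const by (simp add: X.dsym)
  thus ?thesis using j(2) unfolding path_const by (intro exI[of _ j]) simp
qed

text \<open>\<open>C\<close> is undistorted, so a shortest chain inside it joins \<open>y\<close> to
  \<open>y'\<close> and, being a quasi-geodesic, passes near all points of \<open>x\<close> in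
  between.\<close>

lemma coset_fill:
  assumes x: "dmorse \<Phi> x" and C: "C \<in> CC" "y \<in> C" "y' \<in> C" and near: "d y (x s) \<le> K" "d y' (x t) \<le> K"
    and n: "s \<le> n" "n \<le> t"
  shows "\<exists>a\<in>C. d a (x n) \<le> chain_const \<Phi> (max K lip)"
proof -
  let ?K = "max K lip"
  have m: "\<exists>m \<le> 1 * (d z w + 1). (z, w) \<in> jumps C ^^ m" if "z \<in> C" "w \<in> C" for z w
    using coset_chain[OF C(1) that] by (intro exI[of _ "d z w"]) simp
  have K: "lip \<le> ?K" "1 \<le> ?K" using lip_pos by auto
  obtain M q where q: "chain ?K M q" "q 0 = y" "q M = y'" "\<And>i. i \<le> M \<Longrightarrow> q i \<in> C"
    using shortest_chain[OF CC_V[OF C(1)] C(2,3) m K] by metis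
  have "d (q 0) (x s) \<le> ?K" "d (q M) (x t) \<le> ?K" "s \<le> t" using near q n by auto
  then obtain i where "i \<le> M" "d (q i) (x n) \<le> chain_const \<Phi> ?K"
    using dmorse_chain(2)[OF x q(1)] n by blast
  thus ?thesis using q(4) by blast
qed

text \<open>Indices shift by one to make room for the end blocks: block \<open>k\<close> joins
  \<open>g (k - 1)\<close> to \<open>g k\<close>. A step that is short in the Cayley graph gets a
  block of at most two elements, a coset being used only otherwise. For inner blocks the projection
  clauses hold because blocks have diameter at most 1 and \<open>g\<close> is geodesic.\<close>

lemma geo_bpath:
  assumes g: "Y.geo n g" and B: "block B0" "block B1" "g 0 \<in> B0" "g n \<in> B1"
    and proj: "\<And>l. B0 \<in> CC \<Longrightarrow> l \<le> n \<Longrightarrow> proj B0 (g l) (g 0)" "\<And>l. B1 \<in> CC \<Longrightarrow> l \<le> n \<Longrightarrow> proj B1 (g l) (g n)"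
    and ne: "B0 \<in> CC \<Longrightarrow> B0 \<noteq> B1"
  obtains b where "bpath (Suc n) (\<lambda>k. g (k - 1)) b" "b 0 = B0" "b (Suc n) = B1"
    "\<And>k. 1 \<le> k \<Longrightarrow> k \<le> n \<Longrightarrow> b k \<in> CC \<or> d (g (k - 1)) (g k) \<le> 1"
proof -
  have gV: "g k \<in> V" if "k \<le> n" for k using Y.geoV[OF g that] .
  have gD: "D (g k) (g l) = l - k" if "k \<le> l" "l \<le> n" for k l using Y.geoD[OF g that] .
  have "\<exists>b. block b \<and> g (k - 1) \<in> b \<and> g k \<in> b \<and> (b \<in> CC \<or> d (g (k - 1)) (g k) \<le> 1)" if k: "1 \<le> k" "k \<le> n" for k
  proof (cases "d (g (k - 1)) (g k) \<le> 1")
    case True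
    thus ?thesis using gV k by (intro exI[of _ "{g (k - 1), g k}"]) (auto simp: block_def)
  next
    case False
    have "D (g (k - 1)) (g k) \<le> 1" using gD[of "k - 1" k] k by simp
    then obtain C where "C \<in> CC" "g (k - 1) \<in> C" "g k \<in> C" using D1[of "g (k - 1)" "g k"] False gV k by auto
    thus ?thesis by (auto simp: block_def)
  qed
  then obtain b' where b': "\<And>k. 1 \<le> k \<Longrightarrow> k \<le> n \<Longrightarrow> block (b' k) \<and> g (k - 1) \<in> b' k \<and> g k \<in> b' k \<and>
      (b' k \<in> CC \<or> d (g (k - 1)) (g k) \<le> 1)"
    by metis
  define b where "b k = (if k = 0 then B0 else if k = Suc n then B1 else b' k)" for k
  have b0: "b 0 = B0" and b1: "b (Suc n) = B1" and bb: "\<And>k. 1 \<le> k \<Longrightarrow> k \<le> n \<Longrightarrow> b k = b' k"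
    by (auto simp: b_def)
  have blk: "block (b k)" if "k \<le> Suc n" for k
    using b' B that unfolding b_def by (auto simp: le_Suc_eq Suc_le_eq)
  have mem: "g (k - 1) \<in> b (k - 1)" "g (k - 1) \<in> b k" if k: "1 \<le> k" "k \<le> Suc n" for k
  proof -
    show "g (k - 1) \<in> b (k - 1)" using b'[of "k - 1"] B k unfolding b_def by (cases "k = 1") auto
    show "g (k - 1) \<in> b k" using b'[of k] B k unfolding b_def by (cases "k = Suc n") auto
  qed
  have npl: "proj (b k) (g (l - 1)) (g (k - 1))" if k: "k \<le> Suc n" "b k \<in> CC" and l: "1 \<le> l" "l \<le> k" for k l
  proof (cases "k = Suc n")
    case True thus ?thesis using proj(2)[of "l - 1"] k l b1 by simp
  next
    case False
    show ?thesis unfolding proj_def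
    proof (intro conjI ballI)
      show "g (k - 1) \<in> b k" using mem k l by simp
      fix \<beta> assume \<beta>: "\<beta> \<in> b k"
      have gk: "g k \<in> b k" using mem[of "Suc k"] k False by simp
      have "D (g (l - 1)) (g k) \<le> D (g (l - 1)) \<beta> + D \<beta> (g k)"
        using gV k l False block_V[OF blk[OF k(1)] \<beta>] by (intro Y.dtri) auto
      moreover have "D \<beta> (g k) \<le> 1" using block_D[OF blk[OF k(1)] \<beta> gk] .
      ultimately show "D (g (l - 1)) (g (k - 1)) \<le> D (g (l - 1)) \<beta>"
        using gD[of "l - 1" k] gD[of "l - 1" "k - 1"] k l False by simp
    qed
  qed
  have npr: "proj (b k) (g (l - 1)) (g k)" if k: "k < l" "b k \<in> CC" and l: "l \<le> Suc n" for k l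
  proof (cases "k = 0")
    case True thus ?thesis using proj(1)[of "l - 1"] k l b0 by simp
  next
    case False
    show ?thesis unfolding proj_def
    proof (intro conjI ballI)
      show "g k \<in> b k" using mem[of "Suc k"] k l by simp
      fix \<beta> assume \<beta>: "\<beta> \<in> b k"
      have kn: "k \<le> Suc n" using k l by simp
      have gk: "g (k - 1) \<in> b k" using mem[of k] k l False by simp
      have "D (g (k - 1)) (g (l - 1)) \<le> D (g (k - 1)) \<beta> + D \<beta> (g (l - 1))"
        using gV k l False block_V[OF blk[OF kn] \<beta>] by (intro Y.dtri) auto
      moreover have "D (g (k - 1)) \<beta> \<le> 1" using block_D[OF blk[OF kn] gk \<beta>] .
      moreover have "D (g (k - 1)) (g (l - 1)) = l - k" using gD[of "k - 1" "l - 1"] k l False by simp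
      moreover have "D (g (l - 1)) (g k) = l - 1 - k" using gD[of k "l - 1"] k l Y.dsym[of "g (l - 1)" "g k"] by simp
      moreover have "D (g (l - 1)) \<beta> = D \<beta> (g (l - 1))" by (rule Y.dsym)
      ultimately show "D (g (l - 1)) (g k) \<le> D (g (l - 1)) \<beta>" by linarith
    qed
  qed
  have dis: "b k \<noteq> b l" if k: "k < l" "b k \<in> CC" and l: "l \<le> Suc n" for k l
  proof
    assume eq: "b k = b l"
    show False
    proof (cases "l = Suc n")
      case True
      show False
      proof (cases "k = 0")
        case True thus False using ne eq k b0 b1 \<open>l = Suc n\<close> by simp
      next
        case False
        have "g (k - 1) \<in> b l" using mem[of k] eq False k l by simp
        hence "D (g (k - 1)) (g n) \<le> D (g (k - 1)) (g (k - 1))"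
          using proj(2)[of "k - 1"] k l True eq b1 unfolding proj_def by auto
        thus False using gD[of "k - 1" n] gV[of "k - 1"] False k True by simp
      qed
    next
      case False
      have gl: "g l \<in> b l" using mem[of "Suc l"] False l by simp
      show False
      proof (cases "k = 0")
        case True
        hence "D (g l) (g 0) \<le> D (g l) (g l)" using proj(1)[of l] gl k l False eq b0 unfolding proj_def by auto
        thus False using gD[of 0 l] gV[of l] Y.dsym[of "g l" "g 0"] k l True False by simp
      next
        case k0: False
        have "g (k - 1) \<in> b l" using mem[of k] k0 k l eq by simp
        hence "D (g (k - 1)) (g l) \<le> 1" using block_D[OF blk[OF l] _ gl] by blast
        thus False using gD[of "k - 1" l] k0 k l False by simp
      qed
    qed
  qed
  have "bpath (Suc n) (\<lambda>k. g (k - 1)) b"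
    unfolding bpath_def
  proof (intro conjI allI impI)
    fix k l assume "1 \<le> k" "k \<le> l" "l \<le> Suc n"
    thus "D (g (k - 1)) (g (l - 1)) = l - k" using gD[of "k - 1" "l - 1"] by simp
  next
    fix k l assume "k < l" "l \<le> Suc n" "b k \<in> CC"
    thus "proj (b k) (g (l - 1)) (g (Suc k - 1))" using npr by simp
  qed (use blk mem npl dis in auto)
  thus ?thesis using that b0 b1 bb b' by metis
qed

lemma singleton_block: "x \<in> V \<Longrightarrow> block {x}"
  unfolding block_def by (rule disjI2, rule exI[of _ x], rule exI[of _ x]) simp

lemma proj_singleton: "proj {x} u x"
  by (simp add: proj_def)

lemma path_const_ge: "K \<le> path_const \<Phi> K"
  unfolding path_const_def Let_def by simp

lemma geo_near:
  assumes x: "dmorse \<Phi> x" and g: "Y.geo n g" and s: "d (g 0) (x s) \<le> K" and t: "d (g n) (x t) \<le> K"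
    and st: "s \<le> t" and k: "k \<le> n"
  shows "\<exists>j. d (g k) (x j) \<le> path_const \<Phi> K \<and> s \<le> j + path_const \<Phi> K"
proof (cases "n = 0")
  case True
  thus ?thesis using s k path_const_ge[of K \<Phi>] by (intro exI[of _ s]) (auto intro: order_trans)
next
  case False
  have V: "g 0 \<in> V" "g n \<in> V" using Y.geoV[OF g] by auto
  have "D (g 0) (g n) = n" using Y.geoD[OF g, of 0 n] by simp
  \<comment> \<open>A singleton can be a coset, and \<open>geo_bpath\<close> asks a coset at the
    start to differ from the block at the end; hence the separate case \<open>n = 0\<close>.\<close>
  hence ne: "g 0 \<noteq> g n" using V False by auto
  obtain b where b: "bpath (Suc n) (\<lambda>k. g (k - 1)) b" "b 0 = {g 0}" "b (Suc n) = {g n}"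
    by (rule geo_bpath[OF g singleton_block[OF V(1)] singleton_block[OF V(2)]]) (use ne in \<open>auto simp: proj_singleton\<close>)
  thus ?thesis using bpath_near[OF x b(1), of "Suc k" "g 0" s K "g n" t] k s t st by simp
qed

definition mono_const :: "(nat \<Rightarrow> nat) \<Rightarrow> nat" where
  "mono_const \<Phi> = 3 * path_const \<Phi> 0 + 4 + chain_const \<Phi> (max (path_const \<Phi> 0) lip)"

text \<open>Along a geodesic of the coned-off graph from \<open>x 0\<close> to \<open>x s\<close>
  the nearby indices on \<open>x\<close> pass \<open>T\<close> at some step from \<open>g k\<close>
  to \<open>g (Suc k)\<close>. A step in the Cayley graph changes the index little; a step inside a
  coset forces \<open>x T\<close> near that coset by \<open>coset_fill\<close>. Either way
  \<open>x T\<close> is close to \<open>g k\<close> in the coned-off graph, and \<open>g k\<close>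
  is no farther from \<open>x 0\<close> than \<open>x s\<close>.\<close>

lemma dmorse_mono:
  assumes x: "dmorse \<Phi> x" and T: "T \<le> s"
  shows "D (x 0) (x T) \<le> D (x 0) (x s) + mono_const \<Phi>"
proof -
  note xV = dmorseV[OF x]
  define n where "n = D (x 0) (x s)"
  obtain g where g: "g 0 = x 0" "g n = x s" "Y.geo n g" unfolding n_def using Y.geo_ex[OF xV xV] by blast
  have gV: "g k \<in> V" if "k \<le> n" for k using Y.geoV[OF g(3) that] .
  let ?f = "path_const \<Phi> 0"
  have "\<exists>j. d (g k) (x j) \<le> ?f" if "k \<le> n" for k
    using geo_near[OF x g(3), of 0 0 s k] g xV that by auto
  then obtain j' where j': "\<And>k. k \<le> n \<Longrightarrow> d (g k) (x (j' k)) \<le> ?f" by metis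
  show ?thesis
  proof (cases "n = 0")
    case True
    hence "x 0 = x s" using Y.d0 xV n_def by auto
    hence "s \<le> 1" using dmorse_dist(2)[OF x, of 0 s] xV by simp
    hence "d (x 0) (x T) \<le> 2" using dmorse_dist(1)[OF x, of 0 T] T by simp
    hence "D (x 0) (x T) \<le> 2" using D_le[OF xV xV, of 0 T] by simp
    thus ?thesis by (simp add: mono_const_def)
  next
    case False
    define j where "j k = (if k = 0 then 0 else if k = n then s else j' k)" for k
    have j: "d (g k) (x (j k)) \<le> ?f" if "k \<le> n" for k using j'[OF that] g xV by (auto simp: j_def)
    show ?thesis
    proof (cases "T = s")
      case True thus ?thesis by simp
    next
      case ne: False
      have "\<exists>k<n. j k \<le> T \<and> T < j (Suc k)"
      proof (rule ccontr)
        assume no: "\<not> (\<exists>k<n. j k \<le> T \<and> T < j (Suc k))"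
        have "j k \<le> T" if "k \<le> n" for k
          using that
        proof (induction k)
          case 0 thus ?case by (simp add: j_def)
        next
          case (Suc k) thus ?case using no by (meson Suc_le_lessD less_imp_le_nat not_le)
        qed
        from this[of n] show False using False T ne by (simp add: j_def)
      qed
      then obtain k where k: "k < n" "j k \<le> T" "T < j (Suc k)" by blast
      have gk: "D (x 0) (g k) = k" using Y.geoD[OF g(3), of 0 k] g k by simp
      show ?thesis
      proof (cases "d (g k) (g (Suc k)) \<le> 1")
        case True
        have "d (x (j k)) (x (j (Suc k))) \<le> d (x (j k)) (g k) + d (g k) (x (j (Suc k)))"
          "d (g k) (x (j (Suc k))) \<le> d (g k) (g (Suc k)) + d (g (Suc k)) (x (j (Suc k)))"
          using xV gV k by (auto intro!: X.dtri)
        hence "d (x (j k)) (x (j (Suc k))) \<le> 2 * ?f + 1"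
          using j[of k] j[of "Suc k"] k True X.dsym[of "x (j k)" "g k"] by simp
        hence "j (Suc k) \<le> j k + 2 * ?f + 2" using dmorse_dist(2)[OF x, of "j k" "j (Suc k)"] k by simp
        hence "d (x (j k)) (x T) \<le> 2 * ?f + 3" using dmorse_dist(1)[OF x, of "j k" T] k by simp
        moreover have "d (g k) (x T) \<le> d (g k) (x (j k)) + d (x (j k)) (x T)" using xV gV k X.dtri by simp
        ultimately have "d (g k) (x T) \<le> 3 * ?f + 3" using j[of k] k by simp
        hence "D (g k) (x T) \<le> 3 * ?f + 3" using D_le[of "g k" "x T"] gV xV k by simp
        moreover have "D (x 0) (x T) \<le> D (x 0) (g k) + D (g k) (x T)" using xV gV k Y.dtri by simp
        ultimately show ?thesis using gk k unfolding n_def[symmetric] mono_const_def by simp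
      next
        case False
        have "D (g k) (g (Suc k)) \<le> 1" using Y.geoD[OF g(3), of k "Suc k"] k by simp
        then obtain C where C: "C \<in> CC" "g k \<in> C" "g (Suc k) \<in> C" using D1 False gV k by (meson Suc_leI less_imp_le_nat)
        obtain a where a: "a \<in> C" "d a (x T) \<le> chain_const \<Phi> (max ?f lip)"
          using coset_fill[OF x C j[of k] j[of "Suc k"], of T] k by auto
        have aV: "a \<in> V" using CC_mem_V C a by blast
        have "D (x 0) (x T) \<le> D (x 0) (g k) + D (g k) (x T)" "D (g k) (x T) \<le> D (g k) a + D a (x T)"
          using xV gV k Y.dtri aV by auto
        moreover have "D (g k) a \<le> 1" using CC_D C a by blast
        moreover have "D a (x T) \<le> chain_const \<Phi> (max ?f lip)" using D_le[OF aV xV, of T] a by simp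
        ultimately show ?thesis using gk k unfolding n_def[symmetric] mono_const_def by simp
      qed
    qed
  qed
qed

section \<open>Gromov products along a Morse sequence\<close>

lemma tripod:
  assumes "x \<in> V" "y \<in> V" "p \<in> V"
  obtains z where "z \<in> Y.Iv x y" "2 * D p z + D x y \<le> D p x + D p y + 2 * \<delta> + 2"
proof -
  \<comment> \<open>The distance from \<open>x\<close> to the internal point of the triangle
    \<open>x, y, p\<close> on the side from \<open>x\<close> to \<open>y\<close>, rounded down; the
    additive 2 in the bound leaves room for the rounding.\<close>
  define t where "t = (D x p + D x y - D p y) div 2"
  have tri: "D p y \<le> D x p + D x y" "D x p \<le> D x y + D p y"
    using Y.dtri[of p x y] Y.dtri[of x y p] assms Y.dsym by (auto simp: Y.dsym)
  hence t: "2 * t \<le> D x p + D x y - D p y" "D x p + D x y - D p y \<le> 2 * t + 1" unfolding t_def by linarith+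
  hence "t \<le> D x y" using tri by linarith
  then obtain z where z: "z \<in> Y.Iv x y" "D x z = t" "D z y = D x y - t" using Y.Iv_point assms by blast
  have zV: "z \<in> V" using z Y.Iv_D by blast
  have "D p z + D x y \<le> max (D p x + D z y) (D p y + D z x) + \<delta>"
    using hyp[of p z x y] assms zV by (simp add: Y.dsym)
  moreover have "D z x = t" "D p x = D x p" using z by (simp_all add: Y.dsym)
  ultimately have "D p z + D x y \<le> D x p + D x y - t + \<delta> \<or> D p z + D x y \<le> D p y + t + \<delta>"
    using z \<open>t \<le> D x y\<close> by (auto simp: max_def split: if_splits)
  hence "2 * D p z + D x y \<le> D p x + D p y + 2 * \<delta> + 2"
    using t tri \<open>t \<le> D x y\<close> \<open>D p x = D x p\<close> by linarith
  thus ?thesis using that z by blast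
qed

definition gromov_const :: "(nat \<Rightarrow> nat) \<Rightarrow> nat" where
  "gromov_const \<Phi> = 2 * path_const \<Phi> 0 + mono_const \<Phi> + \<delta> + 2"

text \<open>A geodesic from \<open>x s\<close> to \<open>x t\<close> stays near points
  \<open>x j\<close> with \<open>j\<close> not far below \<open>T\<close>, and by
  \<open>dmorse_mono\<close> these are at least as far from \<open>x 0\<close> as
  \<open>x T\<close>, up to a constant.\<close>

lemma dmorse_far:
  assumes x: "dmorse \<Phi> x" and T: "T \<le> s" "T \<le> t" and z: "z \<in> Y.Iv (x s) (x t)"
  shows "D (x 0) (x T) \<le> D (x 0) z + 2 * path_const \<Phi> 0 + mono_const \<Phi> + 1"
  using T z
proof (induction s t rule: linorder_wlog)
  case (sym s t) thus ?case using Y.Iv_sym by simp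
next
  case (le s t)
  note xV = dmorseV[OF x]
  have zV: "z \<in> V" and zD: "D (x s) z + D z (x t) = D (x s) (x t)" using le Y.Iv_D by auto
  obtain h where h: "Y.geo (D (x s) (x t)) h" "h 0 = x s" "h (D (x s) z) = z" "h (D (x s) (x t)) = x t"
    using Y.geo_through[OF xV xV le(4)] by blast
  obtain j where j: "d z (x j) \<le> path_const \<Phi> 0" "s \<le> j + path_const \<Phi> 0"
    using geo_near[OF x h(1), of s 0 t "D (x s) z"] h xV le zD by auto
  have z0: "D (x 0) (x j) \<le> D (x 0) z + path_const \<Phi> 0"
    using Y.dtri[of "x 0" z "x j"] D_le[of z "x j"] zV xV[of j] xV[of 0] j by simp
  show ?case
  proof (cases "T \<le> j")
    case True
    thus ?thesis using dmorse_mono[OF x True] z0 by simp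
  next
    case False
    hence "d (x j) (x T) \<le> path_const \<Phi> 0 + 1" using dmorse_dist(1)[OF x, of j T] j le by simp
    hence "D (x j) (x T) \<le> path_const \<Phi> 0 + 1" using D_le[OF xV xV, of j T] by simp
    thus ?thesis using Y.dtri[of "x 0" "x j" "x T"] xV z0 by simp
  qed
qed

lemma dmorse_gromov:
  assumes x: "dmorse \<Phi> x" and T: "T \<le> s" "T \<le> t"
  shows "2 * D (x 0) (x T) + D (x s) (x t) \<le> D (x 0) (x s) + D (x 0) (x t) + 4 * gromov_const \<Phi>"
proof -
  note xV = dmorseV[OF x]
  obtain z where z: "z \<in> Y.Iv (x s) (x t)" "2 * D (x 0) z + D (x s) (x t) \<le> D (x 0) (x s) + D (x 0) (x t) + 2 * \<delta> + 2"
    using tripod[OF xV xV xV] by blast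
  from dmorse_far[OF x T z(1)] z(2) show ?thesis unfolding gromov_const_def by simp
qed

section \<open>Sequences that do not diverge stay near one coset\<close>

lemma X_walk: "x \<in> V \<Longrightarrow> y \<in> V \<Longrightarrow> (x, y) \<in> asteps C ^^ d x y"
proof -
  assume V: "x \<in> V" "y \<in> V"
  obtain p where p: "p 0 = x" "p (d x y) = y" "X.geo (d x y) p" using X.geo_ex[OF V] by blast
  have "(p i, p (Suc i)) \<in> asteps C" if "i < d x y" for i
    using X.geoD[OF p(3), of i "Suc i"] X.geoV[OF p(3)] that by (simp add: asteps_def astep_def)
  thus ?thesis unfolding relpow_fun_conv using p by blast
qed

text \<open>If both cosets follow \<open>x\<close>, one can pass from \<open>C\<close> to
  \<open>C'\<close>, through the cone point of \<open>C'\<close>, and back to \<open>C\<close> in a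
  bounded number of steps avoiding the cone point of \<open>C\<close>. So the two points of
  \<open>C\<close> are close, although they lie near distant points of \<open>x\<close>.\<close>

lemma coset_unique:
  assumes x: "dmorse \<Phi> x" and C: "C \<in> CC" "C' \<in> CC"
    and near: "\<And>S. \<exists>s\<ge>S. \<exists>a\<in>C. \<exists>b\<in>C'. d a (x s) \<le> R \<and> d b (x s) \<le> R"
  shows "C = C'"
proof (rule ccontr)
  assume ne: "C \<noteq> C'"
  note xV = dmorseV[OF x]
  obtain s0 a0 b0 where 0: "a0 \<in> C" "b0 \<in> C'" "d a0 (x s0) \<le> R" "d b0 (x s0) \<le> R" using near by blast
  let ?m = "2 * (4 * R + 1) + 2"
  obtain s a b where s: "s0 + 2 * R + B ?m + 2 \<le> s" "a \<in> C" "b \<in> C'" "d a (x s) \<le> R" "d b (x s) \<le> R" using near by blast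
  have V: "a0 \<in> V" "b0 \<in> V" "a \<in> V" "b \<in> V" using 0 s CC_mem_V C by auto
  have "(b0, b) \<in> asteps C ^^ 1" using V 0 s ne C by (auto simp: asteps_def astep_def)
  hence w: "(a0, a) \<in> asteps C ^^ (d a0 b0 + 1 + d b a)"
    using X_walk[OF V(1,2), of C] X_walk[OF V(4,3), of C] unfolding relpow_add by blast
  have "d a0 b0 \<le> d a0 (x s0) + d (x s0) b0" "d b a \<le> d b (x s) + d (x s) a" using V xV X.dtri by auto
  hence "2 * (d a0 b0 + 1 + d b a) + 2 \<le> ?m" using 0 s by (simp add: X.dsym)
  hence "d a0 a \<le> B ?m" using angle[OF C(1) 0(1) s(2) w] by blast
  moreover have "d (x s0) (x s) \<le> d (x s0) a0 + d a0 (x s)" "d a0 (x s) \<le> d a0 a + d a (x s)" using V xV X.dtri by auto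
  moreover have "d (x s0) a0 \<le> R" using 0 by (simp add: X.dsym)
  moreover have "s \<le> s0 + d (x s0) (x s) + 1" using dmorse_dist(3)[OF x] by blast
  ultimately show False using s by linarith
qed

definition coset_const :: "(nat \<Rightarrow> nat) \<Rightarrow> nat" where "coset_const \<Phi> = chain_const \<Phi> (max (path_const \<Phi> 0) lip)"

text \<open>An argument in the style of Konig's lemma. Geodesics from \<open>x 0\<close> to
  infinitely many points \<open>x s\<close> at bounded distance branch infinitely at some first step
  \<open>k\<close>; infinite branching at an element \<open>y\<close> happens only inside a coset
  through \<open>y\<close>. The infinitely many branch points are near \<open>x\<close>, hence near
  arbitrarily late points of it, and \<open>coset_fill\<close> covers everything in between.\<close>

lemma dichotomy:
  assumes x: "dmorse \<Phi> x" and bd: "\<And>S. \<exists>s\<ge>S. D (x 0) (x s) < R"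
  obtains C S where "C \<in> CC" "\<And>s. S \<le> s \<Longrightarrow> \<exists>a\<in>C. d a (x s) \<le> coset_const \<Phi>"
proof -
  note xV = dmorseV[OF x]
  let ?f = "path_const \<Phi> 0"
  define S0 where "S0 = {s. D (x 0) (x s) < R}"
  have inf: "infinite S0" unfolding infinite_nat_iff_unbounded_le S0_def using bd by auto
  have "\<exists>g. g 0 = x 0 \<and> g (D (x 0) (x s)) = x s \<and> Y.geo (D (x 0) (x s)) g" for s using Y.geo_ex[OF xV xV] by metis
  then obtain g where g: "\<And>s. g s 0 = x 0" "\<And>s. g s (D (x 0) (x s)) = x s" "\<And>s. Y.geo (D (x 0) (x s)) (g s)" by metis
  \<comment> \<open>Each geodesic is prolonged by its end point, so that it has a
    \<open>k\<close>-th point for every \<open>k\<close>.\<close>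
  define h where "h k s = g s (min k (D (x 0) (x s)))" for k s
  have hV: "h k s \<in> V" for k s unfolding h_def using Y.geoV[OF g(3)] by simp
  have hn: "\<exists>j. d (h k s) (x j) \<le> ?f" for k s
    using geo_near[OF x g(3)[of s], of 0 0 s "min k (D (x 0) (x s))"] g(1,2)[of s] xV unfolding h_def by auto
  have hD: "D (h k s) (h (Suc k) s) \<le> 1" for k s
    using Y.geoD[OF g(3)[of s], of "min k (D (x 0) (x s))" "min (Suc k) (D (x 0) (x s))"] unfolding h_def by auto
  have balls: "finite {y \<in> V. d a y \<le> r}" if "a \<in> V" for a r using fin_ball[OF that] .
  have "infinite (h R ` S0)"
  proof
    assume fin: "finite (h R ` S0)"
    have hx: "h R s = x s" if "s \<in> S0" for s using g(2)[of s] that unfolding h_def S0_def by (simp add: min_absorb2)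
    obtain s0 where s0: "s0 \<in> S0" "infinite {s \<in> S0. h R s = h R s0}" using pigeonhole_infinite[OF inf fin] by blast
    then obtain s where s: "s0 + 2 \<le> s" "s \<in> S0" "h R s = h R s0"
      unfolding infinite_nat_iff_unbounded_le by auto
    hence "x s = x s0" using hx s0 by simp
    thus False using dmorse_dist(3)[OF x, of s s0] s xV by simp
  qed
  moreover define k where "k = (LEAST k. infinite (h k ` S0))"
  ultimately have k: "infinite (h k ` S0)" by (metis LeastI)
  have k0: "k \<noteq> 0"
  proof
    assume "k = 0"
    hence "h k ` S0 \<subseteq> {x 0}" using g(1) by (auto simp: h_def)
    thus False using k finite_subset by blast
  qed
  hence kf: "finite (h (k - 1) ` S0)" using not_less_Least[of "k - 1" "\<lambda>k. infinite (h k ` S0)"] unfolding k_def by simp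
  define W where "W y = h k ` {s \<in> S0. h (k - 1) s = y}" for y
  have "h k ` S0 = (\<Union>y\<in>h (k - 1) ` S0. W y)" unfolding W_def by auto
  hence "\<exists>y\<in>h (k - 1) ` S0. infinite (W y)" using k finite_UN_I[OF kf, of W] by fastforce
  then obtain y where y: "y \<in> h (k - 1) ` S0" "infinite (W y)" by blast
  have yV: "y \<in> V" using y hV by auto
  \<comment> \<open>Only finitely many elements are adjacent to \<open>y\<close> in the Cayley graph
    and only finitely many cosets contain \<open>y\<close>.\<close>
  have "W y \<subseteq> {v \<in> V. d y v \<le> 1} \<union> (\<Union>C\<in>{C \<in> CC. y \<in> C}. W y \<inter> C)"
  proof
    fix v assume v: "v \<in> W y"
    then obtain s where s: "v = h k s" "h (k - 1) s = y" unfolding W_def by auto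
    have "D y v \<le> 1" using hD[of "k - 1" s] s k0 by simp
    thus "v \<in> {v \<in> V. d y v \<le> 1} \<union> (\<Union>C\<in>{C \<in> CC. y \<in> C}. W y \<inter> C)"
      using D1[OF yV, of v] hV s v by auto
  qed
  hence "infinite (\<Union>C\<in>{C \<in> CC. y \<in> C}. W y \<inter> C)"
    using y(2) balls[OF yV, of 1] by (metis (no_types, lifting) finite_UnI finite_subset)
  hence "\<exists>C\<in>{C \<in> CC. y \<in> C}. infinite (W y \<inter> C)"
    using finite_UN_I[OF fin_CC[OF yV], of "\<lambda>C. W y \<inter> C"] by blast
  then obtain C where C: "C \<in> CC" "infinite (W y \<inter> C)" by blast
  define Z where "Z = W y \<inter> C"
  have Zn: "\<exists>j. d z (x j) \<le> ?f" if "z \<in> Z" for z using that hn unfolding Z_def W_def by auto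
  have far: "\<exists>z\<in>Z. \<exists>j\<ge>T. d z (x j) \<le> ?f" for T
  proof (rule ccontr)
    assume no: "\<not> (\<exists>z\<in>Z. \<exists>j\<ge>T. d z (x j) \<le> ?f)"
    have "Z \<subseteq> (\<Union>j<T. {v \<in> V. d (x j) v \<le> ?f})"
    proof
      fix z assume z: "z \<in> Z"
      then obtain j where j: "d z (x j) \<le> ?f" using Zn by blast
      hence "j < T" using no z by (meson not_le)
      moreover have "z \<in> V" using z CC_mem_V C unfolding Z_def by blast
      ultimately show "z \<in> (\<Union>j<T. {v \<in> V. d (x j) v \<le> ?f})" using j by (auto simp: X.dsym)
    qed
    moreover have "finite (\<Union>j<T. {v \<in> V. d (x j) v \<le> ?f})" using balls[OF xV] by simp
    ultimately show False using C(2) finite_subset unfolding Z_def by blast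
  qed
  obtain z0 S where z0: "z0 \<in> Z" "d z0 (x S) \<le> ?f" using far[of 0] by blast
  have "\<exists>a\<in>C. d a (x s) \<le> coset_const \<Phi>" if "S \<le> s" for s
  proof -
    obtain z j where z: "z \<in> Z" "s \<le> j" "d z (x j) \<le> ?f" using far by blast
    thus ?thesis using coset_fill[OF x C(1), of z0 z S ?f j s] z0 that unfolding Z_def coset_const_def by blast
  qed
  thus ?thesis using that C(1) by blast
qed

end

section \<open>Limits of Morse sequences\<close>

context cone_graph begin

section \<open>Word-metric closeness of fellow-travelling geodesics\<close>

lemma geo_walk:
  assumes "Y.geo n g"
  obtains W where "finite W" "card W \<le> 2 * n + 1" "(Inl (g 0), Inl (g n)) \<in> (adj_on W)\<^sup>*" "Inl (g 0) \<in> W"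
    "W \<subseteq> Inl ` g ` {..n} \<union> {Inr C | C i. C \<in> CC \<and> i < n \<and> g i \<in> C \<and> g (Suc i) \<in> C}"
proof -
  have gV: "g i \<in> V" if "i \<le> n" for i using Y.geoV[OF assms that] .
  have "\<exists>W. finite W \<and> card W \<le> 2 * n + 1 \<and> (Inl (g 0), Inl (g n)) \<in> (adj_on W)\<^sup>* \<and> Inl (g 0) \<in> W \<and>
    W \<subseteq> Inl ` g ` {..n} \<union> {Inr C | C i. C \<in> CC \<and> True \<and> i < n \<and> g i \<in> C \<and> g (Suc i) \<in> C \<and> g i \<noteq> g (Suc i)}"
  proof (rule walk_set)
    fix i assume i: "i < n"
    hence "D (g i) (g (Suc i)) \<le> 1" using Y.geoD[OF assms, of i "Suc i"] by simp
    thus "d (g i) (g (Suc i)) \<le> 1 \<or> (\<exists>C\<in>CC. True \<and> g i \<in> C \<and> g (Suc i) \<in> C)"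
      using D1[of "g i" "g (Suc i)"] gV i by auto
  qed (use gV in auto)
  then obtain W where W: "finite W" "card W \<le> 2 * n + 1" "(Inl (g 0), Inl (g n)) \<in> (adj_on W)\<^sup>*" "Inl (g 0) \<in> W"
    "W \<subseteq> Inl ` g ` {..n} \<union> {Inr C | C i. C \<in> CC \<and> True \<and> i < n \<and> g i \<in> C \<and> g (Suc i) \<in> C \<and> g i \<noteq> g (Suc i)}"
    by blast
  show ?thesis by (rule that[OF W(1-4)]) (use W(5) in blast)
qed

text \<open>One side of the circuit in \<open>fellow_close\<close>: back along \<open>c\<close> from
  \<open>c l\<close> to \<open>c k\<close>, then across to \<open>z\<close>. The last two clauses
  locate all vertices so precisely that two such sides can be shown to be disjoint.\<close>

lemma side_walk:
  assumes c: "Y.geo n c" and kl: "k \<le> l" "l \<le> n" and z: "z \<in> V" "D (c k) z \<le> \<eta>"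
  obtains W where "finite W" "card W \<le> 2 * (l - k) + 2 * \<eta> + 2" "(Inl (c l), Inl z) \<in> (adj_on W)\<^sup>*" "Inl (c l) \<in> W"
    "\<forall>y. Inl y \<in> W \<longrightarrow> y \<in> V \<and> ((\<exists>m. k \<le> m \<and> m \<le> l \<and> y = c m) \<or> D (c k) y \<le> \<eta>)"
    "\<forall>C. Inr C \<in> W \<longrightarrow> C \<in> CC \<and> ((\<exists>m. k \<le> m \<and> m < l \<and> c m \<in> C \<and> c (Suc m) \<in> C) \<or> (1 \<le> \<eta> \<and> (\<exists>y\<in>C. D (c k) y \<le> \<eta>)))"
proof -
  have cV: "c i \<in> V" if "i \<le> n" for i using Y.geoV[OF c that] .
  have kV: "c k \<in> V" using cV kl by simp
  have g1: "Y.geo (l - k) (\<lambda>i. c (k + i))" using c by (rule Y.geo_sub) (use kl in auto)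
  obtain W1 where W1: "finite W1" "card W1 \<le> 2 * (l - k) + 1" "(Inl (c k), Inl (c l)) \<in> (adj_on W1)\<^sup>*" "Inl (c k) \<in> W1"
    "W1 \<subseteq> Inl ` (\<lambda>i. c (k + i)) ` {..l - k} \<union> {Inr C | C i. C \<in> CC \<and> i < l - k \<and> c (k + i) \<in> C \<and> c (k + Suc i) \<in> C}"
    by (rule geo_walk[OF g1]) (use kl in simp)
  obtain e where e: "e 0 = c k" "e (D (c k) z) = z" "Y.geo (D (c k) z) e" using Y.geo_ex[OF kV z(1)] by blast
  obtain W2 where W2: "finite W2" "card W2 \<le> 2 * D (c k) z + 1" "(Inl (c k), Inl z) \<in> (adj_on W2)\<^sup>*" "Inl (c k) \<in> W2"
    "W2 \<subseteq> Inl ` e ` {..D (c k) z} \<union> {Inr C | C i. C \<in> CC \<and> i < D (c k) z \<and> e i \<in> C \<and> e (Suc i) \<in> C}"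
    by (rule geo_walk[OF e(3)]) (use e in simp)
  have eD: "D (c k) (e i) = i" if "i \<le> D (c k) z" for i using Y.geoD[OF e(3), of 0 i] e that by simp
  have eV: "e i \<in> V" if "i \<le> D (c k) z" for i using Y.geoV[OF e(3) that] .
  show ?thesis
  proof (rule that[of "W1 \<union> W2"])
    show "finite (W1 \<union> W2)" using W1 W2 by simp
    show "card (W1 \<union> W2) \<le> 2 * (l - k) + 2 * \<eta> + 2" using card_Un_le[of W1 W2] W1(2) W2(2) z by simp
    have "(Inl (c l), Inl (c k)) \<in> (adj_on (W1 \<union> W2))\<^sup>*"
      using adj_on_rtrancl_sym[OF W1(3)] by (rule adj_on_rtrancl_mono[rotated]) simp
    also have "(Inl (c k), Inl z) \<in> (adj_on (W1 \<union> W2))\<^sup>*"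
      using W2(3) by (rule adj_on_rtrancl_mono[rotated]) simp
    finally show "(Inl (c l), Inl z) \<in> (adj_on (W1 \<union> W2))\<^sup>*" .
    have "Inl (c l) \<in> W1" using W1(3,4) by (cases rule: rtranclE) (auto simp: adj_on_def)
    thus "Inl (c l) \<in> W1 \<union> W2" by simp
    have "y \<in> V \<and> ((\<exists>m. k \<le> m \<and> m \<le> l \<and> y = c m) \<or> D (c k) y \<le> \<eta>)" if y: "Inl y \<in> W1 \<union> W2" for y
    proof (cases "Inl y \<in> W1")
      case True
      then obtain i where "i \<le> l - k" "y = c (k + i)" using W1(5) by auto
      thus ?thesis using kl cV by (intro conjI disjI1 exI[of _ "k + i"]) auto
    next
      case False
      then obtain i where "i \<le> D (c k) z" "y = e i" using W2(5) y by auto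
      thus ?thesis using eV eD z by auto
    qed
    thus "\<forall>y. Inl y \<in> W1 \<union> W2 \<longrightarrow> y \<in> V \<and> ((\<exists>m. k \<le> m \<and> m \<le> l \<and> y = c m) \<or> D (c k) y \<le> \<eta>)" by blast
    have "C \<in> CC \<and> ((\<exists>m. k \<le> m \<and> m < l \<and> c m \<in> C \<and> c (Suc m) \<in> C) \<or> (1 \<le> \<eta> \<and> (\<exists>y\<in>C. D (c k) y \<le> \<eta>)))"
      if C: "Inr C \<in> W1 \<union> W2" for C
    proof (cases "Inr C \<in> W1")
      case True
      then obtain i where "C \<in> CC" "i < l - k" "c (k + i) \<in> C" "c (k + Suc i) \<in> C" using W1(5) by auto
      thus ?thesis using kl by (intro conjI disjI1 exI[of _ "k + i"]) auto
    next
      case False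
      then obtain i where "C \<in> CC" "i < D (c k) z" "e i \<in> C" using W2(5) C by auto
      thus ?thesis using eD[of i] z by (intro conjI disjI2 bexI[of _ "e i"]) auto
    qed
    thus "\<forall>C. Inr C \<in> W1 \<union> W2 \<longrightarrow> C \<in> CC \<and> ((\<exists>m. k \<le> m \<and> m < l \<and> c m \<in> C \<and> c (Suc m) \<in> C) \<or> (1 \<le> \<eta> \<and> (\<exists>y\<in>C. D (c k) y \<le> \<eta>)))"
      by blast
  qed
qed

text \<open>The two sides of the edge of \<open>c\<close> from \<open>c k\<close> to \<open>c (Suc k)\<close> are joined by a detour along \<open>c'\<close>.
  This closes the edge to a circuit of bounded length, and fineness bounds its diameter.\<close>

lemma fellow_close:
  assumes c: "Y.geo n c" and c': "Y.geo n' c'" and k: "k1 \<le> k" "Suc k \<le> k2" "k2 \<le> n"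
    and ij: "i \<le> n'" "j \<le> n'" and near: "D (c k1) (c' i) \<le> \<eta>1" "D (c k2) (c' j) \<le> \<eta>2"
    and room: "\<eta>1 = 0 \<or> k1 + \<eta>1 + 2 \<le> k" "\<eta>2 = 0 \<or> k + \<eta>2 + 3 \<le> k2"
    and N: "4 * (k2 - k1) + 4 * \<eta>1 + 4 * \<eta>2 + 10 \<le> N"
  shows "\<exists>l\<le>n'. d (c k) (c' l) \<le> B N"
proof -
  have cV: "c i \<in> V" if "i \<le> n" for i using Y.geoV[OF c that] .
  have c'V: "c' i \<in> V" if "i \<le> n'" for i using Y.geoV[OF c' that] .
  have cD: "D (c i) (c j) = j - i" if "i \<le> j" "j \<le> n" for i j using Y.geoD[OF c that] .
  have kn: "k \<le> n" using k by simp
  obtain L where L: "finite L" "card L \<le> 2 * (k - k1) + 2 * \<eta>1 + 2" "(Inl (c k), Inl (c' i)) \<in> (adj_on L)\<^sup>*" "Inl (c k) \<in> L"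
    "\<forall>y. Inl y \<in> L \<longrightarrow> y \<in> V \<and> ((\<exists>m. k1 \<le> m \<and> m \<le> k \<and> y = c m) \<or> D (c k1) y \<le> \<eta>1)"
    "\<forall>C. Inr C \<in> L \<longrightarrow> C \<in> CC \<and> ((\<exists>m. k1 \<le> m \<and> m < k \<and> c m \<in> C \<and> c (Suc m) \<in> C) \<or> (1 \<le> \<eta>1 \<and> (\<exists>y\<in>C. D (c k1) y \<le> \<eta>1)))"
    by (rule side_walk[OF c k(1) kn c'V[OF ij(1)] near(1)])
  \<comment> \<open>The far side is the same construction for \<open>c\<close> read
    backwards.\<close>
  have rev: "Y.geo n (\<lambda>i. c (n - i))" using Y.geo_rev[OF c] .
  have nR: "D (c (n - (n - k2))) (c' j) \<le> \<eta>2" using near k by simp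
  have aR: "n - k2 \<le> n - Suc k" "n - Suc k \<le> n" using k by auto
  obtain R0 where R0: "finite R0" "card R0 \<le> 2 * ((n - Suc k) - (n - k2)) + 2 * \<eta>2 + 2"
    "(Inl (c (n - (n - Suc k))), Inl (c' j)) \<in> (adj_on R0)\<^sup>*" "Inl (c (n - (n - Suc k))) \<in> R0"
    "\<forall>y. Inl y \<in> R0 \<longrightarrow> y \<in> V \<and> ((\<exists>m. n - k2 \<le> m \<and> m \<le> n - Suc k \<and> y = c (n - m)) \<or> D (c (n - (n - k2))) y \<le> \<eta>2)"
    "\<forall>C. Inr C \<in> R0 \<longrightarrow> C \<in> CC \<and> ((\<exists>m. n - k2 \<le> m \<and> m < n - Suc k \<and> c (n - m) \<in> C \<and> c (n - Suc m) \<in> C) \<or>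
        (1 \<le> \<eta>2 \<and> (\<exists>y\<in>C. D (c (n - (n - k2))) y \<le> \<eta>2)))"
    by (rule side_walk[OF rev aR c'V[OF ij(2)] nR])
  have nn: "n - (n - k2) = k2" "n - (n - Suc k) = Suc k" using k by auto
  note R0' = R0[unfolded nn]
  have R0v: "y \<in> V \<and> ((\<exists>m. Suc k \<le> m \<and> m \<le> k2 \<and> y = c m) \<or> D (c k2) y \<le> \<eta>2)" if "Inl y \<in> R0" for y
  proof -
    have "(\<exists>m. Suc k \<le> m \<and> m \<le> k2 \<and> y = c m)" if "n - k2 \<le> m" "m \<le> n - Suc k" "y = c (n - m)" for m
      using that k by (intro exI[of _ "n - m"]) auto
    thus ?thesis using R0'(5) that by blast
  qed
  have R0c: "C \<in> CC \<and> ((\<exists>m. k \<le> m \<and> m < k2 \<and> c m \<in> C \<and> c (Suc m) \<in> C) \<or> (1 \<le> \<eta>2 \<and> (\<exists>y\<in>C. D (c k2) y \<le> \<eta>2)))"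
    if "Inr C \<in> R0" for C
  proof -
    have "(\<exists>m. k \<le> m \<and> m < k2 \<and> c m \<in> C \<and> c (Suc m) \<in> C)"
      if m: "n - k2 \<le> m" "m < n - Suc k" "c (n - m) \<in> C" "c (n - Suc m) \<in> C" for m
    proof (intro exI[of _ "n - Suc m"] conjI)
      have "Suc (n - Suc m) = n - m" using m by simp
      thus "c (Suc (n - Suc m)) \<in> C" using m by simp
    qed (use m k in auto)
    thus ?thesis using R0'(6) that by blast
  qed
  \<comment> \<open>The detour along \<open>c'\<close> may run in either direction.\<close>
  define lo where "lo = min i j"
  define hi where "hi = max i j"
  have lh: "lo \<le> hi" "hi \<le> n'" using ij by (auto simp: lo_def hi_def)
  have g': "Y.geo (hi - lo) (\<lambda>m. c' (lo + m))" using c' by (rule Y.geo_sub) (use lh in auto)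
  obtain M where M: "finite M" "card M \<le> 2 * (hi - lo) + 1" "(Inl (c' lo), Inl (c' hi)) \<in> (adj_on M)\<^sup>*"
    "M \<subseteq> Inl ` (\<lambda>m. c' (lo + m)) ` {..hi - lo} \<union> {Inr C | C m. C \<in> CC \<and> m < hi - lo \<and> c' (lo + m) \<in> C \<and> c' (lo + Suc m) \<in> C}"
    by (rule geo_walk[OF g']) (use lh in simp)
  have Mconn: "(Inl (c' i), Inl (c' j)) \<in> (adj_on M)\<^sup>*"
    using M(3) adj_on_rtrancl_sym[OF M(3)] unfolding lo_def hi_def by (cases "i \<le> j") (auto simp: min_def max_def)
  have Mv: "\<exists>l\<le>n'. y = c' l" if yM: "Inl y \<in> M" for y
  proof -
    obtain m where "m \<le> hi - lo" "y = c' (lo + m)" using M(4) yM by auto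
    thus ?thesis using lh by (intro exI[of _ "lo + m"]) auto
  qed
  have "hi - lo = D (c' lo) (c' hi)" using Y.geoD[OF c' lh] by simp
  also have "\<dots> = D (c' i) (c' j)" unfolding lo_def hi_def by (cases "i \<le> j") (auto simp: min_def max_def Y.dsym)
  also have "\<dots> \<le> D (c' i) (c k1) + (D (c k1) (c k2) + D (c k2) (c' j))"
    using Y.dtri[of "c' i" "c k1" "c' j"] Y.dtri[of "c k1" "c k2" "c' j"] cV c'V ij k by fastforce
  also have "\<dots> \<le> \<eta>1 + ((k2 - k1) + \<eta>2)" using near cD[of k1 k2] k Y.dsym[of "c' i" "c k1"] by simp
  finally have hilo: "hi - lo \<le> \<eta>1 + \<eta>2 + (k2 - k1)" by simp
  have step: "D (c k) (c (Suc k)) \<le> 1" using cD[of k "Suc k"] k by simp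
  \<comment> \<open>\<open>R\<close> is the far side, enlarged by a cone point if \<open>c k\<close>
    and \<open>c (Suc k)\<close> are joined only through a coset; \<open>q\<close> is the far end of
    the edge to be bypassed.\<close>
  have key: "\<exists>l\<le>n'. d (c k) (c' l) \<le> B N"
    if R: "finite R" "card R \<le> card R0 + 1" "R0 \<subseteq> R" "q \<in> R" "(Inl (c (Suc k)), q) \<in> (adj_on R)\<^sup>*" "L \<inter> R = {}" "adj (Inl (c k)) q"
    for R q
  proof (cases "Inl (c k) \<in> M \<and> q \<in> M")
    case True
    then obtain l where "l \<le> n'" "c k = c' l" using Mv by blast
    thus ?thesis using c'V by (intro exI[of _ l]) simp
  next
    case False
    have "card (L \<union> M \<union> R) \<le> card L + card M + card R"
      by (meson card_Un_le le_trans add_le_mono1)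
    also have "\<dots> \<le> N" using L(2) M(2) R0(2) R(2) hilo N k by linarith
    finally have cd: "card (L \<union> M \<union> R) \<le> N" .
    have "(Inl (c' j), Inl (c (Suc k))) \<in> (adj_on R)\<^sup>*"
      using adj_on_rtrancl_sym[OF R0'(3)] by (rule adj_on_rtrancl_mono[OF R(3)])
    hence conn: "(Inl (c' j), q) \<in> (adj_on R)\<^sup>*" using R(5) by (rule rtrancl_trans)
    obtain v v' where v: "v \<in> M" "v' \<in> M" "adj v v'"
      "\<And>x y. Inl x \<in> {v, v', Inl (c k), q} \<Longrightarrow> Inl y \<in> {v, v', Inl (c k), q} \<Longrightarrow> d x y \<le> B N"
      using edge_in_middle[OF L(1) M(1) R(1) cd L(4) R(4,6,7) False L(3) Mconn conn] by blast
    obtain y where y: "Inl y \<in> {v, v'}" using v(3) by (cases v; cases v') auto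
    hence "Inl y \<in> M" using v(1,2) by auto
    then obtain l where "l \<le> n'" "y = c' l" using Mv by blast
    thus ?thesis using v(4)[of "c k" y] y by auto
  qed
  \<comment> \<open>The assumption \<open>room\<close> keeps the crossing parts, of length at most
    \<eta>1 and \<eta>2, away from the opposite side.\<close>
  have disj_v: "False" if a: "Inl y \<in> L" and b: "Inl y \<in> R0" for y
  proof -
    have yV: "y \<in> V" using L(5)[rule_format, OF a] by blast
    consider m m' where "k1 \<le> m" "m \<le> k" "y = c m" "Suc k \<le> m'" "m' \<le> k2" "y = c m'"
      | m where "k1 \<le> m" "m \<le> k" "y = c m" "D (c k2) y \<le> \<eta>2"
      | m where "D (c k1) y \<le> \<eta>1" "Suc k \<le> m" "m \<le> k2" "y = c m"
      | "D (c k1) y \<le> \<eta>1" "D (c k2) y \<le> \<eta>2"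
      using L(5)[rule_format, OF a] R0v[OF b] by blast
    thus False
    proof cases
      case 1 thus False using cD[of m m'] cV k by auto
    next
      case 2 thus False using cD[of m k2] k room Y.dsym[of y "c k2"] by auto
    next
      case 3 thus False using cD[of k1 m] k room by auto
    next
      case 4
      have "D (c k1) (c k2) \<le> D (c k1) y + D y (c k2)" using yV cV k by (intro Y.dtri) auto
      thus False using 4 cD[of k1 k2] k room Y.dsym[of y "c k2"] by auto
    qed
  qed
  have disj_c: "False" if a: "Inr C \<in> L"
    and b: "(\<exists>m. k \<le> m \<and> m < k2 \<and> c m \<in> C \<and> c (Suc m) \<in> C) \<or> (1 \<le> \<eta>2 \<and> (\<exists>y\<in>C. D (c k2) y \<le> \<eta>2))" for C
  proof -
    have C: "C \<in> CC" using L(6)[rule_format, OF a] by blast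
    consider m m' where "k1 \<le> m" "m < k" "c m \<in> C" "k \<le> m'" "m' < k2" "c (Suc m') \<in> C"
      | m y where "k1 \<le> m" "m < k" "c m \<in> C" "1 \<le> \<eta>2" "y \<in> C" "D (c k2) y \<le> \<eta>2"
      | m y where "1 \<le> \<eta>1" "y \<in> C" "D (c k1) y \<le> \<eta>1" "k \<le> m" "m < k2" "c m \<in> C"
      | y y' where "1 \<le> \<eta>1" "y \<in> C" "D (c k1) y \<le> \<eta>1" "1 \<le> \<eta>2" "y' \<in> C" "D (c k2) y' \<le> \<eta>2"
      using L(6)[rule_format, OF a] b by blast
    thus False
    proof cases
      case 1 thus False using CC_D[OF C 1(3,6)] cD[of m "Suc m'"] k by auto
    next
      case 2
      have "D (c m) (c k2) \<le> D (c m) y + D y (c k2)" using CC_mem_V[OF C 2(5)] cV 2 k by (intro Y.dtri) auto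
      thus False using CC_D[OF C 2(3,5)] cD[of m k2] 2 k room Y.dsym[of y "c k2"] by auto
    next
      case 3
      have "D (c k1) (c m) \<le> D (c k1) y + D y (c m)" using CC_mem_V[OF C 3(2)] cV 3 k by (intro Y.dtri) auto
      thus False using CC_D[OF C 3(2,6)] cD[of k1 m] 3 k room by auto
    next
      case 4
      have "D (c k1) (c k2) \<le> D (c k1) y + D y (c k2)" "D y (c k2) \<le> D y y' + D y' (c k2)"
        using CC_mem_V[OF C 4(2)] CC_mem_V[OF C 4(5)] cV k by (auto intro!: Y.dtri)
      thus False using CC_D[OF C 4(2,5)] cD[of k1 k2] 4 k room Y.dsym[of y' "c k2"] by auto
    qed
  qed
  have LR0: "L \<inter> R0 = {}"
  proof (rule ccontr)
    assume "L \<inter> R0 \<noteq> {}"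
    then obtain v where v: "v \<in> L" "v \<in> R0" by blast
    show False
    proof (cases v)
      case (Inl y) thus False using disj_v[of y] v by simp
    next
      case (Inr C)
      hence "Inr C \<in> L" "Inr C \<in> R0" using v by auto
      thus False using disj_c[OF _ conjunct2[OF R0c]] by blast
    qed
  qed
  show ?thesis
  proof (cases "d (c k) (c (Suc k)) \<le> 1")
    case True
    have "c k \<noteq> c (Suc k)" using cD[of k "Suc k"] cV k by fastforce
    hence "d (c k) (c (Suc k)) = 1" using True X.d0[of "c k" "c (Suc k)"] cV k by simp
    hence "adj (Inl (c k)) (Inl (c (Suc k)))" using cV k by simp
    thus ?thesis using key[OF R0(1) _ _ R0'(4) _ LR0] by simp
  next
    case False
    then obtain C where C: "C \<in> CC" "c k \<in> C" "c (Suc k) \<in> C" using D1[OF _ _ step] cV k by auto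
    have "(\<exists>m. k \<le> m \<and> m < k2 \<and> c m \<in> C \<and> c (Suc m) \<in> C)" using C k by (intro exI[of _ k]) simp
    hence "Inr C \<notin> L" using disj_c[of C] by blast
    moreover have "(Inl (c (Suc k)), Inr C) \<in> adj_on (insert (Inr C) R0)" using C R0'(4) by (simp add: adj_on_def)
    ultimately show ?thesis
      using key[of "insert (Inr C) R0" "Inr C"] R0(1) LR0 C(1,2) by (simp add: card_insert_if insert_absorb subset_insertI r_into_rtrancl)
  qed
qed

end

text \<open>A diagonal argument with nested infinite index sets. Instead of a subsequence it returns
  agreement with \<open>f\<close> on any finite set of coordinates at arbitrarily large indices,
  which is the form in which geodesics pass to the limit.\<close>

lemma diagonal_choice:
  fixes c :: "nat \<Rightarrow> 'i::countable \<Rightarrow> 'a"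
  assumes fin: "\<And>i. \<exists>S F. finite F \<and> (\<forall>m\<ge>S. c m i \<in> F)"
  obtains f where "\<And>A T. finite A \<Longrightarrow> \<exists>m\<ge>T. \<forall>i\<in>A. c m i = f i"
proof -
  define Q where "Q n M M' \<longleftrightarrow> M' \<subseteq> M \<and> infinite M' \<and> (\<exists>v. \<forall>m\<in>M'. c m (from_nat n :: 'i) = v)"
    for n and M M' :: "nat set"
  have step: "\<exists>M'. Q n M M'" if "infinite M" for n M
  proof -
    obtain S F where F: "finite F" "\<And>m. S \<le> m \<Longrightarrow> c m (from_nat n) \<in> F" using fin by blast
    have inf: "infinite (M - {..<S})" using that by simp
    have "(\<lambda>m. c m (from_nat n)) ` (M - {..<S}) \<subseteq> F" by (auto intro!: F(2) simp: not_less)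
    hence "finite ((\<lambda>m. c m (from_nat n)) ` (M - {..<S}))" using F(1) by (rule finite_subset)
    then obtain m0 where "infinite {m \<in> M - {..<S}. c m (from_nat n) = c m0 (from_nat n)}"
      using pigeonhole_infinite[OF inf] by blast
    thus ?thesis unfolding Q_def
      by (intro exI[of _ "{m \<in> M - {..<S}. c m (from_nat n) = c m0 (from_nat n)}"]) auto
  qed
  define M where "M = rec_nat (UNIV :: nat set) (\<lambda>n M. SOME M'. Q n M M')"
  have M: "infinite (M n) \<and> Q n (M n) (M (Suc n))" for n
  proof (induction n)
    case 0
    have "infinite (M 0)" by (simp add: M_def)
    thus ?case using someI_ex[OF step, of "M 0" 0] by (simp add: M_def)
  next
    case (Suc n)
    hence "infinite (M (Suc n))" by (simp add: Q_def)
    thus ?case using someI_ex[OF step, of "M (Suc n)" "Suc n"] by (simp add: M_def)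
  qed
  have anti: "M n \<subseteq> M k" if "k \<le> n" for k n
    using that by (induction n rule: dec_induct) (use M in \<open>auto simp: Q_def\<close>)
  define f where "f i = (SOME v. \<forall>m\<in>M (Suc (to_nat i)). c m i = v)" for i
  have f: "c m i = f i" if m: "m \<in> M (Suc (to_nat i))" for m i
  proof -
    have "\<exists>v. \<forall>m\<in>M (Suc (to_nat i)). c m i = v" using M[of "to_nat i"] by (simp add: Q_def)
    from someI_ex[OF this] show ?thesis using m unfolding f_def by blast
  qed
  have "\<exists>m\<ge>T. \<forall>i\<in>A. c m i = f i" if A: "finite A" for A T
  proof -
    obtain n where n: "\<And>i. i \<in> A \<Longrightarrow> to_nat i < n"
      using A finite_nat_set_iff_bounded[of "to_nat ` A"] by auto
    obtain m where m: "T \<le> m" "m \<in> M n" using M[of n] by (metis infinite_nat_iff_unbounded_le)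
    have "c m i = f i" if "i \<in> A" for i using f anti[of "Suc (to_nat i)" n] n[OF that] m by auto
    thus ?thesis using m by blast
  qed
  thus ?thesis using that by blast
qed

section \<open>Gromov products and points near geodesics\<close>

context cone_graph begin

text \<open>Twice the Gromov product, which is an integer.\<close>

definition gp2 :: "'a \<Rightarrow> 'a \<Rightarrow> 'a \<Rightarrow> int" where
  "gp2 p x y = int (D p x) + int (D p y) - int (D x y)"

lemma gp2_sym: "gp2 p x y = gp2 p y x"
  by (simp add: gp2_def Y.dsym)

lemma gp2_le: "p \<in> V \<Longrightarrow> x \<in> V \<Longrightarrow> y \<in> V \<Longrightarrow> gp2 p x y \<le> 2 * int (D p x)"
  using Y.dtri[of p x y] by (simp add: gp2_def)

lemma gp2_hyp:
  assumes "p \<in> V" "x \<in> V" "y \<in> V" "z \<in> V"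
  shows "min (gp2 p x y) (gp2 p y z) - int \<delta> \<le> gp2 p x z"
proof -
  have "D x z + D p y \<le> max (D x p + D z y) (D x y + D z p) + \<delta>" using hyp[of x z p y] assms by simp
  thus ?thesis unfolding gp2_def using Y.dsym[of z y] Y.dsym[of x p] Y.dsym[of z p] by linarith
qed

lemma gp2_lip:
  assumes "p \<in> V" "x \<in> V" "y \<in> V" "z \<in> V"
  shows "gp2 p y z - 2 * int (D x y) \<le> gp2 p x z"
  using Y.dtri[of p x y] Y.dtri[of x y z] assms unfolding gp2_def by linarith

lemma gp2_base:
  assumes "p \<in> V" "q \<in> V" "x \<in> V" "y \<in> V"
  shows "gp2 p x y - 2 * int (D p q) \<le> gp2 q x y"
  using Y.dtri[of p q x] Y.dtri[of p q y] assms unfolding gp2_def by linarith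

lemma gp2_Iv:
  assumes "p \<in> V" "x \<in> V" "y \<in> V" "z \<in> Y.Iv x y"
  shows "gp2 p x y \<le> 2 * int (D p z)"
  using Y.dtri[of p z x] Y.dtri[of p z y] Y.Iv_D[OF assms(4)] assms Y.dsym[of x z] unfolding gp2_def by linarith

lemma gp2_Iv0: "z \<in> Y.Iv x y \<Longrightarrow> gp2 z x y = 0"
  using Y.Iv_D[of z x y] Y.dsym[of x z] by (simp add: gp2_def)

text \<open>Geodesics from \<open>p\<close> to \<open>x\<close> and from \<open>p\<close> to
  \<open>y\<close> separate only at about the distance given by the Gromov product; a point
  \<open>z\<close> before that is almost between \<open>p\<close> and \<open>y\<close> as
  well.\<close>

lemma shadow:
  assumes "p \<in> V" "x \<in> V" "y \<in> V" "z \<in> Y.Iv p x" "2 * int (D p z) \<le> gp2 p x y"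
  shows "D p z + D z y \<le> D p y + \<delta>"
proof -
  have z: "z \<in> V" "D p z + D z x = D p x" using assms Y.Iv_D by auto
  have "D z y + D p x \<le> max (D z p + D y x) (D z x + D y p) + \<delta>" using hyp[of z y p x] assms z by simp
  thus ?thesis using assms(5) z unfolding gp2_def
    using Y.dsym[of z p] Y.dsym[of y x] Y.dsym[of y p] by linarith
qed

lemma near_geo:
  assumes g: "Y.geo n g" and z: "z \<in> V" "D (g 0) z + D z (g n) \<le> n + \<kappa>"
  obtains i where "i \<le> n" "D z (g i) \<le> \<kappa> + \<delta>"
proof (cases "D (g 0) z \<le> n")
  case True
  let ?t = "D (g 0) z"
  have V: "g 0 \<in> V" "g n \<in> V" "g ?t \<in> V" using Y.geoV[OF g] True by auto
  have "D (g 0) (g n) = n" "D (g 0) (g ?t) = ?t" "D (g ?t) (g n) = n - ?t" using Y.geoD[OF g] True by auto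
  moreover have "D (g 0) (g n) + D z (g ?t) \<le> max (D (g 0) z + D (g n) (g ?t)) (D (g 0) (g ?t) + D (g n) z) + \<delta>"
    using hyp[of "g 0" "g n" z "g ?t"] V z by simp
  ultimately have "D z (g ?t) \<le> \<kappa> + \<delta>"
    using z True Y.dsym[of "g n" "g ?t"] Y.dsym[of "g n" z] by linarith
  thus ?thesis using that True by blast
next
  case False
  hence "D z (g n) \<le> \<kappa> + \<delta>" using z by simp
  thus ?thesis using that[of n] by blast
qed

text \<open>Seen from \<open>z\<close>, \<open>u'\<close> lies in the direction of \<open>u\<close>
  and \<open>w'\<close> in that of \<open>w\<close>. As \<open>z\<close> separates \<open>u\<close>
  from \<open>w\<close>, two uses of the hyperbolic inequality for Gromov products show that it
  coarsely separates \<open>u'\<close> from \<open>w'\<close>.\<close>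

lemma quad:
  assumes V: "u \<in> V" "w \<in> V" "u' \<in> V" "w' \<in> V" and z: "z \<in> Y.Iv u w"
    and far: "2 * int \<delta> < gp2 z u u'" "2 * int \<delta> < gp2 z w w'"
  shows "D u' z + D z w' \<le> D u' w' + 2 * \<delta>"
proof -
  have zV: "z \<in> V" using z Y.Iv_D by blast
  have "min (gp2 z u u') (gp2 z u' w) - int \<delta> \<le> 0" using gp2_hyp[OF zV V(1,3,2)] gp2_Iv0[OF z] by simp
  hence "gp2 z u' w \<le> int \<delta>" using far by linarith
  moreover have "min (gp2 z u' w') (gp2 z w' w) - int \<delta> \<le> gp2 z u' w" using gp2_hyp[OF zV V(3,4,2)] .
  ultimately have "gp2 z u' w' \<le> 2 * int \<delta>" using far(2) gp2_sym[of z w w'] by linarith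
  thus ?thesis unfolding gp2_def using Y.dsym[of z u'] by linarith
qed

section \<open>Sequences with a common limit are asymptotic\<close>

definition gromov_conv :: "'a \<Rightarrow> (nat \<Rightarrow> 'a) \<Rightarrow> (nat \<Rightarrow> 'a) \<Rightarrow> bool" where
  "gromov_conv p u v \<longleftrightarrow> (\<forall>R. \<exists>S. \<forall>s\<ge>S. \<forall>t\<ge>S. R \<le> gp2 p (u s) (v t))"

definition diverges :: "(nat \<Rightarrow> 'a) \<Rightarrow> bool" where
  "diverges x \<longleftrightarrow> (\<forall>R. \<exists>S. \<forall>s\<ge>S. R \<le> D (x 0) (x s))"

lemma dmorse_gromov_conv:
  assumes x: "dmorse \<Phi> x" and "diverges x"
  shows "gromov_conv (x 0) x x"
  unfolding gromov_conv_def
proof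
  fix R
  obtain S where S: "\<And>s. S \<le> s \<Longrightarrow> nat R + 2 * gromov_const \<Phi> \<le> D (x 0) (x s)" using assms(2) unfolding diverges_def by blast
  have "R \<le> gp2 (x 0) (x s) (x t)" if "S \<le> s" "S \<le> t" for s t
    using dmorse_gromov[OF x that] S[of S] unfolding gp2_def by simp
  thus "\<exists>S. \<forall>s\<ge>S. \<forall>t\<ge>S. R \<le> gp2 (x 0) (x s) (x t)" by blast
qed

lemma gromov_conv_large:
  assumes "gromov_conv p x x"
  obtains S where "\<And>s t. S \<le> s \<Longrightarrow> S \<le> t \<Longrightarrow> R \<le> gp2 p (x s) (x t)"
  using assms unfolding gromov_conv_def by meson

text \<open>Geodesics of the coned-off graph to late points of \<open>x\<close> and \<open>y\<close>
  fellow-travel up to a large Gromov product. At parameter \<open>k\<close>,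
  \<open>fellow_close\<close> makes them close in the word metric, and each is near its own Morse
  sequence. Since \<open>c k\<close> is at distance \<open>k\<close> from \<open>p\<close>, a large
  \<open>k\<close> makes the index on \<open>x\<close> large.\<close>

lemma close_points:
  assumes x: "dmorse \<Phi> x" and y: "dmorse \<Psi> y" and p: "x 0 = p" "y 0 = p" and xy: "gromov_conv p x y"
  shows "\<exists>E. \<forall>T. \<exists>s\<ge>T. \<exists>t. d (x s) (y t) \<le> E"
proof -
  note xV = dmorseV[OF x] and yV = dmorseV[OF y]
  have pV: "p \<in> V" using xV p by metis
  \<comment> \<open>The margin on both sides of \<open>k\<close> that \<open>fellow_close\<close>
    demands for deviations of \<open>2 * \<delta>\<close>.\<close>
  let ?r = "2 * \<delta> + 2"
  define N where "N = 4 * (2 * ?r + 1) + 16 * \<delta> + 10"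
  define E where "E = B N + path_const \<Phi> 0 + path_const \<Psi> 0"
  have "\<exists>s\<ge>T. \<exists>t. d (x s) (y t) \<le> E" for T
  proof -
    define k where "k = T + path_const \<Phi> 0 + 1 + ?r"
    define k2 where "k2 = Suc k + ?r"
    obtain S where S: "\<And>s t. S \<le> s \<Longrightarrow> S \<le> t \<Longrightarrow> 2 * int k2 \<le> gp2 p (x s) (y t)"
      using xy unfolding gromov_conv_def by meson
    let ?u = "x S" and ?w = "y S"
    have gp: "2 * int k2 \<le> gp2 p ?u ?w" using S by simp
    let ?n = "D p ?u" and ?m = "D p ?w"
    obtain c where c: "c 0 = p" "c ?n = ?u" "Y.geo ?n c" using Y.geo_ex[OF pV xV] by blast
    obtain c' where c': "c' 0 = p" "c' ?m = ?w" "Y.geo ?m c'" using Y.geo_ex[OF pV yV] by blast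
    have k2n: "k2 \<le> ?n" using gp gp2_le[OF pV xV yV, of S S] by linarith
    have near: "\<exists>i\<le>?m. D (c q) (c' i) \<le> 2 * \<delta>" if q: "q \<le> k2" for q
    proof -
      have I: "c q \<in> Y.Iv p ?u" using Y.geo_Iv[OF c(3), of 0 q ?n] q k2n c by simp
      have dq: "D p (c q) = q" using Y.geoD[OF c(3), of 0 q] q k2n c by simp
      have "D p (c q) + D (c q) ?w \<le> D p ?w + \<delta>" by (rule shadow[OF pV xV yV I]) (use gp q dq in simp)
      then obtain i where "i \<le> ?m" "D (c q) (c' i) \<le> \<delta> + \<delta>"
        using near_geo[OF c'(3), of "c q" \<delta>] c' Y.geoV[OF c(3)] q k2n by auto
      thus ?thesis by auto
    qed
    have "k - ?r \<le> k2" by (simp add: k2_def)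
    then obtain i j where ij: "i \<le> ?m" "D (c (k - ?r)) (c' i) \<le> 2 * \<delta>" "j \<le> ?m" "D (c k2) (c' j) \<le> 2 * \<delta>"
      using near[of "k - ?r"] near[of k2] by blast
    have "\<exists>l\<le>?m. d (c k) (c' l) \<le> B N"
      by (rule fellow_close[OF c(3) c'(3) _ _ k2n ij(1,3,2,4)]) (auto simp: k2_def k_def N_def)
    then obtain l where l: "l \<le> ?m" "d (c k) (c' l) \<le> B N" by blast
    have kn: "k \<le> ?n" using k2n by (simp add: k2_def)
    obtain s where s: "d (c k) (x s) \<le> path_const \<Phi> 0" using geo_near[OF x c(3), of 0 0 S k] c p xV kn pV by auto
    obtain t where t: "d (c' l) (y t) \<le> path_const \<Psi> 0" using geo_near[OF y c'(3), of 0 0 S l] c' p yV l pV by auto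
    have cV: "c k \<in> V" "c' l \<in> V" using Y.geoV[OF c(3) kn] Y.geoV[OF c'(3) l(1)] by auto
    have "d (x s) (y t) \<le> d (x s) (c k) + d (c k) (y t)" "d (c k) (y t) \<le> d (c k) (c' l) + d (c' l) (y t)"
      using xV yV cV X.dtri by auto
    hence "d (x s) (y t) \<le> E" using s t l X.dsym[of "x s" "c k"] unfolding E_def by linarith
    moreover have "T \<le> s"
    proof -
      have "k = D p (c k)" using Y.geoD[OF c(3), of 0 k] c kn by simp
      also have "\<dots> \<le> D p (x s) + D (x s) (c k)" using pV xV cV by (intro Y.dtri) auto
      also have "D p (x s) \<le> d p (x s)" using D_le pV xV by blast
      also have "d p (x s) \<le> s + 1" using dmorse_dist(1)[OF x, of 0 s] p by simp
      also have "D (x s) (c k) \<le> d (x s) (c k)" using D_le cV xV by blast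
      finally show ?thesis using s X.dsym[of "x s" "c k"] unfolding k_def by simp
    qed
    ultimately show ?thesis by blast
  qed
  thus ?thesis by blast
qed

text \<open>A piece of \<open>y\<close> between two points near \<open>x\<close> is a chain, so
  \<open>y n\<close> is near some \<open>x m\<close>; as both sequences have the same start,
  \<open>m\<close> and \<open>n\<close> are both roughly the distance to it.\<close>

lemma asymptotic:
  assumes x: "dmorse \<Phi> x" and y: "dmorse \<Psi> y" and p: "x 0 = y 0"
    and cl: "\<And>T. \<exists>s\<ge>T. \<exists>t. d (x s) (y t) \<le> E"
  shows "\<exists>R. \<forall>n. d (x n) (y n) \<le> R"
proof -
  note xV = dmorseV[OF x] and yV = dmorseV[OF y]
  obtain s0 t0 where 0: "d (x s0) (y t0) \<le> E" using cl by blast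
  define K where "K = max 2 E"
  define R where "R = 2 * t0 + 2 + 2 * \<Phi> K + 4"
  have "d (x n) (y n) \<le> R" for n
  proof (cases "n < t0")
    case True
    have "d (x n) (y n) \<le> d (x n) (x 0) + d (x 0) (y n)" using xV yV X.dtri by blast
    thus ?thesis using dmorse_dist(1)[OF x, of n 0] dmorse_dist(1)[OF y, of 0 n] p True unfolding R_def
      by (simp split: if_splits)
  next
    case False
    obtain s t where st: "n + E + 4 + s0 \<le> s" "d (x s) (y t) \<le> E" using cl by blast
    have "d (x 0) (x s) \<le> d (y 0) (y t) + d (y t) (x s)" using X.dtri[of "x 0" "y t" "x s"] xV yV p by simp
    hence "s \<le> t + 1 + E + 1"
      using dmorse_dist(2)[OF x, of 0 s] dmorse_dist(1)[OF y, of 0 t] st X.dsym[of "y t" "x s"] by simp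
    hence nt: "n \<le> t" using st by simp
    define q where "q i = y (t0 + i)" for i
    have "chain K (t - t0) q"
      unfolding chain_def q_def
    proof (intro conjI allI impI)
      fix i show "y (t0 + i) \<in> V" using yV by blast
      show "d (y (t0 + i)) (y (t0 + Suc i)) \<le> K" using dmorse_dist(1)[OF y, of "t0 + i" "t0 + Suc i"] by (simp add: K_def)
      fix j assume "i \<le> j"
      hence "j - i \<le> 1 * (d (y (t0 + i)) (y (t0 + j)) + 1)" using dmorse_dist(2)[OF y, of "t0 + i" "t0 + j"] by simp
      also have "\<dots> \<le> K * (d (y (t0 + i)) (y (t0 + j)) + 1)" by (rule mult_le_mono1) (simp add: K_def)
      finally show "j - i \<le> K * (d (y (t0 + i)) (y (t0 + j)) + 1)" .
    qed
    moreover have "d (q 0) (x s0) \<le> K" "d (q (t - t0)) (x s) \<le> K"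
      using 0 st False nt X.dsym by (auto simp: q_def K_def)
    ultimately have "\<forall>i\<le>t - t0. \<exists>m. d (q i) (x m) \<le> \<Phi> K" using x unfolding dmorse_def by blast
    from this[rule_format, of "n - t0"] obtain m where m: "d (y n) (x m) \<le> \<Phi> K"
      using diff_le_mono[OF nt, of t0] False by (auto simp: q_def)
    have "d (x 0) (x m) \<le> d (y 0) (y n) + d (y n) (x m)" using X.dtri[of "x 0" "y n" "x m"] xV yV p by simp
    hence 1: "m \<le> n + \<Phi> K + 2" using dmorse_dist(2)[OF x, of 0 m] dmorse_dist(1)[OF y, of 0 n] m by simp
    have "d (y 0) (y n) \<le> d (x 0) (x m) + d (x m) (y n)" using X.dtri[of "y 0" "x m" "y n"] xV yV p by simp
    hence 2: "n \<le> m + \<Phi> K + 2"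
      using dmorse_dist(2)[OF y, of 0 n] dmorse_dist(1)[OF x, of 0 m] m X.dsym[of "x m"] by simp
    have "d (x n) (y n) \<le> d (x n) (x m) + d (x m) (y n)" using xV yV X.dtri by blast
    moreover have "d (x n) (x m) \<le> \<Phi> K + 3" using dmorse_dist(1)[OF x, of n m] 1 2 by (simp split: if_splits)
    ultimately show ?thesis using m X.dsym[of "x m" "y n"] unfolding R_def by linarith
  qed
  thus ?thesis by blast
qed

section \<open>Limits of geodesics: lines, and rays leaving a coset\<close>

lemma finite_balls: "finite (\<Union>l\<le>(n::nat). {v \<in> V. d (g l) v \<le> r})" if "\<And>l. l \<le> n \<Longrightarrow> g l \<in> V"
  using fin_ball that by auto

text \<open>Since the limits differ, geodesics from \<open>x m\<close> to \<open>y m\<close> pass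
  \<open>p\<close> at bounded distance in the coned-off graph; they are parametrized with 0 at such
  a point. For large \<open>m\<close> the \<open>i\<close>-th point is, by
  \<open>fellow_close\<close>, within bounded word distance of one fixed geodesic from
  \<open>x S\<close> to \<open>y S\<close>, and so lies in a finite set;
  \<open>diagonal_choice\<close> then yields the line.\<close>

lemma line_ex:
  assumes x: "dmorse \<Phi> x" and y: "dmorse \<Psi> y" and p: "x 0 = p" "y 0 = p" and dv: "diverges x" "diverges y"
    and ne: "\<not> gromov_conv p x y"
  obtains f :: "int \<Rightarrow> 'a" where "\<And>i. f i \<in> V" "\<And>i j. i \<le> j \<Longrightarrow> int (D (f i) (f j)) = j - i"
    "\<And>n T. \<exists>m\<ge>T. \<forall>i j. - n \<le> i \<longrightarrow> i \<le> j \<longrightarrow> j \<le> n \<longrightarrow>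
       D (x m) (f i) + D (f i) (f j) + D (f j) (y m) = D (x m) (y m)"
proof -
  note xV = dmorseV[OF x] and yV = dmorseV[OF y]
  have pV: "p \<in> V" using xV p by metis
  have gx: "gromov_conv p x x" and gy: "gromov_conv p y y" using dmorse_gromov_conv[OF x dv(1)] dmorse_gromov_conv[OF y dv(2)] p by auto
  obtain R0 where R0: "\<And>S. \<exists>s\<ge>S. \<exists>t\<ge>S. gp2 p (x s) (y t) < R0" using ne unfolding gromov_conv_def by (auto simp: not_le)
  let ?\<delta> = "int \<delta>"
  obtain S1x where S1x: "\<And>s t. S1x \<le> s \<Longrightarrow> S1x \<le> t \<Longrightarrow> R0 + 2 * ?\<delta> \<le> gp2 p (x s) (x t)" using gromov_conv_large[OF gx] by blast
  obtain S1y where S1y: "\<And>s t. S1y \<le> s \<Longrightarrow> S1y \<le> t \<Longrightarrow> R0 + 2 * ?\<delta> \<le> gp2 p (y s) (y t)" using gromov_conv_large[OF gy] by blast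
  define S1 where "S1 = max S1x S1y"
  \<comment> \<open>Different limits give small products only at some pairs of indices; as
    \<open>x\<close> and \<open>y\<close> converge, the bound passes to all late diagonal
    pairs.\<close>
  have bd: "gp2 p (x m) (y m) < R0 + 2 * ?\<delta>" if m: "S1 \<le> m" for m
  proof -
    obtain s t where st: "S1 \<le> s" "S1 \<le> t" "gp2 p (x s) (y t) < R0" using R0 by blast
    have "min (gp2 p (x s) (x m)) (gp2 p (x m) (y t)) - ?\<delta> \<le> gp2 p (x s) (y t)"
      "min (gp2 p (x m) (y m)) (gp2 p (y m) (y t)) - ?\<delta> \<le> gp2 p (x m) (y t)"
      using gp2_hyp pV xV yV by auto
    thus ?thesis using S1x[of s m] S1y[of m t] st m unfolding S1_def by linarith
  qed
  have "\<exists>z. z \<in> Y.Iv (x m) (y m) \<and> 2 * D p z + D (x m) (y m) \<le> D p (x m) + D p (y m) + 2 * \<delta> + 2" for m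
    using tripod[OF xV yV pV] by metis
  then obtain z where z: "\<And>m. z m \<in> Y.Iv (x m) (y m)"
    "\<And>m. 2 * D p (z m) + D (x m) (y m) \<le> D p (x m) + D p (y m) + 2 * \<delta> + 2" by metis
  define R1 where "R1 = nat R0 + 2 * \<delta> + 2"
  have zR: "D p (z m) \<le> R1" if "S1 \<le> m" for m
    using bd[OF that] z(2)[of m] unfolding gp2_def R1_def by linarith
  have zV: "z m \<in> V" for m using z Y.Iv_D by blast
  define N where "N m = D (x m) (y m)" for m
  define k where "k m = D (x m) (z m)" for m
  have "\<exists>h. Y.geo (N m) h \<and> h 0 = x m \<and> h (k m) = z m \<and> h (N m) = y m" for m
    using Y.geo_through[OF xV yV z(1)] unfolding N_def k_def by metis
  then obtain h where h: "\<And>m. Y.geo (N m) (h m)" "\<And>m. h m 0 = x m" "\<And>m. h m (k m) = z m" "\<And>m. h m (N m) = y m"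
    by metis
  have kN: "k m \<le> N m" for m using z(1)[of m] Y.Iv_D unfolding k_def N_def by fastforce
  have room: "\<exists>S\<ge>S1. \<forall>m\<ge>S. n \<le> k m \<and> k m + n \<le> N m" for n
  proof -
    obtain Sx where Sx: "\<And>m. Sx \<le> m \<Longrightarrow> n + R1 \<le> D p (x m)" using dv(1)[unfolded diverges_def p] by blast
    obtain Sy where Sy: "\<And>m. Sy \<le> m \<Longrightarrow> n + R1 \<le> D p (y m)" using dv(2)[unfolded diverges_def p] by blast
    have "n \<le> k m \<and> k m + n \<le> N m" if m: "max S1 (max Sx Sy) \<le> m" for m
    proof -
      have "D p (x m) \<le> D p (z m) + D (z m) (x m)" "D p (y m) \<le> D p (z m) + D (z m) (y m)"
        using pV xV yV zV Y.dtri by auto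
      moreover have "D (x m) (z m) + D (z m) (y m) = N m" using z(1)[of m] Y.Iv_D unfolding N_def by blast
      moreover have "D p (z m) \<le> R1" using zR m by simp
      moreover have "n + R1 \<le> D p (x m)" "n + R1 \<le> D p (y m)" using Sx Sy m by auto
      ultimately show ?thesis unfolding k_def using Y.dsym[of "z m" "x m"] by linarith
    qed
    thus ?thesis by (intro exI[of _ "max S1 (max Sx Sy)"]) auto
  qed
  define c where "c m i = h m (nat (int (k m) + i))" for m and i :: int
  let ?r = "3 * \<delta> + 3"
  define NN where "NN = 4 * (2 * ?r + 1) + 24 * \<delta> + 10"
  have fin: "\<exists>S F. finite F \<and> (\<forall>m\<ge>S. c m i \<in> F)" for i
  proof -
    let ?n = "nat \<bar>i\<bar> + ?r + 1"
    define Q where "Q = R1 + ?n"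
    obtain S0 where S0: "S1 \<le> S0" "\<And>m. S0 \<le> m \<Longrightarrow> ?n \<le> k m \<and> k m + ?n \<le> N m" using room by blast
    obtain Sx where Sx: "\<And>s t. Sx \<le> s \<Longrightarrow> Sx \<le> t \<Longrightarrow> 2 * int Q + 2 * ?\<delta> + 1 \<le> gp2 p (x s) (x t)" using gromov_conv_large[OF gx] by blast
    obtain Sy where Sy: "\<And>s t. Sy \<le> s \<Longrightarrow> Sy \<le> t \<Longrightarrow> 2 * int Q + 2 * ?\<delta> + 1 \<le> gp2 p (y s) (y t)" using gromov_conv_large[OF gy] by blast
    define S where "S = max S0 (max Sx Sy)"
    have "\<exists>l\<le>N S. d (c m i) (h S l) \<le> B NN" if m: "S \<le> m" for m
    proof -
      have rm: "?n \<le> k m" "k m + ?n \<le> N m" using S0(2)[of m] m unfolding S_def by auto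
      define K where "K = nat (int (k m) + i)"
      have K: "int K = int (k m) + i" using rm unfolding K_def by linarith
      have near: "\<exists>j\<le>N S. D (h m q) (h S j) \<le> 3 * \<delta>" if q: "\<bar>int q - int (k m)\<bar> \<le> int ?n" for q
      proof -
        have qN: "q \<le> N m" using q rm by linarith
        have qV: "h m q \<in> V" using Y.geoV[OF h(1) qN] .
        have qI: "h m q \<in> Y.Iv (x m) (y m)" using Y.geo_Iv[OF h(1)[of m], of 0 q "N m"] qN h by simp
        have "int (D (h m q) (z m)) = \<bar>int q - int (k m)\<bar>" using Y.geo_abs[OF h(1) qN kN] h(3)[of m] by simp
        moreover have "D p (h m q) \<le> D p (z m) + D (z m) (h m q)" using pV zV qV by (intro Y.dtri) auto
        moreover have "D p (z m) \<le> R1" using zR m S0(1) unfolding S_def by simp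
        ultimately have dq: "D p (h m q) \<le> Q" using q Y.dsym[of "z m" "h m q"] unfolding Q_def by linarith
        have mS: "Sx \<le> m" "Sx \<le> S" "Sy \<le> m" "Sy \<le> S" using m unfolding S_def by auto
        have "2 * ?\<delta> < gp2 (h m q) (x m) (x S)"
          using gp2_base[OF pV qV xV[of m] xV[of S]] Sx[OF mS(1,2)] dq by linarith
        moreover have "2 * ?\<delta> < gp2 (h m q) (y m) (y S)"
          using gp2_base[OF pV qV yV[of m] yV[of S]] Sy[OF mS(3,4)] dq by linarith
        ultimately have "D (x S) (h m q) + D (h m q) (y S) \<le> D (x S) (y S) + 2 * \<delta>"
          by (rule quad[OF xV yV xV yV qI])
        hence "D (h S 0) (h m q) + D (h m q) (h S (N S)) \<le> N S + 2 * \<delta>" using h by (simp add: N_def)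
        then obtain j where "j \<le> N S" "D (h m q) (h S j) \<le> 2 * \<delta> + \<delta>" using near_geo[OF h(1) qV] by blast
        thus ?thesis by (intro exI[of _ j]) simp
      qed
      have rK: "Suc K + ?r \<le> N m" "?r \<le> K" using K rm by linarith+
      have "int (K - ?r) = int K - int ?r" using rK(2) by (rule of_nat_diff)
      hence "\<bar>int (K - ?r) - int (k m)\<bar> \<le> int ?n" using K by linarith
      then obtain i' where i': "i' \<le> N S" "D (h m (K - ?r)) (h S i') \<le> 3 * \<delta>" using near by blast
      have "\<bar>int (Suc K + ?r) - int (k m)\<bar> \<le> int ?n" using K by linarith
      then obtain j' where j': "j' \<le> N S" "D (h m (Suc K + ?r)) (h S j') \<le> 3 * \<delta>" using near by blast
      show ?thesis
        unfolding c_def K_def[symmetric]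
      proof (rule fellow_close[OF h(1) h(1) _ _ rK(1) i'(1) j'(1) i'(2) j'(2)])
        show "3 * \<delta> = 0 \<or> K - ?r + 3 * \<delta> + 2 \<le> K" using rK(2) by linarith
        have "Suc K + ?r - (K - ?r) = 2 * ?r + 1" using rK(2) by simp
        thus "4 * (Suc K + ?r - (K - ?r)) + 4 * (3 * \<delta>) + 4 * (3 * \<delta>) + 10 \<le> NN" unfolding NN_def by simp
      qed simp_all
    qed
    hence "\<forall>m\<ge>S. c m i \<in> (\<Union>l\<le>N S. {v \<in> V. d (h S l) v \<le> B NN})"
    proof (intro allI impI)
      fix m assume m: "S \<le> m"
      hence "nat (int (k m) + i) \<le> N m" using S0(2)[of m] unfolding S_def by linarith
      hence "c m i \<in> V" unfolding c_def using Y.geoV[OF h(1)] by blast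
      thus "c m i \<in> (\<Union>l\<le>N S. {v \<in> V. d (h S l) v \<le> B NN})"
        using \<open>\<And>m. S \<le> m \<Longrightarrow> \<exists>l\<le>N S. d (c m i) (h S l) \<le> B NN\<close>[OF m] by (auto simp: X.dsym)
    qed
    moreover have "finite (\<Union>l\<le>N S. {v \<in> V. d (h S l) v \<le> B NN})" by (rule finite_balls) (rule Y.geoV[OF h(1)])
    ultimately show ?thesis by blast
  qed
  obtain f where f: "\<And>A T. finite A \<Longrightarrow> \<exists>m\<ge>T. \<forall>i\<in>A. c m i = f i" using diagonal_choice[of c] fin by blast
  have good: "\<exists>m\<ge>T. \<forall>i. - n \<le> i \<longrightarrow> i \<le> n \<longrightarrow> f i = h m (nat (int (k m) + i)) \<and> 0 \<le> int (k m) + i \<and> int (k m) + i \<le> int (N m)" for n T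
  proof -
    obtain S where S: "\<And>m. S \<le> m \<Longrightarrow> nat n \<le> k m \<and> k m + nat n \<le> N m" using room by blast
    obtain m where m: "max S T \<le> m" "\<forall>i\<in>{-n..n}. c m i = f i" using f[of "{-n..n}" "max S T"] by auto
    have "f i = h m (nat (int (k m) + i)) \<and> 0 \<le> int (k m) + i \<and> int (k m) + i \<le> int (N m)" if i: "- n \<le> i" "i \<le> n" for i
    proof -
      have "c m i = f i" using m(2) i by simp
      thus ?thesis using S[of m] m(1) i unfolding c_def by auto
    qed
    thus ?thesis using m(1) by (intro exI[of _ m]) auto
  qed
  show ?thesis
  proof (rule that[of f])
    show "f i \<in> V" for i
    proof -
      obtain m where "f i = h m (nat (int (k m) + i))" "int (k m) + i \<le> int (N m)" using good[of 0 "\<bar>i\<bar>"] by (meson abs_ge_self abs_ge_minus_self minus_le_iff)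
      thus ?thesis using Y.geoV[OF h(1), of "nat (int (k m) + i)" m] by simp
    qed
    show "int (D (f i) (f j)) = j - i" if ij: "i \<le> j" for i j
    proof -
      let ?n = "\<bar>i\<bar> + \<bar>j\<bar>"
      obtain m where m: "\<And>i. - ?n \<le> i \<Longrightarrow> i \<le> ?n \<Longrightarrow> f i = h m (nat (int (k m) + i)) \<and> 0 \<le> int (k m) + i \<and> int (k m) + i \<le> int (N m)"
        using good[of 0 ?n] by blast
      have "f i = h m (nat (int (k m) + i)) \<and> 0 \<le> int (k m) + i \<and> int (k m) + i \<le> int (N m)" by (rule m) linarith+
      moreover have "f j = h m (nat (int (k m) + j)) \<and> 0 \<le> int (k m) + j \<and> int (k m) + j \<le> int (N m)" by (rule m) linarith+
      moreover define i' j' where "i' = nat (int (k m) + i)" and "j' = nat (int (k m) + j)"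
      ultimately have *: "f i = h m i'" "f j = h m j'" "int i' = int (k m) + i" "int j' = int (k m) + j" "j' \<le> N m"
        by auto
      hence "D (f i) (f j) = j' - i'" using Y.geoD[OF h(1), of i' j' m] ij by simp
      thus ?thesis using * ij by linarith
    qed
    show "\<exists>m\<ge>T. \<forall>i j. - n \<le> i \<longrightarrow> i \<le> j \<longrightarrow> j \<le> n \<longrightarrow> D (x m) (f i) + D (f i) (f j) + D (f j) (y m) = D (x m) (y m)" for n T
    proof -
      obtain m where m: "T \<le> m" "\<And>i. - n \<le> i \<Longrightarrow> i \<le> n \<Longrightarrow> f i = h m (nat (int (k m) + i)) \<and> 0 \<le> int (k m) + i \<and> int (k m) + i \<le> int (N m)"
        using good[of T n] by blast
      have "D (x m) (f i) + D (f i) (f j) + D (f j) (y m) = D (x m) (y m)" if ij: "- n \<le> i" "i \<le> j" "j \<le> n" for i j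
      proof -
        let ?i = "nat (int (k m) + i)" and ?j = "nat (int (k m) + j)"
        have "f i = h m ?i" "f j = h m ?j" "?i \<le> ?j" "?j \<le> N m" using m(2)[of i] m(2)[of j] ij by auto
        thus ?thesis
          using Y.geoD[OF h(1)[of m], of 0 ?i] Y.geoD[OF h(1)[of m], of ?i ?j] Y.geoD[OF h(1)[of m], of ?j "N m"] h(2,4)[of m]
          by (simp add: N_def)
      qed
      thus ?thesis using m(1) by blast
    qed
  qed
qed

text \<open>Geodesics between late points of \<open>y\<close> stay far from \<open>C\<close>, so by
  \<open>proj_far\<close> the projections of these points are \<open>lip\<close>-close and one of
  them, \<open>b\<close>, recurs infinitely often. Geodesics from \<open>b\<close> to the
  corresponding points of \<open>y\<close> have a limit as in \<open>line_ex\<close>, with only the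
  far end to control.\<close>

lemma ray_ex:
  assumes y: "dmorse \<Psi> y" and dv: "diverges y" and C: "C \<in> CC"
  obtains f :: "nat \<Rightarrow> 'a" where "\<And>i. f i \<in> V" "\<And>i j. i \<le> j \<Longrightarrow> D (f i) (f j) = j - i"
    "\<And>l. proj C (f l) (f 0)"
    "\<And>n T. \<exists>m\<ge>T. proj C (y m) (f 0) \<and> (\<forall>j\<le>n. D (f 0) (f j) + D (f j) (y m) = D (f 0) (y m))"
proof -
  note yV = dmorseV[OF y]
  define p where "p = y 0"
  have pV: "p \<in> V" using yV p_def by simp
  have gy: "gromov_conv p y y" using dmorse_gromov_conv[OF y dv] p_def by simp
  let ?\<delta> = "int \<delta>"
  have "\<forall>m. \<exists>a. proj C (y m) a" using proj_ex[OF C] by blast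
  then obtain a where a: "\<And>m. proj C (y m) (a m)" by metis
  have aC: "a m \<in> C" for m using a[of m] unfolding proj_def by blast
  have aV: "a m \<in> V" for m using CC_mem_V[OF C aC] .
  obtain S0 where S0: "\<And>s t. S0 \<le> s \<Longrightarrow> S0 \<le> t \<Longrightarrow> 2 * int (D p (a 0) + 1 + \<rho>) \<le> gp2 p (y s) (y t)"
    using gromov_conv_large[OF gy] by blast
  have close: "d (a S0) (a m) \<le> lip" if m: "S0 \<le> m" for m
  proof (rule proj_far[OF C yV yV a a])
    fix w b assume w: "w \<in> Y.Iv (y S0) (y m)" and b: "b \<in> C"
    have wV: "w \<in> V" using w Y.Iv_D by blast
    have "2 * int (D p (a 0) + 1 + \<rho>) \<le> 2 * int (D p w)"
      using S0[OF order_refl m] gp2_Iv[OF pV yV yV w] by (rule order_trans)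
    hence "D p (a 0) + 1 + \<rho> \<le> D p w" by simp
    moreover have "D p w \<le> D p b + D b w" "D p b \<le> D p (a 0) + D (a 0) b"
      using pV wV aV CC_mem_V[OF C b] Y.dtri by auto
    moreover have "D (a 0) b \<le> 1" using CC_D[OF C aC b] .
    ultimately show "\<rho> \<le> D w b" using Y.dsym[of b w] by linarith
  qed
  \<comment> \<open>The pigeonhole principle, as the case of a single coordinate in
    \<open>diagonal_choice\<close>.\<close>
  have "\<exists>S F. finite F \<and> (\<forall>m\<ge>S. (\<lambda>m (_::unit). a m) m i \<in> F)" for i
    using close aV fin_ball[OF aV[of S0], of lip] by (intro exI[of _ S0] exI[of _ "{v \<in> V. d (a S0) v \<le> lip}"]) auto
  then obtain a0 where a0: "\<And>T. \<exists>m\<ge>T. a m = a0 ()"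
    using diagonal_choice[of "\<lambda>m _. a m"] by (metis finite.emptyI finite.insertI insertI1)
  define b where "b = a0 ()"
  obtain r where r: "\<And>T::nat. T \<le> r T" "\<And>T. a (r T) = b" using a0 unfolding b_def by metis
  have bC: "b \<in> C" and bV: "b \<in> V" and bn: "\<And>T. proj C (y (r T)) b" using aC aV a r(2) by metis+
  define N where "N T = D b (y (r T))" for T
  have "\<exists>h. Y.geo (N m) h \<and> h 0 = b \<and> h (N m) = y (r m)" for m
    using Y.geo_ex[OF bV yV] unfolding N_def by metis
  then obtain h where h: "\<And>m. Y.geo (N m) (h m)" "\<And>m. h m 0 = b" "\<And>m. h m (N m) = y (r m)" by metis
  have gb: "\<exists>S. \<forall>s\<ge>S. \<forall>t\<ge>S. R \<le> gp2 b (y (r s)) (y (r t))" for R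
  proof -
    obtain S where S: "\<And>s t. S \<le> s \<Longrightarrow> S \<le> t \<Longrightarrow> R + 2 * int (D p b) \<le> gp2 p (y s) (y t)" using gromov_conv_large[OF gy] by blast
    have "R \<le> gp2 b (y (r s)) (y (r t))" if "S \<le> s" "S \<le> t" for s t
      using gp2_base[OF pV bV yV yV, of "r s" "r t"] S[of "r s" "r t"] r(1)[of s] r(1)[of t] that by linarith
    thus ?thesis by blast
  qed
  have room: "\<exists>S. \<forall>m\<ge>S. n \<le> N m" for n
  proof -
    obtain S where S: "\<And>s t. S \<le> s \<Longrightarrow> S \<le> t \<Longrightarrow> 2 * int n \<le> gp2 b (y (r s)) (y (r t))" using gb by blast
    have "n \<le> N m" if "S \<le> m" for m
      using gp2_le[OF bV yV yV, of "r m" "r m"] S[OF that that] unfolding N_def by linarith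
    thus ?thesis by blast
  qed
  let ?r = "2 * \<delta> + 2"
  have fin: "\<exists>S F. finite F \<and> (\<forall>m\<ge>S. h m i \<in> F)" for i
  proof -
    let ?k2 = "Suc i + ?r"
    define NN where "NN = 4 * ?k2 + 8 * \<delta> + 10"
    obtain S0 where S0: "\<And>m. S0 \<le> m \<Longrightarrow> ?k2 \<le> N m" using room by blast
    obtain S' where S': "\<And>s t. S' \<le> s \<Longrightarrow> S' \<le> t \<Longrightarrow> 2 * int ?k2 \<le> gp2 b (y (r s)) (y (r t))" using gb by blast
    define S where "S = max S0 S'"
    have cl: "\<exists>l\<le>N S. d (h m i) (h S l) \<le> B NN" if m: "S \<le> m" for m
    proof -
      have kN: "?k2 \<le> N m" using S0 m by (simp add: S_def)
      have I: "h m ?k2 \<in> Y.Iv b (y (r m))" using Y.geo_Iv[OF h(1)[of m], of 0 ?k2 "N m"] kN h by simp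
      have dq: "D b (h m ?k2) = ?k2" using Y.geoD[OF h(1)[of m], of 0 ?k2] kN h by simp
      have "2 * int (D b (h m ?k2)) \<le> gp2 b (y (r m)) (y (r S))" using S'[of m S] m dq by (simp add: S_def)
      hence "D b (h m ?k2) + D (h m ?k2) (y (r S)) \<le> D b (y (r S)) + \<delta>" by (rule shadow[OF bV yV yV I])
      hence "D (h S 0) (h m ?k2) + D (h m ?k2) (h S (N S)) \<le> N S + \<delta>" using h by (simp add: N_def)
      then obtain j where j: "j \<le> N S" "D (h m ?k2) (h S j) \<le> \<delta> + \<delta>" using near_geo[OF h(1) Y.geoV[OF h(1) kN]] by blast
      have z: "D (h m 0) (h S 0) \<le> 0" using h(2) bV by simp
      show ?thesis
        by (rule fellow_close[OF h(1) h(1) _ _ kN _ j(1) z j(2)]) (auto simp: NN_def)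
    qed
    have "\<forall>m\<ge>S. h m i \<in> (\<Union>l\<le>N S. {v \<in> V. d (h S l) v \<le> B NN})"
    proof (intro allI impI)
      fix m assume m: "S \<le> m"
      hence "h m i \<in> V" using Y.geoV[OF h(1), of i m] S0[of m] by (simp add: S_def)
      thus "h m i \<in> (\<Union>l\<le>N S. {v \<in> V. d (h S l) v \<le> B NN})" using cl[OF m] by (auto simp: X.dsym)
    qed
    moreover have "finite (\<Union>l\<le>N S. {v \<in> V. d (h S l) v \<le> B NN})" by (rule finite_balls) (rule Y.geoV[OF h(1)])
    ultimately show ?thesis by blast
  qed
  obtain f where f: "\<And>A T. finite A \<Longrightarrow> \<exists>m\<ge>T. \<forall>i\<in>A. h m i = f i" using diagonal_choice[of h] fin by blast
  have good: "\<exists>m\<ge>T. n \<le> N m \<and> (\<forall>i\<le>n. f i = h m i)" for n T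
  proof -
    obtain S where S: "\<And>m. S \<le> m \<Longrightarrow> n \<le> N m" using room by blast
    obtain m where m: "max S T \<le> m" "\<forall>i\<in>{..n}. h m i = f i" using f[of "{..n}" "max S T"] by auto
    thus ?thesis using S[of m] by (intro exI[of _ m]) auto
  qed
  have f0: "f 0 = b" using good[of 0 0] h(2) by auto
  have dist: "D b (f j) + D (f j) (y (r m)) = D b (y (r m))" if "n \<le> N m" "\<forall>i\<le>n. f i = h m i" "j \<le> n" for m n j
    using Y.geoD[OF h(1)[of m], of 0 j] Y.geoD[OF h(1)[of m], of j "N m"] that h[of m] by (simp add: N_def)
  have fV: "f i \<in> V" for i
  proof -
    obtain m where "i \<le> N m" "\<forall>j\<le>i. f j = h m j" using good[of 0 i] by blast
    thus ?thesis using Y.geoV[OF h(1), of i m] by simp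
  qed
  show ?thesis
  proof (rule that[of f])
    show "f i \<in> V" for i by (rule fV)
    show "D (f i) (f j) = j - i" if ij: "i \<le> j" for i j
    proof -
      obtain m where m: "j \<le> N m" "\<forall>i\<le>j. f i = h m i" using good[of 0 j] by blast
      thus ?thesis using Y.geoD[OF h(1), of i j m] ij by simp
    qed
    show "proj C (f l) (f 0)" for l
      unfolding proj_def f0
    proof (intro conjI ballI)
      show "b \<in> C" by (rule bC)
      fix \<beta> assume \<beta>: "\<beta> \<in> C"
      obtain m where m: "l \<le> N m" "\<forall>i\<le>l. f i = h m i" using good[of 0 l] by blast
      have "D (y (r m)) b \<le> D (y (r m)) \<beta>" using bn \<beta> unfolding proj_def by blast
      also have "\<dots> \<le> D (y (r m)) (f l) + D (f l) \<beta>" using yV fV CC_mem_V[OF C \<beta>] by (intro Y.dtri) auto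
      finally show "D (f l) b \<le> D (f l) \<beta>"
        using dist[OF m order_refl] Y.dsym[of "y (r m)" b] Y.dsym[of "y (r m)" "f l"] Y.dsym[of b "f l"] by linarith
    qed
    show "\<exists>m\<ge>T. proj C (y m) (f 0) \<and> (\<forall>j\<le>n. D (f 0) (f j) + D (f j) (y m) = D (f 0) (y m))" for n T
    proof -
      obtain m where m: "T \<le> m" "n \<le> N m" "\<forall>i\<le>n. f i = h m i" using good[of T n] by blast
      have "T \<le> r m" using m(1) r(1)[of m] by linarith
      moreover have "proj C (y (r m)) (f 0)" using bn f0 by simp
      moreover have "\<forall>j\<le>n. D (f 0) (f j) + D (f j) (y (r m)) = D (f 0) (y (r m))" using dist[OF m(2,3)] f0 by simp
      ultimately show ?thesis by blast
    qed
  qed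
qed

section \<open>Uniform estimates for sequences that agree for a long time\<close>

lemma cont_far:
  assumes x: "dmorse \<Phi> x" and dv: "diverges x"
  shows "\<exists>T. \<forall>y. dmorse \<Phi> y \<longrightarrow> y 0 = x 0 \<longrightarrow> (\<forall>t\<le>T. d (x t) (y t) \<le> 2) \<longrightarrow>
    (\<forall>s\<ge>T. \<forall>t\<ge>T. R \<le> gp2 (x 0) (x s) (y t))"
proof -
  note xV = dmorseV[OF x]
  define R' where "R' = nat R + 4 * gromov_const \<Phi> + 2 * \<delta> + 4"
  obtain T where T: "\<And>s. T \<le> s \<Longrightarrow> R' \<le> D (x 0) (x s)" using dv unfolding diverges_def by blast
  have "R \<le> gp2 (x 0) (x s) (y t)"
    if y: "dmorse \<Phi> y" "y 0 = x 0" "\<forall>t\<le>T. d (x t) (y t) \<le> 2" and st: "T \<le> s" "T \<le> t" for y s t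
  proof -
    note yV = dmorseV[OF y(1)]
    have "D (x T) (y T) \<le> 2" using y(3) D_le[OF xV yV, of T T] by (meson order_refl order_trans)
    moreover have "D (x 0) (x T) \<le> D (x 0) (y T) + D (y T) (x T)" using xV yV Y.dtri by blast
    moreover have "R' \<le> D (x 0) (x T)" using T by simp
    moreover have "2 * D (x 0) (x T) + D (x s) (x T) \<le> D (x 0) (x s) + D (x 0) (x T) + 4 * gromov_const \<Phi>"
      using dmorse_gromov[OF x, of T s T] st by simp
    moreover have "2 * D (x 0) (y T) + D (y T) (y t) \<le> D (x 0) (y T) + D (x 0) (y t) + 4 * gromov_const \<Phi>"
      using dmorse_gromov[OF y(1), of T T t] st y(2) by simp
    ultimately have g: "int (2 * R') - 4 * int (gromov_const \<Phi>) \<le> gp2 (x 0) (x s) (x T)" "int (2 * R') - 4 \<le> gp2 (x 0) (x T) (y T)"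
      "int (2 * R') - 4 - 4 * int (gromov_const \<Phi>) \<le> gp2 (x 0) (y T) (y t)"
      unfolding gp2_def using Y.dsym[of "y T" "x T"] by linarith+
    \<comment> \<open>From \<open>x s\<close> over \<open>x T\<close> and \<open>y T\<close> to
      \<open>y t\<close>: three large products, each intermediate point costing one
      \<delta>.\<close>
    have "min (gp2 (x 0) (x s) (x T)) (gp2 (x 0) (x T) (y t)) - int \<delta> \<le> gp2 (x 0) (x s) (y t)"
      "min (gp2 (x 0) (x T) (y T)) (gp2 (x 0) (y T) (y t)) - int \<delta> \<le> gp2 (x 0) (x T) (y t)"
      using gp2_hyp xV yV by auto
    moreover have "int (2 * R') = 2 * int (nat R) + 8 * int (gromov_const \<Phi>) + 4 * int \<delta> + 8" unfolding R'_def by simp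
    ultimately have "int (2 * R') - 4 - 4 * int (gromov_const \<Phi>) - 2 * int \<delta> \<le> gp2 (x 0) (x s) (y t)" using g by linarith
    thus ?thesis using \<open>int (2 * R') = _\<close> by linarith
  qed
  thus ?thesis by blast
qed

text \<open>\<open>y T\<close> is near \<open>C\<close> because \<open>x T\<close> is. A block path
  that starts with \<open>C\<close> and ends near a later point of \<open>y\<close> stays near
  \<open>y\<close>; the point where it leaves \<open>C\<close> is near some \<open>y j\<close> with
  \<open>j\<close> not far below \<open>T\<close>, so it is far from the start. The path leads to
  the point \<open>y m\<close> in the first claim and to the coset \<open>C'\<close> in the
  second.\<close>

lemma cont_coset:
  assumes x: "dmorse \<Phi> x" and C: "C \<in> CC" and near: "\<And>s. S \<le> s \<Longrightarrow> \<exists>a\<in>C. d a (x s) \<le> R0"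
  shows "\<exists>T. \<forall>y. dmorse \<Phi> y \<longrightarrow> y 0 = x 0 \<longrightarrow> (\<forall>t\<le>T. d (x t) (y t) \<le> 2) \<longrightarrow>
    (\<forall>a m. T \<le> m \<longrightarrow> proj C (y m) a \<longrightarrow> N \<le> d (x 0) a) \<and>
    (\<forall>C' g n S'. C' \<in> CC \<longrightarrow> C \<noteq> C' \<longrightarrow> (\<forall>s\<ge>S'. \<exists>b\<in>C'. d b (y s) \<le> coset_const \<Phi>) \<longrightarrow> Y.geo n g \<longrightarrow> g 0 \<in> C \<longrightarrow> g n \<in> C' \<longrightarrow>
       (\<forall>l\<le>n. proj C (g l) (g 0)) \<longrightarrow> (\<forall>l\<le>n. proj C' (g l) (g n)) \<longrightarrow> N \<le> d (x 0) (g 0))"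
proof -
  note xV = dmorseV[OF x]
  define K where "K = max (R0 + 2) (coset_const \<Phi>)"
  define T where "T = S + N + 2 * path_const \<Phi> K + 1"
  obtain aT where aT: "aT \<in> C" "d aT (x T) \<le> R0" using near[of T] by (auto simp: T_def)
  have aV: "aT \<in> V" using CC_mem_V[OF C aT(1)] .
  have main: "N \<le> d (x 0) (g 0)"
    if y: "dmorse \<Phi> y" "y 0 = x 0" "\<forall>t\<le>T. d (x t) (y t) \<le> 2"
      and g: "Y.geo n g" "g 0 \<in> C" "g n \<in> B1" "block B1" "\<forall>l\<le>n. proj C (g l) (g 0)" "\<forall>l\<le>n. proj B1 (g l) (g n)" "C \<noteq> B1"
      and b: "b' \<in> B1" "d b' (y t) \<le> K" "T \<le> t" for y n g B1 b' t
  proof -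
    note yV = dmorseV[OF y(1)]
    obtain b where bp: "bpath (Suc n) (\<lambda>k. g (k - 1)) b" "b 0 = C" "b (Suc n) = B1"
      by (rule geo_bpath[OF g(1) _ g(4) g(2,3)]) (use g C in \<open>auto simp: block_def\<close>)
    have "d aT (y T) \<le> d aT (x T) + d (x T) (y T)" using aV xV yV X.dtri by blast
    moreover have "d (x T) (y T) \<le> 2" using y(3) by simp
    ultimately have "d aT (y T) \<le> K" using aT unfolding K_def by simp
    then obtain j where j: "d (g 0) (y j) \<le> path_const \<Phi> K" "T \<le> j + path_const \<Phi> K"
      using bpath_near[OF y(1) bp(1), of 1 aT T K b' t] bp(2,3) aT(1) b by auto
    have gV: "g 0 \<in> V" using Y.geoV[OF g(1)] by simp
    have "d (y 0) (y j) \<le> d (x 0) (g 0) + d (g 0) (y j)" using X.dtri[of "x 0" "g 0" "y j"] xV yV gV y(2) by simp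
    thus ?thesis using j dmorse_dist(2)[OF y(1), of 0 j] unfolding T_def by simp
  qed
  have 1: "N \<le> d (x 0) a" if y: "dmorse \<Phi> y" "y 0 = x 0" "\<forall>t\<le>T. d (x t) (y t) \<le> 2" and m: "T \<le> m" "proj C (y m) a" for y a m
  proof -
    note yV = dmorseV[OF y(1)]
    have a: "a \<in> C" "a \<in> V" using m(2) CC_mem_V[OF C] unfolding proj_def by auto
    show ?thesis
    proof (cases "C = {y m}")
      \<comment> \<open>The end block \<open>{y m}\<close> would coincide with \<open>C\<close>,
        which \<open>geo_bpath\<close> excludes.\<close>
      case True
      hence "a = y m" using a by simp
      thus ?thesis using dmorse_dist(2)[OF y(1), of 0 m] y(2) m(1) unfolding T_def by simp
    next
      case False
      obtain g where g: "g 0 = a" "g (D a (y m)) = y m" "Y.geo (D a (y m)) g" using Y.geo_ex[OF a(2) yV] by blast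
      have "proj C (g l) (g 0)" if l: "l \<le> D a (y m)" for l
        unfolding proj_def g(1)
      proof (intro conjI ballI)
        fix \<beta> assume \<beta>: "\<beta> \<in> C"
        have glV: "g l \<in> V" using Y.geoV[OF g(3) l] .
        have "D (y m) a \<le> D (y m) \<beta>" using m(2) \<beta> unfolding proj_def by blast
        also have "\<dots> \<le> D (y m) (g l) + D (g l) \<beta>" using yV glV CC_mem_V[OF C \<beta>] by (intro Y.dtri) auto
        finally have "D (y m) a \<le> D (y m) (g l) + D (g l) \<beta>" .
        moreover have "D a (g l) = l" "D (g l) (y m) = D a (y m) - l"
          using Y.geoD[OF g(3), of 0 l] Y.geoD[OF g(3), of l "D a (y m)"] g l by auto
        ultimately show "D (g l) a \<le> D (g l) \<beta>"
          using l Y.dsym[of "y m" a] Y.dsym[of "y m" "g l"] Y.dsym[of a "g l"] by linarith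
      qed (rule a)
      hence "N \<le> d (x 0) (g 0)"
        by (intro main[OF y g(3), of "{y m}" "y m" m]) (use g a yV m False in \<open>auto simp: singleton_block proj_singleton\<close>)
      thus ?thesis using g by simp
    qed
  qed
  have 2: "N \<le> d (x 0) (g 0)"
    if y: "dmorse \<Phi> y" "y 0 = x 0" "\<forall>t\<le>T. d (x t) (y t) \<le> 2"
      and C': "C' \<in> CC" "C \<noteq> C'" "\<forall>s\<ge>S'. \<exists>b\<in>C'. d b (y s) \<le> coset_const \<Phi>"
      and g: "Y.geo n g" "g 0 \<in> C" "g n \<in> C'" "\<forall>l\<le>n. proj C (g l) (g 0)" "\<forall>l\<le>n. proj C' (g l) (g n)" for y C' g n S'
  proof -
    obtain b' where "b' \<in> C'" "d b' (y (max S' T)) \<le> coset_const \<Phi>" using C'(3) by (meson max.cobounded1)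
    thus ?thesis
      by (intro main[OF y g(1-3) _ g(4,5) C'(2), of b' "max S' T"]) (use C' in \<open>auto simp: block_def K_def\<close>)
  qed
  show ?thesis by (rule exI[of _ T]) (use 1 2 in blast)
qed

text \<open>Any geodesic between two points realizing the distance of the cosets will do: a point of
  \<open>C\<close> closer to some \<open>g l\<close> than \<open>g 0\<close> would lead to a shorter
  connection.\<close>

lemma coset_geo:
  assumes C: "C \<in> CC" "C' \<in> CC"
  obtains n g where "Y.geo n g" "g 0 \<in> C" "g n \<in> C'" "\<And>l. l \<le> n \<Longrightarrow> proj C (g l) (g 0)" "\<And>l. l \<le> n \<Longrightarrow> proj C' (g l) (g n)"
    "\<And>u w. u \<in> C \<Longrightarrow> w \<in> C' \<Longrightarrow> n \<le> D u w"
proof -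
  obtain a0 b0 where "a0 \<in> C" "b0 \<in> C'" using C CC_ne by blast
  then obtain q where q: "fst q \<in> C \<and> snd q \<in> C'"
    "\<forall>r. fst r \<in> C \<and> snd r \<in> C' \<longrightarrow> D (fst q) (snd q) \<le> D (fst r) (snd r)"
    using ex_has_least_nat[of "\<lambda>q. fst q \<in> C \<and> snd q \<in> C'" "(a0, b0)" "\<lambda>q. D (fst q) (snd q)"] by auto
  define a b where "a = fst q" and "b = snd q"
  have ab: "a \<in> C" "b \<in> C'" "\<And>a' b'. a' \<in> C \<Longrightarrow> b' \<in> C' \<Longrightarrow> D a b \<le> D a' b'"
    using q unfolding a_def b_def by auto
  have V: "a \<in> V" "b \<in> V" using CC_mem_V[OF C(1) ab(1)] CC_mem_V[OF C(2) ab(2)] by auto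
  obtain g where g: "g 0 = a" "g (D a b) = b" "Y.geo (D a b) g" using Y.geo_ex[OF V] by blast
  show ?thesis
  proof (rule that[OF g(3)])
    fix l assume l: "l \<le> D a b"
    have gV: "g l \<in> V" using Y.geoV[OF g(3) l] .
    have gD: "D (g 0) (g l) = l" "D (g l) (g (D a b)) = D a b - l" using Y.geoD[OF g(3)] l by auto
    show "proj C (g l) (g 0)"
      unfolding proj_def
    proof (intro conjI ballI)
      fix \<beta> assume \<beta>: "\<beta> \<in> C"
      have "D a b \<le> D \<beta> b" "D \<beta> b \<le> D \<beta> (g l) + D (g l) b" using ab \<beta> V gV CC_mem_V[OF C(1) \<beta>] Y.dtri by auto
      thus "D (g l) (g 0) \<le> D (g l) \<beta>" using gD g l Y.dsym[of \<beta> "g l"] Y.dsym[of a "g l"] by simp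
    qed (use g ab in simp)
    show "proj C' (g l) (g (D a b))"
      unfolding proj_def
    proof (intro conjI ballI)
      fix \<beta> assume \<beta>: "\<beta> \<in> C'"
      have "D a b \<le> D a \<beta>" "D a \<beta> \<le> D a (g l) + D (g l) \<beta>" using ab \<beta> V gV CC_mem_V[OF C(2) \<beta>] Y.dtri by auto
      thus "D (g l) (g (D a b)) \<le> D (g l) \<beta>" using gD g l by simp
    qed (use g ab in simp)
  qed (use g ab in auto)
qed

lemma near_not_diverges:
  assumes x: "dmorse \<Phi> x" and C: "C \<in> CC" and near: "\<And>s. S \<le> s \<Longrightarrow> \<exists>a\<in>C. d a (x s) \<le> R0"
  shows "\<not> diverges x"
proof
  note xV = dmorseV[OF x]
  obtain b where b: "b \<in> C" using CC_ne[OF C] by blast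
  assume "diverges x"
  then obtain S' where S': "\<And>s. S' \<le> s \<Longrightarrow> D (x 0) b + R0 + 2 \<le> D (x 0) (x s)" unfolding diverges_def by blast
  obtain a where a: "a \<in> C" "d a (x (max S S')) \<le> R0" using near[of "max S S'"] by auto
  have V: "a \<in> V" "b \<in> V" using a b CC_mem_V[OF C] by auto
  have "D (x 0) (x (max S S')) \<le> D (x 0) b + D b (x (max S S'))" "D b (x (max S S')) \<le> D b a + D a (x (max S S'))"
    using V xV Y.dtri by auto
  moreover have "D b a \<le> 1" using CC_D[OF C b a(1)] .
  moreover have "D a (x (max S S')) \<le> R0" using D_le[OF V(1) xV, of "max S S'"] a by simp
  ultimately show False using S'[of "max S S'"] by simp
qed

lemma diverges_or_near:
  assumes x: "dmorse \<Phi> x" and "\<not> diverges x"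
  obtains C S where "C \<in> CC" "\<And>s. S \<le> s \<Longrightarrow> \<exists>a\<in>C. d a (x s) \<le> coset_const \<Phi>"
proof -
  obtain R where "\<And>S. \<exists>s\<ge>S. D (x 0) (x s) < R" using assms(2) unfolding diverges_def by (auto simp: not_le)
  from dichotomy[OF x this] show ?thesis using that by blast
qed

end

section \<open>Geometric realizations\<close>

locale dist_space =
  fixes M :: "'x set" and d :: "'x \<Rightarrow> 'x \<Rightarrow> real"
  assumes nonneg: "x \<in> M \<Longrightarrow> y \<in> M \<Longrightarrow> 0 \<le> d x y"
    and zero: "x \<in> M \<Longrightarrow> d x x = 0"
    and sym: "x \<in> M \<Longrightarrow> y \<in> M \<Longrightarrow> d x y = d y x"
    and tri: "x \<in> M \<Longrightarrow> y \<in> M \<Longrightarrow> z \<in> M \<Longrightarrow> d x z \<le> d x y + d y z"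
begin

lemma geodesicD:
  assumes "geodesic M d I \<gamma>" "s \<in> I" "t \<in> I"
  shows "\<gamma> s \<in> M" "d (\<gamma> s) (\<gamma> t) = \<bar>s - t\<bar>"
proof -
  have "\<gamma> s \<in> M \<and> \<bar>s - t\<bar> \<le> d (\<gamma> s) (\<gamma> t) \<and> d (\<gamma> s) (\<gamma> t) \<le> \<bar>s - t\<bar>"
    using assms unfolding geodesic_def quasi_geodesic_def by auto
  thus "\<gamma> s \<in> M" "d (\<gamma> s) (\<gamma> t) = \<bar>s - t\<bar>" by auto
qed

lemma geodesicI:
  assumes "is_interval I" "\<And>t. t \<in> I \<Longrightarrow> \<gamma> t \<in> M" "\<And>s t. s \<in> I \<Longrightarrow> t \<in> I \<Longrightarrow> s < t \<Longrightarrow> d (\<gamma> s) (\<gamma> t) = t - s"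
  shows "geodesic M d I \<gamma>"
proof -
  have "d (\<gamma> s) (\<gamma> t) = \<bar>s - t\<bar>" if "s \<in> I" "t \<in> I" for s t
    using assms(2,3) sym[of "\<gamma> s" "\<gamma> t"] zero that by (cases s t rule: linorder_cases) auto
  thus ?thesis using assms unfolding geodesic_def quasi_geodesic_def by auto
qed

text \<open>On \<open>S\<close> the distances are right, and gaps between consecutive times are
  filled with segments. For points in different gaps the triangle inequality through the inner ends
  of the gaps gives the upper bound, and through the outer ends the lower bound.\<close>

lemma geodesic_fill:
  assumes I: "is_interval I" and q: "\<And>s. s \<in> S \<Longrightarrow> q s \<in> M"
    "\<And>s t. s \<in> S \<Longrightarrow> t \<in> S \<Longrightarrow> s < t \<Longrightarrow> d (q s) (q t) = t - s"
    and S: "\<And>t. t \<in> I \<Longrightarrow> t \<notin> S \<Longrightarrow> \<exists>l\<in>S. \<exists>h\<in>S. l < t \<and> t < h \<and> (\<forall>s\<in>S. s \<le> l \<or> h \<le> s)"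
    and gap: "\<And>l h. l \<in> S \<Longrightarrow> h \<in> S \<Longrightarrow> l < h \<Longrightarrow> (\<forall>s\<in>S. s \<le> l \<or> h \<le> s) \<Longrightarrow>
      \<exists>\<sigma>. geodesic M d {0..h - l} \<sigma> \<and> \<sigma> 0 = q l \<and> \<sigma> (h - l) = q h"
  obtains \<gamma> where "geodesic M d I \<gamma>" "\<And>s. s \<in> S \<Longrightarrow> \<gamma> s = q s"
proof -
  have "\<exists>l h. l \<in> S \<and> h \<in> S \<and> l \<le> t \<and> t \<le> h \<and> (\<forall>s\<in>S. s \<le> l \<or> h \<le> s) \<and> (t \<in> S \<longrightarrow> l = t \<and> h = t) \<and> (t \<notin> S \<longrightarrow> l < t \<and> t < h)"
    if "t \<in> I" for t
  proof (cases "t \<in> S")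
    case True thus ?thesis by (intro exI[of _ t]) auto
  next
    case False thus ?thesis using S[OF that] by (metis less_imp_le)
  qed
  then obtain l h where lh: "\<And>t. t \<in> I \<Longrightarrow> l t \<in> S \<and> h t \<in> S \<and> l t \<le> t \<and> t \<le> h t \<and> (\<forall>s\<in>S. s \<le> l t \<or> h t \<le> s) \<and>
      (t \<in> S \<longrightarrow> l t = t \<and> h t = t) \<and> (t \<notin> S \<longrightarrow> l t < t \<and> t < h t)"
    by metis
  define P where "P a b \<sigma> \<longleftrightarrow> geodesic M d {0..b - a} \<sigma> \<and> \<sigma> 0 = q a \<and> \<sigma> (b - a) = q b" for a b \<sigma>
  \<comment> \<open>The segment is chosen from the gap alone, so that two points in one gap lie on
    the same segment.\<close>
  define \<sigma> where "\<sigma> a b = (SOME \<sigma>. P a b \<sigma>)" for a b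
  have \<sigma>: "P (l t) (h t) (\<sigma> (l t) (h t))" if "t \<in> I" "t \<notin> S" for t
    unfolding \<sigma>_def using someI_ex[of "P (l t) (h t)"] gap[of "l t" "h t"] lh[OF that(1)] that(2) unfolding P_def by fastforce
  define \<gamma> where "\<gamma> t = (if t \<in> S then q t else \<sigma> (l t) (h t) (t - l t))" for t
  have gM: "\<gamma> t \<in> M" if "t \<in> I" for t
  proof (cases "t \<in> S")
    case True thus ?thesis using q by (simp add: \<gamma>_def)
  next
    case False
    thus ?thesis using \<sigma>[OF that False] lh[OF that] geodesicD(1)[of "{0..h t - l t}" "\<sigma> (l t) (h t)" "t - l t" 0]
      unfolding P_def \<gamma>_def by auto
  qed
  have ends: "d (q (l t)) (\<gamma> t) = t - l t \<and> d (\<gamma> t) (q (h t)) = h t - t" if "t \<in> I" for t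
  proof (cases "t \<in> S")
    case True thus ?thesis using q lh[OF that] zero by (simp add: \<gamma>_def)
  next
    case False
    note L = lh[OF that]
    have g: "geodesic M d {0..h t - l t} (\<sigma> (l t) (h t))" "\<sigma> (l t) (h t) 0 = q (l t)" "\<sigma> (l t) (h t) (h t - l t) = q (h t)"
      using \<sigma>[OF that False] unfolding P_def by auto
    show ?thesis using geodesicD(2)[OF g(1), of 0 "t - l t"] geodesicD(2)[OF g(1), of "t - l t" "h t - l t"] L g(2,3) False
      by (simp add: \<gamma>_def)
  qed
  have dist: "d (\<gamma> s) (\<gamma> t) = t - s" if st: "s \<in> I" "t \<in> I" "s < t" for s t
  proof (cases "h s \<le> l t")
    case True
    note L = lh[OF st(1)] lh[OF st(2)]
    have M: "q (l s) \<in> M" "q (h s) \<in> M" "q (l t) \<in> M" "q (h t) \<in> M" "\<gamma> s \<in> M" "\<gamma> t \<in> M" using L q gM st by auto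
    have qd: "d (q a) (q b) = b - a" if "a \<in> S" "b \<in> S" "a \<le> b" for a b
      using q(2)[of a b] zero q(1) that by (cases "a = b") auto
    have "d (\<gamma> s) (\<gamma> t) \<le> d (\<gamma> s) (q (h s)) + d (q (h s)) (\<gamma> t)" "d (q (h s)) (\<gamma> t) \<le> d (q (h s)) (q (l t)) + d (q (l t)) (\<gamma> t)"
      using M tri by auto
    moreover have "d (q (h s)) (q (l t)) = l t - h s" using qd L True by blast
    moreover have "d (q (l s)) (q (h t)) = h t - l s" using L True st by (intro qd) auto
    moreover have "d (q (l s)) (q (h t)) \<le> d (q (l s)) (\<gamma> s) + d (\<gamma> s) (q (h t))" "d (\<gamma> s) (q (h t)) \<le> d (\<gamma> s) (\<gamma> t) + d (\<gamma> t) (q (h t))"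
      using M tri by auto
    ultimately show ?thesis using ends[OF st(1)] ends[OF st(2)] by linarith
  next
    case False
    note L = lh[OF st(1)] lh[OF st(2)]
    have nS: "s \<notin> S"
    proof
      assume "s \<in> S"
      hence "s \<le> l t \<or> h t \<le> s" "h s = s" using L by auto
      thus False using False st L(2) by linarith
    qed
    have nT: "t \<notin> S"
    proof
      assume "t \<in> S"
      hence "t \<le> l s \<or> h s \<le> t" "l t = t" using L by auto
      thus False using False st L(1) by linarith
    qed
    have "l t \<le> l s \<or> h s \<le> l t" "l s \<le> l t \<or> h t \<le> l s" "h t \<le> l s \<or> h s \<le> h t" "h s \<le> l t \<or> h t \<le> h s" using L by blast+
    hence eq: "l s = l t" "h s = h t" using False L nS nT st by auto
    have g: "geodesic M d {0..h t - l t} (\<sigma> (l t) (h t))" using \<sigma>[OF st(2) nT] unfolding P_def by auto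
    show ?thesis using geodesicD(2)[OF g, of "s - l t" "t - l t"] L eq st nS nT by (simp add: \<gamma>_def)
  qed
  have "geodesic M d I \<gamma>" by (rule geodesicI[OF I gM dist])
  thus ?thesis by (rule that) (simp add: \<gamma>_def)
qed

lemma segment_ends:
  assumes "geodesic_segment M d x y A"
  shows "x \<in> A" "y \<in> A" "A \<subseteq> M" "c \<in> A \<Longrightarrow> d x c + d c y = d x y"
proof -
  obtain \<gamma> a where g: "0 \<le> a" "geodesic M d {0..a} \<gamma>" "\<gamma> 0 = x" "\<gamma> a = y" "A = \<gamma> ` {0..a}"
    using assms unfolding geodesic_segment_def by blast
  show "x \<in> A" "y \<in> A" using g by (force, force)
  show "A \<subseteq> M" using g geodesicD(1)[OF g(2)] by auto
  assume "c \<in> A"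
  then obtain t where t: "t \<in> {0..a}" "c = \<gamma> t" using g by blast
  thus "d x c + d c y = d x y"
    using geodesicD(2)[OF g(2), of 0 t] geodesicD(2)[OF g(2), of t a] geodesicD(2)[OF g(2), of 0 a] g by simp
qed

text \<open>From \<open>x\<close> to \<open>y\<close> along \<open>A\<close> one passes from points
  near the side \<open>C\<close> to points near the side \<open>B\<close>. At the transition,
  located by a supremum, both sides are near; the parameters \<open>t1\<close>, \<open>t2\<close> of
  the two witnesses differ by at most 2.\<close>

lemma hyperbolic_tripod:
  assumes hyp: "hyperbolic M d \<delta>" and M: "x \<in> M" "y \<in> M" "p \<in> M" and A: "geodesic_segment M d x y A"
  shows "\<exists>m\<in>A. 2 * d p m \<le> d x p + d y p - d x y + 4 * \<delta> + 4"
proof -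
  obtain \<gamma> a where g: "0 \<le> a" "geodesic M d {0..a} \<gamma>" "\<gamma> 0 = x" "\<gamma> a = y" "A = \<gamma> ` {0..a}"
    using A unfolding geodesic_segment_def by blast
  obtain B C where BC: "geodesic_segment M d y p B" "geodesic_segment M d x p C"
    using hyp M unfolding hyperbolic_def by meson
  have slim: "\<exists>b\<in>B \<union> C. d m b \<le> \<delta>" if "m \<in> A" for m
    using hyp A BC that unfolding hyperbolic_def nbhd_def by blast
  have BM: "B \<subseteq> M" and CM: "C \<subseteq> M" using segment_ends(3) BC by auto
  obtain b0 where "b0 \<in> B \<union> C" "d x b0 \<le> \<delta>" using slim[of x] segment_ends(1)[OF A] by blast
  hence \<delta>: "0 \<le> \<delta>" using nonneg[of x b0] M BM CM by force
  define T where "T = {t \<in> {0..a}. \<exists>c\<in>C. d (\<gamma> t) c \<le> \<delta>}"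
  have 0: "0 \<in> T" using g segment_ends(1)[OF BC(2)] zero M \<delta> unfolding T_def by force
  have bdd: "bdd_above T" unfolding T_def by (intro bdd_aboveI[of _ a]) auto
  define u where "u = Sup T"
  have u: "\<And>t. t \<in> T \<Longrightarrow> t \<le> u" unfolding u_def using bdd by (rule cSup_upper[rotated])
  obtain t1 where t1: "t1 \<in> T" "u - 1 < t1" using less_cSupE[of "u - 1" T] 0 unfolding u_def by auto
  have t1a: "t1 \<in> {0..a}" using t1 by (simp add: T_def)
  have "\<exists>t2\<in>{0..a}. \<bar>t1 - t2\<bar> \<le> 2 \<and> (\<exists>b\<in>B. d (\<gamma> t2) b \<le> \<delta>)"
  proof (cases "a \<le> u + 1")
    case True
    thus ?thesis using t1 t1a g segment_ends(1)[OF BC(1)] zero M \<delta>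
      by (intro bexI[of _ a] conjI bexI[of _ y]) auto
  next
    case False
    have "u + 1 \<notin> T" using u by fastforce
    moreover have "u + 1 \<in> {0..a}" using u[OF 0] False by simp
    moreover from this have "\<exists>b\<in>B \<union> C. d (\<gamma> (u + 1)) b \<le> \<delta>" using g by (intro slim) auto
    ultimately have "\<exists>b\<in>B. d (\<gamma> (u + 1)) b \<le> \<delta>" unfolding T_def by auto
    thus ?thesis using \<open>u + 1 \<in> {0..a}\<close> t1 u[OF t1(1)] by (intro bexI[of _ "u + 1"]) auto
  qed
  then obtain t2 b where t2: "t2 \<in> {0..a}" "\<bar>t1 - t2\<bar> \<le> 2" "b \<in> B" "d (\<gamma> t2) b \<le> \<delta>" by blast
  obtain c where c: "c \<in> C" "d (\<gamma> t1) c \<le> \<delta>" using t1 by (auto simp: T_def)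
  let ?m = "\<gamma> t1"
  have mV: "?m \<in> M" "\<gamma> t2 \<in> M" "b \<in> M" "c \<in> M" using geodesicD(1)[OF g(2)] t1a t2 BM CM c by auto
  have m12: "d ?m (\<gamma> t2) \<le> 2" using geodesicD(2)[OF g(2) t1a t2(1)] t2 by simp
  have mb: "d ?m b \<le> \<delta> + 2" using tri[OF mV(1,2,3)] m12 t2 by linarith
  have sx: "d x c + d c p = d x p" and sy: "d y b + d b p = d y p"
    using segment_ends(4)[OF BC(2) c(1)] segment_ends(4)[OF BC(1) t2(3)] by auto
  have sm: "d x ?m + d ?m y = d x y" using segment_ends(4)[OF A] g t1a by auto
  have "d p ?m \<le> d p c + d c ?m" "d x ?m \<le> d x c + d c ?m" "d p ?m \<le> d p b + d b ?m" "d y ?m \<le> d y b + d b ?m"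
    using M mV tri by auto
  hence "2 * d p ?m \<le> d x p + d y p - d x y + 4 * \<delta> + 4"
    using sx sy sm c mb sym[of p c] sym[of c ?m] sym[of p b] sym[of b ?m] sym[of y ?m] M mV by linarith
  thus ?thesis using g t1a by blast
qed

text \<open>The point \<open>m\<close> on the side from \<open>x\<close> to \<open>z\<close>
  realizes the Gromov product at \<open>p\<close> up to a constant, and it is within \<delta> of one
  of the other sides of the triangle \<open>x, y, z\<close>; these are the two cases of the maximum.
  The constant is \<open>4 * \<delta> + 4\<close> from the tripod plus twice \<delta>.\<close>

lemma hyperbolic_four_point:
  assumes hyp: "hyperbolic M d \<delta>" and M: "x \<in> M" "y \<in> M" "z \<in> M" "p \<in> M"
  shows "d x z + d y p \<le> max (d x y + d z p) (d y z + d x p) + (6 * \<delta> + 4)"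
proof -
  obtain A where A: "geodesic_segment M d x z A" using hyp M unfolding hyperbolic_def by meson
  obtain B where B: "geodesic_segment M d y z B" using hyp M unfolding hyperbolic_def by meson
  obtain C where C: "geodesic_segment M d x y C" using hyp M unfolding hyperbolic_def by meson
  obtain B' where B': "geodesic_segment M d z y B'" using hyp M unfolding hyperbolic_def by meson
  obtain m where m: "m \<in> A" "2 * d p m \<le> d x p + d z p - d x z + 4 * \<delta> + 4"
    using hyperbolic_tripod[OF hyp M(1,3,4) A] by blast
  have "A \<subseteq> nbhd M d \<delta> (B' \<union> C)" using hyp A B' C unfolding hyperbolic_def by blast
  then obtain m' where m': "m' \<in> B' \<union> C" "d m m' \<le> \<delta>" using m unfolding nbhd_def by blast
  have V: "m \<in> M" "m' \<in> M" using segment_ends(3) A B' C m m' by auto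
  have pm: "d p m' \<le> d p m + \<delta>" using tri[of p m m'] V M m' by simp
  show ?thesis
  proof (cases "m' \<in> C")
    case True
    hence "d x m' + d m' y = d x y" using segment_ends(4)[OF C] by blast
    moreover have "d x p \<le> d x m' + d m' p" "d y p \<le> d y m' + d m' p" using M V tri by auto
    ultimately show ?thesis using m pm sym[of m' p] sym[of m' y] M V by linarith
  next
    case False
    hence "d z m' + d m' y = d z y" using segment_ends(4)[OF B'] m' by blast
    moreover have "d z p \<le> d z m' + d m' p" "d y p \<le> d y m' + d m' p" using M V tri by auto
    ultimately show ?thesis using m pm sym[of m' p] sym[of m' y] sym[of z y] M V by linarith
  qed
qed

end

section \<open>Barycentric coordinates and the length metric of a graph\<close>

lemma vpoint_simps: "vpoint v v = 1" "u \<noteq> v \<Longrightarrow> vpoint v u = 0"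
  by (auto simp: vpoint_def)

lemma cell_vertex: "cell {v} = {vpoint v}"
  unfolding cell_def vpoint_def by (auto simp: fun_eq_iff indicator_def)

lemma vpoint_inj: "vpoint u = vpoint v \<longleftrightarrow> u = v"
  by (metis vpoint_simps zero_neq_one)

lemma cell_edge:
  assumes "u \<noteq> w"
  shows "x \<in> cell {u, w} \<longleftrightarrow> 0 \<le> x u \<and> 0 \<le> x w \<and> x u + x w = 1 \<and> (\<forall>v. v \<noteq> u \<longrightarrow> v \<noteq> w \<longrightarrow> x v = 0)"
proof -
  have "(\<forall>v. 0 \<le> x v)" if "0 \<le> x u" "0 \<le> x w" "\<forall>v. v \<noteq> u \<longrightarrow> v \<noteq> w \<longrightarrow> x v = 0"
  proof
    fix v show "0 \<le> x v" using that by (cases "v = u"; cases "v = w") auto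
  qed
  thus ?thesis using assms unfolding cell_def by auto
qed

lemma vpoint_cell: "u \<noteq> w \<Longrightarrow> vpoint u \<in> cell {u, w}"
  by (auto simp: cell_edge vpoint_def indicator_def)

lemma chain_length_trans: "chain_length \<Gamma> y z s \<Longrightarrow> chain_length \<Gamma> x y r \<Longrightarrow> chain_length \<Gamma> x z (r + s)"
proof (induction rule: chain_length.induct)
  case (refl x) thus ?case by simp
next
  case (step x' y r' e z)
  from chain_length.step[OF step.IH[OF step.prems] step.hyps(2-4)] show ?case by (simp add: add.assoc)
qed

locale connected_graph =
  fixes \<Gamma> :: "'v metric_graph"
  assumes edge: "e \<in> edges \<Gamma> \<Longrightarrow> \<exists>u w. e = {u, w} \<and> u \<noteq> w \<and> u \<in> verts \<Gamma> \<and> w \<in> verts \<Gamma>"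
    and len: "e \<in> edges \<Gamma> \<Longrightarrow> 0 \<le> edge_len \<Gamma> e" "e \<in> edges \<Gamma> \<Longrightarrow> edge_len \<Gamma> e \<le> 1"
    and conn: "u \<in> verts \<Gamma> \<Longrightarrow> w \<in> verts \<Gamma> \<Longrightarrow> \<exists>r. chain_length \<Gamma> (vpoint u) (vpoint w) r"
begin

abbreviation "R \<equiv> realization \<Gamma>"

lemma vpoint_R: "v \<in> verts \<Gamma> \<Longrightarrow> vpoint v \<in> R"
  unfolding realization_def by (auto simp: cell_vertex)

lemma cell_R: "e \<in> edges \<Gamma> \<Longrightarrow> x \<in> cell e \<Longrightarrow> x \<in> R"
  unfolding realization_def by auto

lemma chain_nonneg: "chain_length \<Gamma> x y r \<Longrightarrow> 0 \<le> r"
  by (induction rule: chain_length.induct) (auto intro!: add_nonneg_nonneg divide_nonneg_nonneg mult_nonneg_nonneg sum_nonneg len)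

lemma chain_edge: "e \<in> edges \<Gamma> \<Longrightarrow> x \<in> cell e \<Longrightarrow> y \<in> cell e \<Longrightarrow> chain_length \<Gamma> x y (edge_len \<Gamma> e * (\<Sum>v\<in>e. \<bar>x v - y v\<bar>) / 2)"
  using chain_length.step[OF chain_length.refl[OF cell_R]] by fastforce

lemma chain_sym: "chain_length \<Gamma> x y r \<Longrightarrow> chain_length \<Gamma> y x r"
proof (induction rule: chain_length.induct)
  case (refl x) thus ?case by (rule chain_length.refl)
next
  case (step x y r e z)
  have "chain_length \<Gamma> z y (edge_len \<Gamma> e * (\<Sum>v\<in>e. \<bar>y v - z v\<bar>) / 2)"
    using chain_edge[OF step.hyps(2,4,3)] by (simp add: abs_minus_commute)
  from chain_length_trans[OF step.IH this] show ?case by (simp add: add.commute)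
qed

lemma edge_sum:
  assumes "u \<noteq> w" "x \<in> cell {u, w}" "y \<in> cell {u, w}"
  shows "(\<Sum>v\<in>{u, w}. \<bar>x v - y v\<bar>) / 2 = \<bar>x u - y u\<bar>"
proof -
  have "x w - y w = y u - x u" using assms by (simp add: cell_edge)
  hence "\<bar>x w - y w\<bar> = \<bar>x u - y u\<bar>" by (simp add: abs_minus_commute)
  thus ?thesis using assms(1) by simp
qed

text \<open>One of the two barycentric coordinates on an edge is at least 1/2, and edges have length
  at most 1.\<close>

lemma near_vertex_chain:
  assumes "x \<in> R"
  shows "\<exists>v\<in>verts \<Gamma>. \<exists>r\<le>1/2. chain_length \<Gamma> x (vpoint v) r \<and> (x = vpoint v \<or> (\<exists>e\<in>edges \<Gamma>. v \<in> e \<and> x \<in> cell e))"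
proof -
  have ex: "\<exists>r\<le>1/2. chain_length \<Gamma> x (vpoint u) r" if e: "{u, w} \<in> edges \<Gamma>" "u \<noteq> w" and x: "x \<in> cell {u, w}" "1/2 \<le> x u" for u w
  proof -
    have "chain_length \<Gamma> x (vpoint u) (edge_len \<Gamma> {u, w} * (\<Sum>v\<in>{u, w}. \<bar>x v - vpoint u v\<bar>) / 2)"
      using chain_edge[OF e(1) x(1)] vpoint_cell[OF e(2)] by blast
    moreover have "(\<Sum>v\<in>{u, w}. \<bar>x v - vpoint u v\<bar>) / 2 = x w"
      using edge_sum[OF e(2) x(1) vpoint_cell[OF e(2)]] x e by (simp add: cell_edge vpoint_simps)
    moreover have "edge_len \<Gamma> {u, w} * x w \<le> 1 * (1/2)" using x e len by (intro mult_mono) (auto simp: cell_edge)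
    ultimately show ?thesis by (metis mult.left_neutral times_divide_eq_right)
  qed
  show ?thesis
  proof (cases "\<exists>v\<in>verts \<Gamma>. x = vpoint v")
    case True
    then obtain v where v: "v \<in> verts \<Gamma>" "x = vpoint v" by blast
    have "chain_length \<Gamma> x (vpoint v) 0" using chain_length.refl[OF assms] v by simp
    thus ?thesis using v by (intro bexI[of _ v] exI[of _ 0]) auto
  next
    case False
    then obtain e where e: "e \<in> edges \<Gamma>" "x \<in> cell e" using assms unfolding realization_def by (auto simp: cell_vertex)
    obtain u w where uw: "e = {u, w}" "u \<noteq> w" "u \<in> verts \<Gamma>" "w \<in> verts \<Gamma>" using edge[OF e(1)] by blast
    have "x u + x w = 1" using e uw by (simp add: cell_edge)
    hence "1/2 \<le> x u \<or> 1/2 \<le> x w" by linarith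
    thus ?thesis
    proof
      assume "1/2 \<le> x u"
      thus ?thesis using ex[of u w] e uw by blast
    next
      assume "1/2 \<le> x w"
      then obtain r where "r \<le> 1/2" "chain_length \<Gamma> x (vpoint w) r" using ex[of w u] e uw by (auto simp: insert_commute)
      thus ?thesis using e uw by (intro bexI[of _ w] exI[of _ r] conjI disjI2 bexI[of _ e]) auto
    qed
  qed
qed

lemma chain_ex:
  assumes "x \<in> R" "y \<in> R" shows "\<exists>r. chain_length \<Gamma> x y r"
proof -
  obtain u r where u: "u \<in> verts \<Gamma>" "chain_length \<Gamma> x (vpoint u) r" using near_vertex_chain[OF assms(1)] by blast
  obtain w s where w: "w \<in> verts \<Gamma>" "chain_length \<Gamma> y (vpoint w) s" using near_vertex_chain[OF assms(2)] by blast
  obtain t where "chain_length \<Gamma> (vpoint u) (vpoint w) t" using conn u w by blast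
  thus ?thesis using u w chain_length_trans chain_sym by blast
qed

lemma gdist_le: "chain_length \<Gamma> x y r \<Longrightarrow> gdist \<Gamma> x y \<le> r"
  unfolding gdist_def by (rule cInf_lower) (auto intro!: bdd_belowI[of _ 0] chain_nonneg)

lemma gdist_ge:
  assumes "x \<in> R" "y \<in> R" "\<And>r. chain_length \<Gamma> x y r \<Longrightarrow> c \<le> r" shows "c \<le> gdist \<Gamma> x y"
  unfolding gdist_def by (rule cInf_greatest) (use chain_ex[OF assms(1,2)] assms(3) in auto)

sublocale dist_space R "gdist \<Gamma>"
proof
  fix x y assume R: "x \<in> R" "y \<in> R"
  show "0 \<le> gdist \<Gamma> x y" by (rule gdist_ge[OF R chain_nonneg])
  have "Collect (chain_length \<Gamma> x y) = Collect (chain_length \<Gamma> y x)" using chain_sym by blast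
  thus "gdist \<Gamma> x y = gdist \<Gamma> y x" unfolding gdist_def by simp
next
  fix x assume "x \<in> R"
  thus "gdist \<Gamma> x x = 0" using gdist_le[OF chain_length.refl] gdist_ge[of x x 0] chain_nonneg by (meson order_antisym)
next
  fix x y z assume R: "x \<in> R" "y \<in> R" "z \<in> R"
  show "gdist \<Gamma> x z \<le> gdist \<Gamma> x y + gdist \<Gamma> y z"
  proof -
    have "gdist \<Gamma> x z - r \<le> gdist \<Gamma> y z" if "chain_length \<Gamma> x y r" for r
    proof (rule gdist_ge[OF R(2,3)])
      fix s assume "chain_length \<Gamma> y z s"
      thus "gdist \<Gamma> x z - r \<le> s" using gdist_le[OF chain_length_trans[OF _ that]] by fastforce
    qed
    hence "gdist \<Gamma> x z - gdist \<Gamma> y z \<le> gdist \<Gamma> x y" by (intro gdist_ge[OF R(1,2)]) (fastforce)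
    thus ?thesis by simp
  qed
qed

lemma near_vertex:
  assumes "x \<in> R" obtains v where "v \<in> verts \<Gamma>" "gdist \<Gamma> x (vpoint v) \<le> 1/2"
  using near_vertex_chain[OF assms] gdist_le by (meson order_trans)

text \<open>Lower bounds for distances come from functions on the vertices that are \<open>1\<close>-Lipschitz along
  the edges, extended linearly.\<close>

definition linear_ext :: "('v \<Rightarrow> real) \<Rightarrow> ('v \<Rightarrow> real) \<Rightarrow> real" where
  "linear_ext h x = (\<Sum>v | x v \<noteq> 0. x v * h v)"

lemma linear_ext_vpoint: "linear_ext h (vpoint v) = h v"
proof -
  have "{u. vpoint v u \<noteq> 0} = {v}" by (auto simp: vpoint_def indicator_def)
  thus ?thesis by (simp add: linear_ext_def vpoint_simps)
qed

lemma linear_ext_cell: "u \<noteq> w \<Longrightarrow> x \<in> cell {u, w} \<Longrightarrow> linear_ext h x = x u * h u + x w * h w"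
proof -
  assume uw: "u \<noteq> w" "x \<in> cell {u, w}"
  hence "{v. x v \<noteq> 0} \<subseteq> {u, w}" by (auto simp: cell_edge)
  hence "linear_ext h x = (\<Sum>v\<in>{u, w}. x v * h v)" unfolding linear_ext_def by (intro sum.mono_neutral_left) auto
  thus ?thesis using uw by simp
qed

text \<open>On an edge the two coordinates change by opposite amounts, so each piece of a path
  changes the linear extension by at most its length.\<close>

lemma gdist_lower:
  assumes h: "\<And>u w. {u, w} \<in> edges \<Gamma> \<Longrightarrow> u \<noteq> w \<Longrightarrow> \<bar>h u - h w\<bar> \<le> edge_len \<Gamma> {u, w}" and R: "x \<in> R" "y \<in> R"
  shows "\<bar>linear_ext h x - linear_ext h y\<bar> \<le> gdist \<Gamma> x y"
proof (rule gdist_ge[OF R])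
  fix r assume "chain_length \<Gamma> x y r"
  thus "\<bar>linear_ext h x - linear_ext h y\<bar> \<le> r"
  proof (induction rule: chain_length.induct)
    case (refl x) thus ?case by simp
  next
    case (step x y r e z)
    obtain u w where e: "e = {u, w}" "u \<noteq> w" using edge step.hyps by blast
    have c: "y w = 1 - y u" "z w = 1 - z u" using step.hyps e by (auto simp: cell_edge)
    have "linear_ext h y - linear_ext h z = (y u - z u) * (h u - h w)"
      using linear_ext_cell[of u w y h] linear_ext_cell[of u w z h] step.hyps e c by (simp add: algebra_simps)
    hence "\<bar>linear_ext h y - linear_ext h z\<bar> = \<bar>y u - z u\<bar> * \<bar>h u - h w\<bar>" by (simp add: abs_mult)
    also have "\<dots> \<le> \<bar>y u - z u\<bar> * edge_len \<Gamma> e" using h[of u w] step.hyps e by (intro mult_left_mono) auto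
    also have "\<dots> = edge_len \<Gamma> e * (\<Sum>v\<in>e. \<bar>y v - z v\<bar>) / 2" using edge_sum[of u w y z] step.hyps e by simp
    finally show ?case using step.IH by linarith
  qed
qed

lemma gdist_vertices_lower:
  assumes "\<And>u w. {u, w} \<in> edges \<Gamma> \<Longrightarrow> u \<noteq> w \<Longrightarrow> \<bar>h u - h w\<bar> \<le> edge_len \<Gamma> {u, w}" "u \<in> verts \<Gamma>" "w \<in> verts \<Gamma>"
  shows "\<bar>h u - h w\<bar> \<le> gdist \<Gamma> (vpoint u) (vpoint w)"
  using gdist_lower[OF assms(1), of "vpoint u" "vpoint w"] assms(2,3) by (simp add: vpoint_R linear_ext_vpoint)

lemma gdist_edge:
  assumes "{u, w} \<in> edges \<Gamma>" "u \<noteq> w"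
  shows "gdist \<Gamma> (vpoint u) (vpoint w) \<le> edge_len \<Gamma> {u, w}"
proof -
  have w: "vpoint w \<in> cell {u, w}" using vpoint_cell[of w u] assms by (simp add: insert_commute)
  from gdist_le[OF chain_edge[OF assms(1) vpoint_cell[OF assms(2)] w]]
  show ?thesis using edge_sum[OF assms(2) vpoint_cell[OF assms(2)] w] assms by (simp add: vpoint_simps)
qed

text \<open>The affine parametrization does not increase distances, and as its ends are at distance
  1 it cannot decrease any.\<close>

lemma edge_geodesic:
  assumes e: "{u, w} \<in> edges \<Gamma>" "u \<noteq> w" "edge_len \<Gamma> {u, w} = 1" and dist: "gdist \<Gamma> (vpoint u) (vpoint w) = 1"
  shows "\<exists>\<sigma>. geodesic R (gdist \<Gamma>) {0..1} \<sigma> \<and> \<sigma> 0 = vpoint u \<and> \<sigma> 1 = vpoint w"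
proof -
  define \<sigma> where "\<sigma> t v = (1 - t) * vpoint u v + t * vpoint w v" for t :: real and v
  have c: "\<sigma> t \<in> cell {u, w}" if "t \<in> {0..1}" for t
    using that e by (auto simp: cell_edge \<sigma>_def vpoint_simps)
  have M: "\<sigma> t \<in> R" if "t \<in> {0..1}" for t using cell_R[OF e(1) c[OF that]] .
  have up: "gdist \<Gamma> (\<sigma> s) (\<sigma> t) \<le> \<bar>s - t\<bar>" if "s \<in> {0..1}" "t \<in> {0..1}" for s t
  proof -
    have "\<bar>\<sigma> s u - \<sigma> t u\<bar> = \<bar>s - t\<bar>" using e by (simp add: \<sigma>_def vpoint_simps)
    thus ?thesis using gdist_le[OF chain_edge[OF e(1) c[OF that(1)] c[OF that(2)]]] edge_sum[OF e(2) c[OF that(1)] c[OF that(2)]] e by simp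
  qed
  have 01: "\<sigma> 0 = vpoint u" "\<sigma> 1 = vpoint w" by (auto simp: \<sigma>_def)
  have "geodesic R (gdist \<Gamma>) {0..1} \<sigma>"
  proof (rule geodesicI)
    fix s t :: real assume st: "s \<in> {0..1}" "t \<in> {0..1}" "s < t"
    have "gdist \<Gamma> (\<sigma> 0) (\<sigma> 1) \<le> gdist \<Gamma> (\<sigma> 0) (\<sigma> s) + gdist \<Gamma> (\<sigma> s) (\<sigma> 1)"
      "gdist \<Gamma> (\<sigma> s) (\<sigma> 1) \<le> gdist \<Gamma> (\<sigma> s) (\<sigma> t) + gdist \<Gamma> (\<sigma> t) (\<sigma> 1)" using M st by (auto intro!: tri)
    thus "gdist \<Gamma> (\<sigma> s) (\<sigma> t) = t - s"
      using up[of 0 s] up[of s t] up[of t 1] st dist 01 by simp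
  qed (use M in \<open>auto simp: is_interval_cc\<close>)
  thus ?thesis using 01 by blast
qed

end

section \<open>Distance as the least length of a walk\<close>

definition rdist :: "('a \<times> 'a) set \<Rightarrow> 'a \<Rightarrow> 'a \<Rightarrow> nat" where
  "rdist R x y = (LEAST n. (x, y) \<in> R ^^ n)"

lemma rdist_le: "(x, y) \<in> R ^^ n \<Longrightarrow> rdist R x y \<le> n"
  unfolding rdist_def by (rule Least_le)

lemma rdist_relpow: "(x, y) \<in> R\<^sup>* \<Longrightarrow> (x, y) \<in> R ^^ rdist R x y"
  unfolding rdist_def by (rule LeastI_ex) (simp add: rtrancl_power)

lemma rdist_sym: "sym R \<Longrightarrow> rdist R x y = rdist R y x"
proof -
  assume R: "sym R"
  have "(x, y) \<in> R ^^ n \<longleftrightarrow> (y, x) \<in> R ^^ n" for n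
    by (rule iffI) (erule relpow_sym[OF R])+
  thus ?thesis unfolding rdist_def by simp
qed

lemma graph_metric_rdist:
  assumes "sym R" "R \<subseteq> V \<times> V" and conn: "\<And>x y. x \<in> V \<Longrightarrow> y \<in> V \<Longrightarrow> (x, y) \<in> R\<^sup>*"
  shows "graph_metric V (rdist R)"
proof
  fix x y assume V: "x \<in> V" "y \<in> V"
  show "rdist R x y = 0 \<longleftrightarrow> x = y"
  proof
    assume "rdist R x y = 0" thus "x = y" using rdist_relpow[OF conn[OF V]] by simp
  next
    assume "x = y" thus "rdist R x y = 0" using rdist_le[where x = x and y = y and R = R and n = 0] by simp
  qed
  obtain f where f: "f 0 = x" "f (rdist R x y) = y" "\<And>i. i < rdist R x y \<Longrightarrow> (f i, f (Suc i)) \<in> R"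
    using rdist_relpow[OF conn[OF V]] unfolding relpow_fun_conv by blast
  define p where "p i = f (min i (rdist R x y))" for i
  have "f i \<in> V" if "i \<le> rdist R x y" for i
    using that f V assms(2) by (cases i) (auto simp: Suc_le_eq)
  hence "\<forall>i. p i \<in> V" by (simp add: p_def)
  moreover have "\<forall>i<rdist R x y. rdist R (p i) (p (Suc i)) \<le> 1"
  proof (intro allI impI)
    fix i assume "i < rdist R x y"
    hence "(p i, p (Suc i)) \<in> R ^^ 1" using f(3)[of i] by (simp add: p_def min_absorb1)
    thus "rdist R (p i) (p (Suc i)) \<le> 1" by (rule rdist_le)
  qed
  ultimately show "\<exists>p. p 0 = x \<and> p (rdist R x y) = y \<and> (\<forall>i. p i \<in> V) \<and> (\<forall>i<rdist R x y. rdist R (p i) (p (Suc i)) \<le> 1)"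
    using f by (intro exI[of _ p]) (simp add: p_def)
next
  fix x y show "rdist R x y = rdist R y x" using assms(1) by (rule rdist_sym)
next
  fix x y z assume V: "x \<in> V" "y \<in> V" "z \<in> V"
  have "(x, z) \<in> R ^^ (rdist R x y + rdist R y z)"
    unfolding relpow_add using rdist_relpow[OF conn] V by blast
  thus "rdist R x z \<le> rdist R x y + rdist R y z" by (rule rdist_le)
qed

lemma rdist_1:
  assumes "(x, y) \<in> R\<^sup>*" "rdist R x y = 1" shows "(x, y) \<in> R"
  using rdist_relpow[OF assms(1)] assms(2) by simp

lemma edge_chain:
  assumes "{u, w} \<in> edges \<Gamma>" "u \<noteq> w" "chain_length \<Gamma> x (vpoint u) r"
  shows "chain_length \<Gamma> x (vpoint w) (r + edge_len \<Gamma> {u, w})"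
proof -
  have "chain_length \<Gamma> x (vpoint w) (r + edge_len \<Gamma> {u, w} * (\<Sum>v\<in>{u, w}. \<bar>vpoint u v - vpoint w v\<bar>) / 2)"
    using assms(1,3) vpoint_cell[OF assms(2)] vpoint_cell[of w u] assms(2)
    by (intro chain_length.step) (auto simp: insert_commute)
  moreover have "(\<Sum>v\<in>{u, w}. \<bar>vpoint u v - vpoint w v\<bar> :: real) = 2" using assms(2) by (simp add: vpoint_simps)
  ultimately show ?thesis by simp
qed

section \<open>Cayley graphs and coned-off Cayley graphs\<close>

locale fg_group = group G for G :: "('a, 'b) monoid_scheme" (structure) +
  fixes S :: "'a set"
  assumes fin_gen: "finite_generating_set G S"
begin

abbreviation "V \<equiv> carrier G"

text \<open>If \<open>\<one> \<in> S\<close>, this relation has loops; they do not change distances,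
  and \<open>cayley_edge_iff\<close> excludes them on both sides.\<close>

definition RX :: "('a \<times> 'a) set" where
  "RX = {(g, h). g \<in> V \<and> h \<in> V \<and> (\<exists>s\<in>S. h = g \<otimes> s \<or> g = h \<otimes> s)}"

definition wd :: "'a \<Rightarrow> 'a \<Rightarrow> nat" where "wd = rdist RX"

lemma S_V: "s \<in> S \<Longrightarrow> s \<in> V" and S_fin: "finite S" and S_gen: "generate G S = V"
  using fin_gen unfolding finite_generating_set_def by auto

lemma RX_sym: "sym RX"
  unfolding RX_def sym_def by blast

lemma RX_V: "RX \<subseteq> V \<times> V"
  unfolding RX_def by auto

lemma RX_conn:
  assumes "x \<in> V" "y \<in> V" shows "(x, y) \<in> RX\<^sup>*"
proof -
  have "(g, g \<otimes> h) \<in> RX\<^sup>*" if "h \<in> generate G S" "g \<in> V" for g h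
    using that
  proof (induction arbitrary: g rule: generate.induct)
    case one thus ?case by simp
  next
    case (incl h) thus ?case using S_V by (intro r_into_rtrancl) (auto simp: RX_def)
  next
    case (inv h)
    hence "g = (g \<otimes> inv h) \<otimes> h" using S_V by (simp add: m_assoc)
    thus ?case using inv S_V by (intro r_into_rtrancl) (auto simp: RX_def)
  next
    case (eng h1 h2)
    have V: "h1 \<in> V" "h2 \<in> V" using eng S_gen by auto
    hence "(g, g \<otimes> h1) \<in> RX\<^sup>*" "(g \<otimes> h1, g \<otimes> h1 \<otimes> h2) \<in> RX\<^sup>*" using eng by auto
    hence "(g, g \<otimes> h1 \<otimes> h2) \<in> RX\<^sup>*" by (rule rtrancl_trans)
    thus ?case using eng V by (simp add: m_assoc)
  qed
  from this[of "inv x \<otimes> y" x] show ?thesis using assms S_gen by (simp add: m_assoc[symmetric])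
qed

sublocale W: graph_metric V wd
  unfolding wd_def by (rule graph_metric_rdist[OF RX_sym RX_V RX_conn])

lemma wd_1: "x \<in> V \<Longrightarrow> y \<in> V \<Longrightarrow> wd x y = 1 \<Longrightarrow> (x, y) \<in> RX"
  unfolding wd_def using rdist_1[OF RX_conn] by blast

lemma RX_wd: "(x, y) \<in> RX \<Longrightarrow> wd x y \<le> 1"
  unfolding wd_def using rdist_le[where x = x and y = y and R = RX and n = 1] by simp

lemma relpow_image:
  assumes "\<And>x y. (x, y) \<in> R \<Longrightarrow> (f x, f y) \<in> R'" "(x, y) \<in> R ^^ n" shows "(f x, f y) \<in> R' ^^ n"
  using assms(2) by (induction n arbitrary: y) (use assms(1) in auto)

lemma RX_left: "g \<in> V \<Longrightarrow> (x, y) \<in> RX \<Longrightarrow> (g \<otimes> x, g \<otimes> y) \<in> RX"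
  using S_V by (auto simp: RX_def m_assoc)

lemma inv_left: "g \<in> V \<Longrightarrow> x \<in> V \<Longrightarrow> inv g \<otimes> (g \<otimes> x) = x" "g \<in> V \<Longrightarrow> x \<in> V \<Longrightarrow> g \<otimes> (inv g \<otimes> x) = x"
  by (simp_all add: m_assoc[symmetric])

lemma left_inv_dist:
  assumes R: "\<And>g x y. g \<in> V \<Longrightarrow> (x, y) \<in> R \<Longrightarrow> (g \<otimes> x, g \<otimes> y) \<in> R" and V: "g \<in> V" "x \<in> V" "y \<in> V"
  shows "rdist R (g \<otimes> x) (g \<otimes> y) = rdist R x y"
proof -
  have "(g \<otimes> x, g \<otimes> y) \<in> R ^^ n \<longleftrightarrow> (x, y) \<in> R ^^ n" for n
  proof
    assume "(x, y) \<in> R ^^ n"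
    thus "(g \<otimes> x, g \<otimes> y) \<in> R ^^ n" by (rule relpow_image[rotated]) (rule R[OF V(1)])
  next
    assume "(g \<otimes> x, g \<otimes> y) \<in> R ^^ n"
    hence "(inv g \<otimes> (g \<otimes> x), inv g \<otimes> (g \<otimes> y)) \<in> R ^^ n" by (rule relpow_image[rotated]) (use R V in auto)
    thus "(x, y) \<in> R ^^ n" using V by (simp add: inv_left)
  qed
  thus ?thesis unfolding rdist_def by simp
qed

lemma wd_left: "g \<in> V \<Longrightarrow> x \<in> V \<Longrightarrow> y \<in> V \<Longrightarrow> wd (g \<otimes> x) (g \<otimes> y) = wd x y"
  unfolding wd_def by (rule left_inv_dist[OF RX_left])

lemma wd_ball:
  assumes "x \<in> V" shows "finite {y \<in> V. wd x y \<le> n}"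
proof (induction n)
  case 0
  have "{y \<in> V. wd x y \<le> 0} \<subseteq> {x}" using W.d0 assms by auto
  thus ?case by (rule finite_subset) simp
next
  case (Suc n)
  let ?A = "{y \<in> V. wd x y \<le> n}"
  have "{y \<in> V. wd x y \<le> Suc n} \<subseteq> ?A \<union> (\<Union>z\<in>?A. (\<lambda>s. z \<otimes> s) ` S \<union> (\<lambda>s. z \<otimes> inv s) ` S)"
  proof
    fix y assume y: "y \<in> {y \<in> V. wd x y \<le> Suc n}"
    show "y \<in> ?A \<union> (\<Union>z\<in>?A. (\<lambda>s. z \<otimes> s) ` S \<union> (\<lambda>s. z \<otimes> inv s) ` S)"
    proof (cases "wd x y \<le> n")
      case False
      then obtain p where p: "W.geo (Suc n) p" "p 0 = x" "p (Suc n) = y"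
        using W.geo_ex[OF assms, of y] y by (metis (mono_tags, lifting) le_SucE mem_Collect_eq)
      have z: "p n \<in> V" "wd x (p n) \<le> n" "wd (p n) y = 1"
        using W.geoV[OF p(1), of n] W.geoD[OF p(1), of 0 n] W.geoD[OF p(1), of n "Suc n"] p by auto
      hence "(p n, y) \<in> RX" using wd_1 y by blast
      then obtain s where s: "s \<in> S" "y = p n \<otimes> s \<or> p n = y \<otimes> s" unfolding RX_def by blast
      have "p n = y \<otimes> s \<Longrightarrow> y = p n \<otimes> inv s" using s y S_V by (simp add: m_assoc)
      hence "y \<in> (\<lambda>s. p n \<otimes> s) ` S \<union> (\<lambda>s. p n \<otimes> inv s) ` S" using s by blast
      thus ?thesis using z by blast
    qed (use y in blast)
  qed
  moreover have "finite (?A \<union> (\<Union>z\<in>?A. (\<lambda>s. z \<otimes> s) ` S \<union> (\<lambda>s. z \<otimes> inv s) ` S))" using Suc S_fin by simp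
  ultimately show ?case by (rule finite_subset)
qed

abbreviation "\<Gamma>X \<equiv> cayley_graph G S"

lemma cayley_edge_iff: "{u, w} \<in> edges \<Gamma>X \<and> u \<noteq> w \<longleftrightarrow> (u, w) \<in> RX \<and> u \<noteq> w"
proof
  assume a: "{u, w} \<in> edges \<Gamma>X \<and> u \<noteq> w"
  then obtain g s where gs: "{u, w} = {g, g \<otimes> s}" "g \<in> V" "s \<in> S" unfolding cayley_graph_def by auto
  hence "g \<otimes> s \<in> V" using S_V by simp
  thus "(u, w) \<in> RX \<and> u \<noteq> w" using a gs unfolding RX_def doubleton_eq_iff by auto
next
  assume a: "(u, w) \<in> RX \<and> u \<noteq> w"
  then obtain s where s: "s \<in> S" "u \<in> V" "w \<in> V" "w = u \<otimes> s \<or> u = w \<otimes> s" unfolding RX_def by blast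
  hence "s \<noteq> \<one>" using a by auto
  thus "{u, w} \<in> edges \<Gamma>X \<and> u \<noteq> w" using a s unfolding cayley_graph_def by (auto simp: insert_commute)
qed

lemma cayley_edges: "e \<in> edges \<Gamma>X \<Longrightarrow> \<exists>u w. e = {u, w} \<and> u \<noteq> w \<and> u \<in> V \<and> w \<in> V"
proof -
  assume "e \<in> edges \<Gamma>X"
  then obtain g s where gs: "e = {g, g \<otimes> s}" "g \<in> V" "s \<in> S" "s \<noteq> \<one>" unfolding cayley_graph_def by auto
  have "g \<noteq> g \<otimes> s" using gs S_V l_cancel_one' by metis
  thus ?thesis using gs S_V by blast
qed

lemma cayley_simps: "verts \<Gamma>X = V" "edge_len \<Gamma>X e = 1"
  unfolding cayley_graph_def by auto

lemma cayley_chain: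
  assumes "(x, y) \<in> RX ^^ n" "x \<in> V" shows "\<exists>r\<le>real n. chain_length \<Gamma>X (vpoint x) (vpoint y) r"
  using assms(1)
proof (induction n arbitrary: y)
  case 0
  have "vpoint x \<in> realization \<Gamma>X" using assms(2) unfolding realization_def by (auto simp: cell_vertex cayley_simps)
  thus ?case using 0 chain_length.refl by fastforce
next
  case (Suc n)
  then obtain z where z: "(x, z) \<in> RX ^^ n" "(z, y) \<in> RX" by auto
  obtain r where r: "r \<le> real n" "chain_length \<Gamma>X (vpoint x) (vpoint z) r" using Suc.IH z by blast
  show ?case
  proof (cases "z = y")
    case True thus ?thesis using r by (intro exI[of _ r]) auto
  next
    case False
    hence "{z, y} \<in> edges \<Gamma>X" using cayley_edge_iff z by blast
    from edge_chain[OF this False r(2)] show ?thesis using r(1) by (intro exI[of _ "r + 1"]) (auto simp: cayley_simps)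
  qed
qed

sublocale X: connected_graph \<Gamma>X
proof
  show "\<exists>r. chain_length \<Gamma>X (vpoint u) (vpoint w) r" if "u \<in> verts \<Gamma>X" "w \<in> verts \<Gamma>X" for u w
    using cayley_chain[OF rdist_relpow[OF RX_conn]] that unfolding cayley_simps by blast
qed (use cayley_edges in \<open>auto simp: cayley_simps\<close>)

text \<open>A walk of \<open>RX\<close> is a path of the same length at most; conversely
  \<open>wd g\<close> changes by at most 1 along each edge, so it serves as test function in
  \<open>gdist_vertices_lower\<close>.\<close>

lemma gdist_wd:
  assumes "g \<in> V" "h \<in> V" shows "gdist \<Gamma>X (vpoint g) (vpoint h) = real (wd g h)"
proof (rule antisym)
  show "gdist \<Gamma>X (vpoint g) (vpoint h) \<le> real (wd g h)"
    using cayley_chain[OF rdist_relpow[OF RX_conn[OF assms]] assms(1)] X.gdist_le unfolding wd_def by fastforce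
  have "\<bar>real (wd g u) - real (wd g w)\<bar> \<le> edge_len \<Gamma>X {u, w}" if "{u, w} \<in> edges \<Gamma>X" "u \<noteq> w" for u w
  proof -
    have R: "(u, w) \<in> RX" using that cayley_edge_iff by blast
    hence V: "u \<in> V" "w \<in> V" using RX_V by auto
    show ?thesis using W.dtri[OF assms(1) V] W.dtri[OF assms(1) V(2,1)] RX_wd[OF R] W.dsym[of u w] by (simp add: cayley_simps)
  qed
  from X.gdist_vertices_lower[of "\<lambda>u. real (wd g u)", OF this, of g h]
  show "real (wd g h) \<le> gdist \<Gamma>X (vpoint g) (vpoint h)" using assms by (simp add: cayley_simps)
qed

end

section \<open>The coned-off graph of a group and its distances between vertices\<close>

locale rh_group = fg_group G S for G :: "('a, 'b) monoid_scheme" (structure) and S +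
  fixes \<P> :: "'a set set"
  assumes fin_P: "finite \<P>" and sub_P: "\<And>P. P \<in> \<P> \<Longrightarrow> subgroup P G"
    and rh: "relatively_hyperbolic G S \<P>"
begin

abbreviation "CC \<equiv> peripheral_cosets G \<P>"
abbreviation "\<Gamma>Y \<equiv> coned_off_graph G S \<P>"

lemma coset_V: "C \<in> CC \<Longrightarrow> C \<subseteq> V"
  unfolding peripheral_cosets_def using sub_P l_coset_subset_G subgroup.subset by blast

lemma coset_rep:
  assumes "C \<in> CC" "x \<in> C" shows "\<exists>P\<in>\<P>. C = x <#\<^bsub>G\<^esub> P"
proof -
  obtain g P where gP: "C = g <#\<^bsub>G\<^esub> P" "g \<in> V" "P \<in> \<P>" using assms(1) unfolding peripheral_cosets_def by blast
  thus ?thesis using l_repr_independence[of x g P] assms(2) sub_P by blast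
qed

lemma coset_ne: "C \<in> CC \<Longrightarrow> C \<noteq> {}"
  unfolding peripheral_cosets_def l_coset_def using subgroup.one_closed[OF sub_P] by fast

lemma coset_left: "g \<in> V \<Longrightarrow> C \<in> CC \<Longrightarrow> g <#\<^bsub>G\<^esub> C \<in> CC"
proof -
  assume g: "g \<in> V" "C \<in> CC"
  then obtain h P where hP: "C = h <#\<^bsub>G\<^esub> P" "h \<in> V" "P \<in> \<P>" unfolding peripheral_cosets_def by blast
  hence "g <#\<^bsub>G\<^esub> C = (g \<otimes> h) <#\<^bsub>G\<^esub> P" using lcos_m_assoc[of P g h] subgroup.subset[OF sub_P] g by simp
  thus ?thesis using g hP unfolding peripheral_cosets_def by blast
qed

lemma lcos_mem: "g <#\<^bsub>G\<^esub> C = (\<lambda>x. g \<otimes> x) ` C"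
  unfolding l_coset_def by auto

text \<open>Elements of one coset are related because the path through the cone point has length 1.
  Thus \<open>rd\<close> is the distance of the coned-off graph restricted to the group, as
  \<open>Y_dist_VV\<close> confirms.\<close>

definition RY :: "('a \<times> 'a) set" where
  "RY = RX \<union> {(g, h). \<exists>C\<in>CC. g \<in> C \<and> h \<in> C}"

definition rd :: "'a \<Rightarrow> 'a \<Rightarrow> nat" where "rd = rdist RY"

lemma RY_sym: "sym RY"
  unfolding RY_def by (rule sym_Un[OF RX_sym]) (auto simp: sym_def)

lemma RY_V: "RY \<subseteq> V \<times> V"
  using RX_V coset_V unfolding RY_def by auto

lemma RY_conn: "x \<in> V \<Longrightarrow> y \<in> V \<Longrightarrow> (x, y) \<in> RY\<^sup>*"
  using RX_conn[of x y] rtrancl_mono[of RX RY] unfolding RY_def by blast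

lemma RY_left: "g \<in> V \<Longrightarrow> (x, y) \<in> RY \<Longrightarrow> (g \<otimes> x, g \<otimes> y) \<in> RY"
proof -
  assume g: "g \<in> V" and "(x, y) \<in> RY"
  then consider "(x, y) \<in> RX" | C where "C \<in> CC" "x \<in> C" "y \<in> C" unfolding RY_def by blast
  thus "(g \<otimes> x, g \<otimes> y) \<in> RY"
  proof cases
    case 1 thus ?thesis using RX_left[OF g] by (simp add: RY_def)
  next
    case 2
    hence "g \<otimes> x \<in> g <#\<^bsub>G\<^esub> C" "g \<otimes> y \<in> g <#\<^bsub>G\<^esub> C" unfolding lcos_mem by blast+
    thus ?thesis using coset_left[OF g 2(1)] unfolding RY_def by blast
  qed
qed

lemma rd_left: "g \<in> V \<Longrightarrow> x \<in> V \<Longrightarrow> y \<in> V \<Longrightarrow> rd (g \<otimes> x) (g \<otimes> y) = rd x y"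
  unfolding rd_def by (rule left_inv_dist[OF RY_left])

sublocale RD: graph_metric V rd
  unfolding rd_def by (rule graph_metric_rdist[OF RY_sym RY_V RY_conn])

lemma rd_1: "x \<in> V \<Longrightarrow> y \<in> V \<Longrightarrow> rd x y = 1 \<Longrightarrow> (x, y) \<in> RY"
  unfolding rd_def using rdist_1[OF RY_conn] by blast

lemma RY_rd: "(x, y) \<in> RY \<Longrightarrow> rd x y \<le> 1"
  unfolding rd_def using rdist_le[where x = x and y = y and R = RY and n = 1] by simp

lemma rd_le_wd: "x \<in> V \<Longrightarrow> y \<in> V \<Longrightarrow> rd x y \<le> wd x y"
proof -
  assume V: "x \<in> V" "y \<in> V"
  have "(x, y) \<in> RX ^^ wd x y" using rdist_relpow[OF RX_conn[OF V]] unfolding wd_def .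
  hence "(x, y) \<in> RY ^^ wd x y"
    using relpow_image[where f = "\<lambda>x. x" and R = RX and R' = RY and x = x and y = y and n = "wd x y"] unfolding RY_def by blast
  thus ?thesis unfolding rd_def by (rule rdist_le)
qed

lemma Y_verts: "verts \<Gamma>Y = Inl ` V \<union> Inr ` CC"
  unfolding coned_off_graph_def by simp

lemma Y_len: "edge_len \<Gamma>Y e = (if e \<subseteq> range Inl then 1 else 1/2)"
  unfolding coned_off_graph_def by simp

lemma Y_edge_cases:
  assumes "e \<in> edges \<Gamma>Y"
  obtains u w where "e = {Inl u, Inl w}" "u \<noteq> w" "(u, w) \<in> RX"
  | u C where "e = {Inl u, Inr C}" "C \<in> CC" "u \<in> C"
proof -
  consider e' where "e' \<in> edges \<Gamma>X" "e = Inl ` e'" | u C where "e = {Inl u, Inr C}" "C \<in> CC" "u \<in> C"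
    using assms unfolding coned_off_graph_def by auto
  thus ?thesis
  proof cases
    case 1
    then obtain u w where "e' = {u, w}" "u \<noteq> w" using cayley_edges by blast
    thus ?thesis using that(1) 1 cayley_edge_iff by auto
  next
    case 2 thus ?thesis using that(2) by blast
  qed
qed

lemma Y_edge_X: "(u, w) \<in> RX \<Longrightarrow> u \<noteq> w \<Longrightarrow> {Inl u, Inl w} \<in> edges \<Gamma>Y"
proof -
  assume "(u, w) \<in> RX" "u \<noteq> w"
  hence "(Inl :: 'a \<Rightarrow> 'a + 'a set) ` {u, w} \<in> (\<lambda>e. Inl ` e) ` edges \<Gamma>X" using cayley_edge_iff[of u w] by blast
  thus ?thesis unfolding coned_off_graph_def by simp
qed

lemma Y_edge_C: "C \<in> CC \<Longrightarrow> u \<in> C \<Longrightarrow> {Inl u, Inr C} \<in> edges \<Gamma>Y"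
  unfolding coned_off_graph_def by auto

lemma Y_len_X: "edge_len \<Gamma>Y {Inl u, Inl w} = 1" and Y_len_C: "edge_len \<Gamma>Y {Inl u, Inr C} = 1/2" "edge_len \<Gamma>Y {Inr C, Inl u} = 1/2"
  unfolding Y_len by auto

lemma Y_chain:
  assumes "(x, y) \<in> RY ^^ n" "x \<in> V" shows "\<exists>r\<le>real n. chain_length \<Gamma>Y (vpoint (Inl x)) (vpoint (Inl y)) r"
  using assms(1)
proof (induction n arbitrary: y)
  case 0
  have "vpoint (Inl x) \<in> realization \<Gamma>Y" using assms(2) unfolding realization_def Y_verts by (auto simp: cell_vertex)
  thus ?case using 0 chain_length.refl by fastforce
next
  case (Suc n)
  then obtain z where z: "(x, z) \<in> RY ^^ n" "(z, y) \<in> RY" by auto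
  obtain r where r: "r \<le> real n" "chain_length \<Gamma>Y (vpoint (Inl x)) (vpoint (Inl z)) r" using Suc.IH z by blast
  consider "z = y" | "z \<noteq> y" "(z, y) \<in> RX" | C where "C \<in> CC" "z \<in> C" "y \<in> C" using z unfolding RY_def by blast
  thus ?case
  proof cases
    case 1 thus ?thesis using r by (intro exI[of _ r]) auto
  next
    case 2
    from edge_chain[OF Y_edge_X[OF 2(2,1)] _ r(2)] show ?thesis using r(1) 2
      by (intro exI[of _ "r + 1"]) (auto simp: Y_len_X)
  next
    case 3
    have "chain_length \<Gamma>Y (vpoint (Inl x)) (vpoint (Inr C)) (r + 1/2)"
      using edge_chain[OF Y_edge_C[OF 3(1,2)] _ r(2)] by (simp add: Y_len_C)
    from edge_chain[OF _ _ this, of "Inl y"] Y_edge_C[OF 3(1,3)]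
    have "chain_length \<Gamma>Y (vpoint (Inl x)) (vpoint (Inl y)) (r + 1/2 + 1/2)" by (simp add: Y_len_C insert_commute)
    thus ?thesis using r(1) by (intro exI[of _ "r + 1/2 + 1/2"]) auto
  qed
qed

sublocale Y: connected_graph \<Gamma>Y
proof
  show "\<exists>u w. e = {u, w} \<and> u \<noteq> w \<and> u \<in> verts \<Gamma>Y \<and> w \<in> verts \<Gamma>Y" if "e \<in> edges \<Gamma>Y" for e
    using that
  proof (cases rule: Y_edge_cases)
    case (1 u w) thus ?thesis using RX_V by (intro exI[of _ "Inl u"] exI[of _ "Inl w"]) (auto simp: Y_verts)
  next
    case (2 u C)
    hence "u \<in> V" using coset_V by blast
    thus ?thesis using 2(1,2) by (intro exI[of _ "Inl u"] exI[of _ "Inr C"]) (simp add: Y_verts)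
  qed
  show "0 \<le> edge_len \<Gamma>Y e" "edge_len \<Gamma>Y e \<le> 1" for e by (auto simp: Y_len)
  have 1: "\<exists>x\<in>V. \<exists>k. chain_length \<Gamma>Y (vpoint u) (vpoint (Inl x)) k \<and>
      (\<forall>v r. chain_length \<Gamma>Y v (vpoint (Inl x)) r \<longrightarrow> chain_length \<Gamma>Y v (vpoint u) (r + k))"
    if "u \<in> verts \<Gamma>Y" for u
  proof -
    have uR: "vpoint u \<in> realization \<Gamma>Y" using that unfolding realization_def by (auto simp: cell_vertex)
    show ?thesis
    proof (cases u)
      case (Inl x)
      hence "x \<in> V" using that by (auto simp: Y_verts)
      thus ?thesis using chain_length.refl[OF uR] Inl by (intro bexI[of _ x] exI[of _ 0]) simp_all
    next
      case (Inr C)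
      hence C: "C \<in> CC" using that by (auto simp: Y_verts)
      obtain x where x: "x \<in> C" using coset_ne[OF C] by blast
      have e: "{Inr C, Inl x} \<in> edges \<Gamma>Y" "{Inl x, Inr C} \<in> edges \<Gamma>Y" using Y_edge_C[OF C x] by (simp_all add: insert_commute)
      have "chain_length \<Gamma>Y (vpoint u) (vpoint (Inl x)) (1/2)"
        using edge_chain[OF e(1) _ chain_length.refl[OF uR[unfolded Inr]]] Inr by (simp add: Y_len_C)
      moreover have "chain_length \<Gamma>Y v (vpoint u) (r + 1/2)" if "chain_length \<Gamma>Y v (vpoint (Inl x)) r" for v r
        using edge_chain[OF e(2) _ that] Inr by (simp add: Y_len_C)
      moreover have "x \<in> V" using coset_V[OF C] x by blast
      ultimately show ?thesis by (intro bexI[of _ x] exI[of _ "1/2"] conjI allI impI)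
    qed
  qed
  show "\<exists>r. chain_length \<Gamma>Y (vpoint u) (vpoint w) r" if uw: "u \<in> verts \<Gamma>Y" "w \<in> verts \<Gamma>Y" for u w
  proof -
    obtain x k where x: "x \<in> V" "chain_length \<Gamma>Y (vpoint u) (vpoint (Inl x)) k" using 1[OF uw(1)] by auto
    obtain y l where y: "y \<in> V" "\<forall>v r. chain_length \<Gamma>Y v (vpoint (Inl y)) r \<longrightarrow> chain_length \<Gamma>Y v (vpoint w) (r + l)"
      using 1[OF uw(2)] by auto
    obtain s where "chain_length \<Gamma>Y (vpoint (Inl x)) (vpoint (Inl y)) s" using Y_chain[OF rdist_relpow[OF RY_conn[OF x(1) y(1)]] x(1)] by blast
    from y(2)[rule_format, OF chain_length_trans[OF this x(2)]] show ?thesis by (rule exI)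
  qed
qed

lemma Y_lip:
  assumes hX: "\<And>u w. (u, w) \<in> RX \<Longrightarrow> \<bar>h (Inl u) - h (Inl w)\<bar> \<le> 1"
    and hC: "\<And>u C. C \<in> CC \<Longrightarrow> u \<in> C \<Longrightarrow> \<bar>h (Inl u) - h (Inr C)\<bar> \<le> 1/2"
    and e: "{a, b} \<in> edges \<Gamma>Y"
  shows "\<bar>h a - h b\<bar> \<le> edge_len \<Gamma>Y {a, b}"
  using e
proof (cases rule: Y_edge_cases)
  case (1 u w)
  hence "(a = Inl u \<and> b = Inl w) \<or> (a = Inl w \<and> b = Inl u)" by (simp add: doubleton_eq_iff)
  thus ?thesis
  proof (elim disjE conjE)
    assume "a = Inl u" "b = Inl w"
    thus ?thesis using hX[OF 1(3)] by (simp add: Y_len_X)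
  next
    assume "a = Inl w" "b = Inl u"
    thus ?thesis using hX[OF 1(3)] abs_minus_commute[of "h (Inl w)" "h (Inl u)"] by (simp add: Y_len_X)
  qed
next
  case (2 u C)
  hence "(a = Inl u \<and> b = Inr C) \<or> (a = Inr C \<and> b = Inl u)" by (simp add: doubleton_eq_iff)
  thus ?thesis
  proof (elim disjE conjE)
    assume "a = Inl u" "b = Inr C"
    thus ?thesis using hC[OF 2(2,3)] by (simp add: Y_len_C)
  next
    assume "a = Inr C" "b = Inl u"
    thus ?thesis using hC[OF 2(2,3)] abs_minus_commute[of "h (Inr C)" "h (Inl u)"] by (simp add: Y_len_C)
  qed
qed

lemma coset_rd: "C \<in> CC \<Longrightarrow> x \<in> C \<Longrightarrow> y \<in> C \<Longrightarrow> rd x y \<le> 1"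
  by (rule RY_rd) (auto simp: RY_def)

lemma coset_mem_V: "C \<in> CC \<Longrightarrow> x \<in> C \<Longrightarrow> x \<in> V"
  using coset_V by blast

text \<open>The lower bound uses the test function \<open>rd g\<close>, extended to a cone point by
  its infimum over the coset plus 1/2: values on a coset differ by at most 1, so the change along a
  half-edge is at most 1/2.\<close>

lemma Y_dist_VV:
  assumes "g \<in> V" "h \<in> V" shows "gdist \<Gamma>Y (vpoint (Inl g)) (vpoint (Inl h)) = real (rd g h)"
proof (rule antisym)
  show "gdist \<Gamma>Y (vpoint (Inl g)) (vpoint (Inl h)) \<le> real (rd g h)"
    using Y_chain[OF rdist_relpow[OF RY_conn[OF assms]] assms(1)] Y.gdist_le unfolding rd_def by fastforce
  define D where "D C = (INF a\<in>C. real (rd g a))" for C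
  have D: "D C \<le> real (rd g a)" "real (rd g a) \<le> D C + 1" if C: "C \<in> CC" "a \<in> C" for C a
  proof -
    show "D C \<le> real (rd g a)" unfolding D_def using C by (intro cINF_lower) (auto intro!: bdd_belowI[of _ 0])
    have "real (rd g a) - 1 \<le> D C" unfolding D_def
    proof (rule cINF_greatest)
      fix b assume b: "b \<in> C"
      have "rd g a \<le> rd g b + rd b a" using RD.dtri assms(1) coset_mem_V C b by blast
      thus "real (rd g a) - 1 \<le> real (rd g b)" using coset_rd[OF C(1) b C(2)] by simp
    qed (use C in blast)
    thus "real (rd g a) \<le> D C + 1" by simp
  qed
  define h' where "h' v = (case v of Inl u \<Rightarrow> real (rd g u) | Inr C \<Rightarrow> D C + 1/2)" for v
  have "\<bar>h' u - h' w\<bar> \<le> edge_len \<Gamma>Y {u, w}" if "{u, w} \<in> edges \<Gamma>Y" for u w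
  proof (rule Y_lip[OF _ _ that])
    fix u w assume R: "(u, w) \<in> RX"
    hence V: "u \<in> V" "w \<in> V" and r: "rd u w \<le> 1" using RX_V RY_rd[of u w] by (auto simp: RY_def)
    show "\<bar>h' (Inl u) - h' (Inl w)\<bar> \<le> 1"
      using RD.dtri[OF assms(1) V] RD.dtri[OF assms(1) V(2,1)] r RD.dsym[of u w] by (simp add: h'_def)
  next
    fix u C assume C: "C \<in> CC" "u \<in> C"
    show "\<bar>h' (Inl u) - h' (Inr C)\<bar> \<le> 1/2" unfolding h'_def sum.case using D[OF C] by linarith
  qed
  from Y.gdist_vertices_lower[of h', OF this, of "Inl g" "Inl h"]
  show "real (rd g h) \<le> gdist \<Gamma>Y (vpoint (Inl g)) (vpoint (Inl h))" using assms by (simp add: Y_verts h'_def)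
qed

lemma Y_dist_edge: "C \<in> CC \<Longrightarrow> a \<in> C \<Longrightarrow> gdist \<Gamma>Y (vpoint (Inl a)) (vpoint (Inr C)) \<le> 1/2"
  using Y.gdist_edge[OF Y_edge_C] by (simp add: Y_len_C)

lemma vI: "g \<in> V \<Longrightarrow> vpoint (Inl g) \<in> Y.R" and vC: "C \<in> CC \<Longrightarrow> vpoint (Inr C) \<in> Y.R"
  by (simp_all add: Y.vpoint_R Y_verts)

text \<open>The test function is built from a function \<open>D\<close> that behaves like the
  distance to \<open>C\<close>: it is 0 at the cone point of \<open>C\<close>, \<open>D\<close> plus
  1/2 on the group, and the infimum of \<open>D\<close> plus 1 at the other cone points.\<close>

lemma Y_lower_cone:
  assumes C: "C \<in> CC" and D: "\<And>x. x \<in> V \<Longrightarrow> 0 \<le> D x" "\<And>x. x \<in> C \<Longrightarrow> D x = 0"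
    "\<And>x y. x \<in> V \<Longrightarrow> y \<in> V \<Longrightarrow> D x \<le> D y + real (rd x y)"
  shows "x \<in> V \<Longrightarrow> D x + 1/2 \<le> gdist \<Gamma>Y (vpoint (Inl x)) (vpoint (Inr C))"
    "C' \<in> CC \<Longrightarrow> C' \<noteq> C \<Longrightarrow> (\<And>x. x \<in> C' \<Longrightarrow> m \<le> D x) \<Longrightarrow> m + 1 \<le> gdist \<Gamma>Y (vpoint (Inr C')) (vpoint (Inr C))"
proof -
  define E where "E C' = (INF a\<in>C'. D a)" for C'
  have E: "E C' \<le> D a" "D a \<le> E C' + 1" if C': "C' \<in> CC" "a \<in> C'" for C' a
  proof -
    show "E C' \<le> D a" unfolding E_def using C' D(1) coset_mem_V by (intro cINF_lower) (auto intro!: bdd_belowI[of _ 0])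
    have "D a - 1 \<le> E C'" unfolding E_def
    proof (rule cINF_greatest)
      fix b assume b: "b \<in> C'"
      have "D a \<le> D b + real (rd a b)" using D(3) coset_mem_V C' b by blast
      thus "D a - 1 \<le> D b" using coset_rd[OF C' b] by simp
    qed (use C' in blast)
    thus "D a \<le> E C' + 1" by simp
  qed
  define h where "h v = (case v of Inl u \<Rightarrow> D u + 1/2 | Inr C' \<Rightarrow> if C' = C then 0 else E C' + 1)" for v
  have lip: "\<bar>h u - h w\<bar> \<le> edge_len \<Gamma>Y {u, w}" if "{u, w} \<in> edges \<Gamma>Y" for u w
  proof (rule Y_lip[OF _ _ that])
    fix u w assume R: "(u, w) \<in> RX"
    hence V: "u \<in> V" "w \<in> V" and r: "rd u w \<le> 1" using RX_V RY_rd[of u w] by (auto simp: RY_def)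
    show "\<bar>h (Inl u) - h (Inl w)\<bar> \<le> 1"
      using D(3)[OF V] D(3)[OF V(2,1)] r RD.dsym[of u w] by (simp add: h_def)
  next
    fix u C' assume C': "C' \<in> CC" "u \<in> C'"
    show "\<bar>h (Inl u) - h (Inr C')\<bar> \<le> 1/2" 
    proof (cases "C' = C")
      case True thus ?thesis using D(2)[of u] C' by (simp add: h_def)
    next
      case False
      hence "h (Inl u) = D u + 1/2" "h (Inr C') = E C' + 1" by (simp_all add: h_def)
      thus ?thesis using E[OF C'] by linarith
    qed
  qed
  note low = Y.gdist_vertices_lower[of h, OF lip]
  show "D x + 1/2 \<le> gdist \<Gamma>Y (vpoint (Inl x)) (vpoint (Inr C))" if "x \<in> V"
    using low[of "Inl x" "Inr C"] that C by (simp add: Y_verts h_def)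
  show "m + 1 \<le> gdist \<Gamma>Y (vpoint (Inr C')) (vpoint (Inr C))" if C': "C' \<in> CC" "C' \<noteq> C" "\<And>x. x \<in> C' \<Longrightarrow> m \<le> D x"
  proof -
    have "m \<le> E C'" unfolding E_def using coset_ne[OF C'(1)] C'(3) by (intro cINF_greatest)
    thus ?thesis using low[of "Inr C'" "Inr C"] C' C by (simp add: Y_verts h_def)
  qed
qed

lemma Y_dist_VC:
  assumes "C \<in> CC" "x \<in> V" "a \<in> C" "\<And>b. b \<in> C \<Longrightarrow> rd x a \<le> rd x b"
  shows "gdist \<Gamma>Y (vpoint (Inl x)) (vpoint (Inr C)) = real (rd x a) + 1/2"
proof (rule antisym)
  have aV: "a \<in> V" using coset_mem_V assms by blast
  show "gdist \<Gamma>Y (vpoint (Inl x)) (vpoint (Inr C)) \<le> real (rd x a) + 1/2"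
    using Y.tri[OF vI[OF assms(2)] vI[OF aV] vC[OF assms(1)]] Y_dist_VV[OF assms(2) aV] Y_dist_edge[OF assms(1,3)] by simp
  define D where "D y = (INF b\<in>C. real (rd y b))" for y
  have bdd: "bdd_below ((\<lambda>b. real (rd y b)) ` C)" for y by (intro bdd_belowI[of _ 0]) auto
  have D3: "D y \<le> D z + real (rd y z)" if V: "y \<in> V" "z \<in> V" for y z
  proof -
    have "D y - real (rd y z) \<le> D z" unfolding D_def[of z]
    proof (rule cINF_greatest)
      fix b assume b: "b \<in> C"
      have "D y \<le> real (rd y b)" unfolding D_def using b bdd by (intro cINF_lower)
      also have "rd y b \<le> rd y z + rd z b" using RD.dtri V coset_mem_V assms(1) b by blast
      finally show "D y - real (rd y z) \<le> real (rd z b)" by simp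
    qed (use assms in blast)
    thus ?thesis by simp
  qed
  have D2: "D y = 0" if "y \<in> C" for y
  proof (rule antisym)
    have "D y \<le> real (rd y y)" unfolding D_def using that bdd by (intro cINF_lower)
    thus "D y \<le> 0" using coset_mem_V[OF assms(1) that] by simp
    show "0 \<le> D y" unfolding D_def using that by (intro cINF_greatest) auto
  qed
  have D1: "0 \<le> D y" for y unfolding D_def using assms by (intro cINF_greatest) auto
  have "real (rd x a) \<le> D x" unfolding D_def using assms by (intro cINF_greatest) auto
  thus "real (rd x a) + 1/2 \<le> gdist \<Gamma>Y (vpoint (Inl x)) (vpoint (Inr C))"
    using Y_lower_cone(1)[OF assms(1) D1 D2 D3 assms(2)] by linarith
qed

lemma Y_dist_CC:
  assumes C: "C \<in> CC" "C' \<in> CC" "C \<noteq> C'" and ab: "a \<in> C" "b \<in> C'" and min: "\<And>x y. x \<in> C \<Longrightarrow> y \<in> C' \<Longrightarrow> rd a b \<le> rd x y"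
  shows "gdist \<Gamma>Y (vpoint (Inr C)) (vpoint (Inr C')) = real (rd a b) + 1"
proof (rule antisym)
  have V: "a \<in> V" "b \<in> V" using coset_mem_V C ab by auto
  show "gdist \<Gamma>Y (vpoint (Inr C)) (vpoint (Inr C')) \<le> real (rd a b) + 1"
    using Y.tri[OF vC[OF C(1)] vI[OF V(1)] vC[OF C(2)]] Y.tri[OF vI[OF V(1)] vI[OF V(2)] vC[OF C(2)]] Y_dist_VV[OF V]
      Y_dist_edge[OF C(1) ab(1)] Y_dist_edge[OF C(2) ab(2)] Y.sym[OF vC[OF C(1)] vI[OF V(1)]] by linarith
  define D where "D y = (INF b\<in>C'. real (rd y b))" for y
  have bdd: "bdd_below ((\<lambda>b. real (rd y b)) ` C')" for y by (intro bdd_belowI[of _ 0]) auto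
  have D3: "D y \<le> D z + real (rd y z)" if V: "y \<in> V" "z \<in> V" for y z
  proof -
    have "D y - real (rd y z) \<le> D z" unfolding D_def[of z]
    proof (rule cINF_greatest)
      fix b assume b: "b \<in> C'"
      have "D y \<le> real (rd y b)" unfolding D_def using b bdd by (intro cINF_lower)
      also have "rd y b \<le> rd y z + rd z b" using RD.dtri V coset_mem_V C(2) b by blast
      finally show "D y - real (rd y z) \<le> real (rd z b)" by simp
    qed (use ab in blast)
    thus ?thesis by simp
  qed
  have D2: "D y = 0" if "y \<in> C'" for y
  proof (rule antisym)
    have "D y \<le> real (rd y y)" unfolding D_def using that bdd by (intro cINF_lower)
    thus "D y \<le> 0" using coset_mem_V[OF C(2) that] by simp
    show "0 \<le> D y" unfolding D_def using that by (intro cINF_greatest) auto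
  qed
  have D1: "0 \<le> D y" for y unfolding D_def using ab by (intro cINF_greatest) auto
  have "real (rd a b) \<le> D x" if "x \<in> C" for x unfolding D_def using ab min that by (intro cINF_greatest) auto
  thus "real (rd a b) + 1 \<le> gdist \<Gamma>Y (vpoint (Inr C)) (vpoint (Inr C'))"
    using Y_lower_cone(2)[OF C(2) D1 D2 D3 C(1,3)] by blast
qed

section \<open>From fineness to a uniform bound on circuits\<close>

definition dY :: real where "dY = (SOME \<delta>. hyperbolic Y.R (gdist \<Gamma>Y) \<delta>)"

lemma hyp_Y: "hyperbolic Y.R (gdist \<Gamma>Y) dY"
  unfolding dY_def by (rule someI_ex) (use rh in \<open>auto simp: relatively_hyperbolic_def Let_def\<close>)

lemma fine_Y: "fine_graph \<Gamma>Y"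
  using rh by (simp add: relatively_hyperbolic_def Let_def)

abbreviation "yadj \<equiv> cadj V wd CC"

lemma yadj_edge: "yadj u w \<Longrightarrow> {u, w} \<in> edges \<Gamma>Y \<and> u \<noteq> w"
proof (induction V wd CC u w rule: cadj.induct)
  case (1 x y)
  have "x \<noteq> y" using 1 by auto
  thus ?case using 1 wd_1 Y_edge_X by auto
next
  case (2 x C) thus ?case using Y_edge_C by auto
next
  case (3 C x) thus ?case using Y_edge_C by (auto simp: insert_commute)
qed auto

text \<open>Edge lengths become sums over end points, 1/2 for a group element and 0 for a cone
  point. The length of a circuit is then the number of its group elements, an integer as in
  \<open>fine_graph\<close>.\<close>

definition half :: "'a + 'a set \<Rightarrow> real" where
  "half v = (case v of Inl _ \<Rightarrow> 1/2 | Inr _ \<Rightarrow> 0)"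

lemma yadj_len: "yadj u w \<Longrightarrow> edge_len \<Gamma>Y {u, w} = half u + half w"
  by (cases u; cases w) (auto simp: half_def Y_len)

definition simple_cycle :: "('a + 'a set) list \<Rightarrow> bool" where
  "simple_cycle vs \<longleftrightarrow> distinct vs \<and> 3 \<le> length vs \<and> (\<forall>i<length vs. yadj (vs ! i) (vs ! (Suc i mod length vs)))"

definition cycle_edges :: "('a + 'a set) list \<Rightarrow> ('a + 'a set) set set" where
  "cycle_edges vs = {{vs ! i, vs ! (Suc i mod length vs)} | i. i < length vs}"

lemma simple_cycle_circuit:
  assumes g: "simple_cycle vs" and x: "Inl x \<in> set vs"
  shows "circuit \<Gamma>Y (cycle_edges vs)" "\<exists>k. 0 < k \<and> k \<le> length vs \<and> (\<Sum>c\<in>cycle_edges vs. edge_len \<Gamma>Y c) = real k"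
proof -
  let ?m = "length vs"
  let ?s = "\<lambda>i. Suc i mod ?m"
  have d: "distinct vs" and m3: "3 \<le> ?m" and adj: "\<And>i. i < ?m \<Longrightarrow> yadj (vs ! i) (vs ! ?s i)" using g by (auto simp: simple_cycle_def)
  have "cycle_edges vs \<subseteq> edges \<Gamma>Y" using yadj_edge[OF adj] unfolding cycle_edges_def by auto
  thus "circuit \<Gamma>Y (cycle_edges vs)" unfolding circuit_def using d m3 by (auto simp: cycle_edges_def)
  have sm: "?s i < ?m" for i using m3 by (intro mod_less_divisor) linarith
  have s_eq: "?s i = (if Suc i = ?m then 0 else Suc i)" if "i < ?m" for i using that by auto
  have inj: "inj_on (\<lambda>i. {vs ! i, vs ! ?s i}) {..<?m}"
  proof (rule inj_onI)
    fix i j assume ij: "i \<in> {..<?m}" "j \<in> {..<?m}" "{vs ! i, vs ! ?s i} = {vs ! j, vs ! ?s j}"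
    have eq: "vs ! a = vs ! b \<longleftrightarrow> a = b" if "a < ?m" "b < ?m" for a b using d that nth_eq_iff_index_eq by blast
    consider "vs ! i = vs ! j" | "vs ! i = vs ! ?s j" "vs ! ?s i = vs ! j" using ij(3) by (auto simp: doubleton_eq_iff)
    thus "i = j"
    proof cases
      case 1 thus ?thesis using eq ij by auto
    next
      case 2
      have a: "i = ?s j" by (rule iffD1[OF eq[OF _ sm] 2(1)]) (use ij in simp)
      have b: "?s i = j" by (rule iffD1[OF eq[OF sm] 2(2)]) (use ij in simp)
      have "i = (if Suc j = ?m then 0 else Suc j)" by (rule trans[OF a s_eq]) (use ij in simp)
      hence 1: "(Suc j = ?m \<and> i = 0) \<or> i = Suc j" by (rule ssubst) simp
      have "(if Suc i = ?m then 0 else Suc i) = j" by (rule trans[OF s_eq[symmetric] b]) (use ij in simp)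
      hence 2: "(Suc i = ?m \<and> j = 0) \<or> j = Suc i" by (rule subst) simp
      from 1 2 m3 show ?thesis by presburger
    qed
  qed
  have cycle_edges: "cycle_edges vs = (\<lambda>i. {vs ! i, vs ! ?s i}) ` {..<?m}" unfolding cycle_edges_def by auto
  have bij: "bij_betw ?s {..<?m} {..<?m}"
  proof -
    have "inj_on ?s {..<?m}" by (rule inj_onI) (use s_eq in \<open>auto split: if_splits\<close>)
    moreover have "?s ` {..<?m} \<subseteq> {..<?m}" using sm by auto
    ultimately show ?thesis unfolding bij_betw_def using endo_inj_surj[of "{..<?m}" ?s] by blast
  qed
  have "(\<Sum>c\<in>cycle_edges vs. edge_len \<Gamma>Y c) = (\<Sum>i<?m. edge_len \<Gamma>Y {vs ! i, vs ! ?s i})"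
    unfolding cycle_edges by (rule sum.reindex_cong[OF inj]) auto
  also have "\<dots> = (\<Sum>i<?m. half (vs ! i) + half (vs ! ?s i))" by (rule sum.cong) (use yadj_len[OF adj] in auto)
  also have "\<dots> = (\<Sum>i<?m. half (vs ! i)) + (\<Sum>i<?m. half (vs ! ?s i))" by (rule sum.distrib)
  also have "(\<Sum>i<?m. half (vs ! ?s i)) = (\<Sum>i<?m. half (vs ! i))" by (rule sum.reindex_bij_betw[OF bij])
  also have "(\<Sum>i<?m. half (vs ! i)) + (\<Sum>i<?m. half (vs ! i)) = (\<Sum>i<?m. if vs ! i \<in> range Inl then 1 else 0)"
    unfolding sum.distrib[symmetric] by (rule sum.cong) (auto simp: half_def split: sum.splits)
  also have "\<dots> = real (card {i. i < ?m \<and> vs ! i \<in> range Inl})"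
    by (simp add: sum.If_cases Int_def lessThan_def)
  finally have sum: "(\<Sum>c\<in>cycle_edges vs. edge_len \<Gamma>Y c) = real (card {i. i < ?m \<and> vs ! i \<in> range Inl})" .
  obtain i where "i < ?m" "vs ! i = Inl x" using x unfolding in_set_conv_nth by blast
  hence "{i. i < ?m \<and> vs ! i \<in> range Inl} \<noteq> {}" by auto
  hence "0 < card {i. i < ?m \<and> vs ! i \<in> range Inl}" by (subst card_gt_0_iff) simp
  moreover have "card {i. i < ?m \<and> vs ! i \<in> range Inl} \<le> card {..<?m}" by (intro card_mono) auto
  ultimately show "\<exists>k. 0 < k \<and> k \<le> length vs \<and> (\<Sum>c\<in>cycle_edges vs. edge_len \<Gamma>Y c) = real k"
    using sum by (intro exI[of _ "card {i. i < ?m \<and> vs ! i \<in> range Inl}"]) simp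
qed

lemma yadj_verts: "yadj u w \<Longrightarrow> u \<in> verts \<Gamma>Y"
  by (cases u; cases w) (auto simp: Y_verts dest: coset_mem_V)

lemma simple_cycle_verts:
  assumes "simple_cycle vs" "v \<in> set vs" shows "v \<in> verts \<Gamma>Y"
proof -
  obtain i where "i < length vs" "vs ! i = v" using assms(2) unfolding in_set_conv_nth by blast
  thus ?thesis using assms(1) yadj_verts unfolding simple_cycle_def by blast
qed

lemma finite_cosets_at: "x \<in> V \<Longrightarrow> finite {C \<in> CC. x \<in> C}"
proof -
  have "{C \<in> CC. x \<in> C} \<subseteq> (\<lambda>P. x <#\<^bsub>G\<^esub> P) ` \<P>" using coset_rep by blast
  thus ?thesis using fin_P finite_surj by blast
qed

text \<open>By fineness only finitely many circuits of bounded length pass through \<open>\<one>\<close>; left translations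
  turn this into the uniform bound \<open>BY\<close>.\<close>

definition circuit_points :: "nat \<Rightarrow> 'a set" where
  "circuit_points n = {y. \<exists>vs. simple_cycle vs \<and> length vs \<le> n \<and> Inl \<one> \<in> set vs \<and> Inl y \<in> set vs}"

text \<open>A circuit through \<one> contains one of the finitely many edges at \<one>, and fineness
  leaves finitely many circuits through that edge for each length up to \<open>n\<close>.\<close>

lemma circuit_points_finite: "finite (circuit_points n)"
proof -
  define E1 where "E1 = {e \<in> edges \<Gamma>Y. Inl \<one> \<in> e}"
  define KK where "KK = (\<Union>e\<in>E1. \<Union>k\<in>{1..n}. {C. circuit \<Gamma>Y C \<and> e \<in> C \<and> (\<Sum>c\<in>C. edge_len \<Gamma>Y c) = real k})"
  have "E1 \<subseteq> (\<lambda>w. {Inl \<one>, Inl w}) ` {w \<in> V. wd \<one> w \<le> 1} \<union> (\<lambda>C. {Inl \<one>, Inr C}) ` {C \<in> CC. \<one> \<in> C}"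
  proof
    fix e assume e: "e \<in> E1"
    hence "e \<in> edges \<Gamma>Y" by (simp add: E1_def)
    thus "e \<in> (\<lambda>w. {Inl \<one>, Inl w}) ` {w \<in> V. wd \<one> w \<le> 1} \<union> (\<lambda>C. {Inl \<one>, Inr C}) ` {C \<in> CC. \<one> \<in> C}"
    proof (cases rule: Y_edge_cases)
      case (1 u w)
      have V: "u \<in> V" "w \<in> V" using 1 RX_V by auto
      have "u = \<one> \<or> w = \<one>" using e 1 by (auto simp: E1_def)
      thus ?thesis using 1 V RX_wd[OF 1(3)] W.dsym[of u w] by (auto simp: insert_commute)
    next
      case (2 u C) thus ?thesis using e by (auto simp: E1_def)
    qed
  qed
  moreover have "finite ((\<lambda>w. {Inl \<one>, Inl w}) ` {w \<in> V. wd \<one> w \<le> 1} \<union> (\<lambda>C. {Inl \<one>, Inr C}) ` {C \<in> CC. \<one> \<in> C})"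
    using wd_ball[OF one_closed] finite_cosets_at[OF one_closed] by simp
  ultimately have E1: "finite E1" by (rule finite_subset)
  have "finite {C. circuit \<Gamma>Y C \<and> e \<in> C \<and> (\<Sum>c\<in>C. edge_len \<Gamma>Y c) = real k}" if "e \<in> E1" "k \<in> {1..n}" for e k
    using fine_Y that unfolding fine_graph_def E1_def by simp
  hence KK: "finite KK" unfolding KK_def using E1 by blast
  have "finite C" "\<forall>e\<in>C. finite e" if circ: "circuit \<Gamma>Y C" for C
  proof -
    obtain vs where "C = {{vs ! i, vs ! (Suc i mod length vs)} | i. i < length vs}" using circ unfolding circuit_def by blast
    thus "finite C" "\<forall>e\<in>C. finite e" by auto
  qed
  moreover have "\<forall>C\<in>KK. circuit \<Gamma>Y C" unfolding KK_def by blast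
  ultimately have "\<And>C. C \<in> KK \<Longrightarrow> finite C" "\<And>e. e \<in> \<Union>KK \<Longrightarrow> finite e" by blast+
  hence fin: "finite (\<Union>(\<Union>KK))" using KK by (intro finite_Union)
  have "Inl ` circuit_points n \<subseteq> \<Union>(\<Union>KK)"
  proof
    fix v :: "'a + 'a set" assume "v \<in> Inl ` circuit_points n"
    then obtain y vs where y: "v = Inl y" "simple_cycle vs" "length vs \<le> n" "Inl \<one> \<in> set vs" "Inl y \<in> set vs" unfolding circuit_points_def by auto
    obtain k where k: "0 < k" "k \<le> length vs" "(\<Sum>c\<in>cycle_edges vs. edge_len \<Gamma>Y c) = real k" using simple_cycle_circuit(2)[OF y(2,4)] by blast
    have c: "circuit \<Gamma>Y (cycle_edges vs)" using simple_cycle_circuit(1)[OF y(2,4)] .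
    have cov: "\<exists>e\<in>cycle_edges vs. u \<in> e" if uv: "u \<in> set vs" for u
    proof -
      obtain i where "i < length vs" "vs ! i = u" using uv unfolding in_set_conv_nth by blast
      thus ?thesis unfolding cycle_edges_def by auto
    qed
    obtain e where e: "e \<in> cycle_edges vs" "Inl \<one> \<in> e" using cov[OF y(4)] by blast
    have "e \<in> E1" using e c unfolding E1_def circuit_def by blast
    hence "cycle_edges vs \<in> KK" unfolding KK_def using e k c y(3) by (auto intro!: bexI[of _ e] bexI[of _ k])
    thus "v \<in> \<Union>(\<Union>KK)" using cov[OF y(5)] y(1) by blast
  qed
  hence "finite (Inl ` circuit_points n :: ('a + 'a set) set)" using fin finite_subset by blast
  thus ?thesis by (rule finite_imageD) simp
qed

definition BY :: "nat \<Rightarrow> nat" where "BY n = Max (insert 0 (wd \<one> ` circuit_points n))"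

lemma BY_mono: "m \<le> n \<Longrightarrow> BY m \<le> BY n"
proof -
  assume "m \<le> n"
  hence "circuit_points m \<subseteq> circuit_points n" unfolding circuit_points_def by (auto intro: order_trans)
  thus ?thesis unfolding BY_def using circuit_points_finite by (intro Max_mono) auto
qed

abbreviation "act \<equiv> coned_off_action G"

lemma act_simps: "act g (Inl x) = Inl (g \<otimes> x)" "act g (Inr C) = Inr (g <#\<^bsub>G\<^esub> C)"
  by (auto simp: coned_off_action_def)

lemma coset_act: "g \<in> V \<Longrightarrow> C \<in> CC \<Longrightarrow> inv g <#\<^bsub>G\<^esub> (g <#\<^bsub>G\<^esub> C) = C" "g \<in> V \<Longrightarrow> C \<in> CC \<Longrightarrow> g <#\<^bsub>G\<^esub> (inv g <#\<^bsub>G\<^esub> C) = C"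
  using lcos_m_assoc[OF coset_V] lcos_mult_one[OF coset_V] by auto

lemma act_verts: "g \<in> V \<Longrightarrow> v \<in> verts \<Gamma>Y \<Longrightarrow> act g v \<in> verts \<Gamma>Y"
  using coset_left by (auto simp: Y_verts act_simps)

lemma act_inv: "g \<in> V \<Longrightarrow> v \<in> verts \<Gamma>Y \<Longrightarrow> act (inv g) (act g v) = v" "g \<in> V \<Longrightarrow> v \<in> verts \<Gamma>Y \<Longrightarrow> act g (act (inv g) v) = v"
  by (auto simp: Y_verts act_simps inv_left coset_act)

lemma yadj_act:
  assumes "g \<in> V" "yadj u w" shows "yadj (act g u) (act g w)"
  using assms(2)
proof (induction V wd CC u w rule: cadj.induct)
  case (1 x y) thus ?case using assms(1) by (simp add: act_simps wd_left)
next
  case (2 x C) thus ?case using assms(1) coset_left by (auto simp: act_simps lcos_mem)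
next
  case (3 C x) thus ?case using assms(1) coset_left by (auto simp: act_simps lcos_mem)
qed auto

lemma simple_cycle_act:
  assumes g: "g \<in> V" and vs: "simple_cycle vs" shows "simple_cycle (map (act g) vs)"
proof -
  have "inj_on (act g) (set vs)" by (intro inj_on_inverseI[of _ "act (inv g)"]) (simp add: act_inv g simple_cycle_verts[OF vs])
  moreover have "Suc i mod length vs < length vs" if "i < length vs" for i using that by (cases vs) auto
  ultimately show ?thesis using vs yadj_act[OF g] unfolding simple_cycle_def by (simp add: distinct_map)
qed

text \<open>The hyperbolicity constant is that of \<open>hyperbolic_four_point\<close>, rounded up
  since distances between group elements are integers.\<close>

sublocale cone_graph V wd rd CC "nat \<lceil>6 * dY + 4\<rceil>" BY
proof
  show "finite {y \<in> V. wd x y \<le> n}" if "x \<in> V" for x n using wd_ball[OF that] .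
  show "rd x y \<le> wd x y" if "x \<in> V" "y \<in> V" for x y using rd_le_wd[OF that] .
  show "C \<subseteq> V" "C \<noteq> {}" if "C \<in> CC" for C using coset_V coset_ne that by auto
  show "rd x y \<le> 1" if "C \<in> CC" "x \<in> C" "y \<in> C" for C x y using coset_rd that .
  show "finite {C \<in> CC. x \<in> C}" if "x \<in> V" for x using finite_cosets_at[OF that] .
  show "wd x y \<le> 1 \<or> (\<exists>C\<in>CC. x \<in> C \<and> y \<in> C)" if V: "x \<in> V" "y \<in> V" and r: "rd x y \<le> 1" for x y
  proof -
    consider "rd x y = 0" | "rd x y = 1" using r by linarith
    thus ?thesis
    proof cases
      case 1 thus ?thesis using RD.d0 V by simp
    next
      case 2
      hence "(x, y) \<in> RX \<or> (\<exists>C\<in>CC. x \<in> C \<and> y \<in> C)" using rd_1[OF V] unfolding RY_def by blast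
      thus ?thesis using RX_wd[of x y] by (elim disjE) simp_all
    qed
  qed
  show "rd x y + rd z w \<le> max (rd x z + rd y w) (rd x w + rd y z) + nat \<lceil>6 * dY + 4\<rceil>"
    if V: "x \<in> V" "y \<in> V" "z \<in> V" "w \<in> V" for x y z w
  proof -
    have "real (rd x y) + real (rd z w) \<le> max (real (rd x z) + real (rd y w)) (real (rd z y) + real (rd x w)) + (6 * dY + 4)"
      using Y.hyperbolic_four_point[OF hyp_Y vI[OF V(1)] vI[OF V(3)] vI[OF V(2)] vI[OF V(4)]] V by (simp add: Y_dist_VV)
    also have "6 * dY + 4 \<le> real (nat \<lceil>6 * dY + 4\<rceil>)" by linarith
    finally have "real (rd x y + rd z w) \<le> real (max (rd x z + rd y w) (rd x w + rd y z) + nat \<lceil>6 * dY + 4\<rceil>)"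
      by (simp add: RD.dsym[of z y] add.commute)
    thus ?thesis by (simp only: of_nat_le_iff)
  qed
  show "wd x y \<le> BY n" if vs: "distinct vs" "3 \<le> length vs" "length vs \<le> n"
      "\<And>i. i < length vs \<Longrightarrow> yadj (vs ! i) (vs ! (Suc i mod length vs))" "Inl x \<in> set vs" "Inl y \<in> set vs" for vs n x y
  proof -
    have g: "simple_cycle vs" using vs unfolding simple_cycle_def by blast
    have V: "x \<in> V" "y \<in> V"
      using simple_cycle_verts[OF g vs(5)] simple_cycle_verts[OF g vs(6)] by (auto simp: Y_verts)
    \<comment> \<open>Translation by the inverse of \<open>x\<close> moves the circuit to one
      through \<one>, where \<open>BY\<close> applies.\<close>
    have "simple_cycle (map (act (inv x)) vs)" using simple_cycle_act[OF _ g] V by simp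
    moreover have "Inl \<one> \<in> set (map (act (inv x)) vs)" using vs(5) V by (auto simp: image_iff act_simps intro!: bexI[of _ "Inl x"])
    moreover have "Inl (inv x \<otimes> y) \<in> set (map (act (inv x)) vs)" using vs(6) by (auto simp: image_iff act_simps intro!: bexI[of _ "Inl y"])
    ultimately have "inv x \<otimes> y \<in> circuit_points n" unfolding circuit_points_def using vs(3) by (intro CollectI exI[of _ "map (act (inv x)) vs"]) simp
    hence "wd \<one> (inv x \<otimes> y) \<le> BY n" unfolding BY_def using circuit_points_finite by (intro Max_ge) auto
    moreover have "wd \<one> (inv x \<otimes> y) = wd x y" using wd_left[of x \<one> "inv x \<otimes> y"] V by (simp add: inv_left)
    ultimately show ?thesis by simp
  qed
  show "BY m \<le> BY n" if "m \<le> n" for m n using BY_mono[OF that] .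
qed

end

section \<open>Morse rays as discrete sequences\<close>

context fg_group begin

abbreviation "dX \<equiv> gdist \<Gamma>X"
abbreviation "vp \<equiv> (vpoint :: 'a \<Rightarrow> 'a \<Rightarrow> real)"

lemma vpR: "v \<in> V \<Longrightarrow> vp v \<in> X.R"
  by (simp add: X.vpoint_R cayley_simps)

lemma nearV:
  assumes "x \<in> X.R" obtains v where "v \<in> V" "dX x (vp v) \<le> 1/2"
  using X.near_vertex[OF assms] by (auto simp: cayley_simps)

definition nearest :: "('a \<Rightarrow> real) \<Rightarrow> 'a" where
  "nearest x = (SOME v. v \<in> V \<and> dX x (vp v) \<le> 1/2)"

lemma nearest: "x \<in> X.R \<Longrightarrow> nearest x \<in> V" "x \<in> X.R \<Longrightarrow> dX x (vp (nearest x)) \<le> 1/2"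
proof -
  assume "x \<in> X.R"
  hence "\<exists>v. v \<in> V \<and> dX x (vp v) \<le> 1/2" using nearV by blast
  from someI_ex[OF this] show "nearest x \<in> V" "dX x (vp (nearest x)) \<le> 1/2" unfolding nearest_def by auto
qed

lemma nearest_vp: "v \<in> V \<Longrightarrow> nearest (vp v) = v"
proof -
  assume v: "v \<in> V"
  have "real (wd v (nearest (vp v))) \<le> 1/2" using nearest[OF vpR[OF v]] gdist_wd[OF v] by simp
  hence "wd v (nearest (vp v)) = 0" by linarith
  thus ?thesis using W.d0[OF v nearest(1)[OF vpR[OF v]]] by simp
qed

lemma nearest_dist:
  assumes "x \<in> X.R" "y \<in> X.R"
  shows "\<bar>real (wd (nearest x) (nearest y)) - dX x y\<bar> \<le> 1"
proof -
  note n = nearest[OF assms(1)] nearest[OF assms(2)]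
  have M: "vp (nearest x) \<in> X.R" "vp (nearest y) \<in> X.R" using n vpR by auto
  have "dX (vp (nearest x)) (vp (nearest y)) \<le> dX (vp (nearest x)) x + dX x (vp (nearest y))"
    "dX x (vp (nearest y)) \<le> dX x y + dX y (vp (nearest y))"
    "dX x y \<le> dX x (vp (nearest x)) + dX (vp (nearest x)) y"
    "dX (vp (nearest x)) y \<le> dX (vp (nearest x)) (vp (nearest y)) + dX (vp (nearest y)) y"
    using assms M X.tri by auto
  thus ?thesis
    using n X.sym[OF assms(1) M(1)] X.sym[OF assms(2) M(2)] gdist_wd[OF n(1) n(3)] by linarith
qed

text \<open>A ray at integer times, rounded to group elements; rounding costs 1/2 at each of two
  points, which is the additive error 1 in \<open>dmorse\<close>.\<close>

definition disc :: "(real \<Rightarrow> 'a \<Rightarrow> real) \<Rightarrow> nat \<Rightarrow> 'a" where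
  "disc \<alpha> n = nearest (\<alpha> (real n))"

lemma ray_R: "geodesic X.R dX {0..} \<alpha> \<Longrightarrow> 0 \<le> t \<Longrightarrow> \<alpha> t \<in> X.R"
  using X.geodesicD(1)[of "{0..}" \<alpha> t t] by simp

lemma ray_dist: "geodesic X.R dX {0..} \<alpha> \<Longrightarrow> 0 \<le> s \<Longrightarrow> 0 \<le> t \<Longrightarrow> dX (\<alpha> s) (\<alpha> t) = \<bar>s - t\<bar>"
  using X.geodesicD(2)[of "{0..}" \<alpha> s t] by simp

lemma disc_V: "geodesic X.R dX {0..} \<alpha> \<Longrightarrow> disc \<alpha> n \<in> V"
  unfolding disc_def using nearest(1)[OF ray_R] by simp

lemma disc_near: "geodesic X.R dX {0..} \<alpha> \<Longrightarrow> dX (\<alpha> (real n)) (vp (disc \<alpha> n)) \<le> 1/2"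
  unfolding disc_def using nearest(2)[OF ray_R] by simp

lemma disc_near_real:
  assumes "geodesic X.R dX {0..} \<alpha>" "0 \<le> t"
  shows "dX (\<alpha> t) (vp (disc \<alpha> (nat \<lfloor>t\<rfloor>))) \<le> 3/2"
proof -
  let ?n = "nat \<lfloor>t\<rfloor>"
  have "dX (\<alpha> t) (\<alpha> (real ?n)) = \<bar>t - real ?n\<bar>" using ray_dist[OF assms(1,2), of "real ?n"] by simp
  also have "\<dots> \<le> 1" using assms(2) by linarith
  finally have "dX (\<alpha> t) (\<alpha> (real ?n)) \<le> 1" .
  moreover have "dX (\<alpha> t) (vp (disc \<alpha> ?n)) \<le> dX (\<alpha> t) (\<alpha> (real ?n)) + dX (\<alpha> (real ?n)) (vp (disc \<alpha> ?n))"
    using ray_R[OF assms(1)] assms(2) vpR[OF disc_V[OF assms(1)]] by (intro X.tri) auto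
  ultimately show ?thesis using disc_near[OF assms(1), of ?n] by linarith
qed

lemma disc_dist:
  assumes "geodesic X.R dX {0..} \<alpha>"
  shows "\<bar>real (wd (disc \<alpha> n) (disc \<alpha> m)) - \<bar>real n - real m\<bar>\<bar> \<le> 1"
  using nearest_dist[of "\<alpha> (real n)" "\<alpha> (real m)"] ray_R[OF assms] ray_dist[OF assms, of "real n" "real m"]
  by (simp add: disc_def)

lemma disc_0: "\<alpha> 0 = vp \<one> \<Longrightarrow> disc \<alpha> 0 = \<one>"
  by (simp add: disc_def nearest_vp)

lemma ray_from_geodesic:
  assumes y: "\<And>i. y i \<in> V" "\<And>i j. i \<le> j \<Longrightarrow> wd (y i) (y j) = j - i"
  obtains \<beta> where "geodesic X.R dX {0..} \<beta>" "\<And>n. \<beta> (real n) = vp (y n)"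
proof -
  define q where "q s = vp (y (nat \<lfloor>s\<rfloor>))" for s :: real
  obtain \<beta> where \<beta>: "geodesic X.R dX {0..} \<beta>" "\<And>s. s \<in> range real \<Longrightarrow> \<beta> s = q s"
  proof (rule X.geodesic_fill[of "{0..}" "range real" q])
    show "q s \<in> X.R" if "s \<in> range real" for s using y vpR by (simp add: q_def)
    show "dX (q s) (q t) = t - s" if st: "s \<in> range real" "t \<in> range real" "s < t" for s t
    proof -
      obtain i j where "s = real i" "t = real j" "i < j" using st by auto
      thus ?thesis using y gdist_wd[OF y(1) y(1)] by (simp add: q_def of_nat_diff)
    qed
    show "\<exists>l\<in>range real. \<exists>h\<in>range real. l < t \<and> t < h \<and> (\<forall>s\<in>range real. s \<le> l \<or> h \<le> s)"
      if t: "t \<in> {0..}" "t \<notin> range real" for t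
    proof -
      obtain k where f: "real k \<le> t" "t < real (Suc k)"
      proof -
        have "real (nat \<lfloor>t\<rfloor>) \<le> t" "t < real (Suc (nat \<lfloor>t\<rfloor>))" using t(1) by (auto simp: of_nat_nat) linarith
        thus ?thesis using that by blast
      qed
      have "real k \<noteq> t" using t(2) by blast
      moreover have "real n \<le> real k \<or> real (Suc k) \<le> real n" for n
        by (cases "n \<le> k") auto
      ultimately show ?thesis using f
        by (intro bexI[of _ "real k"] bexI[of _ "real (Suc k)"]) (auto simp del: of_nat_Suc)
    qed
    show "\<exists>\<sigma>. geodesic X.R dX {0..h - l} \<sigma> \<and> \<sigma> 0 = q l \<and> \<sigma> (h - l) = q h"
      if lh: "l \<in> range real" "h \<in> range real" "l < h" "\<forall>s\<in>range real. s \<le> l \<or> h \<le> s" for l h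
    proof -
      obtain i j where ij: "l = real i" "h = real j" "i < j" using lh by auto
      have "real (Suc i) \<le> l \<or> h \<le> real (Suc i)" using lh(4) by blast
      hence j: "j = Suc i" using ij by auto
      have w: "wd (y i) (y (Suc i)) = 1" using y(2)[of i "Suc i"] by simp
      have ne: "y i \<noteq> y (Suc i)" using w y(1) by fastforce
      have ed: "{y i, y (Suc i)} \<in> edges \<Gamma>X" using cayley_edge_iff wd_1[OF y(1) y(1) w] ne by blast
      have "\<exists>\<sigma>. geodesic X.R dX {0..1} \<sigma> \<and> \<sigma> 0 = vp (y i) \<and> \<sigma> 1 = vp (y (Suc i))"
        using X.edge_geodesic[OF ed ne] gdist_wd[OF y(1) y(1), of i "Suc i"] w by (simp add: cayley_simps)
      moreover have "q (real n) = vp (y n)" for n by (simp add: q_def)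
      hence "q l = vp (y i)" "q h = vp (y (Suc i))" using ij(1,2) unfolding j by blast+
      moreover have "h - l = 1" using ij(1,2) unfolding j by simp
      ultimately show ?thesis by simp
    qed
  qed (auto simp: is_interval_ci)
  show ?thesis by (rule that[OF \<beta>(1)]) (use \<beta>(2) in \<open>simp add: q_def\<close>)
qed

text \<open>Sampling at unit steps and rounding to group elements turns a quasi-geodesic into a
  chain up to constants; the last sample also serves the rest of the interval, whose length is less
  than 1.\<close>

lemma quasi_disc:
  assumes \<sigma>: "quasi_geodesic X.R dX K L {a..b} \<sigma>" "a \<le> b" and KL: "1 \<le> K" "0 \<le> L"
  defines "q \<equiv> \<lambda>i. nearest (\<sigma> (a + real i))" and "M \<equiv> nat \<lfloor>b - a\<rfloor>"
  shows "\<And>i. i \<le> M \<Longrightarrow> q i \<in> V" "\<And>i. i < M \<Longrightarrow> real (wd (q i) (q (Suc i))) \<le> K + L + 1"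
    "\<And>i j. i \<le> j \<Longrightarrow> j \<le> M \<Longrightarrow> real (j - i) \<le> K * (real (wd (q i) (q j)) + L + 1)"
    "\<And>t. t \<in> {a..b} \<Longrightarrow> \<exists>i\<le>M. dX (\<sigma> t) (vp (q i)) \<le> K + L + 1/2 \<and> (t = a \<longrightarrow> i = 0) \<and> (t = b \<longrightarrow> i = M)"
proof -
  have M: "a + real i \<in> {a..b}" if "i \<le> M" for i
    using that assms(2) unfolding M_def by (simp add: le_nat_floor) linarith
  have \<sigma>R: "\<sigma> t \<in> X.R" if "t \<in> {a..b}" for t using \<sigma>(1) that unfolding quasi_geodesic_def by auto
  have up: "dX (\<sigma> s) (\<sigma> t) \<le> K * \<bar>s - t\<bar> + L" and lo: "\<bar>s - t\<bar> / K - L \<le> dX (\<sigma> s) (\<sigma> t)" if "s \<in> {a..b}" "t \<in> {a..b}" for s t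
    using \<sigma>(1) that unfolding quasi_geodesic_def by auto
  show "q i \<in> V" if "i \<le> M" for i unfolding q_def using nearest(1)[OF \<sigma>R[OF M[OF that]]] .
  show "real (wd (q i) (q (Suc i))) \<le> K + L + 1" if "i < M" for i
    using nearest_dist[OF \<sigma>R[OF M] \<sigma>R[OF M], of i "Suc i"] up[OF M M, of i "Suc i"] that unfolding q_def by simp
  show "real (j - i) \<le> K * (real (wd (q i) (q j)) + L + 1)" if "i \<le> j" "j \<le> M" for i j
  proof -
    have "dX (\<sigma> (a + real i)) (\<sigma> (a + real j)) \<le> real (wd (q i) (q j)) + 1"
      using nearest_dist[OF \<sigma>R[OF M] \<sigma>R[OF M], of i j] that unfolding q_def by simp
    moreover have "real (j - i) / K - L \<le> dX (\<sigma> (a + real i)) (\<sigma> (a + real j))"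
      using lo[OF M M, of i j] that by (simp add: of_nat_diff)
    ultimately have "real (j - i) / K \<le> real (wd (q i) (q j)) + L + 1" by linarith
    thus ?thesis using KL by (simp add: divide_le_eq mult.commute)
  qed
  show "\<exists>i\<le>M. dX (\<sigma> t) (vp (q i)) \<le> K + L + 1/2 \<and> (t = a \<longrightarrow> i = 0) \<and> (t = b \<longrightarrow> i = M)" if t: "t \<in> {a..b}" for t
  proof -
    let ?i = "nat \<lfloor>t - a\<rfloor>"
    have i: "?i \<le> M" unfolding M_def using t by (intro nat_mono floor_mono) auto
    have "\<bar>t - (a + real ?i)\<bar> \<le> 1" using t by (simp add: of_nat_nat) linarith
    hence "K * \<bar>t - (a + real ?i)\<bar> \<le> K * 1" using KL by (intro mult_left_mono) auto
    hence "dX (\<sigma> t) (\<sigma> (a + real ?i)) \<le> K + L" using up[OF t M[OF i]] by linarith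
    moreover have "dX (\<sigma> t) (vp (q ?i)) \<le> dX (\<sigma> t) (\<sigma> (a + real ?i)) + dX (\<sigma> (a + real ?i)) (vp (q ?i))"
      unfolding q_def using \<sigma>R[OF t] \<sigma>R[OF M[OF i]] vpR[OF nearest(1)[OF \<sigma>R[OF M[OF i]]]] by (rule X.tri)
    moreover have "dX (\<sigma> (a + real ?i)) (vp (q ?i)) \<le> 1/2" unfolding q_def using nearest(2)[OF \<sigma>R[OF M[OF i]]] .
    ultimately have "dX (\<sigma> t) (vp (q ?i)) \<le> K + L + 1/2" by linarith
    thus ?thesis using i by (intro exI[of _ ?i]) (auto simp: M_def)
  qed
qed

end

section \<open>Transfer of the Morse property between rays and sequences\<close>

context rh_group begin

text \<open>A chain with constant \<open>K\<close> is traced by a discontinuous \<open>(K, 3K + 3)\<close>-quasi-geodesic.\<close>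

definition Gauge :: "(real \<Rightarrow> real \<Rightarrow> real) \<Rightarrow> nat \<Rightarrow> nat" where
  "Gauge N K = max K (nat \<lceil>N (real K) (3 * real K + 3)\<rceil> + 2)"

text \<open>The Morse condition demands end points on the ray itself, so the two end values are
  replaced by points \<open>x0\<close>, \<open>x1\<close> near the ends of the chain. Displacements
  by \<open>K + 1/2\<close> at two parameters and the rounding of the parameters fit into
  \<open>3 * K + 3\<close>.\<close>

lemma chain_ramp:
  assumes q: "chain K M q" and K: "1 \<le> K" and e: "x0 \<in> X.R" "x1 \<in> X.R" "dX x0 (vp (q 0)) \<le> real K + 1/2" "dX x1 (vp (q M)) \<le> real K + 1/2"
    and M: "0 < M"
  defines "\<sigma> \<equiv> \<lambda>t. if t = 0 then x0 else if t = real M then x1 else vp (q (nat \<lfloor>t\<rfloor>))"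
  shows "quasi_geodesic X.R dX (real K) (3 * real K + 3) {0..real M} \<sigma>"
proof -
  have qV: "q i \<in> V" if "i \<le> M" for i using q that unfolding chain_def by blast
  have fl: "nat \<lfloor>t\<rfloor> \<le> M" if "t \<in> {0..real M}" for t using that by (simp add: nat_le_iff floor_le_iff)
  have \<sigma>R: "\<sigma> t \<in> X.R" if "t \<in> {0..real M}" for t unfolding \<sigma>_def using e vpR[OF qV[OF fl[OF that]]] by simp
  have near: "dX (\<sigma> t) (vp (q (nat \<lfloor>t\<rfloor>))) \<le> real K + 1/2" if t: "t \<in> {0..real M}" for t
    using e(3,4) X.zero[OF vpR[OF qV[OF fl[OF t]]]] unfolding \<sigma>_def by auto
  have main: "\<bar>s - t\<bar> / real K - (3 * real K + 3) \<le> dX (\<sigma> s) (\<sigma> t) \<and> dX (\<sigma> s) (\<sigma> t) \<le> real K * \<bar>s - t\<bar> + (3 * real K + 3)"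
    if st: "s \<in> {0..real M}" "t \<in> {0..real M}" "s \<le> t" for s t
  proof -
    let ?i = "nat \<lfloor>s\<rfloor>" and ?j = "nat \<lfloor>t\<rfloor>"
    have ij: "?i \<le> ?j" "?j \<le> M" "?i \<le> M" using st fl by (auto intro!: nat_mono floor_mono)
    have fs: "real ?i \<le> s" "s < real ?i + 1" "real ?j \<le> t" "t < real ?j + 1" using st by (auto simp: of_nat_nat)
    have rd: "real (?j - ?i) = real ?j - real ?i" using ij(1) by (rule of_nat_diff)
    have jj: "real (?j - ?i) \<le> t - s + 1" using fs unfolding rd by linarith
    have R: "\<sigma> s \<in> X.R" "\<sigma> t \<in> X.R" "vp (q ?i) \<in> X.R" "vp (q ?j) \<in> X.R" using \<sigma>R st vpR qV ij by auto
    have w: "dX (vp (q ?i)) (vp (q ?j)) = real (wd (q ?i) (q ?j))" using gdist_wd[OF qV qV] ij by simp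
    have t1: "dX (\<sigma> s) (\<sigma> t) \<le> dX (\<sigma> s) (vp (q ?i)) + dX (vp (q ?i)) (\<sigma> t)" "dX (vp (q ?i)) (\<sigma> t) \<le> dX (vp (q ?i)) (vp (q ?j)) + dX (vp (q ?j)) (\<sigma> t)"
      "dX (vp (q ?i)) (vp (q ?j)) \<le> dX (vp (q ?i)) (\<sigma> s) + dX (\<sigma> s) (vp (q ?j))" "dX (\<sigma> s) (vp (q ?j)) \<le> dX (\<sigma> s) (\<sigma> t) + dX (\<sigma> t) (vp (q ?j))"
      using R X.tri by auto
    have sy: "dX (vp (q ?j)) (\<sigma> t) = dX (\<sigma> t) (vp (q ?j))" "dX (vp (q ?i)) (\<sigma> s) = dX (\<sigma> s) (vp (q ?i))" using R X.sym by auto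
    have diff: "\<bar>dX (\<sigma> s) (\<sigma> t) - real (wd (q ?i) (q ?j))\<bar> \<le> 2 * real K + 1"
      using t1 sy near[OF st(1)] near[OF st(2)] w by linarith
    have "wd (q ?i) (q ?j) \<le> K * (?j - ?i)" using q ij by (intro W.chain_le) (auto simp: chain_def)
    hence "real (wd (q ?i) (q ?j)) \<le> real K * real (?j - ?i)" by (simp only: of_nat_le_iff[where 'a=real, symmetric] of_nat_mult)
    also have "\<dots> \<le> real K * (t - s + 1)" using jj by (intro mult_left_mono) simp_all
    finally have up: "real (wd (q ?i) (q ?j)) \<le> real K * (t - s) + real K" by (simp add: algebra_simps)
    have "?j - ?i \<le> K * (wd (q ?i) (q ?j) + 1)" using q ij unfolding chain_def by blast
    hence "real (?j - ?i) \<le> real K * (real (wd (q ?i) (q ?j)) + 1)" by (simp only: of_nat_le_iff[where 'a=real, symmetric] of_nat_mult of_nat_add of_nat_1)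
    moreover have "t - s - 1 \<le> real (?j - ?i)" using fs unfolding rd by linarith
    ultimately have "t - s - 1 \<le> real K * (real (wd (q ?i) (q ?j)) + 1)" by linarith
    hence "(t - s - 1) / real K \<le> real (wd (q ?i) (q ?j)) + 1" using K by (simp add: pos_divide_le_eq mult.commute)
    hence "(t - s) / real K \<le> real (wd (q ?i) (q ?j)) + 1 + 1 / real K" by (simp add: diff_divide_distrib)
    moreover have "1 / real K \<le> 1" using K by simp
    ultimately have lo: "(t - s) / real K \<le> real (wd (q ?i) (q ?j)) + 2" by linarith
    have ab: "\<bar>s - t\<bar> = t - s" using st by simp
    have "(0::real) \<le> real K" by simp
    with diff up lo show ?thesis unfolding ab by (intro conjI) linarith+
  qed
  have "\<bar>s - t\<bar> / real K - (3 * real K + 3) \<le> dX (\<sigma> s) (\<sigma> t) \<and> dX (\<sigma> s) (\<sigma> t) \<le> real K * \<bar>s - t\<bar> + (3 * real K + 3)"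
    if "s \<in> {0..real M}" "t \<in> {0..real M}" for s t
    using main[OF that] main[OF that(2,1)] X.sym[OF \<sigma>R[OF that(1)] \<sigma>R[OF that(2)]] abs_minus_commute[of s t]
    by (cases "s \<le> t") auto
  thus ?thesis unfolding quasi_geodesic_def using \<sigma>R by (auto simp: is_interval_cc)
qed

lemma dmorse_disc:
  assumes g: "geodesic X.R dX {0..} \<alpha>" and m: "N_morse X.R dX N {0..} \<alpha>"
  shows "dmorse (Gauge N) (disc \<alpha>)"
  unfolding dmorse_def
proof (intro conjI allI impI)
  let ?x = "disc \<alpha>"
  show xV: "?x n \<in> V" for n by (rule disc_V[OF g])
  fix n m :: nat assume "n \<le> m"
  thus "m - n \<le> wd (?x n) (?x m) + 1" "wd (?x n) (?x m) \<le> m - n + 1"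
    using disc_dist[OF g, of n m] by linarith+
next
  let ?x = "disc \<alpha>"
  have xV: "?x n \<in> V" for n by (rule disc_V[OF g])
  fix K M q i
  assume q: "chain K M q" and e0: "\<exists>n. wd (q 0) (?x n) \<le> K" and e1: "\<exists>n. wd (q M) (?x n) \<le> K" and i: "i \<le> M"
  have qV: "q i \<in> V" if "i \<le> M" for i using q that unfolding chain_def by blast
  show "\<exists>n. wd (q i) (?x n) \<le> Gauge N K"
  proof (cases "i = 0 \<or> i = M")
    case True
    thus ?thesis using e0 e1 by (auto simp: Gauge_def intro: max.coboundedI1)
  next
    case False
    hence i0: "0 < i" "i < M" "0 < M" using i by auto
    \<comment> \<open>A chain with constant 0 has no interior points.\<close>
    have K: "1 \<le> K"
    proof (rule ccontr)
      assume "\<not> 1 \<le> K"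
      hence "K = 0" by simp
      hence "M - 0 \<le> 0 * (wd (q 0) (q M) + 1)" using q unfolding chain_def by blast
      thus False using i0 by simp
    qed
    obtain n0 n1 where n: "wd (q 0) (?x n0) \<le> K" "wd (q M) (?x n1) \<le> K" using e0 e1 by blast
    have end0: "dX (\<alpha> (real n)) (vp (q j)) \<le> real K + 1/2" if "wd (q j) (?x n) \<le> K" "j \<le> M" for n j
    proof -
      have "dX (\<alpha> (real n)) (vp (q j)) \<le> dX (\<alpha> (real n)) (vp (?x n)) + dX (vp (?x n)) (vp (q j))"
        using ray_R[OF g, of "real n"] vpR[OF xV] vpR[OF qV[OF that(2)]] by (intro X.tri) auto
      thus ?thesis using disc_near[OF g, of n] gdist_wd[OF xV qV[OF that(2)]] that(1) W.dsym[of "?x n"] by simp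
    qed
    define \<sigma> where "\<sigma> t = (if t = 0 then \<alpha> (real n0) else if t = real M then \<alpha> (real n1) else vp (q (nat \<lfloor>t\<rfloor>)))" for t
    have qg: "quasi_geodesic X.R dX (real K) (3 * real K + 3) {0..real M} \<sigma>"
      unfolding \<sigma>_def by (rule chain_ramp[OF q K _ _ end0[OF n(1)] end0[OF n(2)] i0(3)]) (use ray_R[OF g] in auto)
    have "\<sigma> ` {0..real M} \<subseteq> nbhd X.R dX (N (real K) (3 * real K + 3)) (\<alpha> ` {0..})"
    proof -
      have "\<sigma> 0 \<in> \<alpha> ` {0..}" "\<sigma> (real M) \<in> \<alpha> ` {0..}" using i0 by (auto simp: \<sigma>_def)
      moreover have "(1::real) \<le> real K" "(0::real) < 3 * real K + 3" "(0::real) \<le> real M" using K by auto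
      ultimately show ?thesis using m qg unfolding N_morse_def by blast
    qed
    moreover have "\<sigma> (real i) = vp (q i)" "real i \<in> {0..real M}" using i0 by (auto simp: \<sigma>_def)
    ultimately have "vp (q i) \<in> nbhd X.R dX (N (real K) (3 * real K + 3)) (\<alpha> ` {0..})" by (metis image_subset_iff)
    then obtain t where t: "0 \<le> t" "dX (vp (q i)) (\<alpha> t) \<le> N (real K) (3 * real K + 3)" unfolding nbhd_def by auto
    let ?n = "nat \<lfloor>t\<rfloor>"
    have "dX (vp (q i)) (vp (?x ?n)) \<le> dX (vp (q i)) (\<alpha> t) + dX (\<alpha> t) (vp (?x ?n))"
      using vpR[OF qV[OF i]] ray_R[OF g t(1)] vpR[OF xV] by (rule X.tri)
    hence "real (wd (q i) (?x ?n)) \<le> N (real K) (3 * real K + 3) + 3/2"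
      using gdist_wd[OF qV[OF i] xV] t(2) disc_near_real[OF g t(1)] by simp
    hence "wd (q i) (?x ?n) \<le> nat \<lceil>N (real K) (3 * real K + 3)\<rceil> + 2" by linarith
    thus ?thesis unfolding Gauge_def by (intro exI[of _ ?n]) simp
  qed
qed

lemma chain_mono: "chain K M q \<Longrightarrow> K \<le> K' \<Longrightarrow> chain K' M q"
  unfolding chain_def by (meson le_trans mult_le_mono1)

lemma dmorse_near:
  assumes "dmorse \<Phi> x" "chain K M q" "wd (q 0) (x n) \<le> K" "wd (q M) (x m) \<le> K" "i \<le> M"
  shows "\<exists>n. wd (q i) (x n) \<le> \<Phi> K"
  using assms unfolding dmorse_def by blast

text \<open>The images under \<open>\<iota>\<close> of geodesics of \<open>H\<close> from \<open>\<one>\<close> to \<open>h n\<close>, where \<open>\<iota> (h n)\<close> is near \<open>x n\<close>, are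
  uniform quasi-geodesics and hence stay near \<open>x\<close>; a limit of these geodesics is the required ray.\<close>

lemma pull_back_ray:
  assumes H: "fg_group H T" and x: "dmorse \<Phi> x"
    and \<iota>: "\<And>h. h \<in> carrier H \<Longrightarrow> \<iota> h \<in> V"
    and up: "\<And>h h'. h \<in> carrier H \<Longrightarrow> h' \<in> carrier H \<Longrightarrow> wd (\<iota> h) (\<iota> h') \<le> c * fg_group.wd H T h h'"
    and lo: "\<And>h h'. h \<in> carrier H \<Longrightarrow> h' \<in> carrier H \<Longrightarrow> fg_group.wd H T h h' \<le> c * (wd (\<iota> h) (\<iota> h') + 1)"
    and near: "\<And>n. \<exists>h\<in>carrier H. wd (\<iota> h) (x n) \<le> c"
  obtains \<beta> y E where "\<beta> \<in> morse_rays (cayley_space H T) (cayley_dist H T) (vpoint \<one>\<^bsub>H\<^esub>)"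
    "\<And>n. y n \<in> carrier H" "\<And>n. \<beta> (real n) = vpoint (y n)"
    "\<And>i. \<exists>n. wd (\<iota> (y i)) (x n) \<le> E" "\<And>n. \<exists>i. wd (\<iota> (y i)) (x n) \<le> E"
proof -
  interpret H: fg_group H T by (rule H)
  note xV = dmorseV[OF x]
  obtain h where h: "\<And>n. h n \<in> carrier H" "\<And>n. wd (\<iota> (h n)) (x n) \<le> c" using near by metis
  define N where "N m = H.wd \<one>\<^bsub>H\<^esub> (h m)" for m
  have "\<exists>g. g 0 = \<one>\<^bsub>H\<^esub> \<and> g (N m) = h m \<and> H.W.geo (N m) g" for m
    using H.W.geo_ex[OF H.one_closed h(1)] unfolding N_def by metis
  then obtain g where g: "\<And>m. g m 0 = \<one>\<^bsub>H\<^esub>" "\<And>m. g m (N m) = h m" "\<And>m. H.W.geo (N m) (g m)" by metis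
  have gH: "g m i \<in> carrier H" if "i \<le> N m" for m i using H.W.geoV[OF g(3) that] .
  let ?o = "\<iota> \<one>\<^bsub>H\<^esub>"
  have oV: "?o \<in> V" using \<iota> by simp
  define e0 where "e0 = wd ?o (x 0)"
  define K where "K = max c e0"
  define E1 where "E1 = max K (\<Phi> K)"
  define E2 where "E2 = chain_const \<Phi> K"
  \<comment> \<open>\<iota> is Lipschitz, so \<open>h m\<close> is far from the identity of
    \<open>H\<close> when \<open>x m\<close> is far from \<open>x 0\<close>; the geodesics
    \<open>g m\<close> therefore become arbitrarily long.\<close>
  have grow: "m \<le> e0 + c * N m + c + 1" for m
  proof -
    have "wd (x 0) (x m) \<le> wd (x 0) ?o + wd ?o (x m)" "wd ?o (x m) \<le> wd ?o (\<iota> (h m)) + wd (\<iota> (h m)) (x m)"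
      using xV oV \<iota>[OF h(1)] W.dtri by auto
    moreover have "wd ?o (\<iota> (h m)) \<le> c * N m" using up[OF H.one_closed h(1)] by (simp add: N_def)
    ultimately show ?thesis using h(2)[of m] dmorse_dist(2)[OF x, of 0 m] W.dsym[of "x 0" ?o] unfolding e0_def by linarith
  qed
  have room: "\<exists>S. \<forall>m\<ge>S. n \<le> N m" for n
  proof (intro exI allI impI)
    fix m assume m: "e0 + c * n + c + 2 \<le> m"
    show "n \<le> N m"
    proof (rule ccontr)
      assume "\<not> n \<le> N m"
      hence "c * N m \<le> c * n" by simp
      thus False using grow[of m] m by linarith
    qed
  qed
  have fin: "\<exists>S F. finite F \<and> (\<forall>m\<ge>S. g m i \<in> F)" for i
  proof -
    obtain S where S: "\<And>m. S \<le> m \<Longrightarrow> i \<le> N m" using room by blast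
    have "g m i \<in> {y \<in> carrier H. H.wd \<one>\<^bsub>H\<^esub> y \<le> i}" if "S \<le> m" for m
      using gH[OF S[OF that]] H.W.geoD[OF g(3), of 0 i m] S[OF that] g(1)[of m] by simp
    thus ?thesis using H.wd_ball[OF H.one_closed, of i] by blast
  qed
  obtain y where y: "\<And>A T. finite A \<Longrightarrow> \<exists>m\<ge>T. \<forall>i\<in>A. g m i = y i" using diagonal_choice[of g] fin by blast
  have good: "\<exists>m\<ge>T. n \<le> N m \<and> (\<forall>i\<le>n. y i = g m i)" for n T
  proof -
    obtain S where S: "\<And>m. S \<le> m \<Longrightarrow> n \<le> N m" using room by blast
    obtain m where m: "max S T \<le> m" "\<forall>i\<in>{..n}. g m i = y i" using y[of "{..n}" "max S T"] by auto
    thus ?thesis using S[of m] by (intro exI[of _ m]) auto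
  qed
  have yH: "y i \<in> carrier H" for i
  proof -
    obtain m where "i \<le> N m" "\<forall>j\<le>i. y j = g m j" using good[of 0 i] by blast
    thus ?thesis using gH by simp
  qed
  have yD: "H.wd (y i) (y j) = j - i" if ij: "i \<le> j" for i j
  proof -
    obtain m where "j \<le> N m" "\<forall>i\<le>j. y i = g m i" using good[of 0 j] by blast
    thus ?thesis using H.W.geoD[OF g(3), of i j m] ij by simp
  qed
  have y0: "y 0 = \<one>\<^bsub>H\<^esub>" using good[of 0 0] g(1) by auto
  have ch: "chain K (N m) (\<lambda>i. \<iota> (g m i))" for m
  proof -
    have "chain c (N m) (\<lambda>i. \<iota> (g m i))"
      unfolding chain_def
    proof (intro conjI allI impI)
      fix i assume "i \<le> N m" thus "\<iota> (g m i) \<in> V" using gH \<iota> by blast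
    next
      fix i assume i: "i < N m"
      thus "wd (\<iota> (g m i)) (\<iota> (g m (Suc i))) \<le> c"
        using up[OF gH gH, of i m "Suc i" m] H.W.geoD[OF g(3), of i "Suc i" m] by simp
    next
      fix i j assume "i \<le> j" "j \<le> N m"
      thus "j - i \<le> c * (wd (\<iota> (g m i)) (\<iota> (g m j)) + 1)"
        using lo[OF gH gH, of i m j m] H.W.geoD[OF g(3), of i j m] by simp
    qed
    thus ?thesis by (rule chain_mono) (simp add: K_def)
  qed
  have ce: "wd (\<iota> (g m 0)) (x 0) \<le> K" "wd (\<iota> (g m (N m))) (x m) \<le> K" for m
    using g(1,2)[of m] h(2)[of m] by (auto simp: K_def e0_def)
  have near1: "\<exists>n. wd (\<iota> (g m i)) (x n) \<le> E1" if "i \<le> N m" for m i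
    using dmorse_chain(1)[OF x ch ce(1,2) _ that] unfolding E1_def by blast
  have near2: "\<exists>i\<le>N m. wd (\<iota> (g m i)) (x n) \<le> E2" if "n \<le> m" for m n
    using dmorse_chain(2)[OF x ch ce(1,2), of m n] that unfolding E2_def by blast
  define E where "E = max E1 E2"
  have yx: "\<exists>n. wd (\<iota> (y i)) (x n) \<le> E1" for i
  proof -
    obtain m where "i \<le> N m" "\<forall>j\<le>i. y j = g m j" using good[of 0 i] by blast
    thus ?thesis using near1 by auto
  qed
  have xy: "\<exists>i. wd (\<iota> (y i)) (x n) \<le> E2" for n
  proof -
    \<comment> \<open>Bounds the index of any point of \<open>g m\<close> whose image is near
      \<open>x n\<close>, independently of \<open>m\<close>; such a point already lies on the limit
      once \<open>g m\<close> and \<open>y\<close> agree up to \<open>b\<close>.\<close>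
    define b where "b = c * (e0 + (n + 1) + E2 + 1)"
    obtain m where m: "n \<le> m" "\<forall>i\<le>b. y i = g m i" using good[of n b] by blast
    obtain i where i: "i \<le> N m" "wd (\<iota> (g m i)) (x n) \<le> E2" using near2[OF m(1)] by blast
    have iV: "\<iota> (g m i) \<in> V" using \<iota>[OF gH[OF i(1)]] .
    have "i = H.wd \<one>\<^bsub>H\<^esub> (g m i)" using H.W.geoD[OF g(3), of 0 i m] g(1)[of m] i by simp
    also have "\<dots> \<le> c * (wd ?o (\<iota> (g m i)) + 1)" using lo[OF H.one_closed gH[OF i(1)]] .
    also have "\<dots> \<le> b"
    proof -
      have "wd ?o (\<iota> (g m i)) \<le> wd ?o (x n) + wd (x n) (\<iota> (g m i))" "wd ?o (x n) \<le> wd ?o (x 0) + wd (x 0) (x n)"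
        using oV xV iV W.dtri by auto
      hence "wd ?o (\<iota> (g m i)) + 1 \<le> e0 + (n + 1) + E2 + 1"
        using i(2) dmorse_dist(1)[OF x, of 0 n] W.dsym[of "x n" "\<iota> (g m i)"] unfolding e0_def by simp
      thus ?thesis unfolding b_def by (rule mult_le_mono2)
    qed
    finally have "y i = g m i" using m(2) by blast
    thus ?thesis using i(2) by metis
  qed
  obtain \<beta> where \<beta>: "geodesic H.X.R H.dX {0..} \<beta>" "\<And>n. \<beta> (real n) = vpoint (y n)"
    using H.ray_from_geodesic[OF yH yD] by blast
  have \<beta>near: "H.dX (\<beta> t) (vpoint (y (nat \<lfloor>t\<rfloor>))) \<le> 1" if t: "0 \<le> t" for t
    using H.ray_dist[OF \<beta>(1) t, of "real (nat \<lfloor>t\<rfloor>)"] \<beta>(2)[of "nat \<lfloor>t\<rfloor>"] t by (simp add: of_nat_nat) linarith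
  have c1: "real c * a \<le> real c * b" if "a \<le> b" for a b using that by (intro mult_left_mono) auto
  \<comment> \<open>Large enough that every sampled \<open>(K', L)\<close>-quasi-geodesic of
    \<open>H\<close> with ends on \<beta> has as image a chain with this constant and with ends this
    close to \<open>x\<close>.\<close>
  define C where "C K' L = nat \<lceil>real c * (K' + L + 2) + real E1 + K' * (real c + L + 1)\<rceil>" for K' L :: real
  define NH where "NH K' L = max 0 (real (c * (\<Phi> (C K' L) + E2 + 1)) + K' + L + 1)" for K' L
  have "N_morse H.X.R H.dX NH {0..} \<beta>"
    unfolding N_morse_def
  proof (intro allI impI)
    fix K' L :: real and \<sigma> a b
    assume KL: "1 \<le> K'" "0 < L" and ab: "a \<le> b" and \<sigma>: "quasi_geodesic H.X.R H.dX K' L {a..b} \<sigma>"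
      and ends: "\<sigma> a \<in> \<beta> ` {0..}" "\<sigma> b \<in> \<beta> ` {0..}"
    have L0: "0 \<le> L" using KL by simp
    note qd = H.quasi_disc[OF \<sigma> ab KL(1) L0]
    define q where "q i = H.nearest (\<sigma> (a + real i))" for i
    define M where "M = nat \<lfloor>b - a\<rfloor>"
    note q = qd[folded q_def M_def]
    have qV: "\<iota> (q i) \<in> V" if "i \<le> M" for i using \<iota>[OF q(1)[OF that]] .
    let ?C = "C K' L"
    have Cge: "real c * (K' + L + 2) + real E1 + K' * (real c + L + 1) \<le> real ?C" unfolding C_def by linarith
    have n1: "0 \<le> K' * (real c + L + 1)" "0 \<le> real c * (K' + L + 2)" using KL by auto
    have qch: "chain ?C M (\<lambda>i. \<iota> (q i))"
      unfolding chain_def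
    proof (intro conjI allI impI)
      fix i assume "i \<le> M" thus "\<iota> (q i) \<in> V" using qV by blast
    next
      fix i assume i: "i < M"
      have "wd (\<iota> (q i)) (\<iota> (q (Suc i))) \<le> c * H.wd (q i) (q (Suc i))" using up[OF q(1) q(1), of i "Suc i"] i by simp
      hence "real (wd (\<iota> (q i)) (\<iota> (q (Suc i)))) \<le> real c * real (H.wd (q i) (q (Suc i)))" by (simp only: of_nat_le_iff[where 'a=real, symmetric] of_nat_mult)
      also have "\<dots> \<le> real c * (K' + L + 2)" using q(2)[OF i] by (intro c1) simp
      finally show "wd (\<iota> (q i)) (\<iota> (q (Suc i))) \<le> ?C" using Cge n1 by linarith
    next
      fix i j assume ij: "i \<le> j" "j \<le> M"
      let ?w = "real (wd (\<iota> (q i)) (\<iota> (q j)))"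
      have "H.wd (q i) (q j) \<le> c * (wd (\<iota> (q i)) (\<iota> (q j)) + 1)" using lo[OF q(1) q(1), of i j] ij by simp
      hence "real (H.wd (q i) (q j)) \<le> real c * (?w + 1)" by (simp only: of_nat_le_iff[where 'a=real, symmetric] of_nat_mult of_nat_add of_nat_1)
      moreover have "L + 1 \<le> (L + 1) * (?w + 1)" using L0 by (simp add: algebra_simps)
      ultimately have "real (H.wd (q i) (q j)) + L + 1 \<le> (real c + L + 1) * (?w + 1)" by (simp add: algebra_simps)
      hence "K' * (real (H.wd (q i) (q j)) + L + 1) \<le> K' * ((real c + L + 1) * (?w + 1))" using KL by (intro mult_left_mono) auto
      hence "real (j - i) \<le> K' * (real c + L + 1) * (?w + 1)" using q(3)[OF ij] by (simp add: mult.assoc)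
      also have "\<dots> \<le> real ?C * (?w + 1)" using Cge n1 by (intro mult_right_mono) auto
      finally show "j - i \<le> ?C * (wd (\<iota> (q i)) (\<iota> (q j)) + 1)" by (simp only: of_nat_le_iff[where 'a=real, symmetric] of_nat_mult of_nat_add of_nat_1)
    qed
    have endn: "\<exists>n. wd (\<iota> (q i)) (x n) \<le> ?C" if i: "i \<le> M" and s: "s \<in> {a..b}" "\<sigma> s \<in> \<beta> ` {0..}" "H.dX (\<sigma> s) (vpoint (q i)) \<le> K' + L + 1/2" for i s
    proof -
      obtain t where t: "0 \<le> t" "\<sigma> s = \<beta> t" using s(2) by auto
      let ?k = "nat \<lfloor>t\<rfloor>"
      have R: "\<beta> t \<in> H.X.R" "vpoint (q i) \<in> H.X.R" "vpoint (y ?k) \<in> H.X.R"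
        using H.ray_R[OF \<beta>(1) t(1)] H.vpR[OF q(1)[OF i]] H.vpR[OF yH] by auto
      have "H.dX (vpoint (q i)) (vpoint (y ?k)) \<le> H.dX (vpoint (q i)) (\<beta> t) + H.dX (\<beta> t) (vpoint (y ?k))" using R H.X.tri by blast
      hence "real (H.wd (q i) (y ?k)) \<le> K' + L + 3/2"
        using H.gdist_wd[OF q(1)[OF i] yH] s(3) t(2) \<beta>near[OF t(1)] H.X.sym[OF R(1,2)] by simp
      hence "real c * real (H.wd (q i) (y ?k)) \<le> real c * (K' + L + 2)" by (intro c1) simp
      moreover have "real (wd (\<iota> (q i)) (\<iota> (y ?k))) \<le> real c * real (H.wd (q i) (y ?k))"
        using up[OF q(1)[OF i] yH, of ?k] by (simp only: of_nat_le_iff[where 'a=real, symmetric] of_nat_mult)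
      moreover obtain n where n: "wd (\<iota> (y ?k)) (x n) \<le> E1" using yx by blast
      moreover have "wd (\<iota> (q i)) (x n) \<le> wd (\<iota> (q i)) (\<iota> (y ?k)) + wd (\<iota> (y ?k)) (x n)"
        using qV[OF i] \<iota>[OF yH] xV by (intro W.dtri) auto
      ultimately have "real (wd (\<iota> (q i)) (x n)) \<le> real ?C" using Cge n1 by linarith
      thus ?thesis by (intro exI[of _ n]) simp
    qed
    have ab': "a \<in> {a..b}" "b \<in> {a..b}" using ab by auto
    obtain n0 where n0: "wd (\<iota> (q 0)) (x n0) \<le> ?C" using endn[OF _ ab'(1) ends(1)] q(4)[OF ab'(1)] by auto
    obtain n1 where n1: "wd (\<iota> (q M)) (x n1) \<le> ?C" using endn[OF _ ab'(2) ends(2)] q(4)[OF ab'(2)] by auto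
    show "\<sigma> ` {a..b} \<subseteq> nbhd H.X.R H.dX (NH K' L) (\<beta> ` {0..})"
    proof
      fix z assume "z \<in> \<sigma> ` {a..b}"
      then obtain t where t: "t \<in> {a..b}" "z = \<sigma> t" by blast
      have zR: "\<sigma> t \<in> H.X.R" using \<sigma> t unfolding quasi_geodesic_def by auto
      obtain i where i: "i \<le> M" "H.dX (\<sigma> t) (vpoint (q i)) \<le> K' + L + 1/2" using q(4)[OF t(1)] by blast
      obtain n where n: "wd (\<iota> (q i)) (x n) \<le> \<Phi> ?C" using dmorse_near[OF x qch n0 n1 i(1)] by blast
      obtain j where j: "wd (\<iota> (y j)) (x n) \<le> E2" using xy by blast
      have "wd (\<iota> (q i)) (\<iota> (y j)) \<le> wd (\<iota> (q i)) (x n) + wd (x n) (\<iota> (y j))" using qV[OF i(1)] xV \<iota>[OF yH] by (intro W.dtri) auto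
      hence "wd (\<iota> (q i)) (\<iota> (y j)) + 1 \<le> \<Phi> ?C + E2 + 1" using n j W.dsym[of "x n" "\<iota> (y j)"] by simp
      hence "c * (wd (\<iota> (q i)) (\<iota> (y j)) + 1) \<le> c * (\<Phi> ?C + E2 + 1)" by (rule mult_le_mono2)
      hence "H.wd (q i) (y j) \<le> c * (\<Phi> ?C + E2 + 1)" using lo[OF q(1)[OF i(1)] yH, of j] by (rule order_trans[rotated])
      hence w: "real (H.wd (q i) (y j)) \<le> real (c * (\<Phi> ?C + E2 + 1))" by (simp only: of_nat_le_iff)
      have R: "vpoint (q i) \<in> H.X.R" "vpoint (y j) \<in> H.X.R" using H.vpR[OF q(1)[OF i(1)]] H.vpR[OF yH] by auto
      have "H.dX (\<sigma> t) (vpoint (y j)) \<le> H.dX (\<sigma> t) (vpoint (q i)) + H.dX (vpoint (q i)) (vpoint (y j))" using zR R by (rule H.X.tri)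
      hence "H.dX (\<sigma> t) (\<beta> (real j)) \<le> NH K' L" using i(2) w H.gdist_wd[OF q(1)[OF i(1)] yH, of j] \<beta>(2)[of j] unfolding NH_def by simp
      thus "z \<in> nbhd H.X.R H.dX (NH K' L) (\<beta> ` {0..})" unfolding nbhd_def using zR t(2) by auto
    qed
  qed
  moreover have "morse_gauge NH" unfolding morse_gauge_def NH_def by simp
  moreover have "\<beta> 0 = vpoint \<one>\<^bsub>H\<^esub>" using \<beta>(2)[of 0] y0 by simp
  ultimately have "\<beta> \<in> morse_rays (cayley_space H T) (cayley_dist H T) (vpoint \<one>\<^bsub>H\<^esub>)"
    unfolding morse_rays_def N_morse_rays_def using \<beta>(1) by blast
  moreover have "\<exists>n. wd (\<iota> (y i)) (x n) \<le> E" for i using yx[of i] unfolding E_def by (auto intro: max.coboundedI1)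
  moreover have "\<exists>i. wd (\<iota> (y i)) (x n) \<le> E" for n using xy[of n] unfolding E_def by (auto intro: max.coboundedI2)
  ultimately show ?thesis using that yH \<beta>(2) by blast
qed

end

section \<open>The boundary map\<close>

context rh_group begin

abbreviation "gY \<equiv> gdist \<Gamma>Y"
abbreviation "vY g \<equiv> (vpoint (Inl g) :: 'a + 'a set \<Rightarrow> real)"
abbreviation "mrays \<equiv> morse_rays X.R dX (vp \<one>)"
abbreviation "mrel \<equiv> ray_rel X.R dX (vp \<one>)"

lemma mraysD:
  assumes "\<alpha> \<in> mrays"
  shows "geodesic X.R dX {0..} \<alpha>" "\<exists>\<Phi>. dmorse \<Phi> (disc \<alpha>)" "disc \<alpha> 0 = \<one>"
proof -
  obtain N where "geodesic X.R dX {0..} \<alpha>" "\<alpha> 0 = vp \<one>" "N_morse X.R dX N {0..} \<alpha>"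
    using assms unfolding morse_rays_def N_morse_rays_def by blast
  thus "geodesic X.R dX {0..} \<alpha>" "\<exists>\<Phi>. dmorse \<Phi> (disc \<alpha>)" "disc \<alpha> 0 = \<one>"
    using dmorse_disc disc_0 by blast+
qed

definition bounded_dist :: "(nat \<Rightarrow> 'a) \<Rightarrow> (nat \<Rightarrow> 'a) \<Rightarrow> bool" where
  "bounded_dist x y \<longleftrightarrow> (\<exists>R. \<forall>n. wd (x n) (y n) \<le> R)"

lemma mrel_iff: "(\<alpha>, \<beta>) \<in> mrel \<longleftrightarrow> \<alpha> \<in> mrays \<and> \<beta> \<in> mrays \<and> bounded_dist (disc \<alpha>) (disc \<beta>)"
proof (cases "\<alpha> \<in> mrays \<and> \<beta> \<in> mrays")
  case True
  note g = mraysD(1)[OF conjunct1[OF True]] mraysD(1)[OF conjunct2[OF True]]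
  have n: "\<bar>real (wd (disc \<alpha> n) (disc \<beta> n)) - dX (\<alpha> (real n)) (\<beta> (real n))\<bar> \<le> 1" for n
    unfolding disc_def using nearest_dist[OF ray_R[OF g(1)] ray_R[OF g(2)], of "real n" "real n"] by simp
  have "(\<exists>K. \<forall>t>0. dX (\<alpha> t) (\<beta> t) < K) \<longleftrightarrow> bounded_dist (disc \<alpha>) (disc \<beta>)"
  proof
    assume "\<exists>K. \<forall>t>0. dX (\<alpha> t) (\<beta> t) < K"
    then obtain K where K: "\<And>t. 0 < t \<Longrightarrow> dX (\<alpha> t) (\<beta> t) < K" by blast
    have "wd (disc \<alpha> n) (disc \<beta> n) \<le> nat \<lceil>K\<rceil> + 1" if "0 < n" for n
      using n[of n] K[of "real n"] that by linarith
    moreover have "disc \<alpha> 0 = disc \<beta> 0" using mraysD(3) True by simp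
    hence "wd (disc \<alpha> 0) (disc \<beta> 0) \<le> nat \<lceil>K\<rceil> + 1" using W.drefl disc_V[OF g(2)] by simp
    ultimately show "bounded_dist (disc \<alpha>) (disc \<beta>)" unfolding bounded_dist_def by (metis neq0_conv)
  next
    assume "bounded_dist (disc \<alpha>) (disc \<beta>)"
    then obtain R where R: "\<And>n. wd (disc \<alpha> n) (disc \<beta> n) \<le> R" unfolding bounded_dist_def by blast
    have "dX (\<alpha> t) (\<beta> t) < real R + 4" if t: "0 < t" for t
    proof -
      define k where "k = nat \<lfloor>t\<rfloor>"
      have k: "dX (\<alpha> t) (vp (disc \<alpha> k)) \<le> 3/2" "dX (\<beta> t) (vp (disc \<beta> k)) \<le> 3/2"
        using disc_near_real[OF g(1), of t] disc_near_real[OF g(2), of t] t unfolding k_def by auto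
      have V: "disc \<alpha> k \<in> V" "disc \<beta> k \<in> V" using disc_V g by auto
      have M: "\<alpha> t \<in> X.R" "\<beta> t \<in> X.R" "vp (disc \<alpha> k) \<in> X.R" "vp (disc \<beta> k) \<in> X.R"
        using ray_R g t V vpR by auto
      show ?thesis using k X.tri[OF M(1,3,2)] X.tri[OF M(3,4,2)] X.sym[OF M(2,4)] gdist_wd[OF V] R[of k] by linarith
    qed
    thus "\<exists>K. \<forall>t>0. dX (\<alpha> t) (\<beta> t) < K" by blast
  qed
  thus ?thesis using True unfolding ray_rel_def by simp
qed (auto simp: ray_rel_def)

lemma bounded_dist_refl: "(\<And>n. x n \<in> V) \<Longrightarrow> bounded_dist x x"
  unfolding bounded_dist_def using W.drefl by auto

lemma bounded_dist_sym: "(\<And>n. x n \<in> V) \<Longrightarrow> (\<And>n. y n \<in> V) \<Longrightarrow> bounded_dist x y \<Longrightarrow> bounded_dist y x"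
  unfolding bounded_dist_def using W.dsym by metis

lemma bounded_dist_trans:
  assumes V: "\<And>n. x n \<in> V" "\<And>n. y n \<in> V" "\<And>n. z n \<in> V" and "bounded_dist x y" "bounded_dist y z"
  shows "bounded_dist x z"
proof -
  obtain R R' where R: "\<And>n. wd (x n) (y n) \<le> R" "\<And>n. wd (y n) (z n) \<le> R'" using assms unfolding bounded_dist_def by blast
  have "wd (x n) (z n) \<le> R + R'" for n using W.dtri[OF V, of n n n] R[of n] by linarith
  thus ?thesis unfolding bounded_dist_def by blast
qed

lemma mrel_equiv: "equiv mrays mrel"
proof (rule equivI)
  have V: "disc \<alpha> n \<in> V" if "\<alpha> \<in> mrays" for \<alpha> n using disc_V mraysD(1)[OF that] by blast
  show "mrel \<subseteq> mrays \<times> mrays" by (auto simp: mrel_iff)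
  show "refl_on mrays mrel" unfolding refl_on_def using bounded_dist_refl V by (auto simp: mrel_iff)
  show "sym mrel" unfolding sym_def using bounded_dist_sym V by (auto simp: mrel_iff)
  show "trans mrel"
  proof (rule transI)
    fix x y z assume "(x, y) \<in> mrel" "(y, z) \<in> mrel"
    hence xyz: "x \<in> mrays" "y \<in> mrays" "z \<in> mrays" "bounded_dist (disc x) (disc y)" "bounded_dist (disc y) (disc z)" by (auto simp: mrel_iff)
    show "(x, z) \<in> mrel" using bounded_dist_trans[OF V[OF xyz(1)] V[OF xyz(2)] V[OF xyz(3)] xyz(4,5)] xyz by (simp add: mrel_iff)
  qed
qed

section \<open>Cosets followed by a sequence\<close>

definition near_coset :: "(nat \<Rightarrow> 'a) \<Rightarrow> 'a set \<Rightarrow> bool" where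
  "near_coset x C \<longleftrightarrow> C \<in> CC \<and> (\<exists>R. \<forall>n. \<exists>a\<in>C. wd a (x n) \<le> R)"

lemma near_coset_ray:
  assumes g: "geodesic X.R dX {0..} \<alpha>" and C: "C \<in> CC"
  shows "(\<exists>R. \<alpha> ` {0..} \<subseteq> nbhd X.R dX R (vpoint ` C)) \<longleftrightarrow> near_coset (disc \<alpha>) C"
proof
  assume "\<exists>R. \<alpha> ` {0..} \<subseteq> nbhd X.R dX R (vpoint ` C)"
  then obtain R where R: "\<alpha> ` {0..} \<subseteq> nbhd X.R dX R (vpoint ` C)" by blast
  have "\<exists>a\<in>C. wd a (disc \<alpha> n) \<le> nat \<lceil>R\<rceil> + 1" for n
  proof -
    have "\<alpha> (real n) \<in> nbhd X.R dX R (vpoint ` C)" using R by auto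
    then obtain a where a: "a \<in> C" "dX (\<alpha> (real n)) (vp a) \<le> R" unfolding nbhd_def by blast
    have aV: "a \<in> V" using coset_mem_V[OF C a(1)] .
    have M: "\<alpha> (real n) \<in> X.R" "vp a \<in> X.R" "vp (disc \<alpha> n) \<in> X.R" using ray_R g vpR aV disc_V by auto
    have "real (wd a (disc \<alpha> n)) \<le> R + 1/2"
      using X.tri[OF M(2,1,3)] X.sym[OF M(1,2)] disc_near[OF g, of n] a gdist_wd[OF aV disc_V[OF g]] by simp
    thus ?thesis using a(1) by (intro bexI[of _ a]) linarith+
  qed
  thus "near_coset (disc \<alpha>) C" unfolding near_coset_def using C by blast
next
  assume "near_coset (disc \<alpha>) C"
  then obtain R where R: "\<And>n. \<exists>a\<in>C. wd a (disc \<alpha> n) \<le> R" unfolding near_coset_def by blast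
  have "\<alpha> t \<in> nbhd X.R dX (real R + 3/2) (vpoint ` C)" if t: "0 \<le> t" for t
  proof -
    define k where "k = nat \<lfloor>t\<rfloor>"
    have k: "dX (\<alpha> t) (vp (disc \<alpha> k)) \<le> 3/2" using disc_near_real[OF g, of t] t unfolding k_def by auto
    obtain a where a: "a \<in> C" "wd a (disc \<alpha> k) \<le> R" using R by blast
    have aV: "a \<in> V" using coset_mem_V[OF C a(1)] .
    have M: "\<alpha> t \<in> X.R" "vp a \<in> X.R" "vp (disc \<alpha> k) \<in> X.R" using ray_R g vpR aV disc_V t by auto
    have "dX (\<alpha> t) (vp a) \<le> real R + 3/2"
      using X.tri[OF M(1,3,2)] X.sym[OF M(2,3)] k a gdist_wd[OF aV disc_V[OF g], of k] by simp
    thus ?thesis unfolding nbhd_def using M a by blast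
  qed
  thus "\<exists>R. \<alpha> ` {0..} \<subseteq> nbhd X.R dX R (vpoint ` C)" by blast
qed

lemma near_coset_eventually:
  assumes x: "dmorse \<Phi> x" and C: "C \<in> CC" and near: "\<And>s. s0 \<le> s \<Longrightarrow> \<exists>a\<in>C. wd a (x s) \<le> R"
  shows "near_coset x C"
proof -
  obtain b where b: "b \<in> C" using coset_ne[OF C] by blast
  have "\<exists>a\<in>C. wd a (x n) \<le> max R (wd b (x 0) + s0 + 1)" for n
  proof (cases "s0 \<le> n")
    case True thus ?thesis using near[OF True] by (auto intro: max.coboundedI1)
  next
    case False
    have "wd b (x n) \<le> wd b (x 0) + wd (x 0) (x n)" using dmorseV[OF x] coset_mem_V[OF C b] by (intro W.dtri)
    moreover have "wd (x 0) (x n) \<le> n + 1" using dmorse_dist(1)[OF x, of 0 n] by simp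
    ultimately have "wd b (x n) \<le> wd b (x 0) + s0 + 1" using False by linarith
    thus ?thesis using b by (auto intro: max.coboundedI2)
  qed
  thus ?thesis unfolding near_coset_def using C by blast
qed

lemma near_coset_diverges: "dmorse \<Phi> x \<Longrightarrow> near_coset x C \<Longrightarrow> \<not> diverges x"
  unfolding near_coset_def using near_not_diverges[where S = 0] by blast

lemma near_coset_or_diverges: "dmorse \<Phi> x \<Longrightarrow> \<not> diverges x \<Longrightarrow> \<exists>C. near_coset x C"
  using diverges_or_near[of \<Phi> x] near_coset_eventually by metis

lemma near_coset_unique:
  assumes x: "dmorse \<Phi> x" and C: "near_coset x C" "near_coset x C'" shows "C = C'"
proof -
  obtain R R' where R: "\<And>n. \<exists>a\<in>C. wd a (x n) \<le> R" "\<And>n. \<exists>a\<in>C'. wd a (x n) \<le> R'" using C unfolding near_coset_def by blast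
  have C': "C \<in> CC" "C' \<in> CC" using C unfolding near_coset_def by auto
  show ?thesis
  proof (rule coset_unique[OF x C'])
    fix S
    obtain a b where "a \<in> C" "wd a (x S) \<le> R" "b \<in> C'" "wd b (x S) \<le> R'" using R by blast
    thus "\<exists>s\<ge>S. \<exists>a\<in>C. \<exists>b\<in>C'. wd a (x s) \<le> max R R' \<and> wd b (x s) \<le> max R R'"
      by (intro exI[of _ S]) (auto intro: max.coboundedI1 max.coboundedI2)
  qed
qed

lemma near_coset_bounded_dist:
  assumes V: "\<And>n. x n \<in> V" "\<And>n. y n \<in> V" and xy: "bounded_dist x y" and C: "near_coset x C"
  shows "near_coset y C"
proof -
  obtain R R' where R: "\<And>n. \<exists>a\<in>C. wd a (x n) \<le> R" "\<And>n. wd (x n) (y n) \<le> R'" using C xy unfolding near_coset_def bounded_dist_def by blast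
  have C': "C \<in> CC" using C unfolding near_coset_def by auto
  have "\<exists>a\<in>C. wd a (y n) \<le> R + R'" for n
  proof -
    obtain a where a: "a \<in> C" "wd a (x n) \<le> R" using R by blast
    have "wd a (y n) \<le> wd a (x n) + wd (x n) (y n)" using W.dtri V coset_mem_V[OF C' a(1)] by blast
    thus ?thesis using a R(2)[of n] by (intro bexI[of _ a]) linarith+
  qed
  thus ?thesis unfolding near_coset_def using C' by blast
qed

section \<open>Classes of sequences in the boundary of the coned-off graph\<close>

abbreviation "gprod \<equiv> gromov_product gY (vY \<one>)"
abbreviation "gprod_inf u w \<equiv> \<forall>C. \<exists>n. \<forall>i\<ge>n. \<forall>j\<ge>n. C \<le> gprod (u i) (w j)"
abbreviation "grel \<equiv> gromov_rel Y.R gY (vY \<one>)"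
definition "gseqs = {u. range u \<subseteq> Y.R \<and> (gprod_inf u u)}"

text \<open>Half of the four-point inequality based at \<one>, whence
  \<open>3 * dY + 2\<close>.\<close>

lemma gprod_hyp:
  assumes "x \<in> Y.R" "y \<in> Y.R" "z \<in> Y.R"
  shows "min (gprod x y) (gprod y z) - (3 * dY + 2) \<le> gprod x z"
proof -
  have o: "vY \<one> \<in> Y.R" by (simp add: vI)
  show ?thesis using Y.hyperbolic_four_point[OF hyp_Y assms o] Y.sym[OF o] assms unfolding gromov_product_def
    by (simp add: min_def max_def field_simps split: if_splits) 
qed

lemma gprod_sym: "x \<in> Y.R \<Longrightarrow> y \<in> Y.R \<Longrightarrow> gprod x y = gprod y x"
  unfolding gromov_product_def using Y.sym by simp

lemma grel_mem: "(u, w) \<in> grel \<longleftrightarrow> u \<in> gseqs \<and> w \<in> gseqs \<and> (gprod_inf u w)"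
  unfolding gromov_rel_def gseqs_def by simp blast

lemma gseqs_R: "u \<in> gseqs \<Longrightarrow> u i \<in> Y.R"
  unfolding gseqs_def by auto

lemma grel_equiv: "equiv gseqs grel"
proof (rule equivI)
  show "grel \<subseteq> gseqs \<times> gseqs" by (auto simp: grel_mem)
  show "refl_on gseqs grel" by (rule refl_onI) (unfold grel_mem, simp add: gseqs_def)
  show "sym grel"
  proof (rule symI)
    fix u w assume uw: "(u, w) \<in> grel"
    have U: "u \<in> gseqs" "w \<in> gseqs" using uw grel_mem by blast+
    note R = gseqs_R[OF U(1)] gseqs_R[OF U(2)]
    have "\<exists>n. \<forall>i\<ge>n. \<forall>j\<ge>n. C \<le> gprod (w i) (u j)" for C
    proof -
      obtain n where n: "\<And>i j. n \<le> i \<Longrightarrow> n \<le> j \<Longrightarrow> C \<le> gprod (u i) (w j)" using uw grel_mem by blast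
      hence "C \<le> gprod (w i) (u j)" if "n \<le> i" "n \<le> j" for i j using n[OF that(2,1)] gprod_sym[OF R(1)[of j] R(2)[of i]] by simp
      thus ?thesis by blast
    qed
    thus "(w, u) \<in> grel" using U grel_mem by blast
  qed
  show "trans grel"
  proof (rule transI)
    fix u v w assume uv: "(u, v) \<in> grel" and vw: "(v, w) \<in> grel"
    have U: "u \<in> gseqs" "v \<in> gseqs" "w \<in> gseqs" using uv vw grel_mem by blast+
    note R = gseqs_R[OF U(1)] gseqs_R[OF U(2)] gseqs_R[OF U(3)]
    have "\<exists>n. \<forall>i\<ge>n. \<forall>j\<ge>n. C \<le> gprod (u i) (w j)" for C
    proof -
      obtain n where n: "\<And>i j. n \<le> i \<Longrightarrow> n \<le> j \<Longrightarrow> C + (3 * dY + 2) \<le> gprod (u i) (v j)" using uv grel_mem by blast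
      obtain m where m: "\<And>i j. m \<le> i \<Longrightarrow> m \<le> j \<Longrightarrow> C + (3 * dY + 2) \<le> gprod (v i) (w j)" using vw grel_mem by blast
      have "C \<le> gprod (u i) (w j)" if "max n m \<le> i" "max n m \<le> j" for i j
        using gprod_hyp[OF R(1) R(2) R(3), of i i j] n[of i i] m[of i j] that by linarith
      thus ?thesis by blast
    qed
    thus "(u, w) \<in> grel" using U grel_mem by blast
  qed
qed

lemma gprod_V: "x \<in> V \<Longrightarrow> y \<in> V \<Longrightarrow> gprod (vY x) (vY y) = real_of_int (gp2 \<one> x y) / 2"
  unfolding gromov_product_def gp2_def using Y_dist_VV RD.dsym[of \<one>] by simp

lemma gromov_conv_gprod:
  assumes "\<And>n. x n \<in> V" "\<And>n. y n \<in> V"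
  shows "(\<forall>C. \<exists>n. \<forall>i\<ge>n. \<forall>j\<ge>n. C \<le> gprod (vY (x i)) (vY (y j))) \<longleftrightarrow> gromov_conv \<one> x y"
  unfolding gprod_V[OF assms] gromov_conv_def
proof
  assume a: "\<forall>C. \<exists>n. \<forall>i\<ge>n. \<forall>j\<ge>n. C \<le> real_of_int (gp2 \<one> (x i) (y j)) / 2"
  show "\<forall>R. \<exists>S. \<forall>s\<ge>S. \<forall>t\<ge>S. R \<le> gp2 \<one> (x s) (y t)"
  proof
    fix R
    obtain n where "\<And>i j. n \<le> i \<Longrightarrow> n \<le> j \<Longrightarrow> real_of_int R / 2 \<le> real_of_int (gp2 \<one> (x i) (y j)) / 2" using a by blast
    thus "\<exists>S. \<forall>s\<ge>S. \<forall>t\<ge>S. R \<le> gp2 \<one> (x s) (y t)" by auto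
  qed
next
  assume a: "\<forall>R. \<exists>S. \<forall>s\<ge>S. \<forall>t\<ge>S. R \<le> gp2 \<one> (x s) (y t)"
  show "\<forall>C. \<exists>n. \<forall>i\<ge>n. \<forall>j\<ge>n. C \<le> real_of_int (gp2 \<one> (x i) (y j)) / 2"
  proof
    fix C :: real
    obtain n where n: "\<And>i j. n \<le> i \<Longrightarrow> n \<le> j \<Longrightarrow> \<lceil>2 * C\<rceil> \<le> gp2 \<one> (x i) (y j)" using a by blast
    have "C \<le> real_of_int (gp2 \<one> (x i) (y j)) / 2" if "n \<le> i" "n \<le> j" for i j using n[OF that] by linarith
    thus "\<exists>n. \<forall>i\<ge>n. \<forall>j\<ge>n. C \<le> real_of_int (gp2 \<one> (x i) (y j)) / 2" by blast
  qed
qed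

lemma grel_iff:
  assumes "\<And>n. x n \<in> V" "\<And>n. y n \<in> V"
  shows "(\<lambda>n. vY (x n), \<lambda>n. vY (y n)) \<in> grel \<longleftrightarrow> gromov_conv \<one> x x \<and> gromov_conv \<one> y y \<and> gromov_conv \<one> x y"
  using assms unfolding gromov_rel_def by (auto simp: gromov_conv_gprod vI)

definition end_class :: "(nat \<Rightarrow> 'a) \<Rightarrow> (nat \<Rightarrow> 'a + 'a set \<Rightarrow> real) set" where
  "end_class x = grel `` {\<lambda>n. vY (x n)}"

lemma end_class_boundary:
  assumes "\<And>n. x n \<in> V" "gromov_conv \<one> x x" shows "Inr (end_class x) \<in> nonparabolic_points G S \<P>"
proof -
  have "(\<lambda>n. vY (x n)) \<in> gseqs" using assms gromov_conv_gprod[OF assms(1,1)] unfolding gseqs_def by (auto simp: vI)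
  hence "end_class x \<in> gseqs // grel" unfolding end_class_def by (rule quotientI)
  thus ?thesis unfolding nonparabolic_points_def Let_def hyperbolic_boundary_def gseqs_def by blast
qed

lemma end_class_eq:
  assumes "\<And>n. x n \<in> V" "\<And>n. y n \<in> V" "gromov_conv \<one> x x" "gromov_conv \<one> y y"
  shows "end_class x = end_class y \<longleftrightarrow> gromov_conv \<one> x y"
proof -
  have "(\<lambda>n. vY (x n)) \<in> gseqs" "(\<lambda>n. vY (y n)) \<in> gseqs" using assms gromov_conv_gprod[OF assms(1,1)] gromov_conv_gprod[OF assms(2,2)] unfolding gseqs_def by (auto simp: vI)
  thus ?thesis unfolding end_class_def using eq_equiv_class_iff[OF grel_equiv] grel_iff[of x y, OF assms(1,2)] assms(3,4) by simp
qed

section \<open>The boundary point of a Morse sequence and its invariance\<close>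

lemma bounded_dist_diverges:
  assumes V: "\<And>n. x n \<in> V" "\<And>n. y n \<in> V" and xy: "bounded_dist x y" "x 0 = y 0" and x: "diverges x"
  shows "diverges y"
proof -
  obtain R' where R': "\<And>n. wd (x n) (y n) \<le> R'" using xy unfolding bounded_dist_def by blast
  show ?thesis unfolding diverges_def
  proof
    fix R
    obtain s0 where S: "\<And>s. s0 \<le> s \<Longrightarrow> R + R' \<le> rd (x 0) (x s)" using x unfolding diverges_def by blast
    have "R \<le> rd (y 0) (y s)" if "s0 \<le> s" for s
    proof -
      have "rd (x 0) (x s) \<le> rd (x 0) (y s) + rd (y s) (x s)" using V by (intro RD.dtri)
      moreover have "rd (y s) (x s) \<le> R'" using rd_le_wd[OF V(2) V(1), of s s] R'[of s] W.dsym[of "y s" "x s"] by linarith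
      ultimately show ?thesis using S[OF that] xy(2) by simp
    qed
    thus "\<exists>S. \<forall>s\<ge>S. R \<le> rd (y 0) (y s)" by blast
  qed
qed

lemma bounded_dist_gromov_conv:
  assumes V: "\<And>n. x n \<in> V" "\<And>n. y n \<in> V" and xy: "bounded_dist x y" and x: "gromov_conv \<one> x x"
  shows "gromov_conv \<one> x y"
  unfolding gromov_conv_def
proof
  fix R
  obtain R' where R': "\<And>n. wd (x n) (y n) \<le> R'" using xy unfolding bounded_dist_def by blast
  obtain s0 where S: "\<And>s t. s0 \<le> s \<Longrightarrow> s0 \<le> t \<Longrightarrow> R + 2 * int R' \<le> gp2 \<one> (x s) (x t)" using gromov_conv_large[OF x] by blast
  have "R \<le> gp2 \<one> (x s) (y t)" if "s0 \<le> s" "s0 \<le> t" for s t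
  proof -
    have "gp2 \<one> (x t) (x s) - 2 * int (rd (x t) (y t)) \<le> gp2 \<one> (y t) (x s)"
      using gp2_lip[of \<one> "y t" "x t" "x s"] V RD.dsym[of "y t" "x t"] by simp
    moreover have "rd (x t) (y t) \<le> R'" using rd_le_wd[OF V, of t t] R'[of t] by linarith
    ultimately show ?thesis using S[OF that] gp2_sym[of \<one> "x s" "x t"] gp2_sym[of \<one> "x s" "y t"] by linarith
  qed
  thus "\<exists>S. \<forall>s\<ge>S. \<forall>t\<ge>S. R \<le> gp2 \<one> (x s) (y t)" by blast
qed

text \<open>For a Morse sequence, \<open>near_coset_unique\<close> makes the description by
  \<open>THE\<close> meaningful, and a sequence near no coset diverges by
  \<open>near_coset_or_diverges\<close>, so it converges to a point of the hyperbolic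
  boundary.\<close>

definition bpoint :: "(nat \<Rightarrow> 'a) \<Rightarrow> 'a bowditch_point" where
  "bpoint x = (if \<exists>C. near_coset x C then Inl (Inr (THE C. near_coset x C)) else Inr (end_class x))"

lemma bpoint_near_coset: "dmorse \<Phi> x \<Longrightarrow> near_coset x C \<Longrightarrow> bpoint x = Inl (Inr C)"
  unfolding bpoint_def using near_coset_unique by (auto intro!: the_equality)

lemma bpoint_diverges: "dmorse \<Phi> x \<Longrightarrow> diverges x \<Longrightarrow> bpoint x = Inr (end_class x)"
  unfolding bpoint_def using near_coset_diverges by auto

lemma bpoint_bounded_dist:
  assumes x: "dmorse \<Phi> x" "x 0 = \<one>" and y: "dmorse \<Psi> y" "y 0 = \<one>" and xy: "bounded_dist x y"
  shows "bpoint x = bpoint y"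
proof (cases "diverges x")
  case True
  note V = dmorseV[OF x(1)] dmorseV[OF y(1)]
  have dy: "diverges y" using bounded_dist_diverges[OF V xy _ True] x y by simp
  have "gromov_conv \<one> x x" "gromov_conv \<one> y y" using dmorse_gromov_conv[OF x(1) True] dmorse_gromov_conv[OF y(1) dy] x y by auto
  thus ?thesis using end_class_eq[OF V] bounded_dist_gromov_conv[OF V xy] bpoint_diverges[OF x(1) True] bpoint_diverges[OF y(1) dy] by simp
next
  case False
  then obtain C where C: "near_coset x C" using near_coset_or_diverges[OF x(1)] by blast
  have "near_coset y C" using near_coset_bounded_dist[OF dmorseV[OF x(1)] dmorseV[OF y(1)] xy C] .
  thus ?thesis using bpoint_near_coset[OF x(1) C] bpoint_near_coset[OF y(1)] by simp
qed

lemma bpoint_inj: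
  assumes x: "dmorse \<Phi> x" "x 0 = \<one>" "diverges x" and y: "dmorse \<Psi> y" "y 0 = \<one>" "diverges y" and eq: "bpoint x = bpoint y"
  shows "bounded_dist x y"
proof -
  have "gromov_conv \<one> x x" "gromov_conv \<one> y y" using dmorse_gromov_conv[OF x(1,3)] dmorse_gromov_conv[OF y(1,3)] x y by auto
  moreover have "end_class x = end_class y" using eq bpoint_diverges[OF x(1,3)] bpoint_diverges[OF y(1,3)] by simp
  ultimately have "gromov_conv \<one> x y" using end_class_eq[OF dmorseV[OF x(1)] dmorseV[OF y(1)]] by simp
  then obtain E where E: "\<And>T. \<exists>s\<ge>T. \<exists>t. wd (x s) (y t) \<le> E" using close_points[OF x(1) y(1) x(2) y(2)] by blast
  have "x 0 = y 0" using x(2) y(2) by simp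
  from asymptotic[OF x(1) y(1) this E] show ?thesis unfolding bounded_dist_def .
qed

lemma bpoint_boundary: "dmorse \<Phi> x \<Longrightarrow> x 0 = \<one> \<Longrightarrow> bpoint x \<in> bowditch_boundary G S \<P>"
proof (cases "diverges x")
  case True
  assume x: "dmorse \<Phi> x" "x 0 = \<one>"
  thus ?thesis using bpoint_diverges[OF x(1) True] end_class_boundary[OF dmorseV[OF x(1)]] dmorse_gromov_conv[OF x(1) True]
    unfolding bowditch_boundary_def by simp
next
  case False
  assume x: "dmorse \<Phi> x" "x 0 = \<one>"
  then obtain C where C: "near_coset x C" using near_coset_or_diverges[OF x(1) False] by blast
  thus ?thesis using bpoint_near_coset[OF x(1) C] unfolding bowditch_boundary_def parabolic_points_def near_coset_def by blast
qed

end

section \<open>Continuity\<close>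

context rh_group begin

lemma seg_ex:
  assumes "p \<in> Y.R" "q \<in> Y.R"
  shows "\<exists>\<sigma>. geodesic Y.R gY {0..gY p q} \<sigma> \<and> \<sigma> 0 = p \<and> \<sigma> (gY p q) = q"
proof -
  obtain \<gamma> a where g: "0 \<le> a" "geodesic Y.R gY {0..a} \<gamma>" "\<gamma> 0 = p" "\<gamma> a = q"
    using hyp_Y assms unfolding hyperbolic_def geodesic_segment_def by meson
  have "gY p q = a" using Y.geodesicD(2)[OF g(2), of 0 a] g by simp
  thus ?thesis using g by auto
qed

text \<open>Common construction of lines, rays from a cone point and segments between cone points.
  The times \<tau> are indexed by an interval of integers because their spacing is 1/2 next to a
  cone point and 1 elsewhere.\<close>

lemma fill_int:
  fixes K :: "int set" and \<tau> :: "int \<Rightarrow> real"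
  assumes K: "\<And>i j k. i \<in> K \<Longrightarrow> j \<in> K \<Longrightarrow> i \<le> k \<Longrightarrow> k \<le> j \<Longrightarrow> k \<in> K"
    and \<tau>: "\<And>i. i \<in> K \<Longrightarrow> i + 1 \<in> K \<Longrightarrow> \<tau> i < \<tau> (i + 1) \<and> \<tau> (i + 1) \<le> \<tau> i + 1"
    and q: "\<And>i. i \<in> K \<Longrightarrow> q i \<in> Y.R" "\<And>i j. i \<in> K \<Longrightarrow> j \<in> K \<Longrightarrow> i < j \<Longrightarrow> gY (q i) (q j) = \<tau> j - \<tau> i"
    and I: "is_interval I" "\<And>t. t \<in> I \<Longrightarrow> \<exists>i\<in>K. \<exists>j\<in>K. \<tau> i \<le> t \<and> t \<le> \<tau> j" "\<And>i. i \<in> K \<Longrightarrow> \<tau> i \<in> I"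
  obtains \<gamma> where "geodesic Y.R gY I \<gamma>" "\<And>i. i \<in> K \<Longrightarrow> \<gamma> (\<tau> i) = q i" "\<And>t. t \<in> I \<Longrightarrow> \<exists>i\<in>K. gY (\<gamma> t) (q i) \<le> 1"
proof -
  have mono: "\<tau> i < \<tau> j" if "i \<in> K" "j \<in> K" "i < j" for i j
  proof -
    have "j \<in> K \<longrightarrow> \<tau> i < \<tau> j" using that(3)
    proof (induction j rule: int_gr_induct)
      case base thus ?case using \<tau>[OF that(1)] by simp
    next
      case (step j) thus ?case using \<tau>[of j] K[OF that(1), of "j + 1" j] by fastforce
    qed
    thus ?thesis using that by blast
  qed
  have le_iff: "\<tau> i \<le> \<tau> j \<longleftrightarrow> i \<le> j" if "i \<in> K" "j \<in> K" for i j
    using mono[OF that] mono[OF that(2,1)] by (cases i j rule: linorder_cases) auto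
  have inj: "i = j" if "i \<in> K" "j \<in> K" "\<tau> i = \<tau> j" for i j
    using le_iff[OF that(1,2)] le_iff[OF that(2,1)] that(3) by simp
  define p where "p s = q (THE i. i \<in> K \<and> \<tau> i = s)" for s
  have p: "p (\<tau> i) = q i" if "i \<in> K" for i
  proof -
    have "(THE j. j \<in> K \<and> \<tau> j = \<tau> i) = i" using that inj by (intro the_equality) auto
    thus ?thesis by (simp add: p_def)
  qed
  have br: "\<exists>i\<in>K. i + 1 \<in> K \<and> \<tau> i < t \<and> t < \<tau> (i + 1)" if t: "t \<in> I" "t \<notin> \<tau> ` K" for t
  proof -
    obtain i0 j0 where ij: "i0 \<in> K" "j0 \<in> K" "\<tau> i0 \<le> t" "t \<le> \<tau> j0" using I(2)[OF t(1)] by blast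
    define A where "A = {i0..j0} \<inter> {i. \<tau> i \<le> t}"
    have "i0 \<le> j0" using le_iff[OF ij(1,2)] ij(3,4) by linarith
    hence "i0 \<in> A" "finite A" using ij unfolding A_def by auto
    hence m: "Max A \<in> A" "\<And>i. i \<in> A \<Longrightarrow> i \<le> Max A" using Max_in[of A] Max_ge[of A] by blast+
    let ?i = "Max A"
    have iK: "?i \<in> K" using m(1) K[OF ij(1,2)] unfolding A_def by simp
    have "\<tau> ?i \<noteq> t" using t(2) iK by blast
    moreover have "\<tau> ?i \<le> t" using m(1) unfolding A_def by blast
    ultimately have lt: "\<tau> ?i < t" by linarith
    have "?i \<noteq> j0" using lt ij(4) by auto
    hence i1: "?i + 1 \<in> {i0..j0}" using m(1) unfolding A_def by auto
    hence K1: "?i + 1 \<in> K" using K[OF ij(1,2)] by simp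
    have "?i + 1 \<notin> A" using m(2)[of "?i + 1"] by auto
    hence "t < \<tau> (?i + 1)" using i1 unfolding A_def by auto
    thus ?thesis using iK K1 lt by blast
  qed
  have consec: "s \<le> \<tau> i \<or> \<tau> (i + 1) \<le> s" if c: "i \<in> K" "i + 1 \<in> K" "s \<in> \<tau> ` K" for i s
  proof -
    obtain k where k: "k \<in> K" "s = \<tau> k" using c(3) by blast
    show ?thesis using le_iff[OF k(1) c(1)] le_iff[OF c(2) k(1)] k(2) by auto
  qed
  obtain \<gamma> where \<gamma>: "geodesic Y.R gY I \<gamma>" "\<And>s. s \<in> \<tau> ` K \<Longrightarrow> \<gamma> s = p s"
  proof (rule Y.geodesic_fill[of I "\<tau> ` K" p])
    show "is_interval I" by (rule I)
    show "p s \<in> Y.R" if "s \<in> \<tau> ` K" for s using that q(1) p by auto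
    show d: "gY (p s) (p t) = t - s" if st: "s \<in> \<tau> ` K" "t \<in> \<tau> ` K" "s < t" for s t
    proof -
      obtain i j where ij: "i \<in> K" "j \<in> K" "s = \<tau> i" "t = \<tau> j" using st by blast
      hence "i < j" using le_iff[OF ij(2,1)] st(3) by auto
      thus ?thesis using q(2) ij p by simp
    qed
    show "\<exists>l\<in>\<tau> ` K. \<exists>h\<in>\<tau> ` K. l < t \<and> t < h \<and> (\<forall>s\<in>\<tau> ` K. s \<le> l \<or> h \<le> s)" if t: "t \<in> I" "t \<notin> \<tau> ` K" for t
    proof -
      obtain i where "i \<in> K" "i + 1 \<in> K" "\<tau> i < t" "t < \<tau> (i + 1)" using br[OF t] by blast
      thus ?thesis using consec by (intro bexI[of _ "\<tau> i"] bexI[of _ "\<tau> (i + 1)"]) auto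
    qed
    show "\<exists>\<sigma>. geodesic Y.R gY {0..h - l} \<sigma> \<and> \<sigma> 0 = p l \<and> \<sigma> (h - l) = p h"
      if lh: "l \<in> \<tau> ` K" "h \<in> \<tau> ` K" "l < h" for l h
    proof -
      have "p l \<in> Y.R" "p h \<in> Y.R" using lh p q(1) by auto
      from seg_ex[OF this] show ?thesis using d[OF lh] by simp
    qed
  qed blast
  have "\<exists>i\<in>K. gY (\<gamma> t) (q i) \<le> 1" if t: "t \<in> I" for t
  proof (cases "t \<in> \<tau> ` K")
    case True
    then obtain i where i: "i \<in> K" "t = \<tau> i" by blast
    thus ?thesis using \<gamma>(2)[OF True] p[OF i(1)] Y.zero[OF q(1)[OF i(1)]] by (intro bexI[of _ i]) auto
  next
    case False
    then obtain i where i: "i \<in> K" "i + 1 \<in> K" "\<tau> i < t" "t < \<tau> (i + 1)" using br[OF t] by blast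
    have "gY (\<gamma> t) (\<gamma> (\<tau> i)) = \<bar>t - \<tau> i\<bar>" by (rule Y.geodesicD(2)[OF \<gamma>(1) t I(3)[OF i(1)]])
    thus ?thesis using \<gamma>(2)[of "\<tau> i"] p[OF i(1)] i \<tau>[OF i(1,2)] by (intro bexI[of _ i]) auto
  qed
  thus ?thesis using that[OF \<gamma>(1)] \<gamma>(2) p by simp
qed

section \<open>Geodesics that witness membership in a neighbourhood\<close>

lemma nbhdI:
  assumes "b \<in> bowditch_boundary G S \<P>" "geodesic Y.R gY I \<gamma>" "starts_at I \<gamma> a" "ends_at I \<gamma> b" "\<And>t w. t \<in> I \<Longrightarrow> w \<in> A \<Longrightarrow> \<gamma> t \<noteq> vpoint w"
  shows "b \<in> bowditch_nbhd G S \<P> a A"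
proof -
  have "\<gamma> ` I \<inter> vpoint ` A = {}" using assms(5) by auto
  thus ?thesis using assms(1-4) unfolding bowditch_nbhd_def Let_def by blast
qed

text \<open>Each \<open>c n\<close> lies between \<open>c 0\<close> and some late
  \<open>x m\<close>, so the Gromov product of \<open>c n\<close> and that \<open>x m\<close> at
  \<open>c 0\<close> is \<open>n\<close>; as \<open>x m\<close> has a large product with every late
  \<open>x s\<close>, so has \<open>c n\<close>.\<close>

lemma limit_seq:
  assumes c: "\<And>i. c i \<in> V" "\<And>i j. i \<le> j \<Longrightarrow> rd (c i) (c j) = j - i" and x: "\<And>n. x n \<in> V" "gromov_conv \<one> x x"
    and lim: "\<And>n T. \<exists>m\<ge>T. rd (c 0) (c n) + rd (c n) (x m) = rd (c 0) (x m)"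
  shows "(\<lambda>n. vY (c n)) \<in> end_class x" "gromov_conv \<one> x c"
proof -
  have o: "\<one> \<in> V" by simp
  define e where "e = rd \<one> (c 0)"
  have base: "gp2 (c 0) u w - 2 * int e \<le> gp2 \<one> u w" if "u \<in> V" "w \<in> V" for u w
    using gp2_base[OF c(1)[of 0] o that] RD.dsym[of "c 0" \<one>] unfolding e_def by simp
  have cc: "gromov_conv \<one> c c"
    unfolding gromov_conv_def
  proof
    fix R
    have "R \<le> gp2 \<one> (c i) (c j)" if "nat R + 2 * e \<le> i" "nat R + 2 * e \<le> j" for i j
    proof -
      have "gp2 (c 0) (c i) (c j) = 2 * int (min i j)"
      proof (cases "i \<le> j")
        case True thus ?thesis using c(2)[of 0 i] c(2)[of 0 j] c(2)[of i j] unfolding gp2_def by simp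
      next
        case False thus ?thesis using c(2)[of 0 i] c(2)[of 0 j] c(2)[of j i] RD.dsym[of "c i" "c j"] unfolding gp2_def by simp
      qed
      thus ?thesis using base[OF c(1) c(1), of i j] that by linarith
    qed
    thus "\<exists>S. \<forall>s\<ge>S. \<forall>t\<ge>S. R \<le> gp2 \<one> (c s) (c t)" by blast
  qed
  show xc: "gromov_conv \<one> x c"
    unfolding gromov_conv_def
  proof
    fix R
    define r where "r = R + int (nat \<lceil>6 * dY + 4\<rceil>)"
    obtain s0 where S: "\<And>s t. s0 \<le> s \<Longrightarrow> s0 \<le> t \<Longrightarrow> r \<le> gp2 \<one> (x s) (x t)" using gromov_conv_large[OF x(2)] by blast
    define J where "J = max s0 (nat r + 2 * e)"
    have "R \<le> gp2 \<one> (x s) (c j)" if sj: "J \<le> s" "J \<le> j" for s j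
    proof -
      obtain m where m: "s0 \<le> m" "rd (c 0) (c j) + rd (c j) (x m) = rd (c 0) (x m)" using lim by blast
      have "gp2 (c 0) (x m) (c j) = 2 * int j" using m(2) c(2)[of 0 j] RD.dsym[of "c j" "x m"] unfolding gp2_def by simp
      moreover have "r \<le> 2 * int j - 2 * int e" using sj(2) unfolding J_def by linarith
      ultimately have "r \<le> gp2 \<one> (x m) (c j)" using base[OF x(1) c(1), of m j] by linarith
      moreover have "r \<le> gp2 \<one> (x s) (x m)" using S[of s m] sj m(1) unfolding J_def by simp
      ultimately show ?thesis using gp2_hyp[OF o x(1)[of s] x(1)[of m] c(1)[of j]] unfolding r_def by linarith
    qed
    thus "\<exists>S. \<forall>s\<ge>S. \<forall>t\<ge>S. R \<le> gp2 \<one> (x s) (c t)" by blast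
  qed
  show "(\<lambda>n. vY (c n)) \<in> end_class x" unfolding end_class_def using grel_iff[of x c, OF x(1) c(1)] x(2) cc xc by simp
qed

lemma far_vertices:
  assumes "finite A" "A \<subseteq> verts \<Gamma>Y"
  obtains r :: nat where "\<And>w p. w \<in> A \<Longrightarrow> p \<in> Y.R \<Longrightarrow> real r \<le> gY (vY \<one>) p \<Longrightarrow> p \<noteq> vpoint w"
proof -
  define r where "r = Max (insert 0 ((\<lambda>w. nat \<lceil>gY (vY \<one>) (vpoint w)\<rceil>) ` A)) + 1"
  have "gY (vY \<one>) (vpoint w) < real r" if "w \<in> A" for w
  proof -
    have "nat \<lceil>gY (vY \<one>) (vpoint w)\<rceil> \<le> Max (insert 0 ((\<lambda>w. nat \<lceil>gY (vY \<one>) (vpoint w)\<rceil>) ` A))"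
      using that assms(1) by (intro Max_ge) auto
    hence "nat \<lceil>gY (vY \<one>) (vpoint w)\<rceil> < r" unfolding r_def by linarith
    thus ?thesis by linarith
  qed
  thus ?thesis using that[of r] by fastforce
qed

lemma far_point:
  assumes "p \<in> Y.R" "g \<in> V" "gY p (vY g) \<le> 1" shows "real (rd \<one> g) \<le> gY (vY \<one>) p + 1"
  using Y.tri[of "vY \<one>" p "vY g"] assms Y_dist_VV[of \<one> g] vI by simp

text \<open>The line of \<open>line_ex\<close> joins the two limits. Each of its group elements lies
  between late points of \<open>x\<close> and \<open>y\<close>, so half their Gromov product bounds
  its distance from \<one> below, and all of the line is too far out to meet
  \<open>A\<close>.\<close>

lemma nbhd_line:
  assumes x: "dmorse \<Phi> x" "x 0 = \<one>" "diverges x" and y: "dmorse \<Psi> y" "y 0 = \<one>" "diverges y" and ne: "\<not> gromov_conv \<one> x y"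
    and A: "\<And>w p. w \<in> A \<Longrightarrow> p \<in> Y.R \<Longrightarrow> real r \<le> gY (vY \<one>) p \<Longrightarrow> p \<noteq> vpoint w"
    and far: "\<And>s t. T \<le> s \<Longrightarrow> T \<le> t \<Longrightarrow> 2 * int r + 2 \<le> gp2 \<one> (x s) (y t)"
  shows "bpoint y \<in> bowditch_nbhd G S \<P> (bpoint x) A"
proof -
  note V = dmorseV[OF x(1)] dmorseV[OF y(1)]
  have gx: "gromov_conv \<one> x x" and gy: "gromov_conv \<one> y y" using dmorse_gromov_conv[OF x(1,3)] dmorse_gromov_conv[OF y(1,3)] x y by auto
  obtain f :: "int \<Rightarrow> 'a" where f: "\<And>i. f i \<in> V" "\<And>i j. i \<le> j \<Longrightarrow> int (rd (f i) (f j)) = j - i"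
    "\<And>n T. \<exists>m\<ge>T. \<forall>i j. - n \<le> i \<longrightarrow> i \<le> j \<longrightarrow> j \<le> n \<longrightarrow>
       rd (x m) (f i) + rd (f i) (f j) + rd (f j) (y m) = rd (x m) (y m)"
    using line_ex[OF x(1) y(1) x(2) y(2) x(3) y(3) ne] by blast
  obtain \<gamma> where \<gamma>: "geodesic Y.R gY UNIV \<gamma>" "\<And>i. \<gamma> (real_of_int i) = vY (f i)" "\<And>t. \<exists>i. gY (\<gamma> t) (vY (f i)) \<le> 1"
  proof (rule fill_int[of UNIV real_of_int "\<lambda>i. vY (f i)" UNIV])
    show "gY (vY (f i)) (vY (f j)) = real_of_int j - real_of_int i" if "i < j" for i j
      using f(2)[of i j] that Y_dist_VV[OF f(1) f(1)] by (metis of_int_diff of_int_of_nat_eq less_imp_le)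
    show "\<exists>i\<in>UNIV. \<exists>j\<in>UNIV. real_of_int i \<le> t \<and> t \<le> real_of_int j" for t
      by (intro bexI[of _ "\<lfloor>t\<rfloor>"] bexI[of _ "\<lceil>t\<rceil>"]) auto
  qed (use f(1) vI in auto)
  have x_end: "(\<lambda>n. vY (f (- int n))) \<in> end_class x"
  proof (rule limit_seq(1)[OF f(1) _ V(1) gx])
    show "rd (f (- int i)) (f (- int j)) = j - i" if "i \<le> j" for i j
      using f(2)[of "- int j" "- int i"] that RD.dsym[of "f (- int i)" "f (- int j)"] by simp
    show "\<exists>m\<ge>T. rd (f (- int 0)) (f (- int n)) + rd (f (- int n)) (x m) = rd (f (- int 0)) (x m)" for n T
    proof -
      obtain m where m: "T \<le> m" "\<And>i j. - int n \<le> i \<Longrightarrow> i \<le> j \<Longrightarrow> j \<le> int n \<Longrightarrow>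
        rd (x m) (f i) + rd (f i) (f j) + rd (f j) (y m) = rd (x m) (y m)" using f(3)[of T "int n"] by blast
      have "rd (x m) (f (- int n)) + rd (f (- int n)) (f 0) + rd (f 0) (y m) = rd (x m) (y m)" using m(2)[of "- int n" 0] by simp
      moreover have "rd (x m) (f 0) + rd (f 0) (f 0) + rd (f 0) (y m) = rd (x m) (y m)" using m(2)[of 0 0] by simp
      moreover have "rd (f 0) (f 0) = 0" using RD.drefl f(1) by simp
      ultimately have "rd (f 0) (f (- int n)) + rd (f (- int n)) (x m) = rd (f 0) (x m)"
        using RD.dsym[of "f 0" "f (- int n)"] RD.dsym[of "f 0" "x m"] RD.dsym[of "f (- int n)" "x m"] by linarith
      thus ?thesis using m(1) by (intro exI[of _ m]) simp
    qed
  qed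
  have y_end: "(\<lambda>n. vY (f (int n))) \<in> end_class y"
  proof (rule limit_seq(1)[OF f(1) _ V(2) gy])
    show "rd (f (int i)) (f (int j)) = j - i" if "i \<le> j" for i j
      using f(2)[of "int i" "int j"] that by simp
    show "\<exists>m\<ge>T. rd (f (int 0)) (f (int n)) + rd (f (int n)) (y m) = rd (f (int 0)) (y m)" for n T
    proof -
      obtain m where m: "T \<le> m" "\<And>i j. - int n \<le> i \<Longrightarrow> i \<le> j \<Longrightarrow> j \<le> int n \<Longrightarrow>
        rd (x m) (f i) + rd (f i) (f j) + rd (f j) (y m) = rd (x m) (y m)" using f(3)[of T "int n"] by blast
      have "rd (x m) (f 0) + rd (f 0) (f (int n)) + rd (f (int n)) (y m) = rd (x m) (y m)" using m(2)[of 0 "int n"] by simp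
      moreover have "rd (x m) (f 0) + rd (f 0) (f 0) + rd (f 0) (y m) = rd (x m) (y m)" using m(2)[of 0 0] by simp
      moreover have "rd (f 0) (f 0) = 0" using RD.drefl f(1) by simp
      ultimately show ?thesis using m(1) by (intro exI[of _ m]) simp
    qed
  qed
  have dist: "r + 1 \<le> rd \<one> (f i)" for i
  proof -
    obtain m where m: "T \<le> m" "\<And>j k. - \<bar>i\<bar> \<le> j \<Longrightarrow> j \<le> k \<Longrightarrow> k \<le> \<bar>i\<bar> \<Longrightarrow>
      rd (x m) (f j) + rd (f j) (f k) + rd (f k) (y m) = rd (x m) (y m)" using f(3)[of T "\<bar>i\<bar>"] by blast
    have "rd (x m) (f i) + rd (f i) (f i) + rd (f i) (y m) = rd (x m) (y m)" by (rule m(2)) auto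
    hence "f i \<in> RD.Iv (x m) (y m)" using RD.drefl f(1) by (simp add: RD.Iv_def)
    hence "gp2 \<one> (x m) (y m) \<le> 2 * int (rd \<one> (f i))" using V by (intro gp2_Iv) auto
    thus ?thesis using far[OF m(1,1)] by linarith
  qed
  have px: "bpoint x = Inr (end_class x)" "bpoint y = Inr (end_class y)" using bpoint_diverges x y by auto
  show ?thesis
  proof (rule nbhdI[OF _ \<gamma>(1)])
    show "bpoint y \<in> bowditch_boundary G S \<P>" using bpoint_boundary y by blast
    have "\<gamma> (0 - real n) = vY (f (- int n))" "\<gamma> (0 + real n) = vY (f (int n))" for n using \<gamma>(2)[of "- int n"] \<gamma>(2)[of "int n"] by simp_all
    thus "starts_at UNIV \<gamma> (bpoint x)" "ends_at UNIV \<gamma> (bpoint y)" unfolding px using x_end y_end by (auto intro!: exI[of _ 0])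
    fix t w assume "w \<in> A"
    moreover have tR: "\<gamma> t \<in> Y.R" using Y.geodesicD(1)[OF \<gamma>(1)] by blast
    moreover obtain i where "gY (\<gamma> t) (vY (f i)) \<le> 1" using \<gamma>(3) by blast
    hence "real r \<le> gY (vY \<one>) (\<gamma> t)" using far_point[OF tR f(1)] dist[of i] by fastforce
    ultimately show "\<gamma> t \<noteq> vpoint w" using A by blast
  qed
qed

abbreviation "vC C \<equiv> (vpoint (Inr C) :: 'a + 'a set \<Rightarrow> real)"

lemma vC_sym: "C \<in> CC \<Longrightarrow> g \<in> V \<Longrightarrow> gY (vC C) (vY g) = gY (vY g) (vC C)"
  by (intro Y.sym vC vI)

lemma proj_dist: "C \<in> CC \<Longrightarrow> g \<in> V \<Longrightarrow> proj C g a \<Longrightarrow> gY (vY g) (vC C) = real (rd g a) + 1/2"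
  by (rule Y_dist_VC) (auto simp: proj_def)

lemma cone_ray:
  assumes C: "C \<in> CC" and f: "\<And>i. f i \<in> V" "\<And>i j. i \<le> j \<Longrightarrow> rd (f i) (f j) = j - i" "\<And>l. proj C (f l) (f 0)"
  obtains \<gamma> where "geodesic Y.R gY {0..} \<gamma>" "\<gamma> 0 = vC C" "\<And>n. \<gamma> (1/2 + real n) = vY (f n)"
    "\<And>t. 0 \<le> t \<Longrightarrow> \<exists>i. gY (\<gamma> t) (vY (f i)) \<le> 2"
proof -
  \<comment> \<open>The edge leaving the cone point has length 1/2, all later steps have length
    1.\<close>
  define \<tau> where "\<tau> i = (if i = 0 then 0 else real_of_int i - 1/2)" for i :: int
  define q where "q i = (if i = 0 then vC C else vY (f (nat (i - 1))))" for i :: int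
  have qR: "q i \<in> Y.R" for i using vC[OF C] vI[OF f(1)] by (simp add: q_def)
  obtain \<gamma> where \<gamma>: "geodesic Y.R gY {0..} \<gamma>" "\<And>i. i \<in> {0..} \<Longrightarrow> \<gamma> (\<tau> i) = q i" "\<And>t. t \<in> {0..} \<Longrightarrow> \<exists>i\<in>{0..}. gY (\<gamma> t) (q i) \<le> 1"
  proof (rule fill_int[of "{0..}" \<tau> q "{0..}"])
    show "gY (q i) (q j) = \<tau> j - \<tau> i" if ij: "i \<in> {0..}" "j \<in> {0..}" "i < j" for i j
    proof (cases "i = 0")
      case True
      hence "gY (q i) (q j) = gY (vC C) (vY (f (nat (j - 1))))" using ij by (simp add: q_def)
      also have "\<dots> = real (rd (f (nat (j - 1))) (f 0)) + 1/2" using proj_dist[OF C f(1) f(3)] vC_sym[OF C f(1)] by simp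
      also have "\<dots> = real (nat (j - 1)) + 1/2" using f(2)[of 0 "nat (j - 1)"] RD.dsym[of "f 0"] by simp
      finally show ?thesis using ij True by (simp add: \<tau>_def of_nat_nat)
    next
      case False
      have "gY (q i) (q j) = real (rd (f (nat (i - 1))) (f (nat (j - 1))))" using ij False Y_dist_VV[OF f(1) f(1)] by (simp add: q_def)
      also have "\<dots> = real (nat (j - 1) - nat (i - 1))" using f(2)[of "nat (i - 1)" "nat (j - 1)"] ij by simp
      also have "\<dots> = real_of_int (j - i)" using ij False by (simp add: of_nat_diff nat_le_eq_zle of_nat_nat)
      finally show ?thesis using ij False by (simp add: \<tau>_def)
    qed
    show "\<exists>i\<in>{0..}. \<exists>j\<in>{0..}. \<tau> i \<le> t \<and> t \<le> \<tau> j" if "t \<in> {0..}" for t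
      using that by (intro bexI[of _ 0] bexI[of _ "\<lceil>t\<rceil> + 1"]) (auto simp: \<tau>_def, linarith+)
  qed (auto simp: \<tau>_def is_interval_ci qR)
  show ?thesis
  proof (rule that[OF \<gamma>(1)])
    show "\<gamma> 0 = vC C" using \<gamma>(2)[of 0] by (simp add: \<tau>_def q_def)
    show "\<gamma> (1/2 + real n) = vY (f n)" for n using \<gamma>(2)[of "int n + 1"] by (simp add: \<tau>_def q_def)
    show "\<exists>i. gY (\<gamma> t) (vY (f i)) \<le> 2" if t: "0 \<le> t" for t
    proof -
      obtain i where i: "i \<in> {0..}" "gY (\<gamma> t) (q i) \<le> 1" using \<gamma>(3) t by auto
      have tR: "\<gamma> t \<in> Y.R" using Y.geodesicD(1)[OF \<gamma>(1), of t t] t by simp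
      show ?thesis
      proof (cases "i = 0")
        case True
        have "f 0 \<in> C" using f(3) unfolding proj_def by blast
        hence "gY (vC C) (vY (f 0)) \<le> 1/2" using Y_dist_edge[OF C] vC_sym[OF C f(1)] by simp
        moreover have "gY (\<gamma> t) (vY (f 0)) \<le> gY (\<gamma> t) (vC C) + gY (vC C) (vY (f 0))" using tR vC[OF C] vI[OF f(1)] by (rule Y.tri)
        ultimately show ?thesis using i True by (intro exI[of _ 0]) (simp add: q_def)
      next
        case False
        thus ?thesis using i by (intro exI[of _ "nat (i - 1)"]) (simp add: q_def)
      qed
    qed
  qed
qed

lemma cone_segment:
  assumes C: "C \<in> CC" "C' \<in> CC" "C \<noteq> C'" and g: "RD.geo n g" "\<And>l. l \<le> n \<Longrightarrow> proj C (g l) (g 0)" "\<And>l. l \<le> n \<Longrightarrow> proj C' (g l) (g n)"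
    and min: "\<And>u w. u \<in> C \<Longrightarrow> w \<in> C' \<Longrightarrow> n \<le> rd u w"
  obtains \<gamma> where "geodesic Y.R gY {0..real n + 1} \<gamma>" "\<gamma> 0 = vC C" "\<And>k. k \<le> n \<Longrightarrow> \<gamma> (1/2 + real k) = vY (g k)" "\<gamma> (real n + 1) = vC C'"
proof -
  \<comment> \<open>There is a half-edge at each end, so the total length is
    \<open>n + 1\<close>.\<close>
  define \<tau> where "\<tau> i = (if i = 0 then 0 else if i = int n + 2 then real n + 1 else real_of_int i - 1/2)" for i :: int
  define q where "q i = (if i = 0 then vC C else if i = int n + 2 then vC C' else vY (g (nat (i - 1))))" for i :: int
  let ?K = "{0..int n + 2}"
  have gV: "g k \<in> V" if "k \<le> n" for k using RD.geoV[OF g(1) that] .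
  have gD: "rd (g k) (g l) = l - k" if "k \<le> l" "l \<le> n" for k l using RD.geoD[OF g(1) that] .
  have qR: "q i \<in> Y.R" if "i \<in> ?K" for i using vC[OF C(1)] vC[OF C(2)] vI[OF gV, of "nat (i - 1)"] that by (auto simp: q_def)
  have in_C: "g 0 \<in> C" "g n \<in> C'" using g(2)[of n] g(3)[of n] unfolding proj_def by auto
  obtain \<gamma> where \<gamma>: "geodesic Y.R gY {0..real n + 1} \<gamma>" "\<And>i. i \<in> ?K \<Longrightarrow> \<gamma> (\<tau> i) = q i"
  proof (rule fill_int[of ?K \<tau> q "{0..real n + 1}"])
    show "gY (q i) (q j) = \<tau> j - \<tau> i" if ij: "i \<in> ?K" "j \<in> ?K" "i < j" for i j
    proof -
      consider "i = 0" "j = int n + 2" | "i = 0" "j < int n + 2" | "0 < i" "j = int n + 2" | "0 < i" "j < int n + 2" using ij by force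
      thus ?thesis
      proof cases
        case 1
        have "gY (vC C) (vC C') = real (rd (g 0) (g n)) + 1"
          using Y_dist_CC[OF C in_C] min gD[of 0 n] by simp
        thus ?thesis using 1 gD[of 0 n] by (simp add: q_def \<tau>_def)
      next
        case 2
        hence k: "nat (j - 1) \<le> n" "0 < j" using ij by auto
        have "gY (q i) (q j) = gY (vC C) (vY (g (nat (j - 1))))" using 2 k by (simp add: q_def)
        also have "\<dots> = real (rd (g (nat (j - 1))) (g 0)) + 1/2" using proj_dist[OF C(1) gV[OF k(1)] g(2)[OF k(1)]] vC_sym[OF C(1) gV[OF k(1)]] by simp
        also have "\<dots> = real (nat (j - 1)) + 1/2" using gD[of 0 "nat (j - 1)"] k RD.dsym[of "g 0"] by simp
        finally show ?thesis using k 2 by (simp add: \<tau>_def of_nat_nat)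
      next
        case 3
        hence k: "nat (i - 1) \<le> n" "i < int n + 2" using ij by auto
        have "gY (q i) (q j) = gY (vY (g (nat (i - 1)))) (vC C')" using 3 k by (simp add: q_def)
        also have "\<dots> = real (rd (g (nat (i - 1))) (g n)) + 1/2" using proj_dist[OF C(2) gV[OF k(1)] g(3)[OF k(1)]] by simp
        also have "\<dots> = real (n - nat (i - 1)) + 1/2" using gD[of "nat (i - 1)" n] k by simp
        also have "real (n - nat (i - 1)) = real n - real_of_int (i - 1)" using k 3 by (simp add: of_nat_diff of_nat_nat)
        finally show ?thesis using k 3 by (simp add: \<tau>_def)
      next
        case 4
        hence k: "nat (i - 1) \<le> nat (j - 1)" "nat (j - 1) \<le> n" "nat (i - 1) \<le> n" using ij by auto
        have "gY (q i) (q j) = real (rd (g (nat (i - 1))) (g (nat (j - 1))))" using 4 ij Y_dist_VV[OF gV[OF k(3)] gV[OF k(2)]] by (simp add: q_def)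
        also have "\<dots> = real (nat (j - 1) - nat (i - 1))" using gD[OF k(1,2)] by simp
        also have "\<dots> = real_of_int (j - i)" using ij 4 by (simp add: of_nat_diff nat_le_eq_zle of_nat_nat)
        finally show ?thesis using ij 4 by (simp add: \<tau>_def)
      qed
    qed
    show "\<exists>i\<in>?K. \<exists>j\<in>?K. \<tau> i \<le> t \<and> t \<le> \<tau> j" if "t \<in> {0..real n + 1}" for t
      using that by (intro bexI[of _ 0] bexI[of _ "int n + 2"]) (auto simp: \<tau>_def)
    show "\<tau> i < \<tau> (i + 1) \<and> \<tau> (i + 1) \<le> \<tau> i + 1" if c: "i \<in> ?K" "i + 1 \<in> ?K" for i
    proof -
      consider "i = 0" | "0 < i" "i = int n + 1" | "0 < i" "i < int n + 1" using c by force
      thus ?thesis by cases (auto simp: \<tau>_def)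
    qed
    show "\<tau> i \<in> {0..real n + 1}" if c: "i \<in> ?K" for i
    proof -
      consider "i = 0" | "i = int n + 2" | "0 < i" "i \<le> int n + 1" using c by force
      thus ?thesis
      proof cases
        case 3
        hence "real_of_int i \<le> real n + 1" "1 \<le> real_of_int i" by linarith+
        thus ?thesis using 3 by (simp add: \<tau>_def)
      qed (auto simp: \<tau>_def)
    qed
  qed (auto simp: is_interval_cc qR)
  show ?thesis
  proof (rule that[OF \<gamma>(1)])
    show "\<gamma> 0 = vC C" using \<gamma>(2)[of 0] by (simp add: \<tau>_def q_def)
    show "\<gamma> (1/2 + real k) = vY (g k)" if "k \<le> n" for k using \<gamma>(2)[of "int k + 1"] that by (simp add: \<tau>_def q_def)
    show "\<gamma> (real n + 1) = vC C'" using \<gamma>(2)[of "int n + 2"] by (simp add: \<tau>_def q_def)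
  qed
qed

abbreviation incident :: "'a + 'a set \<Rightarrow> 'a \<Rightarrow> bool" where
  "incident w g \<equiv> w = Inl g \<or> (\<exists>C\<in>CC. w = Inr C \<and> g \<in> C)"

text \<open>Each vertex in \<open>A\<close> is a group element or adjacent to one, so finitely many
  projections to \<open>C\<close> represent \<open>A\<close>; \<open>N\<close> exceeds the largest
  of their distances from \<one> by \<open>lip + 1\<close>.\<close>

lemma far_proj:
  assumes A: "finite A" "A \<subseteq> verts \<Gamma>Y" and C: "C \<in> CC"
  obtains N where "\<And>b w. b \<in> V \<Longrightarrow> N \<le> wd \<one> b \<Longrightarrow> w \<in> A \<Longrightarrow>
    \<exists>g a. g \<in> V \<and> proj C g a \<and> incident w g \<and> lip < wd b a"
proof -
  have "\<exists>g a. g \<in> V \<and> proj C g a \<and> incident w g" if w: "w \<in> A" for w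
  proof -
    have "w \<in> Inl ` V \<union> Inr ` CC" using A(2) w Y_verts by auto
    then consider g where "w = Inl g" "g \<in> V" | C' where "w = Inr C'" "C' \<in> CC" by blast
    thus ?thesis
    proof cases
      case 1 thus ?thesis using proj_ex[OF C] by blast
    next
      case 2
      obtain g where g: "g \<in> C'" using coset_ne[OF 2(2)] by blast
      obtain a where "proj C g a" using proj_ex[OF C] by blast
      thus ?thesis using 2 g coset_mem_V[OF 2(2) g] by (intro exI[of _ g] exI[of _ a]) blast
    qed
  qed
  hence "\<forall>w\<in>A. \<exists>g a. g \<in> V \<and> proj C g a \<and> incident w g" by blast
  from bchoice[OF this] obtain G where "\<forall>w\<in>A. \<exists>a. G w \<in> V \<and> proj C (G w) a \<and> (w = Inl (G w) \<or> (\<exists>C'\<in>CC. w = Inr C' \<and> G w \<in> C'))" by (rule exE)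
  from bchoice[OF this] obtain A' where "\<forall>w\<in>A. G w \<in> V \<and> proj C (G w) (A' w) \<and> (w = Inl (G w) \<or> (\<exists>C'\<in>CC. w = Inr C' \<and> G w \<in> C'))" by (rule exE)
  note ga = bspec[OF this]
  define N where "N = lip + 1 + Max (insert 0 ((\<lambda>w. wd \<one> (A' w)) ` A))"
  show ?thesis
  proof (rule that[of N])
    fix b w assume b: "b \<in> V" "N \<le> wd \<one> b" and w: "w \<in> A"
    have aV: "A' w \<in> V" using ga[OF w] coset_mem_V[OF C] unfolding proj_def by blast
    have "wd \<one> (A' w) \<le> Max (insert 0 ((\<lambda>w. wd \<one> (A' w)) ` A))" using w A(1) by (intro Max_ge) auto
    moreover have "wd \<one> b \<le> wd \<one> (A' w) + wd (A' w) b" using b aV by (intro W.dtri) auto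
    ultimately have "lip < wd b (A' w)" using b(2) W.dsym[of b "A' w"] unfolding N_def by linarith
    thus "\<exists>g a. g \<in> V \<and> proj C g a \<and> incident w g \<and> lip < wd b a" using ga[OF w] by blast
  qed
qed

text \<open>If the geodesic met \<open>w\<close>, it would pass through \<open>g\<close> or through
  an element sharing with \<open>g\<close> a coset other than \<open>C\<close>. Its elements all
  project to \<open>f 0\<close>, so \<open>proj_step\<close> would put \<open>f 0\<close> within
  \<open>lip\<close> of the projection \<open>a\<close> of \<open>g\<close>.\<close>

lemma cone_avoid:
  assumes C: "C \<in> CC" and \<gamma>: "geodesic Y.R gY I \<gamma>" "is_interval I" "0 \<in> I" "I \<subseteq> {0..}" "\<gamma> 0 = vC C"
    and f: "\<And>k. 1/2 + real k \<in> I \<Longrightarrow> \<gamma> (1/2 + real k) = vY (f k) \<and> f k \<in> V \<and> proj C (f k) (f 0)"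
    and w: "w \<noteq> Inr C" "g \<in> V" "proj C g a" "incident w g" "lip < wd (f 0) a" and t: "t \<in> I"
  shows "\<gamma> t \<noteq> vpoint w"
proof
  assume eq: "\<gamma> t = vpoint w"
  have t0: "0 \<le> t" using t \<gamma>(4) by auto
  have dist: "gY (vC C) (vpoint w) = t" using Y.geodesicD(2)[OF \<gamma>(1,3) t] \<gamma>(5) eq t0 by simp
  have contra: False if k: "1/2 + real k \<in> I" "astep C (f k) g" for k
    using proj_step[OF C _ w(2) _ w(3) k(2), of "f 0"] f[OF k(1)] w(5) by simp
  from w(4) show False
  proof
    assume wg: "w = Inl g"
    have "t = 1/2 + real (rd g a)" using dist proj_dist[OF C w(2,3)] vC_sym[OF C w(2)] unfolding wg by simp
    hence k: "1/2 + real (rd g a) \<in> I" "\<gamma> (1/2 + real (rd g a)) = vY g" using t eq wg by auto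
    hence "f (rd g a) = g" using f[OF k(1)] by (simp add: vpoint_inj)
    thus False using contra[OF k(1)] w(2) W.drefl unfolding astep_def by simp
  next
    assume "\<exists>C'\<in>CC. w = Inr C' \<and> g \<in> C'"
    then obtain C' where C': "C' \<in> CC" "w = Inr C'" "g \<in> C'" by blast
    have ne: "C \<noteq> C'" using w(1) C'(2) by auto
    obtain n h where h: "RD.geo n h" "h 0 \<in> C" "h n \<in> C'" "\<And>u w. u \<in> C \<Longrightarrow> w \<in> C' \<Longrightarrow> n \<le> rd u w"
      by (rule coset_geo[OF C C'(1)]) blast
    have "rd (h 0) (h n) = n" using RD.geoD[OF h(1), of 0 n] by simp
    hence tn: "t = real n + 1" using dist Y_dist_CC[OF C C'(1) ne h(2,3)] h(4) unfolding C'(2) by simp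
    \<comment> \<open>The point 1/2 before the cone point of \<open>C'\<close> is a group element,
      and it turns out to lie in \<open>C'\<close>.\<close>
    have I: "1/2 + real n \<in> I" by (rule mem_is_interval_1_I[OF \<gamma>(2,3) t]) (use tn in auto)
    have "gY (\<gamma> (1/2 + real n)) (\<gamma> t) = \<bar>1/2 + real n - t\<bar>" by (rule Y.geodesicD(2)[OF \<gamma>(1) I t])
    hence half: "gY (vY (f n)) (vC C') = 1/2" using f[OF I] eq C'(2) tn by simp
    obtain b where b: "proj C' (f n) b" using proj_ex[OF C'(1)] by blast
    have fV: "f n \<in> V" using f[OF I] by blast
    have "rd (f n) b = 0" using proj_dist[OF C'(1) fV b] half by simp
    moreover have bC: "b \<in> C'" using b unfolding proj_def by blast
    ultimately have "f n \<in> C'" using RD.d0[OF fV coset_mem_V[OF C'(1) bC]] by simp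
    thus False using contra[OF I] C' ne unfolding astep_def by blast
  qed
qed

text \<open>The ray from the cone point of \<open>C\<close> to the limit of \<open>x\<close> is
  traversed backwards, since \<open>M(a,A)\<close> prescribes the starting point. Its elements lie
  between \<open>f 0\<close>, which is close in the coned-off graph to late points of
  \<open>y\<close>, and late points of \<open>x\<close>; this keeps it far from \<one> and so away
  from \<open>A\<close>.\<close>

lemma nbhd_to_cone:
  assumes x: "dmorse \<Phi> x" "x 0 = \<one>" "diverges x" and y: "dmorse \<Psi> y" "y 0 = \<one>"
    and C: "C \<in> CC" "\<And>s. s0 \<le> s \<Longrightarrow> \<exists>a\<in>C. wd a (y s) \<le> e"
    and A: "\<And>w p. w \<in> A \<Longrightarrow> p \<in> Y.R \<Longrightarrow> real r \<le> gY (vY \<one>) p \<Longrightarrow> p \<noteq> vpoint w"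
    and far: "\<And>s t. T \<le> s \<Longrightarrow> T \<le> t \<Longrightarrow> 2 * int r + 2 * int e + 6 \<le> gp2 \<one> (x s) (y t)"
  shows "bpoint y \<in> bowditch_nbhd G S \<P> (bpoint x) A"
proof -
  note V = dmorseV[OF x(1)] dmorseV[OF y(1)]
  have gx: "gromov_conv \<one> x x" using dmorse_gromov_conv[OF x(1,3)] x by auto
  have py: "bpoint y = Inl (Inr C)" by (rule bpoint_near_coset[OF y(1) near_coset_eventually[OF y(1) C]])
  have px: "bpoint x = Inr (end_class x)" using bpoint_diverges x by auto
  obtain f :: "nat \<Rightarrow> 'a" where f: "\<And>i. f i \<in> V" "\<And>i j. i \<le> j \<Longrightarrow> rd (f i) (f j) = j - i" "\<And>l. proj C (f l) (f 0)"
    "\<And>n T. \<exists>m\<ge>T. proj C (x m) (f 0) \<and> (\<forall>j\<le>n. rd (f 0) (f j) + rd (f j) (x m) = rd (f 0) (x m))"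
    by (rule ray_ex[OF x(1,3) C(1)]) (assumption | rule that)+
  obtain \<gamma> where \<gamma>: "geodesic Y.R gY {0..} \<gamma>" "\<gamma> 0 = vC C" "\<And>n. \<gamma> (1/2 + real n) = vY (f n)"
    "\<And>t. 0 \<le> t \<Longrightarrow> \<exists>i. gY (\<gamma> t) (vY (f i)) \<le> 2"
    by (rule cone_ray[OF C(1) f(1-3)]) (assumption | rule that)+
  have lim: "(\<lambda>n. vY (f n)) \<in> end_class x"
  proof (rule limit_seq(1)[OF f(1,2) V(1) gx])
    show "\<exists>m\<ge>T. rd (f 0) (f n) + rd (f n) (x m) = rd (f 0) (x m)" for n T using f(4)[of T n] by blast
  qed
  have dist: "r + 2 \<le> rd \<one> (f j)" for j
  proof -
    obtain m where m: "T \<le> m" "rd (f 0) (f j) + rd (f j) (x m) = rd (f 0) (x m)" using f(4)[of T j] by blast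
    hence "f j \<in> RD.Iv (f 0) (x m)" using f(1) by (simp add: RD.Iv_def)
    hence 1: "gp2 \<one> (f 0) (x m) \<le> 2 * int (rd \<one> (f j))" using V f(1) by (intro gp2_Iv) auto
    obtain a where a: "a \<in> C" "wd a (y (max T s0)) \<le> e" using C(2)[of "max T s0"] by auto
    have aV: "a \<in> V" using coset_mem_V[OF C(1) a(1)] .
    have "f 0 \<in> C" using f(3) unfolding proj_def by blast
    hence "rd (f 0) a \<le> 1" using coset_rd[OF C(1)] a(1) by blast
    moreover have "rd a (y (max T s0)) \<le> e" using rd_le_wd[OF aV V(2)] a(2) order_trans by blast
    moreover have "gp2 \<one> (y (max T s0)) (x m) - 2 * int (rd a (y (max T s0))) \<le> gp2 \<one> a (x m)" using V aV by (intro gp2_lip) auto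
    moreover have "gp2 \<one> a (x m) - 2 * int (rd (f 0) a) \<le> gp2 \<one> (f 0) (x m)" using V aV f(1) by (intro gp2_lip) auto
    ultimately show ?thesis using 1 far[OF m(1), of "max T s0"] gp2_sym[of \<one> "y (max T s0)" "x m"] by linarith
  qed
  have rev: "geodesic Y.R gY {..0} (\<lambda>t. \<gamma> (- t))"
  proof (rule Y.geodesicI)
    show "\<gamma> (- t) \<in> Y.R" if "t \<in> {..0}" for t using Y.geodesicD(1)[OF \<gamma>(1), of "- t" "- t"] that by simp
    show "gY (\<gamma> (- s)) (\<gamma> (- t)) = t - s" if "s \<in> {..0}" "t \<in> {..0}" "s < t" for s t
      using Y.geodesicD(2)[OF \<gamma>(1), of "- s" "- t"] that by simp
  qed (simp add: is_interval_ic)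
  show ?thesis
  proof (rule nbhdI[OF _ rev])
    show "bpoint y \<in> bowditch_boundary G S \<P>" using bpoint_boundary y by blast
    have "\<gamma> (- (- 1/2 - real n)) = vY (f n)" for n using \<gamma>(3)[of n] by (simp add: add.commute)
    thus "starts_at {..0} (\<lambda>t. \<gamma> (- t)) (bpoint x)" unfolding px starts_at.simps using lim by (intro exI[of _ "- 1/2"]) simp
    show "ends_at {..0} (\<lambda>t. \<gamma> (- t)) (bpoint y)" unfolding py ends_at.simps using \<gamma>(2) by auto
    fix t :: real and w assume t: "t \<in> {..0}" and w: "w \<in> A"
    have tR: "\<gamma> (- t) \<in> Y.R" using Y.geodesicD(1)[OF \<gamma>(1), of "- t" "- t"] t by simp
    obtain i where i: "gY (\<gamma> (- t)) (vY (f i)) \<le> 2" using \<gamma>(4)[of "- t"] t by auto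
    have o: "vY \<one> \<in> Y.R" by (simp add: vI)
    have "real (rd \<one> (f i)) \<le> gY (vY \<one>) (\<gamma> (- t)) + 2"
      using Y.tri[OF o tR vI[OF f(1)], of i] i Y_dist_VV[OF one_closed f(1), of i] by simp
    hence "real r \<le> gY (vY \<one>) (\<gamma> (- t))" using dist[of i] by linarith
    thus "\<gamma> (- t) \<noteq> vpoint w" using A w tR by blast
  qed
qed

text \<open>The geodesic starts at a fixed cone point, so distance from \<one> cannot separate it
  from \<open>A\<close> as in \<open>nbhd_to_cone\<close>. Instead it leaves \<open>C\<close> at a
  projection of a late \<open>y m\<close>, which is far from \<one> in the word metric, and
  \<open>cone_avoid\<close> applies.\<close>

lemma nbhd_from_cone:
  assumes C: "C \<in> CC" and y: "dmorse \<Psi> y" "y 0 = \<one>" "diverges y" and A: "Inr C \<notin> A"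
    and proj: "\<And>b w. b \<in> V \<Longrightarrow> N \<le> wd \<one> b \<Longrightarrow> w \<in> A \<Longrightarrow>
    \<exists>g a. g \<in> V \<and> proj C g a \<and> incident w g \<and> lip < wd b a"
    and far: "\<And>a m. T \<le> m \<Longrightarrow> proj C (y m) a \<Longrightarrow> N \<le> wd \<one> a"
  shows "bpoint y \<in> bowditch_nbhd G S \<P> (Inl (Inr C)) A"
proof -
  note V = dmorseV[OF y(1)]
  have gy: "gromov_conv \<one> y y" using dmorse_gromov_conv[OF y(1,3)] y by auto
  have py: "bpoint y = Inr (end_class y)" using bpoint_diverges y by auto
  obtain f :: "nat \<Rightarrow> 'a" where f: "\<And>i. f i \<in> V" "\<And>i j. i \<le> j \<Longrightarrow> rd (f i) (f j) = j - i" "\<And>l. proj C (f l) (f 0)"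
    "\<And>n T. \<exists>m\<ge>T. proj C (y m) (f 0) \<and> (\<forall>j\<le>n. rd (f 0) (f j) + rd (f j) (y m) = rd (f 0) (y m))"
    by (rule ray_ex[OF y(1,3) C(1)]) (assumption | rule that)+
  obtain \<gamma> where \<gamma>: "geodesic Y.R gY {0..} \<gamma>" "\<gamma> 0 = vC C" "\<And>n. \<gamma> (1/2 + real n) = vY (f n)"
    "\<And>t. 0 \<le> t \<Longrightarrow> \<exists>i. gY (\<gamma> t) (vY (f i)) \<le> 2"
    by (rule cone_ray[OF C(1) f(1-3)]) (assumption | rule that)+
  have lim: "(\<lambda>n. vY (f n)) \<in> end_class y"
  proof (rule limit_seq(1)[OF f(1,2) V(1) gy])
    show "\<exists>m\<ge>T. rd (f 0) (f n) + rd (f n) (y m) = rd (f 0) (y m)" for n T using f(4)[of T n] by blast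
  qed
  have N: "N \<le> wd \<one> (f 0)" using f(4)[of T 0] far by blast
  show ?thesis
  proof (rule nbhdI[OF _ \<gamma>(1)])
    show "bpoint y \<in> bowditch_boundary G S \<P>" using bpoint_boundary y by blast
    show "starts_at {0..} \<gamma> (Inl (Inr C))" using \<gamma>(2) by auto
    show "ends_at {0..} \<gamma> (bpoint y)" unfolding py ends_at.simps using lim \<gamma>(3) by (intro exI[of _ "1/2"]) simp
    fix t :: real and w assume t: "t \<in> {0..}" and w: "w \<in> A"
    obtain g a where ga: "g \<in> V" "proj C g a" "incident w g" "lip < wd (f 0) a"
      using proj[OF f(1) N w] by blast
    show "\<gamma> t \<noteq> vpoint w"
      by (rule cone_avoid[where f = f and g = g and a = a and C = C, OF C \<gamma>(1)]) (use A w f \<gamma> ga t in \<open>auto simp: is_interval_ci\<close>)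
  qed
qed

lemma nbhd_cone_cone:
  assumes C: "C \<in> CC" "C' \<in> CC" "C \<noteq> C'" and A: "Inr C \<notin> A"
    and proj: "\<And>b w. b \<in> V \<Longrightarrow> N \<le> wd \<one> b \<Longrightarrow> w \<in> A \<Longrightarrow>
    \<exists>g a. g \<in> V \<and> proj C g a \<and> incident w g \<and> lip < wd b a"
    and far: "\<And>n g. RD.geo n g \<Longrightarrow> g 0 \<in> C \<Longrightarrow> g n \<in> C' \<Longrightarrow> \<forall>l\<le>n. proj C (g l) (g 0) \<Longrightarrow> \<forall>l\<le>n. proj C' (g l) (g n) \<Longrightarrow> N \<le> wd \<one> (g 0)"
  shows "Inl (Inr C') \<in> bowditch_nbhd G S \<P> (Inl (Inr C)) A"
proof -
  obtain n f where f: "RD.geo n f" "f 0 \<in> C" "f n \<in> C'" "\<And>l. l \<le> n \<Longrightarrow> proj C (f l) (f 0)" "\<And>l. l \<le> n \<Longrightarrow> proj C' (f l) (f n)"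
    "\<And>u w. u \<in> C \<Longrightarrow> w \<in> C' \<Longrightarrow> n \<le> rd u w" by (rule coset_geo[OF C(1,2)]) (assumption | rule that)+
  have fV: "f k \<in> V" if "k \<le> n" for k using RD.geoV[OF f(1) that] .
  obtain \<gamma> where \<gamma>: "geodesic Y.R gY {0..real n + 1} \<gamma>" "\<gamma> 0 = vC C" "\<And>k. k \<le> n \<Longrightarrow> \<gamma> (1/2 + real k) = vY (f k)" "\<gamma> (real n + 1) = vC C'"
    by (rule cone_segment[OF C f(1,4,5,6)]) (assumption | rule that)+
  have N: "N \<le> wd \<one> (f 0)" using far f by blast
  show ?thesis
  proof (rule nbhdI[OF _ \<gamma>(1)])
    show "Inl (Inr C') \<in> bowditch_boundary G S \<P>" using C unfolding bowditch_boundary_def parabolic_points_def by blast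
    show "starts_at {0..real n + 1} \<gamma> (Inl (Inr C))" using \<gamma>(2) by (auto intro!: bexI[of _ 0])
    show "ends_at {0..real n + 1} \<gamma> (Inl (Inr C'))" using \<gamma>(4) by (auto intro!: bexI[of _ "real n + 1"])
    fix t :: real and w assume t: "t \<in> {0..real n + 1}" and w: "w \<in> A"
    obtain g a where ga: "g \<in> V" "proj C g a" "incident w g" "lip < wd (f 0) a"
      using proj[OF fV N w] by blast
    have k: "k \<le> n" if "1/2 + real k \<in> {0..real n + 1}" for k
    proof -
      have "real k < real (n + 1)" using that by simp
      thus ?thesis by linarith
    qed
    show "\<gamma> t \<noteq> vpoint w"
    proof (rule cone_avoid[where f = f and g = g and a = a and C = C, OF C(1) \<gamma>(1)])
      show "\<gamma> (1/2 + real k) = vY (f k) \<and> f k \<in> V \<and> proj C (f k) (f 0)" if "1/2 + real k \<in> {0..real n + 1}" for k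
        using \<gamma>(3) f(4) fV k[OF that] by blast
    qed (use A w ga t \<gamma>(2) in \<open>auto simp: is_interval_cc\<close>)
  qed
qed

text \<open>The first alternative is needed: no geodesic joins a non-parabolic point \<open>a\<close> to itself, so
  \<open>a\<close> does not lie in \<open>M(a,A)\<close>.\<close>

lemma bpoint_continuous:
  assumes x: "dmorse \<Phi> x" "x 0 = \<one>" and A: "finite A" "A \<subseteq> verts \<Gamma>Y" "bpoint x \<notin> Inl ` A"
  obtains T :: nat where "\<And>y. dmorse \<Phi> y \<Longrightarrow> y 0 = \<one> \<Longrightarrow> \<forall>t\<le>T. wd (x t) (y t) \<le> 2 \<Longrightarrow>
    bpoint y = bpoint x \<or> bpoint y \<in> bowditch_nbhd G S \<P> (bpoint x) A"
proof (cases "diverges x")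
  case True
  obtain r :: nat where r: "\<And>w p. w \<in> A \<Longrightarrow> p \<in> Y.R \<Longrightarrow> real r \<le> gY (vY \<one>) p \<Longrightarrow> p \<noteq> vpoint w"
    by (rule far_vertices[OF A(1,2)]) (assumption | rule that)+
  obtain T where T: "\<And>y s t. dmorse \<Phi> y \<Longrightarrow> y 0 = \<one> \<Longrightarrow> (\<forall>t\<le>T. wd (x t) (y t) \<le> 2) \<Longrightarrow> T \<le> s \<Longrightarrow> T \<le> t \<Longrightarrow>
      2 * int r + 2 * int (coset_const \<Phi>) + 6 \<le> gp2 \<one> (x s) (y t)"
    using cont_far[OF x(1) True, of "2 * int r + 2 * int (coset_const \<Phi>) + 6"] unfolding x(2) by blast
  show ?thesis
  proof (rule that[of T])
    fix y assume y: "dmorse \<Phi> y" "y 0 = \<one>" and c: "\<forall>t\<le>T. wd (x t) (y t) \<le> 2"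
    note far = T[OF y c]
    show "bpoint y = bpoint x \<or> bpoint y \<in> bowditch_nbhd G S \<P> (bpoint x) A"
    proof (cases "diverges y")
      case dy: True
      show ?thesis
      proof (cases "gromov_conv \<one> x y")
        case True
        have "gromov_conv \<one> x x" "gromov_conv \<one> y y" using dmorse_gromov_conv[OF x(1) \<open>diverges x\<close>] dmorse_gromov_conv[OF y(1) dy] x y by auto
        hence "end_class x = end_class y" using end_class_eq[of x y, OF dmorseV[OF x(1)] dmorseV[OF y(1)]] True by blast
        thus ?thesis using bpoint_diverges[OF x(1) \<open>diverges x\<close>] bpoint_diverges[OF y(1) dy] by simp
      next
        case False
        have "2 * int r + 2 \<le> gp2 \<one> (x s) (y t)" if "T \<le> s" "T \<le> t" for s t using far[OF that] by linarith
        thus ?thesis using nbhd_line[OF x True y dy False r] by blast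
      qed
    next
      case False
      obtain C s0 where C: "C \<in> CC" "\<And>s. s0 \<le> s \<Longrightarrow> \<exists>a\<in>C. wd a (y s) \<le> coset_const \<Phi>" by (rule diverges_or_near[OF y(1) False]) (assumption | rule that)+
      show ?thesis using nbhd_to_cone[OF x True y C r far] by blast
    qed
  qed
next
  case False
  obtain C s0 where C: "C \<in> CC" "\<And>s. s0 \<le> s \<Longrightarrow> \<exists>a\<in>C. wd a (x s) \<le> coset_const \<Phi>" by (rule diverges_or_near[OF x(1) False]) (assumption | rule that)+
  have px: "bpoint x = Inl (Inr C)" by (rule bpoint_near_coset[OF x(1) near_coset_eventually[OF x(1) C]])
  hence AC: "Inr C \<notin> A" using A(3) by auto
  obtain N where N: "\<And>b w. b \<in> V \<Longrightarrow> N \<le> wd \<one> b \<Longrightarrow> w \<in> A \<Longrightarrow>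
    \<exists>g a. g \<in> V \<and> proj C g a \<and> incident w g \<and> lip < wd b a"
    by (rule far_proj[OF A(1,2) C(1)]) (assumption | rule that)+
  obtain T where T: "\<forall>y. dmorse \<Phi> y \<longrightarrow> y 0 = x 0 \<longrightarrow> (\<forall>t\<le>T. wd (x t) (y t) \<le> 2) \<longrightarrow>
    (\<forall>a m. T \<le> m \<longrightarrow> proj C (y m) a \<longrightarrow> N \<le> wd (x 0) a) \<and>
    (\<forall>C' g n S'. C' \<in> CC \<longrightarrow> C \<noteq> C' \<longrightarrow> (\<forall>s\<ge>S'. \<exists>b\<in>C'. wd b (y s) \<le> coset_const \<Phi>) \<longrightarrow> RD.geo n g \<longrightarrow> g 0 \<in> C \<longrightarrow> g n \<in> C' \<longrightarrow>
       (\<forall>l\<le>n. proj C (g l) (g 0)) \<longrightarrow> (\<forall>l\<le>n. proj C' (g l) (g n)) \<longrightarrow> N \<le> wd (x 0) (g 0))"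
    by (rule exE[OF cont_coset[where N = N, OF x(1) C]]) (assumption | rule that)+
  show ?thesis
  proof (rule that[of T])
    fix y assume y: "dmorse \<Phi> y" "y 0 = \<one>" and c: "\<forall>t\<le>T. wd (x t) (y t) \<le> 2"
    have y0: "y 0 = x 0" using x(2) y(2) by simp
    note T' = mp[OF mp[OF mp[OF spec[OF T] y(1)] y0] c, unfolded x(2)]
    have far: "\<And>a m. T \<le> m \<Longrightarrow> proj C (y m) a \<Longrightarrow> N \<le> wd \<one> a"
      and far2: "\<And>C' g n S'. C' \<in> CC \<Longrightarrow> C \<noteq> C' \<Longrightarrow> (\<forall>s\<ge>S'. \<exists>b\<in>C'. wd b (y s) \<le> coset_const \<Phi>) \<Longrightarrow> RD.geo n g \<Longrightarrow> g 0 \<in> C \<Longrightarrow> g n \<in> C' \<Longrightarrow>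
       \<forall>l\<le>n. proj C (g l) (g 0) \<Longrightarrow> \<forall>l\<le>n. proj C' (g l) (g n) \<Longrightarrow> N \<le> wd \<one> (g 0)"
      using conjunct1[OF T'] conjunct2[OF T'] by blast+
    show "bpoint y = bpoint x \<or> bpoint y \<in> bowditch_nbhd G S \<P> (bpoint x) A"
    proof (cases "diverges y")
      case dy: True
      show ?thesis using nbhd_from_cone[OF C(1) y dy AC N far] px by simp
    next
      case False
      obtain C' s1 where C': "C' \<in> CC" "\<And>s. s1 \<le> s \<Longrightarrow> \<exists>a\<in>C'. wd a (y s) \<le> coset_const \<Phi>" by (rule diverges_or_near[OF y(1) False]) (assumption | rule that)+
      have py: "bpoint y = Inl (Inr C')" by (rule bpoint_near_coset[OF y(1) near_coset_eventually[OF y(1) C']])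
      show ?thesis
      proof (cases "C = C'")
        case True thus ?thesis using px py by simp
      next
        case ne: False
        have near: "\<forall>s\<ge>s1. \<exists>b\<in>C'. wd b (y s) \<le> coset_const \<Phi>" using C'(2) by blast
        have "Inl (Inr C') \<in> bowditch_nbhd G S \<P> (Inl (Inr C)) A"
          by (rule nbhd_cone_cone[where N = N, OF C(1) C'(1) ne AC]) (erule (2) N, erule (4) far2[OF C'(1) ne near])
        thus ?thesis using px py by simp
      qed
    qed
  qed
qed

section \<open>The map on classes of Morse rays\<close>

abbreviation "morse_bd \<equiv> group_morse_boundary G S"

definition boundary_map :: "(real \<Rightarrow> 'a \<Rightarrow> real) set \<Rightarrow> 'a bowditch_point" where
  "boundary_map x = bpoint (disc (SOME \<alpha>. \<alpha> \<in> x))"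

lemma boundary_quotient: "morse_bd = mrays // mrel"
  unfolding group_morse_boundary_def morse_boundary_def by simp

lemma boundary_ne: "x \<in> morse_bd \<Longrightarrow> \<exists>\<alpha>. \<alpha> \<in> x"
  unfolding boundary_quotient using in_quotient_imp_non_empty[OF mrel_equiv] by blast

lemma boundary_ray: "x \<in> morse_bd \<Longrightarrow> \<alpha> \<in> x \<Longrightarrow> \<alpha> \<in> mrays"
  unfolding boundary_quotient using in_quotient_imp_subset[OF mrel_equiv] by blast

lemma boundary_rel: "x \<in> morse_bd \<Longrightarrow> \<alpha> \<in> x \<Longrightarrow> \<beta> \<in> x \<Longrightarrow> bounded_dist (disc \<alpha>) (disc \<beta>)"
  using quotient_eq_iff[OF mrel_equiv, of x x \<alpha> \<beta>] unfolding boundary_quotient mrel_iff by blast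

lemma ray_bpoint:
  assumes "\<alpha> \<in> mrays" "\<beta> \<in> mrays" "bounded_dist (disc \<alpha>) (disc \<beta>)"
  shows "bpoint (disc \<alpha>) = bpoint (disc \<beta>)"
proof -
  obtain \<Phi> \<Psi> where "dmorse \<Phi> (disc \<alpha>)" "dmorse \<Psi> (disc \<beta>)" using mraysD(2) assms by blast
  thus ?thesis using bpoint_bounded_dist mraysD(3) assms by blast
qed

lemma boundary_map_eq: "x \<in> morse_bd \<Longrightarrow> \<alpha> \<in> x \<Longrightarrow> boundary_map x = bpoint (disc \<alpha>)"
  unfolding boundary_map_def
  by (rule ray_bpoint) (use boundary_ray boundary_rel someI[of "\<lambda>\<alpha>. \<alpha> \<in> x" \<alpha>] in auto)

lemma coset_boundary_iff:
  assumes "x \<in> morse_bd" "\<alpha> \<in> x" "C \<in> CC"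
  shows "x \<in> coset_morse_boundary G S C \<longleftrightarrow> near_coset (disc \<alpha>) C"
proof -
  have g: "geodesic X.R dX {0..} \<gamma>" if "\<gamma> \<in> x" for \<gamma> using mraysD(1) boundary_ray assms(1) that by blast
  have "near_coset (disc \<gamma>) C \<longleftrightarrow> near_coset (disc \<alpha>) C" if "\<gamma> \<in> x" for \<gamma>
    using near_coset_bounded_dist[of "disc \<gamma>" "disc \<alpha>" C] near_coset_bounded_dist[of "disc \<alpha>" "disc \<gamma>" C] disc_V g that assms(2) boundary_rel[OF assms(1)] by blast
  thus ?thesis unfolding coset_morse_boundary_def using assms near_coset_ray[OF g assms(3)] by blast
qed

lemma nonperipheral_diverges:
  assumes "x \<in> nonperipheral_limit_points G S \<P>" "\<alpha> \<in> x"
  shows "diverges (disc \<alpha>)"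
proof (rule ccontr)
  assume n: "\<not> diverges (disc \<alpha>)"
  have x: "x \<in> morse_bd" using assms(1) unfolding nonperipheral_limit_points_def by blast
  obtain \<Phi> where "dmorse \<Phi> (disc \<alpha>)" using mraysD(2)[OF boundary_ray[OF x assms(2)]] by blast
  then obtain C where C: "near_coset (disc \<alpha>) C" using near_coset_or_diverges n by blast
  hence "C \<in> CC" unfolding near_coset_def by blast
  thus False using assms(1) C coset_boundary_iff[OF x assms(2)]
    unfolding nonperipheral_limit_points_def peripheral_limit_points_def by blast
qed

lemma boundary_map_inj: "inj_on boundary_map (nonperipheral_limit_points G S \<P>)"
proof (rule inj_onI)
  fix x y assume x: "x \<in> nonperipheral_limit_points G S \<P>" and y: "y \<in> nonperipheral_limit_points G S \<P>" and eq: "boundary_map x = boundary_map y"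
  have xy: "x \<in> morse_bd" "y \<in> morse_bd" using x y unfolding nonperipheral_limit_points_def by auto
  obtain \<alpha> \<beta> where ab: "\<alpha> \<in> x" "\<beta> \<in> y" using boundary_ne xy by meson
  have m: "\<alpha> \<in> mrays" "\<beta> \<in> mrays" using boundary_ray xy ab by auto
  obtain \<Phi> \<Psi> where d: "dmorse \<Phi> (disc \<alpha>)" "dmorse \<Psi> (disc \<beta>)" using mraysD(2) m by blast
  have "bpoint (disc \<alpha>) = bpoint (disc \<beta>)" using eq boundary_map_eq[OF xy(1) ab(1)] boundary_map_eq[OF xy(2) ab(2)] by simp
  hence "bounded_dist (disc \<alpha>) (disc \<beta>)"
    using bpoint_inj[OF d(1) mraysD(3)[OF m(1)] nonperipheral_diverges[OF x ab(1)] d(2) mraysD(3)[OF m(2)] nonperipheral_diverges[OF y ab(2)]] by simp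
  hence "(\<alpha>, \<beta>) \<in> mrel" using m mrel_iff by blast
  thus "x = y" using quotient_eq_iff[OF mrel_equiv _ _ ab] xy unfolding boundary_quotient by blast
qed

lemma boundary_map_nonperipheral: "boundary_map ` nonperipheral_limit_points G S \<P> \<subseteq> nonparabolic_points G S \<P>"
proof clarify
  fix x assume x: "x \<in> nonperipheral_limit_points G S \<P>"
  have xb: "x \<in> morse_bd" using x unfolding nonperipheral_limit_points_def by auto
  obtain \<alpha> where a: "\<alpha> \<in> x" using boundary_ne[OF xb] by blast
  have m: "\<alpha> \<in> mrays" using boundary_ray[OF xb a] .
  obtain \<Phi> where d: "dmorse \<Phi> (disc \<alpha>)" using mraysD(2)[OF m] by blast
  have "gromov_conv \<one> (disc \<alpha>) (disc \<alpha>)" using dmorse_gromov_conv[OF d nonperipheral_diverges[OF x a]] mraysD(3)[OF m] by simp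
  thus "boundary_map x \<in> nonparabolic_points G S \<P>"
    using boundary_map_eq[OF xb a] bpoint_diverges[OF d nonperipheral_diverges[OF x a]] end_class_boundary[OF dmorseV[OF d]] by simp
qed

lemma boundary_map_coset:
  assumes "C \<in> CC" "x \<in> coset_morse_boundary G S C" shows "boundary_map x = Inl (Inr C)"
proof -
  have xb: "x \<in> morse_bd" using assms(2) unfolding coset_morse_boundary_def by blast
  obtain \<alpha> where a: "\<alpha> \<in> x" using boundary_ne[OF xb] by blast
  obtain \<Phi> where d: "dmorse \<Phi> (disc \<alpha>)" using mraysD(2)[OF boundary_ray[OF xb a]] by blast
  show ?thesis using boundary_map_eq[OF xb a] bpoint_near_coset[OF d] coset_boundary_iff[OF xb a assms(1)] assms(2) by simp
qed

lemma boundary_map_boundary: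
  assumes "x \<in> morse_bd" shows "boundary_map x \<in> bowditch_boundary G S \<P>"
proof -
  obtain \<alpha> where a: "\<alpha> \<in> x" using boundary_ne[OF assms] by blast
  thus ?thesis using boundary_map_eq[OF assms a] mraysD(2,3)[OF boundary_ray[OF assms a]] bpoint_boundary by auto
qed

lemma dmorse_weaken:
  assumes x: "dmorse \<Phi> x" and le: "\<And>K. \<Phi> K \<le> \<Psi> K" shows "dmorse \<Psi> x"
  unfolding dmorse_def
proof (intro conjI allI impI)
  fix K M q i assume "chain K M q" "\<exists>n. wd (q 0) (x n) \<le> K" "\<exists>n. wd (q M) (x n) \<le> K" "i \<le> M"
  then obtain n where "wd (q i) (x n) \<le> \<Phi> K" using x unfolding dmorse_def by blast
  thus "\<exists>n. wd (q i) (x n) \<le> \<Psi> K" using le[of K] by (intro exI[of _ n]) simp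
qed (use x in \<open>auto simp: dmorse_def\<close>)

lemma topspace_bowditch: "topspace (bowditch_topology G S \<P>) = bowditch_boundary G S \<P>"
proof -
  have "openin (bowditch_topology G S \<P>) (bowditch_boundary G S \<P>)"
    unfolding openin_bowditch_topology bowditch_open_def bowditch_nbhd_def Let_def
    by (intro conjI subset_refl ballI exI[of _ "{}"]) auto
  moreover have "U \<subseteq> bowditch_boundary G S \<P>" if "openin (bowditch_topology G S \<P>) U" for U
    using that unfolding openin_bowditch_topology bowditch_open_def by blast
  ultimately show ?thesis unfolding topspace_def by blast
qed

text \<open>Convergence in a stratum supplies rays of one gauge \<open>N\<close> that subconverge on
  \<open>[0, T]\<close> to a ray \<alpha> of the limit class. As \<alpha> comes with a gauge of its
  own, \<Phi> is the maximum of both, and \<open>bpoint_continuous\<close> applies to a late member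
  of the subsequence.\<close>

lemma boundary_map_preimage_closed:
  assumes U: "bowditch_open G S \<P> U"
  shows "stratum_closed X.R dX (vp \<one>) N {x \<in> morse_stratum X.R dX (vp \<one>) N. boundary_map x \<notin> U}"
  unfolding stratum_closed_def
proof (intro conjI allI impI)
  let ?st = "morse_stratum X.R dX (vp \<one>) N"
  fix xs x assume xs: "range xs \<subseteq> {x \<in> ?st. boundary_map x \<notin> U}" and conv: "stratum_converges X.R dX (vp \<one>) N xs x"
  have st: "?st \<subseteq> morse_bd" unfolding morse_stratum_def group_morse_boundary_def by blast
  have x: "x \<in> ?st" using conv unfolding stratum_converges_def by blast
  have "\<exists>as. (\<forall>n. as n \<in> N_morse_rays X.R dX (vp \<one>) N \<and> as n \<in> xs n) \<and>
        (\<forall>r::nat \<Rightarrow> nat. strict_mono r \<longrightarrow>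
          (\<exists>r'::nat \<Rightarrow> nat. strict_mono r' \<and> (\<exists>\<alpha>\<in>x. converges_on_compacts dX (as \<circ> r \<circ> r') \<alpha>)))"
    using conv unfolding stratum_converges_def by (elim conjE)
  then obtain as where as: "\<And>n. as n \<in> N_morse_rays X.R dX (vp \<one>) N" "\<And>n. as n \<in> xs n"
    and sub: "\<forall>r::nat \<Rightarrow> nat. strict_mono r \<longrightarrow>
          (\<exists>r'::nat \<Rightarrow> nat. strict_mono r' \<and> (\<exists>\<alpha>\<in>x. converges_on_compacts dX (as \<circ> r \<circ> r') \<alpha>))" by blast
  obtain r' :: "nat \<Rightarrow> nat" and \<alpha> where \<alpha>: "\<alpha> \<in> x" "converges_on_compacts dX (as \<circ> id \<circ> r') \<alpha>"
    using sub[rule_format, OF strict_mono_id] by blast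
  have xb: "x \<in> morse_bd" using x st by blast
  have m: "\<alpha> \<in> mrays" using boundary_ray[OF xb \<alpha>(1)] .
  obtain \<Phi>0 where d0: "dmorse \<Phi>0 (disc \<alpha>)" using mraysD(2)[OF m] by blast
  define \<Phi> where "\<Phi> K = max (\<Phi>0 K) (Gauge N K)" for K
  have d: "dmorse \<Phi> (disc \<alpha>)" by (rule dmorse_weaken[OF d0]) (simp add: \<Phi>_def)
  have as_g: "geodesic X.R dX {0..} (as n)" "N_morse X.R dX N {0..} (as n)" "as n 0 = vp \<one>" for n
    using as(1)[of n] unfolding N_morse_rays_def by auto
  have das: "dmorse \<Phi> (disc (as n))" for n
    by (rule dmorse_weaken[OF dmorse_disc[OF as_g(1,2)]]) (simp add: \<Phi>_def)
  show "x \<in> {x \<in> ?st. boundary_map x \<notin> U}"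
  proof (rule ccontr)
    assume "x \<notin> {x \<in> ?st. boundary_map x \<notin> U}"
    hence "boundary_map x \<in> U" using x by blast
    hence pU: "bpoint (disc \<alpha>) \<in> U" using boundary_map_eq[OF xb \<alpha>(1)] by simp
    then obtain A where A: "finite A" "A \<subseteq> verts \<Gamma>Y" "bpoint (disc \<alpha>) \<notin> Inl ` A" "bowditch_nbhd G S \<P> (bpoint (disc \<alpha>)) A \<subseteq> U"
      using U unfolding bowditch_open_def by blast
    obtain T :: nat where T: "\<And>y. dmorse \<Phi> y \<Longrightarrow> y 0 = \<one> \<Longrightarrow> \<forall>t\<le>T. wd (disc \<alpha> t) (y t) \<le> 2 \<Longrightarrow>
      bpoint y = bpoint (disc \<alpha>) \<or> bpoint y \<in> bowditch_nbhd G S \<P> (bpoint (disc \<alpha>)) A"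
      by (rule bpoint_continuous[OF d mraysD(3)[OF m] A(1-3)]) (assumption | rule that)+
    have "\<forall>\<^sub>F n in sequentially. \<forall>t\<in>{0..real T}. dX ((as \<circ> id \<circ> r') n t) (\<alpha> t) < 1"
      using \<alpha>(2)[unfolded converges_on_compacts_def, rule_format, of "{0..real T}" 1] by auto
    hence "\<exists>n. \<forall>t\<in>{0..real T}. dX ((as \<circ> id \<circ> r') n t) (\<alpha> t) < 1" unfolding eventually_sequentially by blast
    then obtain n where n: "\<And>t. t \<in> {0..real T} \<Longrightarrow> dX (as (r' n) t) (\<alpha> t) < 1" unfolding comp_def id_def by blast
    let ?y = "disc (as (r' n))"
    \<comment> \<open>The rays are at distance less than 1, and rounding to group elements adds at
      most 1.\<close>
    have "\<forall>t\<le>T. wd (disc \<alpha> t) (?y t) \<le> 2"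
    proof (intro allI impI)
      fix t assume t: "t \<le> T"
      have "\<bar>real (wd (?y t) (disc \<alpha> t)) - dX (as (r' n) (real t)) (\<alpha> (real t))\<bar> \<le> 1"
        unfolding disc_def using ray_R[OF as_g(1)] ray_R[OF mraysD(1)[OF m]] by (intro nearest_dist) auto
      thus "wd (disc \<alpha> t) (?y t) \<le> 2" using n[of "real t"] t W.dsym[of "disc \<alpha> t" "?y t"] by simp
    qed
    moreover have "?y 0 = \<one>" by (rule disc_0) (rule as_g(3))
    ultimately have "bpoint ?y \<in> U" using T[OF das[of "r' n"]] pU A(4) by auto
    moreover have "xs (r' n) \<in> morse_bd" "boundary_map (xs (r' n)) \<notin> U" using xs st by auto
    ultimately show False using boundary_map_eq[OF _ as(2)] by simp
  qed
qed blast

lemma boundary_map_continuous: "continuous_map (group_morse_topology G S) (bowditch_topology G S \<P>) boundary_map"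
proof -
  let ?MT = "morse_topology X.R dX (vp \<one>)"
  have ts: "topspace ?MT \<subseteq> morse_bd"
    unfolding topspace_def openin_morse_topology group_morse_boundary_def by blast
  have "openin ?MT {x \<in> topspace ?MT. boundary_map x \<in> U}" if U: "bowditch_open G S \<P> U" for U
  proof -
    have "openin ?MT {x \<in> morse_bd. boundary_map x \<in> U}"
      unfolding openin_morse_topology
    proof (intro conjI allI impI)
      show "{x \<in> morse_bd. boundary_map x \<in> U} \<subseteq> morse_boundary X.R dX (vp \<one>)" unfolding group_morse_boundary_def by blast
      fix N :: "real \<Rightarrow> real \<Rightarrow> real"
      let ?st = "morse_stratum X.R dX (vp \<one>) N"
      have "?st - {x \<in> morse_bd. boundary_map x \<in> U} \<inter> ?st = {x \<in> ?st. boundary_map x \<notin> U}"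
        unfolding group_morse_boundary_def morse_stratum_def by blast
      thus "openin (stratum_topology X.R dX (vp \<one>) N) ({x \<in> morse_bd. boundary_map x \<in> U} \<inter> ?st)"
        unfolding openin_stratum_topology using boundary_map_preimage_closed[OF U, of N] by simp
    qed
    hence "openin ?MT (topspace ?MT \<inter> {x \<in> morse_bd. boundary_map x \<in> U})" by blast
    moreover have "topspace ?MT \<inter> {x \<in> morse_bd. boundary_map x \<in> U} = {x \<in> topspace ?MT. boundary_map x \<in> U}" using ts by blast
    ultimately show ?thesis by simp
  qed
  moreover have "boundary_map \<in> topspace ?MT \<rightarrow> topspace (bowditch_topology G S \<P>)"
    unfolding topspace_bowditch using ts boundary_map_boundary by blast
  ultimately show ?thesis
    unfolding continuous_map_def group_morse_topology_def openin_bowditch_topology by blast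
qed

end

section \<open>Equivariance\<close>

lemma extend_vpoint: "extend_map \<phi> (vpoint v) = vpoint (\<phi> v)"
proof
  fix w
  have "{u. vpoint v u \<noteq> 0 \<and> \<phi> u = w} = (if \<phi> v = w then {v} else {})" by (auto simp: vpoint_def indicator_def)
  thus "extend_map \<phi> (vpoint v) w = vpoint (\<phi> v) w" by (auto simp: extend_map_def vpoint_def indicator_def)
qed

lemma extend_cell:
  assumes uw: "u \<noteq> w" "\<phi> u \<noteq> \<phi> w" and x: "x \<in> cell {u, w}"
  shows "extend_map \<phi> x (\<phi> u) = x u" "extend_map \<phi> x \<in> cell {\<phi> u, \<phi> w}"
proof -
  have supp: "v = u \<or> v = w" if "x v \<noteq> 0" for v using x that uw(1) by (auto simp: cell_edge)
  have U: "extend_map \<phi> x (\<phi> u) = x u"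
  proof -
    have "{v. x v \<noteq> 0 \<and> \<phi> v = \<phi> u} = (if x u = 0 then {} else {u})" using supp uw by force
    thus ?thesis by (simp add: extend_map_def)
  qed
  have W: "extend_map \<phi> x (\<phi> w) = x w"
  proof -
    have "{v. x v \<noteq> 0 \<and> \<phi> v = \<phi> w} = (if x w = 0 then {} else {w})" using supp uw by force
    thus ?thesis by (simp add: extend_map_def)
  qed
  have Z: "extend_map \<phi> x z = 0" if "z \<noteq> \<phi> u" "z \<noteq> \<phi> w" for z
  proof -
    have "{v. x v \<noteq> 0 \<and> \<phi> v = z} = {}" using supp that by blast
    thus ?thesis unfolding extend_map_def by (simp only: sum.empty)
  qed
  show "extend_map \<phi> x (\<phi> u) = x u" by (rule U)
  show "extend_map \<phi> x \<in> cell {\<phi> u, \<phi> w}" unfolding cell_edge[OF uw(2)] U W using x Z uw(1) by (simp add: cell_edge)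
qed

context connected_graph begin

text \<open>Edges are only asked to go to edges. Isometry follows from the pair of translations by
  \<open>g\<close> and by its inverse, neither of which increases distances.\<close>

definition automorphism :: "('v \<Rightarrow> 'v) \<Rightarrow> bool" where
  "automorphism \<phi> \<longleftrightarrow> inj_on \<phi> (verts \<Gamma>) \<and> \<phi> ` verts \<Gamma> \<subseteq> verts \<Gamma> \<and>
     (\<forall>u w. {u, w} \<in> edges \<Gamma> \<longrightarrow> u \<noteq> w \<longrightarrow> {\<phi> u, \<phi> w} \<in> edges \<Gamma> \<and> edge_len \<Gamma> {\<phi> u, \<phi> w} = edge_len \<Gamma> {u, w})"

lemma automorphism_edge:
  assumes "automorphism \<phi>" "e \<in> edges \<Gamma>"
  obtains u w where "e = {u, w}" "u \<noteq> w" "\<phi> u \<noteq> \<phi> w" "{\<phi> u, \<phi> w} \<in> edges \<Gamma>" "edge_len \<Gamma> {\<phi> u, \<phi> w} = edge_len \<Gamma> e" "u \<in> verts \<Gamma>" "w \<in> verts \<Gamma>"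
proof -
  obtain u w where uw: "e = {u, w}" "u \<noteq> w" "u \<in> verts \<Gamma>" "w \<in> verts \<Gamma>" using edge[OF assms(2)] by blast
  have "\<phi> u \<noteq> \<phi> w" using assms(1) uw unfolding automorphism_def inj_on_def by blast
  moreover have "{\<phi> u, \<phi> w} \<in> edges \<Gamma> \<and> edge_len \<Gamma> {\<phi> u, \<phi> w} = edge_len \<Gamma> e" using assms uw(1,2) unfolding automorphism_def by blast
  ultimately show ?thesis using that uw by blast
qed

lemma R_cases:
  assumes "x \<in> R"
  obtains v where "v \<in> verts \<Gamma>" "x = vpoint v" | e where "e \<in> edges \<Gamma>" "x \<in> cell e"
  using assms unfolding realization_def by (auto simp: cell_vertex)

lemma extend_R:
  assumes \<phi>: "automorphism \<phi>" and x: "x \<in> R" shows "extend_map \<phi> x \<in> R"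
  using x
proof (cases rule: R_cases)
  case (1 v)
  thus ?thesis using \<phi> vpoint_R[of "\<phi> v"] unfolding automorphism_def by (auto simp: extend_vpoint)
next
  case (2 e)
  obtain u w where uw: "e = {u, w}" "u \<noteq> w" "\<phi> u \<noteq> \<phi> w" "{\<phi> u, \<phi> w} \<in> edges \<Gamma>" by (rule automorphism_edge[OF \<phi> 2(1)])
  show ?thesis using cell_R[OF uw(4) extend_cell(2)[where \<phi> = \<phi>, OF uw(2,3)]] 2(2) uw(1) by blast
qed

lemma extend_chain:
  assumes \<phi>: "automorphism \<phi>" and "chain_length \<Gamma> x y r"
  shows "chain_length \<Gamma> (extend_map \<phi> x) (extend_map \<phi> y) r"
  using assms(2)
proof (induction rule: chain_length.induct)
  case (refl x) thus ?case using extend_R[OF \<phi>] chain_length.refl by blast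
next
  case (step x y r e z)
  obtain u w where uw: "e = {u, w}" "u \<noteq> w" "\<phi> u \<noteq> \<phi> w" "{\<phi> u, \<phi> w} \<in> edges \<Gamma>" "edge_len \<Gamma> {\<phi> u, \<phi> w} = edge_len \<Gamma> e"
    by (rule automorphism_edge[OF \<phi> step.hyps(2)])
  have c: "y \<in> cell {u, w}" "z \<in> cell {u, w}" using step.hyps uw(1) by auto
  note y = extend_cell[where \<phi> = \<phi>, OF uw(2,3) c(1)] and z = extend_cell[where \<phi> = \<phi>, OF uw(2,3) c(2)]
  have s: "(\<Sum>v\<in>{\<phi> u, \<phi> w}. \<bar>extend_map \<phi> y v - extend_map \<phi> z v\<bar>) / 2 = (\<Sum>v\<in>{u, w}. \<bar>y v - z v\<bar>) / 2"
    unfolding edge_sum[OF uw(2) c] edge_sum[OF uw(3) y(2) z(2)] y(1) z(1) ..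
  have "edge_len \<Gamma> {\<phi> u, \<phi> w} * (\<Sum>v\<in>{\<phi> u, \<phi> w}. \<bar>extend_map \<phi> y v - extend_map \<phi> z v\<bar>) / 2 = edge_len \<Gamma> e * (\<Sum>v\<in>e. \<bar>y v - z v\<bar>) / 2"
    unfolding times_divide_eq_right[symmetric] s uw(5) unfolding uw(1) ..
  thus ?case using chain_length.step[OF step.IH uw(4) y(2) z(2)] by simp
qed

lemma extend_dist:
  assumes "automorphism \<phi>" "x \<in> R" "y \<in> R" shows "gdist \<Gamma> (extend_map \<phi> x) (extend_map \<phi> y) \<le> gdist \<Gamma> x y"
  using gdist_ge[OF assms(2,3)] gdist_le[OF extend_chain[OF assms(1)]] by blast

lemma extend_inverse:
  assumes \<phi>: "automorphism \<phi>" and \<psi>: "automorphism \<psi>" and inv: "\<And>v. v \<in> verts \<Gamma> \<Longrightarrow> \<psi> (\<phi> v) = v" and x: "x \<in> R"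
  shows "extend_map \<psi> (extend_map \<phi> x) = x"
  using x
proof (cases rule: R_cases)
  case (1 v) thus ?thesis by (simp add: extend_vpoint inv)
next
  case (2 e)
  obtain u w where uw: "e = {u, w}" "u \<noteq> w" "\<phi> u \<noteq> \<phi> w" "{\<phi> u, \<phi> w} \<in> edges \<Gamma>" "edge_len \<Gamma> {\<phi> u, \<phi> w} = edge_len \<Gamma> e" "u \<in> verts \<Gamma>" "w \<in> verts \<Gamma>"
    by (rule automorphism_edge[OF \<phi> 2(1)])
  have c: "x \<in> cell {u, w}" using 2(2) uw(1) by simp
  have i: "\<psi> (\<phi> u) = u" "\<psi> (\<phi> w) = w" using inv uw by auto
  note y = extend_cell[where \<phi> = \<phi>, OF uw(2,3) c]
  have "\<psi> (\<phi> u) \<noteq> \<psi> (\<phi> w)" using i uw(2) by simp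
  note z = extend_cell[where \<phi> = \<psi>, OF uw(3) this y(2), unfolded i]
  show ?thesis
  proof
    fix v show "extend_map \<psi> (extend_map \<phi> x) v = x v"
      using z c y(1) unfolding cell_edge[OF uw(2)] by (cases "v = u"; cases "v = w") auto
  qed
qed

end

section \<open>Translations of both graphs and of boundary classes\<close>

context rh_group begin

lemma Y_automorphism:
  assumes g: "g \<in> V" shows "Y.automorphism (act g)"
  unfolding Y.automorphism_def
proof (intro conjI allI impI)
  show "inj_on (act g) (verts \<Gamma>Y)" by (rule inj_on_inverseI[of _ "act (inv g)"]) (rule act_inv(1)[OF g])
  show "act g ` verts \<Gamma>Y \<subseteq> verts \<Gamma>Y" using act_verts[OF g] by blast
  fix u w assume "{u, w} \<in> edges \<Gamma>Y" "u \<noteq> w"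
  hence "{act g u, act g w} \<in> edges \<Gamma>Y \<and> edge_len \<Gamma>Y (act g ` {u, w}) = edge_len \<Gamma>Y {u, w}"
  proof (cases rule: Y_edge_cases[of "{u, w}"])
    case (1 a b)
    have "a \<in> V" "b \<in> V" using 1(3) RX_V by auto
    hence "g \<otimes> a \<noteq> g \<otimes> b" using 1(2) g by (simp add: Units_eq)
    hence "{Inl (g \<otimes> a), Inl (g \<otimes> b)} \<in> edges \<Gamma>Y" using Y_edge_X[OF RX_left[OF g 1(3)]] by blast
    moreover have "{act g u, act g w} = act g ` {u, w}" by simp
    ultimately show ?thesis unfolding 1(1) by (simp add: act_simps Y_len_X)
  next
    case (2 a C)
    have "g \<otimes> a \<in> g <#\<^bsub>G\<^esub> C" using 2(3) by (simp add: lcos_mem)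
    hence "{Inl (g \<otimes> a), Inr (g <#\<^bsub>G\<^esub> C)} \<in> edges \<Gamma>Y" using Y_edge_C[OF coset_left[OF g 2(2)]] by blast
    moreover have "{act g u, act g w} = act g ` {u, w}" by simp
    ultimately show ?thesis unfolding 2(1) by (simp add: act_simps Y_len_C)
  qed
  thus "{act g u, act g w} \<in> edges \<Gamma>Y" "edge_len \<Gamma>Y {act g u, act g w} = edge_len \<Gamma>Y {u, w}" by auto
qed

lemma X_automorphism:
  assumes g: "g \<in> V" shows "X.automorphism (\<lambda>h. g \<otimes> h)"
  unfolding X.automorphism_def
proof (intro conjI allI impI)
  show "inj_on (\<lambda>h. g \<otimes> h) (verts \<Gamma>X)" unfolding cayley_simps using g by (intro inj_onI) simp
  show "(\<lambda>h. g \<otimes> h) ` verts \<Gamma>X \<subseteq> verts \<Gamma>X" using g by (auto simp: cayley_simps)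
  fix u w assume "{u, w} \<in> edges \<Gamma>X" "u \<noteq> w"
  hence r: "(u, w) \<in> RX" "u \<noteq> w" using cayley_edge_iff by blast+
  hence "u \<in> V" "w \<in> V" using RX_V by auto
  hence "g \<otimes> u \<noteq> g \<otimes> w" using g r(2) by (simp add: Units_eq)
  thus "{g \<otimes> u, g \<otimes> w} \<in> edges \<Gamma>X" using RX_left[OF g r(1)] cayley_edge_iff by blast
qed (simp add: cayley_simps)

abbreviation "transY g \<equiv> extend_map (act g)"
abbreviation "transX g \<equiv> extend_map (\<lambda>h. g \<otimes> h)"

lemma transY_R: "g \<in> V \<Longrightarrow> p \<in> Y.R \<Longrightarrow> transY g p \<in> Y.R"
  by (rule Y.extend_R[OF Y_automorphism])

lemma transY_inv:
  assumes "g \<in> V" "p \<in> Y.R" shows "transY (inv g) (transY g p) = p" "transY g (transY (inv g) p) = p"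
  by (intro Y.extend_inverse[OF Y_automorphism Y_automorphism] act_inv; use assms in simp)+

lemma transY_dist:
  assumes g: "g \<in> V" and p: "p \<in> Y.R" "q \<in> Y.R" shows "gY (transY g p) (transY g q) = gY p q"
  using Y.extend_dist[OF Y_automorphism[OF g] p] Y.extend_dist[OF Y_automorphism[OF inv_closed[OF g]] transY_R[OF g p(1)] transY_R[OF g p(2)]]
  by (simp add: transY_inv g p)

lemma transY_vY: "transY g (vY x) = vY (g \<otimes> x)"
  by (simp add: extend_vpoint act_simps)

text \<open>Translation carries the base point to \<open>g\<close>; moving it back to \<one> changes
  a Gromov product by at most the distance from \<one> to \<open>g\<close>.\<close>

lemma gprod_transY:
  assumes g: "g \<in> V" and p: "p \<in> Y.R" "q \<in> Y.R"
  shows "gprod p q \<le> gprod (transY g p) (transY g q) + real (rd \<one> g)"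
proof -
  have o: "vY \<one> \<in> Y.R" "vY g \<in> Y.R" using g by (simp_all add: vI)
  have "gY p (vY \<one>) = gY (transY g p) (vY g)" "gY q (vY \<one>) = gY (transY g q) (vY g)"
    using transY_dist[OF g p(1) o(1)] transY_dist[OF g p(2) o(1)] g by (simp_all add: transY_vY)
  moreover have "gY (transY g p) (vY g) \<le> gY (transY g p) (vY \<one>) + gY (vY \<one>) (vY g)"
    "gY (transY g q) (vY g) \<le> gY (transY g q) (vY \<one>) + gY (vY \<one>) (vY g)"
    using o transY_R[OF g] p Y.tri by auto
  moreover have "gY (vY \<one>) (vY g) = real (rd \<one> g)" using Y_dist_VV[OF one_closed g] .
  ultimately show ?thesis unfolding gromov_product_def using transY_dist[OF g p] by argo
qed

lemma grel_transY:
  assumes g: "g \<in> V" and uw: "(u, w) \<in> grel"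
  shows "(transY g \<circ> u, transY g \<circ> w) \<in> grel"
proof -
  have *: "\<forall>C. \<exists>n. \<forall>i\<ge>n. \<forall>j\<ge>n. C \<le> gprod ((transY g \<circ> u) i) ((transY g \<circ> w) j)"
    if R: "\<And>i. u i \<in> Y.R" "\<And>i. w i \<in> Y.R" and c: "gprod_inf u w" for u w
  proof
    fix C
    obtain n where n: "\<And>i j. n \<le> i \<Longrightarrow> n \<le> j \<Longrightarrow> C + real (rd \<one> g) \<le> gprod (u i) (w j)" using c by meson
    have "C \<le> gprod ((transY g \<circ> u) i) ((transY g \<circ> w) j)" if "n \<le> i" "n \<le> j" for i j
      using n[OF that] gprod_transY[OF g R(1)[of i] R(2)[of j]] unfolding comp_def by linarith
    thus "\<exists>n. \<forall>i\<ge>n. \<forall>j\<ge>n. C \<le> gprod ((transY g \<circ> u) i) ((transY g \<circ> w) j)" by blast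
  qed
  have U: "u \<in> gseqs" "w \<in> gseqs" and c: "gprod_inf u w" using uw grel_mem by blast+
  note R = gseqs_R[OF U(1)] gseqs_R[OF U(2)]
  have "transY g \<circ> u \<in> gseqs" "transY g \<circ> w \<in> gseqs"
  proof -
    have "transY g \<circ> v \<in> gseqs" if v: "v \<in> gseqs" for v
    proof -
      have "gprod_inf v v" using v unfolding gseqs_def by blast
      from *[of v v, OF gseqs_R[OF v] gseqs_R[OF v] this] show ?thesis
        using transY_R[OF g gseqs_R[OF v]] unfolding gseqs_def by (simp add: image_subset_iff)
    qed
    thus "transY g \<circ> u \<in> gseqs" "transY g \<circ> w \<in> gseqs" using U by auto
  qed
  thus ?thesis unfolding grel_mem using *[of u w, OF R c] by blast
qed

text \<open>A translation maps a class into a class, which is that of \<open>y\<close> because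
  \<open>y\<close> is equivalent to the translated \<open>x\<close>. That the whole class is reached
  follows by translating back with the inverse of \<open>g\<close>.\<close>

lemma end_class_act:
  assumes g: "g \<in> V" and x: "\<And>n. x n \<in> V" "gromov_conv \<one> x x" and y: "\<And>n. y n \<in> V" "gromov_conv \<one> y y"
    and xy: "gromov_conv \<one> (\<lambda>n. g \<otimes> x n) y"
  shows "end_class y = (\<lambda>u. transY g \<circ> u) ` end_class x"
proof -
  have xx: "(\<lambda>n. vY (x n), \<lambda>n. vY (x n)) \<in> grel" using grel_iff[of x x, OF x(1) x(1)] x(2) by simp
  have c: "transY g \<circ> (\<lambda>n. vY (x n)) = (\<lambda>n. vY (g \<otimes> x n))" by (auto simp: transY_vY)
  have "(\<lambda>n. vY (g \<otimes> x n), \<lambda>n. vY (g \<otimes> x n)) \<in> grel" using grel_transY[OF g xx] unfolding c .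
  hence "gromov_conv \<one> (\<lambda>n. g \<otimes> x n) (\<lambda>n. g \<otimes> x n)" using grel_iff[of "\<lambda>n. g \<otimes> x n" "\<lambda>n. g \<otimes> x n"] g x(1) by simp
  hence gy: "(\<lambda>n. vY (g \<otimes> x n), \<lambda>n. vY (y n)) \<in> grel" using grel_iff[of "\<lambda>n. g \<otimes> x n" y] g x(1) y xy by simp
  have sym: "(v, u) \<in> grel" if "(u, v) \<in> grel" for u v using grel_equiv that unfolding equiv_def sym_def by blast
  have trans: "(u, w) \<in> grel" if "(u, v) \<in> grel" "(v, w) \<in> grel" for u v w using grel_equiv that unfolding equiv_def trans_def by blast
  show ?thesis
  proof (intro equalityI subsetI)
    fix w assume "w \<in> end_class y"
    hence w: "(\<lambda>n. vY (g \<otimes> x n), w) \<in> grel" using trans[OF gy] unfolding end_class_def by blast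
    have ig: "inv g \<in> V" using g by simp
    have e: "transY (inv g) \<circ> (\<lambda>n. vY (g \<otimes> x n)) = (\<lambda>n. vY (x n))" using g x(1) by (auto simp: transY_vY inv_left)
    have "(\<lambda>n. vY (x n), transY (inv g) \<circ> w) \<in> grel" using grel_transY[OF ig w] unfolding e .
    moreover have "w \<in> gseqs" using w grel_mem by blast
    hence "transY g \<circ> (transY (inv g) \<circ> w) = w" by (simp add: fun_eq_iff transY_inv(2)[OF g gseqs_R])
    ultimately show "w \<in> (\<lambda>u. transY g \<circ> u) ` end_class x" unfolding end_class_def by (intro image_eqI[of _ _ "transY (inv g) \<circ> w"]) auto
  next
    fix w assume "w \<in> (\<lambda>u. transY g \<circ> u) ` end_class x"
    then obtain u where u: "(\<lambda>n. vY (x n), u) \<in> grel" "w = transY g \<circ> u" unfolding end_class_def by blast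
    have "(\<lambda>n. vY (g \<otimes> x n), w) \<in> grel" using grel_transY[OF g u(1)] unfolding c u(2) .
    thus "w \<in> end_class y" using trans[OF sym[OF gy]] unfolding end_class_def by blast
  qed
qed

section \<open>Hausdorff distance of rays in terms of sequences\<close>

definition hausdorff_close :: "(nat \<Rightarrow> 'a) \<Rightarrow> (nat \<Rightarrow> 'a) \<Rightarrow> bool" where
  "hausdorff_close y x \<longleftrightarrow> (\<exists>E. \<forall>i. \<exists>n. wd (y i) (x n) \<le> E) \<and> (\<exists>E. \<forall>n. \<exists>i. wd (x n) (y i) \<le> E)"

text \<open>\<open>a\<close> is a discrete model of the path \<open>A\<close>, each staying near the
  other; the bound 3/2 is that of \<open>disc_near_real\<close>.\<close>

definition track :: "(real \<Rightarrow> 'a \<Rightarrow> real) \<Rightarrow> (nat \<Rightarrow> 'a) \<Rightarrow> bool" where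
  "track A a \<longleftrightarrow> (\<forall>t\<ge>0. A t \<in> X.R) \<and> (\<forall>n. a n \<in> V) \<and> (\<forall>t\<ge>0. \<exists>n. dX (A t) (vp (a n)) \<le> 3/2) \<and>
     (\<forall>n. \<exists>t\<ge>0. dX (A t) (vp (a n)) \<le> 3/2)"

lemma track_nbhd:
  assumes A: "track A a" and B: "track B b"
  shows "(\<exists>r. A ` {0..} \<subseteq> nbhd X.R dX r (B ` {0..})) \<longleftrightarrow> (\<exists>E. \<forall>n. \<exists>i. wd (a n) (b i) \<le> E)"
proof -
  have V: "a n \<in> V" "b n \<in> V" for n using A B unfolding track_def by auto
  have R: "A t \<in> X.R" "B t \<in> X.R" if "0 \<le> t" for t using A B that unfolding track_def by auto
  have close: "\<bar>dX (A t) (B s) - real (wd (a n) (b i))\<bar> \<le> 3"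
    if "0 \<le> t" "0 \<le> s" "dX (A t) (vp (a n)) \<le> 3/2" "dX (B s) (vp (b i)) \<le> 3/2" for t s n i
  proof -
    note M = R(1)[OF that(1)] R(2)[OF that(2)] vpR[OF V(1)[of n]] vpR[OF V(2)[of i]]
    show ?thesis
      using X.tri[OF M(1,3,2)] X.tri[OF M(3,4,2)] X.tri[OF M(3,1,4)] X.tri[OF M(1,2,4)] X.sym[OF M(1,3)] X.sym[OF M(2,4)] gdist_wd[OF V(1)[of n] V(2)[of i]] that(3,4)
      by linarith
  qed
  show ?thesis
  proof
    assume "\<exists>r. A ` {0..} \<subseteq> nbhd X.R dX r (B ` {0..})"
    then obtain r where r: "A ` {0..} \<subseteq> nbhd X.R dX r (B ` {0..})" by blast
    have "\<exists>i. wd (a n) (b i) \<le> nat \<lceil>r\<rceil> + 3" for n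
    proof -
      obtain t where t: "0 \<le> t" "dX (A t) (vp (a n)) \<le> 3/2" using A unfolding track_def by blast
      have "A t \<in> nbhd X.R dX r (B ` {0..})" using r t(1) by auto
      then obtain s where s: "0 \<le> s" "dX (A t) (B s) \<le> r" unfolding nbhd_def by auto
      obtain i where i: "dX (B s) (vp (b i)) \<le> 3/2" using B s(1) unfolding track_def by blast
      have "wd (a n) (b i) \<le> nat \<lceil>r\<rceil> + 3" using close[OF t(1) s(1) t(2) i] s(2) by linarith
      thus ?thesis by blast
    qed
    thus "\<exists>E. \<forall>n. \<exists>i. wd (a n) (b i) \<le> E" by blast
  next
    assume "\<exists>E. \<forall>n. \<exists>i. wd (a n) (b i) \<le> E"
    then obtain E where E: "\<And>n. \<exists>i. wd (a n) (b i) \<le> E" by blast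
    have "A t \<in> nbhd X.R dX (real E + 3) (B ` {0..})" if t: "0 \<le> t" for t
    proof -
      obtain n where n: "dX (A t) (vp (a n)) \<le> 3/2" using A t unfolding track_def by blast
      obtain i where i: "wd (a n) (b i) \<le> E" using E by blast
      obtain s where s: "0 \<le> s" "dX (B s) (vp (b i)) \<le> 3/2" using B unfolding track_def by blast
      have "dX (A t) (B s) \<le> real E + 3" using close[OF t s(1) n s(2)] i by linarith
      thus ?thesis unfolding nbhd_def using R(1)[OF t] s(1) by auto
    qed
    thus "\<exists>r. A ` {0..} \<subseteq> nbhd X.R dX r (B ` {0..})" by blast
  qed
qed

lemma finite_hausdorff_track:
  assumes A: "track A a" and B: "track B b"
  shows "finite_hausdorff_distance X.R dX (A ` {0..}) (B ` {0..}) \<longleftrightarrow> hausdorff_close b a"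
proof -
  have mono: "nbhd X.R dX r Z \<subseteq> nbhd X.R dX r' Z" if "r \<le> r'" for r r' Z
    unfolding nbhd_def using that by force
  have "finite_hausdorff_distance X.R dX (A ` {0..}) (B ` {0..}) \<longleftrightarrow>
     (\<exists>r. A ` {0..} \<subseteq> nbhd X.R dX r (B ` {0..})) \<and> (\<exists>r. B ` {0..} \<subseteq> nbhd X.R dX r (A ` {0..}))"
  proof
    assume "(\<exists>r. A ` {0..} \<subseteq> nbhd X.R dX r (B ` {0..})) \<and> (\<exists>r. B ` {0..} \<subseteq> nbhd X.R dX r (A ` {0..}))"
    then obtain r r' where "A ` {0..} \<subseteq> nbhd X.R dX r (B ` {0..})" "B ` {0..} \<subseteq> nbhd X.R dX r' (A ` {0..})" by blast
    hence "A ` {0..} \<subseteq> nbhd X.R dX (max r r') (B ` {0..})" "B ` {0..} \<subseteq> nbhd X.R dX (max r r') (A ` {0..})"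
      using mono[of r "max r r'"] mono[of r' "max r r'"] by (meson max.cobounded1 max.cobounded2 order_trans)+
    thus "finite_hausdorff_distance X.R dX (A ` {0..}) (B ` {0..})" unfolding finite_hausdorff_distance_def by blast
  qed (auto simp: finite_hausdorff_distance_def)
  thus ?thesis unfolding hausdorff_close_def track_nbhd[OF A B] track_nbhd[OF B A] by blast
qed

lemma track_disc:
  assumes \<alpha>: "geodesic X.R dX {0..} \<alpha>" and g: "g \<in> V"
  shows "track (\<lambda>t. transX g (\<alpha> t)) (\<lambda>n. g \<otimes> disc \<alpha> n)"
proof -
  have le: "dX (transX g (\<alpha> t)) (vp (g \<otimes> disc \<alpha> n)) \<le> dX (\<alpha> t) (vp (disc \<alpha> n))" if "0 \<le> t" for t n
    using X.extend_dist[OF X_automorphism[OF g] ray_R[OF \<alpha> that] vpR[OF disc_V[OF \<alpha>, of n]]] by (simp add: extend_vpoint)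
  show ?thesis unfolding track_def
  proof (intro conjI allI impI)
    show "transX g (\<alpha> t) \<in> X.R" if "0 \<le> t" for t by (rule X.extend_R[OF X_automorphism[OF g] ray_R[OF \<alpha> that]])
    show "g \<otimes> disc \<alpha> n \<in> V" for n using g disc_V[OF \<alpha>] by simp
    show "\<exists>n. dX (transX g (\<alpha> t)) (vp (g \<otimes> disc \<alpha> n)) \<le> 3/2" if "0 \<le> t" for t
      using le[OF that] disc_near_real[OF \<alpha> that] order_trans by blast
    show "\<exists>t\<ge>0. dX (transX g (\<alpha> t)) (vp (g \<otimes> disc \<alpha> n)) \<le> 3/2" for n
      using le[of "real n" n] disc_near[OF \<alpha>, of n] by (intro exI[of _ "real n"]) simp
  qed
qed

lemma track_disc1:
  assumes \<alpha>: "geodesic X.R dX {0..} \<alpha>" shows "track \<alpha> (disc \<alpha>)"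
  unfolding track_def
proof (intro conjI allI impI)
  show "\<exists>t\<ge>0. dX (\<alpha> t) (vp (disc \<alpha> n)) \<le> 3/2" for n
    using disc_near[OF \<alpha>, of n] by (intro exI[of _ "real n"]) simp
  show "\<exists>n. dX (\<alpha> t) (vp (disc \<alpha> n)) \<le> 3/2" if "0 \<le> t" for t using disc_near_real[OF \<alpha> that] by blast
qed (use ray_R[OF \<alpha>] disc_V[OF \<alpha>] in auto)

lemma action_mem:
  assumes "\<alpha> \<in> mrays" "\<beta> \<in> mrays" "g \<in> V"
  shows "finite_hausdorff_distance X.R dX (transX g ` \<alpha> ` {0..}) (\<beta> ` {0..}) \<longleftrightarrow> hausdorff_close (disc \<beta>) (\<lambda>n. g \<otimes> disc \<alpha> n)"
  using finite_hausdorff_track[OF track_disc[OF mraysD(1)[OF assms(1)] assms(3)] track_disc1[OF mraysD(1)[OF assms(2)]]]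
  by (simp add: image_image)

lemma chain_translate: "g \<in> V \<Longrightarrow> chain K M q \<Longrightarrow> chain K M (\<lambda>i. g \<otimes> q i)"
  unfolding chain_def by (auto simp: wd_left)

lemma dmorse_translate:
  assumes g: "g \<in> V" and x: "dmorse \<Phi> x" shows "dmorse \<Phi> (\<lambda>n. g \<otimes> x n)"
  unfolding dmorse_def
proof (intro conjI allI impI)
  have xV: "x n \<in> V" for n using dmorseV[OF x] .
  show "g \<otimes> x n \<in> V" for n using g xV by simp
  show "m - n \<le> wd (g \<otimes> x n) (g \<otimes> x m) + 1" "wd (g \<otimes> x n) (g \<otimes> x m) \<le> m - n + 1" if "n \<le> m" for n m
    using x that g xV wd_left unfolding dmorse_def by auto
  fix K M q i assume q: "chain K M q" "\<exists>n. wd (q 0) (g \<otimes> x n) \<le> K" "\<exists>n. wd (q M) (g \<otimes> x n) \<le> K" "i \<le> M"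
  have qV: "q j \<in> V" if "j \<le> M" for j using q(1) that unfolding chain_def by blast
  have w: "wd (inv g \<otimes> q j) (x n) = wd (q j) (g \<otimes> x n)" if "j \<le> M" for j n
    using wd_left[of g "inv g \<otimes> q j" "x n"] g qV[OF that] xV by (simp add: inv_left)
  obtain n m where "wd (inv g \<otimes> q 0) (x n) \<le> K" "wd (inv g \<otimes> q M) (x m) \<le> K" using q(2,3) w[of 0] w[of M] by auto
  from dmorse_near[OF x chain_translate[OF inv_closed[OF g] q(1)] this q(4)]
  have "\<exists>n. wd (inv g \<otimes> q i) (x n) \<le> \<Phi> K" .
  thus "\<exists>n. wd (q i) (g \<otimes> x n) \<le> \<Phi> K" using w[OF q(4)] by simp
qed

lemma near_coset_translate:
  assumes g: "g \<in> V" and V: "\<And>n. x n \<in> V" "\<And>n. y n \<in> V" and h: "\<And>i. \<exists>n. wd (y i) (g \<otimes> x n) \<le> E" and C: "near_coset x C"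
  shows "near_coset y (g <#\<^bsub>G\<^esub> C)"
proof -
  have CC: "C \<in> CC" using C unfolding near_coset_def by blast
  obtain r where r: "\<And>n. \<exists>a\<in>C. wd a (x n) \<le> r" using C unfolding near_coset_def by blast
  have "\<exists>a\<in>g <#\<^bsub>G\<^esub> C. wd a (y i) \<le> r + E" for i
  proof -
    obtain n where n: "wd (y i) (g \<otimes> x n) \<le> E" using h by blast
    obtain a where a: "a \<in> C" "wd a (x n) \<le> r" using r by blast
    have aV: "a \<in> V" using coset_mem_V[OF CC a(1)] .
    have "wd (g \<otimes> a) (y i) \<le> wd (g \<otimes> a) (g \<otimes> x n) + wd (g \<otimes> x n) (y i)" using g aV V by (intro W.dtri) auto
    hence "wd (g \<otimes> a) (y i) \<le> r + E" using a(2) n wd_left[OF g aV V(1), of n] W.dsym[of "y i" "g \<otimes> x n"] by linarith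
    thus ?thesis using a(1) by (auto simp: lcos_mem)
  qed
  thus ?thesis unfolding near_coset_def using coset_left[OF g CC] by blast
qed

lemma gromov_conv_translate:
  assumes g: "g \<in> V" and x: "dmorse \<Phi> x" "x 0 = \<one>" "diverges x" and y: "dmorse \<Psi> y" "y 0 = \<one>" and h: "\<And>i. \<exists>n. wd (y i) (g \<otimes> x n) \<le> E"
  shows "gromov_conv \<one> (\<lambda>n. g \<otimes> x n) y"
  unfolding gromov_conv_def
proof
  fix R
  note V = dmorseV[OF x(1)] dmorseV[OF y(1)]
  have gx: "gromov_conv \<one> x x" using dmorse_gromov_conv[OF x(1,3)] x(2) by simp
  obtain s0 where S: "\<And>s t. s0 \<le> s \<Longrightarrow> s0 \<le> t \<Longrightarrow> R + 2 * int E + 2 * int (rd g \<one>) \<le> gp2 \<one> (x s) (x t)" using gromov_conv_large[OF gx] by blast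
  define T where "T = s0 + E + wd \<one> g + 3"
  have "R \<le> gp2 \<one> (g \<otimes> x m) (y i)" if mi: "T \<le> m" "T \<le> i" for m i
  proof -
    obtain n where n: "wd (y i) (g \<otimes> x n) \<le> E" using h by blast
    have gV: "g \<otimes> x n \<in> V" "g \<otimes> x m \<in> V" "\<one> \<in> V" using g V by auto
    have "i \<le> wd \<one> (y i) + 1" using dmorse_dist(2)[OF y(1), of 0 i] y(2) by simp
    moreover have "wd \<one> (y i) \<le> wd \<one> (g \<otimes> x n) + wd (g \<otimes> x n) (y i)" "wd \<one> (g \<otimes> x n) \<le> wd \<one> g + wd g (g \<otimes> x n)"
      using gV g V by (auto intro!: W.dtri)
    moreover have "wd g (g \<otimes> x n) \<le> n + 1" using wd_left[OF g gV(3) V(1), of n] g dmorse_dist(1)[OF x(1), of 0 n] x(2) by simp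
    \<comment> \<open>A late \<open>y i\<close> is far from \<one>, hence so is the nearby
      translated point, hence \<open>n\<close> is late.\<close>
    ultimately have "s0 \<le> n" using n mi(2) W.dsym[of "y i" "g \<otimes> x n"] unfolding T_def by linarith
    moreover have "s0 \<le> m" using mi unfolding T_def by simp
    ultimately have 1: "R + 2 * int E + 2 * int (rd g \<one>) \<le> gp2 \<one> (x n) (x m)" using S by blast
    have 2: "gp2 \<one> (x n) (x m) = gp2 g (g \<otimes> x n) (g \<otimes> x m)"
      unfolding gp2_def using rd_left[OF g] V g gV(3) rd_left[OF g gV(3) V(1)] by simp
    have 3: "gp2 g (g \<otimes> x n) (g \<otimes> x m) - 2 * int (rd g \<one>) \<le> gp2 \<one> (g \<otimes> x n) (g \<otimes> x m)"
      using g gV by (intro gp2_base) auto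
    have 4: "gp2 \<one> (g \<otimes> x n) (g \<otimes> x m) - 2 * int (rd (y i) (g \<otimes> x n)) \<le> gp2 \<one> (y i) (g \<otimes> x m)"
      using gV V by (intro gp2_lip) auto
    have "rd (y i) (g \<otimes> x n) \<le> E" using rd_le_wd[OF V(2) gV(1), of i] n by simp
    thus ?thesis using 1 2 3 4 gp2_sym[of \<one> "y i" "g \<otimes> x m"] by linarith
  qed
  thus "\<exists>S. \<forall>s\<ge>S. \<forall>t\<ge>S. R \<le> gp2 \<one> (g \<otimes> x s) (y t)" by blast
qed

lemma bpoint_translate:
  assumes g: "g \<in> V" and x: "dmorse \<Phi> x" "x 0 = \<one>" and y: "dmorse \<Psi> y" "y 0 = \<one>" and h: "hausdorff_close y (\<lambda>n. g \<otimes> x n)"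
  shows "bpoint y = bowditch_action G g (bpoint x)"
proof -
  note V = dmorseV[OF x(1)] dmorseV[OF y(1)]
  obtain E E' where E: "\<And>i. \<exists>n. wd (y i) (g \<otimes> x n) \<le> E" and E': "\<And>n. \<exists>i. wd (g \<otimes> x n) (y i) \<le> E'" using h unfolding hausdorff_close_def by blast
  show ?thesis
  proof (cases "diverges x")
    case True
    \<comment> \<open>If \<open>y\<close> followed a coset, \<open>x\<close> would follow its
      translate by the inverse of \<open>g\<close>.\<close>
    have dy: "diverges y"
    proof (rule ccontr)
      assume "\<not> diverges y"
      then obtain C where C: "near_coset y C" using near_coset_or_diverges[OF y(1)] by blast
      have "\<exists>i. wd (x n) (inv g \<otimes> y i) \<le> E'" for n
      proof -
        obtain i where "wd (g \<otimes> x n) (y i) \<le> E'" using E' by blast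
        thus ?thesis using wd_left[OF g V(1), of "inv g \<otimes> y i" n] g V by (auto simp: inv_left)
      qed
      hence "near_coset x (inv g <#\<^bsub>G\<^esub> C)" by (rule near_coset_translate[OF inv_closed[OF g] V(2) V(1) _ C])
      thus False using near_coset_diverges[OF x(1)] True by blast
    qed
    have gx: "gromov_conv \<one> x x" "gromov_conv \<one> y y" using dmorse_gromov_conv[OF x(1) True] dmorse_gromov_conv[OF y(1) dy] x(2) y(2) by auto
    have "end_class y = (\<lambda>u. transY g \<circ> u) ` end_class x" by (rule end_class_act[OF g V(1) gx(1) V(2) gx(2) gromov_conv_translate[OF g x True y E]])
    thus ?thesis using bpoint_diverges[OF x(1) True] bpoint_diverges[OF y(1) dy] by (simp add: bowditch_action_def)
  next
    case False
    then obtain C where C: "near_coset x C" using near_coset_or_diverges[OF x(1)] by blast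
    have "near_coset y (g <#\<^bsub>G\<^esub> C)" by (rule near_coset_translate[OF g V E C])
    thus ?thesis using bpoint_near_coset[OF x(1) C] bpoint_near_coset[OF y(1)] by (simp add: bowditch_action_def act_simps)
  qed
qed

text \<open>The translated ray starts at \<open>g\<close>. A Morse ray from the base point with the
  same end is obtained from \<open>pull_back_ray\<close> with the identity for \<iota>.\<close>

lemma action_ex:
  assumes \<alpha>: "\<alpha> \<in> mrays" and g: "g \<in> V"
  shows "\<exists>\<beta>\<in>mrays. hausdorff_close (disc \<beta>) (\<lambda>n. g \<otimes> disc \<alpha> n)"
proof -
  obtain \<Phi> where d: "dmorse \<Phi> (disc \<alpha>)" using mraysD(2)[OF \<alpha>] by blast
  let ?x = "\<lambda>n. g \<otimes> disc \<alpha> n"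
  have dx: "dmorse \<Phi> ?x" by (rule dmorse_translate[OF g d])
  obtain \<beta> y E where \<beta>: "\<beta> \<in> mrays" "\<And>n. y n \<in> V" "\<And>n. \<beta> (real n) = vp (y n)"
    "\<And>i. \<exists>n. wd (y i) (?x n) \<le> E" "\<And>n. \<exists>i. wd (y i) (?x n) \<le> E"
  proof (rule pull_back_ray[OF fg_group_axioms dx, of "\<lambda>h. h" 1])
    show "\<exists>h\<in>V. wd h (?x n) \<le> 1" for n using dmorseV[OF dx, of n] W.drefl by (intro bexI[of _ "?x n"]) auto
  qed (auto)
  have "disc \<beta> n = y n" for n unfolding disc_def \<beta>(3) by (rule nearest_vp[OF \<beta>(2)])
  hence "disc \<beta> = y" by auto
  hence "hausdorff_close (disc \<beta>) ?x" unfolding hausdorff_close_def using \<beta>(4,5) W.dsym by metis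
  thus ?thesis using \<beta>(1) by blast
qed

lemma boundary_map_equivariant:
  assumes g: "g \<in> V" and x: "x \<in> morse_bd"
  shows "boundary_map (morse_action G S g x) = bowditch_action G g (boundary_map x)"
proof -
  have mem: "\<beta> \<in> morse_action G S g x \<longleftrightarrow> \<beta> \<in> mrays \<and> (\<exists>\<alpha>\<in>x. hausdorff_close (disc \<beta>) (\<lambda>n. g \<otimes> disc \<alpha> n))" for \<beta>
    unfolding morse_action_def using action_mem[OF boundary_ray[OF x] _ g] by blast
  obtain \<alpha> where "\<alpha> \<in> x" using boundary_ne[OF x] by blast
  \<comment> \<open>\<open>boundary_map\<close> evaluates at a chosen member of the translated
    class, so a member has to exist.\<close>
  hence "\<exists>\<beta>. \<beta> \<in> morse_action G S g x" using action_ex[OF boundary_ray[OF x] g] mem by blast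
  hence b: "(SOME \<beta>. \<beta> \<in> morse_action G S g x) \<in> morse_action G S g x" by (rule someI_ex)
  define \<beta> where "\<beta> = (SOME \<beta>. \<beta> \<in> morse_action G S g x)"
  obtain \<alpha> where a: "\<beta> \<in> mrays" "\<alpha> \<in> x" "hausdorff_close (disc \<beta>) (\<lambda>n. g \<otimes> disc \<alpha> n)" using b[folded \<beta>_def] mem by blast
  note m = boundary_ray[OF x a(2)]
  obtain \<Phi> \<Psi> where "dmorse \<Phi> (disc \<alpha>)" "dmorse \<Psi> (disc \<beta>)" using mraysD(2)[OF m] mraysD(2)[OF a(1)] by blast
  hence "bpoint (disc \<beta>) = bowditch_action G g (bpoint (disc \<alpha>))"
    using bpoint_translate[OF g _ mraysD(3)[OF m] _ mraysD(3)[OF a(1)] a(3)] by blast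
  thus ?thesis using boundary_map_eq[OF x a(2)] unfolding boundary_map_def \<beta>_def by simp
qed

section \<open>Peripheral subgroups with empty Morse boundary\<close>

text \<open>The two bounds demanded by \<open>pull_back_ray\<close> have different sources:
  \<open>c1\<close> comes from the word lengths of the finitely many generators in \<open>T\<close>,
  and \<open>c2\<close> from \<open>coset_chain\<close>, which joins elements of \<open>P\<close> by
  jumps inside \<open>P\<close>, each of them a translate of one of finitely many elements.\<close>

lemma peripheral_empty:
  assumes P: "P \<in> \<P>" "empty_morse_boundary (G\<lparr>carrier := P\<rparr>)" and c: "c0 \<in> V"
  shows "coset_morse_boundary G S (c0 <#\<^bsub>G\<^esub> P) = {}"
proof (rule ccontr)
  assume "coset_morse_boundary G S (c0 <#\<^bsub>G\<^esub> P) \<noteq> {}"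
  then obtain x where x: "x \<in> coset_morse_boundary G S (c0 <#\<^bsub>G\<^esub> P)" by blast
  have xb: "x \<in> morse_bd" using x unfolding coset_morse_boundary_def by blast
  obtain \<alpha> where a: "\<alpha> \<in> x" using boundary_ne[OF xb] by blast
  obtain \<Phi> where d: "dmorse \<Phi> (disc \<alpha>)" using mraysD(2)[OF boundary_ray[OF xb a]] by blast
  have CC: "c0 <#\<^bsub>G\<^esub> P \<in> CC" using P c unfolding peripheral_cosets_def by blast
  obtain r where r: "\<And>n. \<exists>a\<in>c0 <#\<^bsub>G\<^esub> P. wd a (disc \<alpha> n) \<le> r" using coset_boundary_iff[OF xb a CC] x unfolding near_coset_def by blast
  let ?H = "G\<lparr>carrier := P\<rparr>"
  have sub: "subgroup P G" using sub_P P by blast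
  have PV: "P \<subseteq> V" using subgroup.subset[OF sub] .
  obtain T where T: "finite_generating_set ?H T" "group_morse_boundary ?H T = {}" using P(2) unfolding empty_morse_boundary_def by blast
  interpret H: fg_group ?H T
    by (intro fg_group.intro fg_group_axioms.intro subgroup.subgroup_is_group[OF sub is_group] T(1))
  have H: "fg_group ?H T" by (rule H.fg_group_axioms)
  have PP: "P \<in> CC"
  proof -
    have "\<one> <#\<^bsub>G\<^esub> P = P" using lcos_mult_one[OF PV] .
    thus ?thesis using P(1) unfolding peripheral_cosets_def by (intro CollectI exI[of _ \<one>] exI[of _ P]) simp
  qed
  define c1 where "c1 = Max (insert 0 ((\<lambda>t. wd \<one> t) ` T))"
  have TP: "T \<subseteq> P" using H.S_V by auto
  have c1: "wd \<one> t \<le> c1" if "t \<in> T" for t unfolding c1_def using that H.S_fin by (intro Max_ge) auto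
  have step: "wd h h' \<le> c1" if hh: "(h, h') \<in> H.RX" for h h'
  proof -
    obtain t where t: "t \<in> T" "h' = h \<otimes> t \<or> h = h' \<otimes> t" and hV: "h \<in> V" "h' \<in> V" using hh PV unfolding H.RX_def by auto
    have tV: "t \<in> V" using t TP PV by blast
    show ?thesis using t(2) c1[OF t(1)] wd_left[OF hV(1) one_closed tV] wd_left[OF hV(2) one_closed tV] hV W.dsym[of h h'] by auto
  qed
  have up: "wd h h' \<le> c1 * H.wd h h'" if hh: "h \<in> P" "h' \<in> P" for h h'
  proof -
    have "wd h k \<le> c1 * n" if "(h, k) \<in> H.RX ^^ n" for n k
      using that
    proof (induction n arbitrary: k)
      case 0 thus ?case using W.drefl hh PV by auto
    next
      case (Suc n)
      then obtain z where z: "(h, z) \<in> H.RX ^^ n" "(z, k) \<in> H.RX" by auto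
      have "z \<in> V" "k \<in> V" using z(2) H.RX_V PV by auto
      hence "wd h k \<le> wd h z + wd z k" using hh PV by (intro W.dtri) auto
      thus ?case using Suc.IH[OF z(1)] step[OF z(2)] by simp
    qed
    moreover have "(h, h') \<in> H.RX ^^ H.wd h h'" using rdist_relpow[OF H.RX_conn] hh unfolding H.wd_def by simp
    ultimately show ?thesis by blast
  qed
  \<comment> \<open>The ball also contains elements outside \<open>P\<close>, at which
    \<open>H.wd\<close> has some arbitrary value; the maximum is still over a finite set.\<close>
  define c2 where "c2 = Max (insert 0 ((\<lambda>h. H.wd \<one> h) ` {h \<in> V. wd \<one> h \<le> lip}))"
  have jump: "H.wd h h' \<le> c2" if hh: "h \<in> P" "h' \<in> P" "wd h h' \<le> lip" for h h'
  proof -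
    have hV: "h \<in> V" "h' \<in> V" using hh PV by auto
    have i: "inv h \<otimes> h' \<in> P" using subgroup.m_inv_closed[OF sub hh(1)] subgroup.m_closed[OF sub] hh(2) by blast
    have "H.wd (h \<otimes> \<one>) (h \<otimes> (inv h \<otimes> h')) = H.wd \<one> (inv h \<otimes> h')"
      using H.wd_left[of h \<one> "inv h \<otimes> h'"] hh(1) i subgroup.one_closed[OF sub] by simp
    hence e: "H.wd h h' = H.wd \<one> (inv h \<otimes> h')" using hV by (simp add: inv_left)
    have "wd (h \<otimes> \<one>) (h \<otimes> (inv h \<otimes> h')) = wd \<one> (inv h \<otimes> h')" using hV by (intro wd_left) auto
    hence "wd \<one> (inv h \<otimes> h') \<le> lip" using hh(3) hV by (simp add: inv_left)
    hence "inv h \<otimes> h' \<in> {h \<in> V. wd \<one> h \<le> lip}" using hV by simp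
    thus ?thesis unfolding e c2_def using wd_ball[OF one_closed, of lip] by (intro Max_ge) auto
  qed
  have lo: "H.wd h h' \<le> c2 * wd h h'" if hh: "h \<in> P" "h' \<in> P" for h h'
  proof -
    have "k \<in> P \<and> H.wd h k \<le> c2 * n" if "(h, k) \<in> jumps P ^^ n" for n k
      using that
    proof (induction n arbitrary: k)
      case 0 thus ?case using H.W.drefl hh by auto
    next
      case (Suc n)
      then obtain z where z: "(h, z) \<in> jumps P ^^ n" "(z, k) \<in> jumps P" by auto
      have zk: "z \<in> P" "k \<in> P" "wd z k \<le> lip" using z(2) unfolding jumps_def by auto
      have "H.wd h k \<le> H.wd h z + H.wd z k" using hh zk by (intro H.W.dtri) auto
      thus ?case using Suc.IH[OF z(1)] jump[OF zk] zk by simp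
    qed
    thus ?thesis using coset_chain[OF PP hh] by blast
  qed
  define c where "c = max r (max c1 c2)"
  obtain \<beta> y E where "\<beta> \<in> morse_rays (cayley_space ?H T) (cayley_dist ?H T) (vpoint \<one>\<^bsub>?H\<^esub>)"
  proof (rule pull_back_ray[OF H d, of "\<lambda>h. c0 \<otimes> h" c])
    show "c0 \<otimes> h \<in> V" if "h \<in> carrier ?H" for h using that c PV by auto
    show "wd (c0 \<otimes> h) (c0 \<otimes> h') \<le> c * H.wd h h'" if "h \<in> carrier ?H" "h' \<in> carrier ?H" for h h'
    proof -
      have hP: "h \<in> P" "h' \<in> P" using that by auto
      have "wd (c0 \<otimes> h) (c0 \<otimes> h') = wd h h'" using wd_left[OF c] hP PV by blast
      also have "\<dots> \<le> c1 * H.wd h h'" by (rule up[OF hP])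
      also have "\<dots> \<le> c * H.wd h h'" by (rule mult_le_mono1) (simp add: c_def)
      finally show ?thesis .
    qed
    show "H.wd h h' \<le> c * (wd (c0 \<otimes> h) (c0 \<otimes> h') + 1)" if "h \<in> carrier ?H" "h' \<in> carrier ?H" for h h'
    proof -
      have hP: "h \<in> P" "h' \<in> P" using that by auto
      have "H.wd h h' \<le> c2 * wd h h'" by (rule lo[OF hP])
      also have "\<dots> \<le> c * (wd h h' + 1)" by (rule mult_le_mono) (simp_all add: c_def)
      also have "wd h h' = wd (c0 \<otimes> h) (c0 \<otimes> h')" using wd_left[OF c, of h h'] hP PV by (simp add: subset_iff)
      finally show ?thesis .
    qed
    show "\<exists>h\<in>carrier ?H. wd (c0 \<otimes> h) (disc \<alpha> n) \<le> c" for n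
    proof -
      obtain h where "h \<in> P" "wd (c0 \<otimes> h) (disc \<alpha> n) \<le> r" using r[of n] by (auto simp: lcos_mem)
      thus ?thesis unfolding c_def by (intro bexI[of _ h]) auto
    qed
  qed
  hence "group_morse_boundary ?H T \<noteq> {}" unfolding group_morse_boundary_def morse_boundary_def quotient_def by blast
  thus False using T(2) by blast
qed

lemma all_nonperipheral:
  assumes "\<forall>P\<in>\<P>. empty_morse_boundary (G\<lparr>carrier := P\<rparr>)"
  shows "nonperipheral_limit_points G S \<P> = morse_bd"
  using peripheral_empty assms unfolding nonperipheral_limit_points_def peripheral_limit_points_def peripheral_cosets_def by auto

end

theorem theorem1p5:
  fixes G :: "('a, 'b) monoid_scheme" and S :: "'a set" and \<P> :: "'a set set"
  assumes "group G"
    and "finite_generating_set G S"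
    and "finite \<P>" and "\<And>P. P \<in> \<P> \<Longrightarrow> subgroup P G"
    and "relatively_hyperbolic G S \<P>"
  shows "\<exists>f :: (real \<Rightarrow> 'a \<Rightarrow> real) set \<Rightarrow> 'a bowditch_point.
    continuous_map (group_morse_topology G S) (bowditch_topology G S \<P>) f \<and>
    (\<forall>g\<in>carrier G. \<forall>x\<in>group_morse_boundary G S.
       f (morse_action G S g x) = bowditch_action G g (f x)) \<and>
    (inj_on f (nonperipheral_limit_points G S \<P>) \<and>
       f ` nonperipheral_limit_points G S \<P> \<subseteq> nonparabolic_points G S \<P>) \<and>
    (\<forall>x y. same_type G S \<P> x y \<longrightarrow> f x = f y \<and> f x \<in> parabolic_points G \<P>) \<and>
    ((\<forall>P\<in>\<P>. empty_morse_boundary (G\<lparr>carrier := P\<rparr>)) \<longrightarrow>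
       inj_on f (group_morse_boundary G S) \<and>
       f ` group_morse_boundary G S \<subseteq> nonparabolic_points G S \<P>)"
proof -
  interpret rh_group G S \<P>
    by (intro rh_group.intro fg_group.intro fg_group_axioms.intro rh_group_axioms.intro assms)
  have same: "\<forall>x y. same_type G S \<P> x y \<longrightarrow> boundary_map x = boundary_map y \<and> boundary_map x \<in> parabolic_points G \<P>"
    using boundary_map_coset unfolding same_type_def parabolic_points_def by auto
  have empty: "(\<forall>P\<in>\<P>. empty_morse_boundary (G\<lparr>carrier := P\<rparr>)) \<longrightarrow>
      inj_on boundary_map morse_bd \<and> boundary_map ` morse_bd \<subseteq> nonparabolic_points G S \<P>"
    using boundary_map_inj boundary_map_nonperipheral all_nonperipheral by auto
  have equi: "\<forall>g\<in>V. \<forall>x\<in>morse_bd. boundary_map (morse_action G S g x) = bowditch_action G g (boundary_map x)"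
    using boundary_map_equivariant by blast
  show ?thesis
    by (intro exI[of _ boundary_map] conjI boundary_map_continuous equi boundary_map_inj boundary_map_nonperipheral same empty)
qed

end
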